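(* Let $h:[0,\infty)\to[0,\infty)$ be a function of class $C^2$ satisfying conditions (A1), (A2), (A3) listed in the context, and let $T(\varepsilon)=\mu(|\varepsilon|)\,\varepsilon$ with $\mu(t)=\frac{h'(t)}{t}$ be the associated stress tensor on symmetric $2\times 2$ matrices. Suppose $u\in C^1(\mathbb{R}^2,\mathbb{R}^2)\cap L^\infty(\mathbb{R}^2,\mathbb{R}^2)$ is an entire weak solution of the system $$-\operatorname{div}[T(\varepsilon(u))]+u^k\partial_k u+D\pi=0,\qquad \operatorname{div} u=0\quad\text{in }\mathbb{R}^2,$$ i.e. $\operatorname{div}u=0$ in $\mathbb{R}^2$ and $$\int_{\mathbb{R}^2}T(\varepsilon(u)):\varepsilon(\varphi)\,dx-\int_{\mathbb{R}^2}u^k u^i\,\partial_k\varphi^i\,dx=0$$ for all $\varphi\in C_0^\infty(\mathbb{R}^2,\mathbb{R}^2)$ with $\operatorname{div}\varphi=0$. Then $u$ is a constant vector.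
   Context: Repeated indices are summed over $\{1,2\}$. For a vector field $u=(u^1,u^2)$ on $\mathbb{R}^2$, $Du$ is its differential matrix and $\varepsilon(u)=\frac12(Du+(Du)^T)=\frac12(\partial_i u^k+\partial_k u^i)_{1\le i,k\le 2}$ is its symmetric part. The symbol $:$ denotes the scalar product of matrices, $A:B=A_{ij}B_{ij}$, and $|\cdot|$ is the associated Euclidean (Frobenius) norm. $C_0^\infty$ denotes smooth functions with compact support. The stress tensor $T$ is the gradient of the potential $H(\varepsilon)=h(|\varepsilon|)$ on the space of symmetric $2\times2$ real matrices, i.e. $T(\varepsilon)=DH(\varepsilon)=\mu(|\varepsilon|)\varepsilon$ with $\mu(t)=\frac{h'(t)}{t}$ (so $T(0)=0$; at $t=0$ the quotient $\frac{h'(t)}{t}$ is understood as its limit $h''(0)$). The function $h:[0,\infty)\to[0,\infty)$ is of class $C^2$ and satisfies: (A1) $h$ is strictly increasing and convex, $h''(0)>0$, and $\lim_{t\to0}\frac{h(t)}{t}=0$; (A2) (doubling property) there exists a constant $a\ge 1$ such that $h(2t)\le a\,h(t)$ for all $t\ge0$; (A3) $\frac{h'(t)}{t}\le h''(t)$ for all $t\ge0$. In the system, $u$ is the velocity field and $\pi:\mathbb{R}^2\to\mathbb{R}$ is the pressure, which does not appear in the weak formulation because the test fields are divergence free. *)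

theory Defs
  imports "HOL-Analysis.Analysis"
begin

(* In finite dimension, continuity of all (iterated) directional derivatives is continuity of the
   (iterated) Frechet derivative, so this is the usual class C^n. *)
primrec Ck :: "nat \<Rightarrow> ('a::euclidean_space \<Rightarrow> 'b::euclidean_space) \<Rightarrow> bool" where
  "Ck 0 f \<longleftrightarrow> continuous_on UNIV f"
| "Ck (Suc n) f \<longleftrightarrow>
     (\<forall>x. f differentiable (at x)) \<and> (\<forall>v. Ck n (\<lambda>x. frechet_derivative f (at x) v))"

definition smooth :: "('a::euclidean_space \<Rightarrow> 'b::euclidean_space) \<Rightarrow> bool" where
  "smooth f \<longleftrightarrow> (\<forall>n. Ck n f)"

definition test_function :: "('a::euclidean_space \<Rightarrow> 'b::euclidean_space) \<Rightarrow> bool" where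
  "test_function f \<longleftrightarrow> smooth f \<and> compact (closure {x. f x \<noteq> 0})"

definition L_infinity :: "('a::euclidean_space \<Rightarrow> 'b::euclidean_space) \<Rightarrow> bool" where
  "L_infinity f \<longleftrightarrow>
     f \<in> borel_measurable lebesgue \<and> (\<exists>C. AE x in lebesgue. norm (f x) \<le> C)"

(* One-sided at t = 0, since h is a function on the half-line {0..}; its values on negative
   arguments play no role. *)
definition half_deriv :: "(real \<Rightarrow> real) \<Rightarrow> real \<Rightarrow> real" where
  "half_deriv h t = vector_derivative h (at t within {0..})"

definition C2_half_line :: "(real \<Rightarrow> real) \<Rightarrow> bool" where
  "C2_half_line h \<longleftrightarrow>
     h differentiable_on {0..} \<and> half_deriv h differentiable_on {0..} \<and>
     continuous_on {0..} (half_deriv (half_deriv h))"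

(* h'(t)/t, extended to t = 0 by its limit (h'(0) = 0 for the potentials considered). *)
definition mu :: "(real \<Rightarrow> real) \<Rightarrow> real \<Rightarrow> real" where
  "mu h t = (if t = 0 then half_deriv (half_deriv h) 0 else half_deriv h t / t)"

definition A1 :: "(real \<Rightarrow> real) \<Rightarrow> bool" where
  "A1 h \<longleftrightarrow> strict_mono_on {0..} h \<and> convex_on {0..} h \<and>
     half_deriv (half_deriv h) 0 > 0 \<and> ((\<lambda>t. h t / t) \<longlongrightarrow> 0) (at_right 0)"

definition A2 :: "(real \<Rightarrow> real) \<Rightarrow> bool" where
  "A2 h \<longleftrightarrow> (\<exists>a\<ge>1. \<forall>t\<ge>0. h (2 * t) \<le> a * h t)"

definition A3 :: "(real \<Rightarrow> real) \<Rightarrow> bool" where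
  "A3 h \<longleftrightarrow> (\<forall>t\<ge>0. mu h t \<le> half_deriv (half_deriv h) t)"

(* The library norm and inner product on real^2^2 are the Frobenius norm and A : B, and
   jacobian u (at x) $ i $ k is the k-th partial derivative of the i-th component of u. *)

definition sym_grad :: "(real^2 \<Rightarrow> real^2) \<Rightarrow> real^2 \<Rightarrow> real^2^2" where
  "sym_grad u x = (1/2) *\<^sub>R (jacobian u (at x) + transpose (jacobian u (at x)))"

definition divergence :: "(real^2 \<Rightarrow> real^2) \<Rightarrow> real^2 \<Rightarrow> real" where
  "divergence u x = trace (jacobian u (at x))"

(* Only ever applied to symmetric matrices. *)
definition stress :: "(real \<Rightarrow> real) \<Rightarrow> real^2^2 \<Rightarrow> real^2^2" where
  "stress h E = mu h (norm E) *\<^sub>R E"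

definition entire_weak_solution :: "(real \<Rightarrow> real) \<Rightarrow> (real^2 \<Rightarrow> real^2) \<Rightarrow> bool" where
  "entire_weak_solution h u \<longleftrightarrow>
     (\<forall>x. divergence u x = 0) \<and>
     (\<forall>\<phi>. test_function \<phi> \<and> (\<forall>x. divergence \<phi> x = 0) \<longrightarrow>
        (LINT x|lebesgue. stress h (sym_grad u x) \<bullet> sym_grad \<phi> x)
        - (LINT x|lebesgue. (\<Sum>i\<in>UNIV. \<Sum>k\<in>UNIV. u x $ k * u x $ i * jacobian \<phi> (at x) $ i $ k))
        = 0)"

end

theory Submission
  imports Defs
begin

text \<open>
Why the theorem holds. Since u is divergence free, it has a stream function \<open>\<psi>\<close>, and everything is
written in terms of the complex gradient \<open>f = \<psi>_1 + i \<psi>_2\<close>, of the same modulus as u, and of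
\<open>E = f_1 + i f_2\<close>, whose modulus is \<open>sqrt 2\<close> times that of the symmetric gradient. With \<open>dbar\<close> the
operator \<open>\<partial>_1 + i \<partial>_2\<close>, with \<open>p = M * cnj E\<close> for the stress (\<open>M\<close> the viscosity) and
\<open>n = i * (cnj f)^2\<close> for the convective term, the weak equation becomes \<open>Re \<integral> (p - n) dbar (dbar F) = 0\<close>
for compactly supported real \<open>F\<close>; the pressure is gone. Mollification extends it from smooth bumps to all
\<open>F\<close> of class C2, and this is the only form in which the equation is used (locale \<open>flow\<close>).

The cutoffs are \<open>q L a b = lam^a rho^b\<close>, where \<open>lam\<close> is the positive part of
\<open>1 - ln (1 + |x|^2) / L\<close> and \<open>rho = (1 + |x|^2)^(-1/2)\<close>. One derivative of \<open>q L a b\<close> costs one power of \<open>lam\<close>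
and gains one power of \<open>rho\<close>; a derivative of \<open>lam\<close> also gains the factor \<open>1/L\<close>. By the divergence theorem the
integral of \<open>lam^2 rho^3\<close> is bounded independently of \<open>L\<close>, and that of \<open>lam^2 rho^2\<close> grows at most
like \<open>L\<close>.

First order estimate (\<open>energy\<close>). Test with \<open>\<psi>\<close> times \<open>lam^N rho^2\<close>. As \<open>|f| \<le> m\<close> and
\<open>|\<psi> x| \<le> m |x|\<close>, all error terms are bounded by integrals of \<open>lam^2 rho^3\<close>, except that the stress enters
them linearly. The doubling property of h gives polynomial growth of the viscosity, so a high power N of
\<open>lam\<close> lets that term be absorbed. Hence the integral of \<open>lam^N rho^2 M |E|^2\<close> is bounded independently of
\<open>L\<close>.

Second order estimate (\<open>second_order_inequality\<close>). The field u is only C1, so \<open>E\<close> cannot be differentiated;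
difference quotients \<open>dq s j\<close> of step s are used, and the step tends to zero before the cutoff is removed.
Testing the differences of the equation with \<open>\<eta> dq \<psi>\<close>, and the equation itself with \<open>\<eta>_k dq_k \<psi>\<close>,
produces terms with second derivatives of \<open>\<psi>\<close> that are not controlled by \<open>E\<close>; the
combination used in \<open>main_identity\<close> is the one in which they cancel up to errors that are small relative to
\<open>1 + \<integral> w |dq E|\<close>. In the convective part the term \<open>\<eta>\<close> times a cubic form in the second
derivatives of \<open>\<psi>\<close> has vanishing real part (\<open>trace_cancel\<close>): this is the two-dimensional fact that
there is no vortex stretching. What remains carries a derivative of \<open>\<eta>\<close>. The monotonicity of the stress, which
follows from \<open>A3\<close>, bounds the left hand side from below.

With \<open>\<eta> = lam^(N + 3)\<close> every derivative of \<open>\<eta>\<close> contains a factor \<open>1/L\<close>, and Young's inequality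
together with the energy estimate gives \<open>\<integral> \<eta> |dq E|^2 \<le> C/L\<close> for small s (\<open>second_order_decay\<close>).
Letting \<open>L\<close> tend to infinity makes \<open>E\<close> constant (\<open>E_const\<close>). A bounded field with constant
symmetric gradient is constant (\<open>f_const\<close>).
\<close>

section \<open>Difference quotients and integrals on the plane\<close>

type_synonym plane = "real^2"

text \<open>The two partial derivatives are carried along as data, so that identities between integrals can be stated with them.\<close>
definition C1 :: "(plane \<Rightarrow> 'b::real_normed_vector) \<Rightarrow> (2 \<Rightarrow> plane \<Rightarrow> 'b) \<Rightarrow> bool" where
  "C1 g g' \<longleftrightarrow> (\<forall>x. (g has_derivative (\<lambda>v. v $ 1 *\<^sub>R g' 1 x + v $ 2 *\<^sub>R g' 2 x)) (at x)) \<and>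
     (\<forall>j. continuous_on UNIV (g' j))"

definition vanishes_outside_ball :: "(plane \<Rightarrow> 'b::zero) \<Rightarrow> bool" where
  "vanishes_outside_ball f \<longleftrightarrow> (\<exists>r. \<forall>x. norm x > r \<longrightarrow> f x = 0)"

text \<open>Steps s up to 1 are enough for limits as s tends to zero, and keep the supports of all translates in one ball.\<close>
definition unif_vanishes :: "(real \<Rightarrow> plane \<Rightarrow> 'b::zero) \<Rightarrow> bool" where
  "unif_vanishes F \<longleftrightarrow> (\<exists>r. \<forall>s\<in>{-1..1}. \<forall>x. norm x > r \<longrightarrow> F s x = 0)"

abbreviation I :: "(plane \<Rightarrow> 'b::{banach,second_countable_topology}) \<Rightarrow> 'b" where
  "I f \<equiv> integral\<^sup>L lborel f"

definition sh :: "real \<Rightarrow> 2 \<Rightarrow> (plane \<Rightarrow> 'b) \<Rightarrow> plane \<Rightarrow> 'b" where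
  "sh s j g x = g (x + s *\<^sub>R axis j 1)"

definition dq :: "real \<Rightarrow> 2 \<Rightarrow> (plane \<Rightarrow> 'b::real_vector) \<Rightarrow> plane \<Rightarrow> 'b" where
  "dq s j g x = (1/s) *\<^sub>R (sh s j g x - g x)"

text \<open>Only positive steps s are considered; the backward difference is \<open>dq (-s)\<close>.\<close>
definition loc_unif :: "(real \<Rightarrow> plane \<Rightarrow> 'b::real_normed_vector) \<Rightarrow> (plane \<Rightarrow> 'b) \<Rightarrow> bool" where
  "loc_unif F f \<longleftrightarrow> (\<forall>r. uniform_limit (cball 0 r) F f (at_right 0))"

named_theorems supp

lemma supp_scaleR [supp]:
  fixes f :: "plane \<Rightarrow> 'b::real_vector"
  shows "vanishes_outside_ball f \<Longrightarrow> vanishes_outside_ball (\<lambda>x. c x *\<^sub>R f x)"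
    "vanishes_outside_ball g \<Longrightarrow> vanishes_outside_ball (\<lambda>x. g x *\<^sub>R h x :: 'b)"
  unfolding vanishes_outside_ball_def by (metis scale_zero_right, metis scale_zero_left)

lemma supp_mult [supp]:
  fixes f :: "plane \<Rightarrow> 'b::real_algebra"
  shows "vanishes_outside_ball f \<Longrightarrow> vanishes_outside_ball (\<lambda>x. f x * g x)"
    "vanishes_outside_ball f \<Longrightarrow> vanishes_outside_ball (\<lambda>x. g x * f x)"
  unfolding vanishes_outside_ball_def by (metis mult_zero_left, metis mult_zero_right)

lemma supp_comb:
  assumes "vanishes_outside_ball f" "vanishes_outside_ball g" "h 0 0 = 0"
  shows "vanishes_outside_ball (\<lambda>x. h (f x) (g x))"
proof -
  obtain r1 r2 where "\<forall>x. norm x > r1 \<longrightarrow> f x = 0" "\<forall>x. norm x > r2 \<longrightarrow> g x = 0"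
    using assms unfolding vanishes_outside_ball_def by blast
  then show ?thesis unfolding vanishes_outside_ball_def using assms(3)
    by (intro exI[of _ "max r1 r2"]) auto
qed

lemma supp_add [supp]:
  fixes f :: "plane \<Rightarrow> 'b::real_vector"
  assumes "vanishes_outside_ball f" "vanishes_outside_ball g"
  shows "vanishes_outside_ball (\<lambda>x. f x + g x)" "vanishes_outside_ball (\<lambda>x. f x - g x)"
  using supp_comb[OF assms, of "(+)"] supp_comb[OF assms, of "(-)"] by auto

lemma supp_map [supp]:
  "vanishes_outside_ball f \<Longrightarrow> vanishes_outside_ball (\<lambda>x. norm (f x))"
  "vanishes_outside_ball g \<Longrightarrow> vanishes_outside_ball (\<lambda>x. Re (g x))"
  "vanishes_outside_ball g \<Longrightarrow> vanishes_outside_ball (\<lambda>x. Im (g x))"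
  "vanishes_outside_ball g \<Longrightarrow> vanishes_outside_ball (\<lambda>x. cnj (g x))"
  "vanishes_outside_ball h \<Longrightarrow> vanishes_outside_ball (\<lambda>x. - h x :: 'c::group_add)"
  "vanishes_outside_ball k \<Longrightarrow> vanishes_outside_ball (\<lambda>x. complex_of_real (k x))"
  "vanishes_outside_ball k \<Longrightarrow> n > 0 \<Longrightarrow> vanishes_outside_ball (\<lambda>x. k x ^ n)"
  "vanishes_outside_ball k \<Longrightarrow> vanishes_outside_ball (\<lambda>x. \<bar>k x\<bar>)"
  "vanishes_outside_ball k \<Longrightarrow> vanishes_outside_ball (\<lambda>x. k x / l x)"
  unfolding vanishes_outside_ball_def
  by (metis norm_zero complex_cnj_zero neg_equal_0_iff_equal of_real_0 zero_complex.simps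
      abs_zero zero_power div_0)+

lemma unif_vanishes_const [supp]: "vanishes_outside_ball f \<Longrightarrow> unif_vanishes (\<lambda>s. f)"
  unfolding vanishes_outside_ball_def unif_vanishes_def by blast

lemma norm_ax [simp]: "norm (axis j 1 :: plane) = 1"
  by (simp add: norm_axis_1)

lemma norm_shift: "s \<in> {-1..1} \<Longrightarrow> norm x > r + 1 \<Longrightarrow> norm (x + s *\<^sub>R axis j 1 :: plane) > r"
proof -
  assume a: "s \<in> {-1..1}" "norm x > r + 1"
  have "norm x \<le> norm (x + s *\<^sub>R axis j 1 :: plane) + norm (s *\<^sub>R axis j 1 :: plane)"
    by (metis add_diff_cancel norm_triangle_sub norm_minus_commute norm_triangle_ineq4)
  moreover have "norm (s *\<^sub>R axis j 1 :: plane) \<le> 1" using a by auto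
  ultimately show ?thesis using a by linarith
qed

lemma uv_sh [supp]: "vanishes_outside_ball f \<Longrightarrow> unif_vanishes (\<lambda>s. sh s j f)"
  unfolding vanishes_outside_ball_def unif_vanishes_def sh_def
  by (metis norm_shift)

lemma uv_scaleR [supp]:
  fixes f :: "real \<Rightarrow> plane \<Rightarrow> 'b::real_vector"
  shows "unif_vanishes f \<Longrightarrow> unif_vanishes (\<lambda>s x. c s x *\<^sub>R f s x)"
    "unif_vanishes g \<Longrightarrow> unif_vanishes (\<lambda>s x. g s x *\<^sub>R h s x :: 'b)"
  unfolding unif_vanishes_def by (metis scale_zero_right, metis scale_zero_left)

lemma uv_mult [supp]:
  fixes f :: "real \<Rightarrow> plane \<Rightarrow> 'b::real_algebra"
  shows "unif_vanishes f \<Longrightarrow> unif_vanishes (\<lambda>s x. f s x * g s x)"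
    "unif_vanishes f \<Longrightarrow> unif_vanishes (\<lambda>s x. g s x * f s x)"
  unfolding unif_vanishes_def by (metis mult_zero_left, metis mult_zero_right)

lemma uv_comb:
  assumes "unif_vanishes f" "unif_vanishes g" "h 0 0 = 0"
  shows "unif_vanishes (\<lambda>s x. h (f s x) (g s x))"
proof -
  obtain r1 r2 where "\<forall>s\<in>{-1..1}. \<forall>x. norm x > r1 \<longrightarrow> f s x = 0"
    "\<forall>s\<in>{-1..1}. \<forall>x. norm x > r2 \<longrightarrow> g s x = 0"
    using assms unfolding unif_vanishes_def by blast
  then show ?thesis unfolding unif_vanishes_def using assms(3)
    by (intro exI[of _ "max r1 r2"]) auto
qed

lemma uv_add [supp]:
  fixes f :: "real \<Rightarrow> plane \<Rightarrow> 'b::real_vector"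
  assumes "unif_vanishes f" "unif_vanishes g"
  shows "unif_vanishes (\<lambda>s x. f s x + g s x)" "unif_vanishes (\<lambda>s x. f s x - g s x)"
  using uv_comb[OF assms, of "(+)"] uv_comb[OF assms, of "(-)"] by auto

lemma uv_dq [supp]: 
  fixes f :: "plane \<Rightarrow> 'b::real_vector"
  shows "vanishes_outside_ball f \<Longrightarrow> unif_vanishes (\<lambda>s. dq s j f)"
  unfolding dq_def[abs_def] by (intro supp)

lemma supp_sh [supp]: "vanishes_outside_ball f \<Longrightarrow> vanishes_outside_ball (sh s j f)"
proof -
  assume "vanishes_outside_ball f"
  then obtain r where r: "\<forall>x. norm x > r \<longrightarrow> f x = 0" unfolding vanishes_outside_ball_def by blast
  have "norm (x + s *\<^sub>R axis j 1) > r" if "norm x > r + \<bar>s\<bar>" for x :: plane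
  proof -
    have "norm x \<le> norm (x + s *\<^sub>R axis j 1 :: plane) + norm (s *\<^sub>R axis j 1 :: plane)"
      by (metis add_diff_cancel norm_triangle_sub norm_minus_commute norm_triangle_ineq4)
    then show ?thesis using that by simp
  qed
  then show ?thesis using r unfolding vanishes_outside_ball_def sh_def by blast
qed

lemma supp_dq [supp]: 
  fixes f :: "plane \<Rightarrow> 'b::real_vector"
  shows "vanishes_outside_ball f \<Longrightarrow> vanishes_outside_ball (dq s j f)"
  unfolding dq_def[abs_def] by (intro supp)

lemma cont_sh [continuous_intros]: "continuous_on UNIV g \<Longrightarrow> continuous_on UNIV (sh s j g)"
  unfolding sh_def by (rule continuous_on_compose2[of UNIV g]) (auto intro!: continuous_intros)

lemma cont_dq [continuous_intros]:
  fixes g :: "plane \<Rightarrow> 'b::real_normed_vector"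
  shows "continuous_on UNIV g \<Longrightarrow> continuous_on UNIV (dq s j g)"
  unfolding dq_def[abs_def] by (intro continuous_intros)

lemma C1_cont: "C1 g g' \<Longrightarrow> continuous_on UNIV g"
  unfolding C1_def
  by (meson continuous_at_imp_continuous_on has_derivative_continuous)

lemma C1_cont': "C1 g g' \<Longrightarrow> continuous_on UNIV (g' j)"
  unfolding C1_def by blast

lemma integrable_cc:
  fixes f :: "plane \<Rightarrow> 'b::{banach,second_countable_topology}"
  assumes "continuous_on UNIV f" "vanishes_outside_ball f"
  shows "integrable lborel f"
proof -
  obtain r where r: "\<forall>x. norm x > r \<longrightarrow> f x = 0" using assms(2) unfolding vanishes_outside_ball_def by blast
  have "integrable lborel (\<lambda>x. indicator (cball 0 r) x *\<^sub>R f x)"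
    by (rule borel_integrable_compact) (use assms continuous_on_subset in auto)
  moreover have "(\<lambda>x. indicator (cball 0 r) x *\<^sub>R f x) = f"
    using r by (auto simp: indicator_def fun_eq_iff)
  ultimately show ?thesis by simp
qed

lemma I_translate:
  fixes f :: "plane \<Rightarrow> 'b::{banach,second_countable_topology}"
  assumes "continuous_on UNIV f"
  shows "I (\<lambda>x. f (x + y)) = I f"
proof -
  have "I f = integral\<^sup>L (distr lborel borel ((+) y)) f" by (simp add: lborel_distr_plus)
  also have "\<dots> = I (\<lambda>x. f (y + x))"
    by (rule integral_distr) (auto intro: borel_measurable_continuous_onI assms)
  finally show ?thesis by (simp add: add.commute)
qed

lemma I_sh:
  fixes f :: "plane \<Rightarrow> 'b::{banach,second_countable_topology}"
  shows "continuous_on UNIV f \<Longrightarrow> I (sh s j f) = I f"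
  unfolding sh_def by (rule I_translate)

lemma I_dq_zero:
  fixes f :: "plane \<Rightarrow> 'b::{banach,second_countable_topology}"
  assumes "continuous_on UNIV f" "vanishes_outside_ball f"
  shows "I (dq s j f) = 0"
proof -
  have "I (\<lambda>x. sh s j f x - f x) = I (sh s j f) - I f"
    by (rule Bochner_Integration.integral_diff) (intro integrable_cc continuous_intros supp assms)+
  then show ?thesis unfolding dq_def[abs_def] using I_sh[OF assms(1)] by simp
qed

lemma dq_mult:
  fixes f g :: "plane \<Rightarrow> complex"
  shows "dq s j (\<lambda>x. f x * g x) x = dq s j f x * g x + sh s j f x * dq s j g x"
  unfolding dq_def sh_def by (simp add: algebra_simps)

lemma dq_mult':
  fixes f g :: "plane \<Rightarrow> complex"
  shows "dq s j (\<lambda>x. f x * g x) x = dq s j f x * sh s j g x + f x * dq s j g x"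
  unfolding dq_def sh_def by (simp add: algebra_simps)

text \<open>The integral of a difference quotient vanishes by translation invariance; this replaces integration by parts and needs no differentiability.\<close>
lemma I_parts:
  fixes f g :: "plane \<Rightarrow> complex"
  assumes "continuous_on UNIV f" "continuous_on UNIV g" "vanishes_outside_ball f \<or> vanishes_outside_ball g"
  shows "I (\<lambda>x. dq s j f x * g x) = - I (\<lambda>x. sh s j f x * dq s j g x)"
proof -
  have v: "vanishes_outside_ball (\<lambda>x. f x * g x)" "vanishes_outside_ball (\<lambda>x. dq s j f x * g x)"
    "vanishes_outside_ball (\<lambda>x. sh s j f x * dq s j g x)" using assms(3) by (auto intro: supp)
  have "0 = I (dq s j (\<lambda>x. f x * g x))"
    by (rule I_dq_zero[symmetric]) (intro continuous_intros supp assms v)+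
  also have "\<dots> = I (\<lambda>x. dq s j f x * g x + sh s j f x * dq s j g x)"
    by (rule Bochner_Integration.integral_cong) (auto simp: dq_mult)
  also have "\<dots> = I (\<lambda>x. dq s j f x * g x) + I (\<lambda>x. sh s j f x * dq s j g x)"
    by (rule Bochner_Integration.integral_add) (intro integrable_cc continuous_intros supp assms v)+
  finally show ?thesis by (simp add: eq_neg_iff_add_eq_0)
qed

text \<open>The same with the difference moved entirely to the other factor, where it becomes a backward one.\<close>
lemma I_parts_back:
  fixes f g :: "plane \<Rightarrow> complex"
  assumes "continuous_on UNIV f" "continuous_on UNIV g" "vanishes_outside_ball f \<or> vanishes_outside_ball g"
  shows "I (\<lambda>x. dq s j f x * g x) = - I (\<lambda>x. f x * dq (-s) j g x)"
proof -
  have v: "vanishes_outside_ball (\<lambda>x. f x * dq (-s) j g x)" using assms(3) by (auto intro: supp)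
  have c: "continuous_on UNIV (\<lambda>x. f x * dq (-s) j g x)" by (intro continuous_intros assms)
  have "I (\<lambda>x. f x * dq (-s) j g x) = I (sh s j (\<lambda>x. f x * dq (-s) j g x))"
    by (rule I_sh[OF c, symmetric])
  also have "sh s j (\<lambda>x. f x * dq (-s) j g x) = (\<lambda>x. sh s j f x * dq s j g x)"
    by (rule ext) (cases "s = 0"; simp add: sh_def dq_def algebra_simps)
  finally show ?thesis using I_parts[OF assms] by simp
qed

lemma unif_cont_cball:
  fixes g :: "plane \<Rightarrow> 'b::real_normed_vector"
  assumes "continuous_on UNIV g" "e > 0"
  obtains d where "d > 0" "d \<le> 1" "\<And>x y. norm x \<le> r \<Longrightarrow> norm (y - x) < d \<Longrightarrow> norm (g y - g x) < e"
proof -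
  have "uniformly_continuous_on (cball 0 (r+1)) g"
    by (rule compact_uniformly_continuous) (use assms continuous_on_subset in auto)
  then obtain d where d: "d > 0" "\<And>x y. x \<in> cball 0 (r+1) \<Longrightarrow> y \<in> cball 0 (r+1) \<Longrightarrow> dist y x < d \<Longrightarrow> dist (g y) (g x) < e"
    unfolding uniformly_continuous_on_def using assms(2) by metis
  show ?thesis
  proof (rule that[of "min d 1"])
    fix x y :: plane assume a: "norm x \<le> r" "norm (y - x) < min d 1"
    have "norm y \<le> norm x + norm (y - x)" by (metis norm_triangle_sub)
    then show "norm (g y - g x) < e" using d(2)[of x y] a by (auto simp: dist_norm)
  qed (use d in auto)
qed

lemma loc_unifI:
  assumes "\<And>r e. e > 0 \<Longrightarrow> \<exists>d>0. \<forall>s. 0 < s \<and> s < d \<longrightarrow> (\<forall>x. norm x \<le> r \<longrightarrow> norm (F s x - f x) < e)"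
  shows "loc_unif F f"
  unfolding loc_unif_def
proof (intro allI uniform_limitI)
  fix r e :: real assume "e > 0"
  from assms[OF this, of r] obtain d where "d>0" 
    "\<forall>s. 0 < s \<and> s < d \<longrightarrow> (\<forall>x. norm x \<le> r \<longrightarrow> norm (F s x - f x) < e)" by blast
  then show "\<forall>\<^sub>F s in at_right 0. \<forall>x\<in>cball 0 r. dist (F s x) (f x) < e"
    unfolding eventually_at_right_field by (intro exI[of _ d]) (auto simp: dist_norm)
qed

lemma loc_unif_sh:
  fixes g :: "plane \<Rightarrow> 'b::real_normed_vector"
  assumes "continuous_on UNIV g"
  shows "loc_unif (\<lambda>s. sh s j g) g" "loc_unif (\<lambda>s. sh (-s) j g) g"
proof -
  have *: "\<exists>d>0. \<forall>s. \<bar>s\<bar> < d \<longrightarrow> (\<forall>x. norm x \<le> r \<longrightarrow> norm (sh s j g x - g x) < e)" if e: "e > 0" for r e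
  proof -
    obtain d where d: "d > 0" "\<And>x y. norm x \<le> r \<Longrightarrow> norm (y - x) < d \<Longrightarrow> norm (g y - g x) < e"
      using unif_cont_cball[where g=g and e=e and r=r, OF assms e] by metis
    then show ?thesis unfolding sh_def by (intro exI[of _ d]) auto
  qed
  show "loc_unif (\<lambda>s. sh s j g) g"
  proof (rule loc_unifI)
    fix r e :: real assume "e > 0"
    from *[OF this, of r] show "\<exists>d>0. \<forall>s. 0 < s \<and> s < d \<longrightarrow> (\<forall>x. norm x \<le> r \<longrightarrow> norm (sh s j g x - g x) < e)"
      by (metis abs_of_pos)
  qed
  show "loc_unif (\<lambda>s. sh (-s) j g) g"
  proof (rule loc_unifI)
    fix r e :: real assume "e > 0"
    from *[OF this, of r] show "\<exists>d>0. \<forall>s. 0 < s \<and> s < d \<longrightarrow> (\<forall>x. norm x \<le> r \<longrightarrow> norm (sh (-s) j g x - g x) < e)"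
      by (metis abs_minus_cancel abs_of_pos)
  qed
qed

text \<open>Mean value theorem along the segment from x to \<open>x + s e_j\<close>, with uniform continuity of the derivative on balls. Both signs of s are covered, for later use of backward differences.\<close>
lemma dq_close:
  fixes g :: "plane \<Rightarrow> 'b::real_normed_vector"
  assumes C: "C1 g g'" and e: "e > 0"
  shows "\<exists>d>0. \<forall>s. s \<noteq> 0 \<and> \<bar>s\<bar> < d \<longrightarrow> (\<forall>x. norm x \<le> r \<longrightarrow> norm (dq s j g x - g' j x) < e)"
proof -
  obtain d where d: "d > 0" "\<And>x y. norm x \<le> r \<Longrightarrow> norm (y - x) < d \<Longrightarrow> norm (g' j y - g' j x) < e/2"
    using unif_cont_cball[OF C1_cont'[OF C], of "e/2" r j] e by (metis half_gt_zero)
  have "norm (dq s j g x - g' j x) < e" if s: "s \<noteq> 0" "\<bar>s\<bar> < d" and x: "norm x \<le> r" for s x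
  proof -
    define k where "k t = g (x + t *\<^sub>R axis j 1) - t *\<^sub>R g' j x" for t
    have dv: "(k has_derivative (\<lambda>t. t *\<^sub>R (g' j (x + u *\<^sub>R axis j 1) - g' j x))) (at u within S)" for u S
    proof -
      have "((\<lambda>t. x + t *\<^sub>R axis j 1) has_derivative (\<lambda>t. t *\<^sub>R axis j 1)) (at u within S)"
        by (auto intro!: derivative_eq_intros)
      moreover have "(g has_derivative (\<lambda>v. v $ 1 *\<^sub>R g' 1 (x + u *\<^sub>R axis j 1) + v $ 2 *\<^sub>R g' 2 (x + u *\<^sub>R axis j 1))) (at (x + u *\<^sub>R axis j 1))"
        using C unfolding C1_def by blast
      ultimately have "((\<lambda>t. g (x + t *\<^sub>R axis j 1)) has_derivative (\<lambda>t. (t *\<^sub>R axis j 1 :: plane) $ 1 *\<^sub>R g' 1 (x + u *\<^sub>R axis j 1) + (t *\<^sub>R axis j 1 :: plane) $ 2 *\<^sub>R g' 2 (x + u *\<^sub>R axis j 1))) (at u within S)"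
        by (rule has_derivative_compose)
      moreover have "(\<lambda>t. (t *\<^sub>R axis j 1 :: plane) $ 1 *\<^sub>R g' 1 (x + u *\<^sub>R axis j 1) + (t *\<^sub>R axis j 1 :: plane) $ 2 *\<^sub>R g' 2 (x + u *\<^sub>R axis j 1)) = (\<lambda>t. t *\<^sub>R g' j (x + u *\<^sub>R axis j 1))"
        using exhaust_2[of j] by (auto simp: axis_def)
      ultimately have "((\<lambda>t. g (x + t *\<^sub>R axis j 1)) has_derivative (\<lambda>t. t *\<^sub>R g' j (x + u *\<^sub>R axis j 1))) (at u within S)"
        by simp
      from has_derivative_diff[OF this has_derivative_scaleR_left[OF has_derivative_ident, of "g' j x"]]
      show ?thesis unfolding k_def by (simp add: algebra_simps)
    qed
    have "norm (k s - k 0) \<le> (e/2) * norm (s - 0)"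
    proof (rule differentiable_bound[of "closed_segment 0 s" k])
      show "convex (closed_segment 0 s)" by simp
      show "(k has_derivative (\<lambda>t. t *\<^sub>R (g' j (x + u *\<^sub>R axis j 1) - g' j x))) (at u within closed_segment 0 s)" for u
        by (rule dv)
      show "onorm (\<lambda>t. t *\<^sub>R (g' j (x + u *\<^sub>R axis j 1) - g' j x)) \<le> e/2" if "u \<in> closed_segment 0 s" for u
      proof (rule onorm_le)
        fix t :: real
        have "\<bar>u\<bar> < d" using that s by (auto simp: closed_segment_eq_real_ivl split: if_splits)
        then have "norm (g' j (x + u *\<^sub>R axis j 1) - g' j x) < e/2" by (intro d(2) x) auto
        then show "norm (t *\<^sub>R (g' j (x + u *\<^sub>R axis j 1) - g' j x)) \<le> e / 2 * norm t"
          using mult_left_mono[of "norm (g' j (x + u *\<^sub>R axis j 1) - g' j x)" "e/2" "\<bar>t\<bar>"] by (simp add: mult.commute)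
      qed
    qed auto
    then have *: "norm (k s - k 0) \<le> (e/2) * \<bar>s\<bar>" by simp
    have "dq s j g x - g' j x = (1/s) *\<^sub>R (k s - k 0)"
      unfolding dq_def sh_def k_def using s by (simp add: algebra_simps)
    then have "norm (dq s j g x - g' j x) = (1/\<bar>s\<bar>) * norm (k s - k 0)" by simp
    also have "\<dots> \<le> (1/\<bar>s\<bar>) * ((e/2) * \<bar>s\<bar>)" by (intro mult_left_mono *) auto
    also have "\<dots> < e" using s e by simp
    finally show ?thesis .
  qed
  then show ?thesis using d(1) by blast
qed

lemma loc_unif_dq:
  fixes g :: "plane \<Rightarrow> 'b::real_normed_vector"
  assumes C: "C1 g g'"
  shows "loc_unif (\<lambda>s. dq s j g) (g' j)" "loc_unif (\<lambda>s. dq (-s) j g) (g' j)"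
proof -
  show "loc_unif (\<lambda>s. dq s j g) (g' j)"
  proof (rule loc_unifI)
    fix r e :: real assume "e > 0"
    from dq_close[OF C this, of r j] 
    show "\<exists>d>0. \<forall>s. 0 < s \<and> s < d \<longrightarrow> (\<forall>x. norm x \<le> r \<longrightarrow> norm (dq s j g x - g' j x) < e)"
      by (metis abs_of_pos less_irrefl)
  qed
  show "loc_unif (\<lambda>s. dq (-s) j g) (g' j)"
  proof (rule loc_unifI)
    fix r e :: real assume "e > 0"
    from dq_close[OF C this, of r j] 
    show "\<exists>d>0. \<forall>s. 0 < s \<and> s < d \<longrightarrow> (\<forall>x. norm x \<le> r \<longrightarrow> norm (dq (-s) j g x - g' j x) < e)"
      by (metis abs_of_pos abs_minus_cancel less_irrefl neg_equal_0_iff_equal)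
  qed
qed

named_theorems loc_unif_intros

lemmas [loc_unif_intros] = loc_unif_sh loc_unif_dq

lemma loc_unif_const [loc_unif_intros]: "loc_unif (\<lambda>s. f) f"
  unfolding loc_unif_def by (simp add: uniform_limit_const)

lemma loc_unif_add [loc_unif_intros]: "loc_unif F f \<Longrightarrow> loc_unif G g \<Longrightarrow> loc_unif (\<lambda>s x. F s x + G s x) (\<lambda>x. f x + g x)"
  unfolding loc_unif_def by (auto intro: uniform_limit_add)

lemma loc_unif_diff [loc_unif_intros]: "loc_unif F f \<Longrightarrow> loc_unif G g \<Longrightarrow> loc_unif (\<lambda>s x. F s x - G s x) (\<lambda>x. f x - g x)"
  unfolding loc_unif_def by (auto intro: uniform_limit_minus)

lemma loc_unif_uminus [loc_unif_intros]: "loc_unif F f \<Longrightarrow> loc_unif (\<lambda>s x. - F s x) (\<lambda>x. - f x)"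
  unfolding loc_unif_def by (auto intro: uniform_limit_uminus)

lemma loc_unif_cnj [loc_unif_intros]: "loc_unif F f \<Longrightarrow> loc_unif (\<lambda>s x. cnj (F s x)) (\<lambda>x. cnj (f x))"
  unfolding loc_unif_def by (auto intro!: bounded_linear.uniform_limit[OF bounded_linear_cnj])

lemma loc_unif_of_real [loc_unif_intros]: "loc_unif F f \<Longrightarrow> loc_unif (\<lambda>s x. complex_of_real (F s x)) (\<lambda>x. complex_of_real (f x))"
  unfolding loc_unif_def by (auto intro!: bounded_linear.uniform_limit[OF bounded_linear_of_real])

lemma bdd_cball:
  assumes "continuous_on UNIV (f :: plane \<Rightarrow> 'b::real_normed_vector)"
  shows "bounded (f ` cball 0 r)"
  by (rule compact_imp_bounded, rule compact_continuous_image)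
     (use assms continuous_on_subset in auto)

lemma loc_unif_mult [loc_unif_intros]: 
  fixes f g :: "plane \<Rightarrow> complex"
  shows "loc_unif F f \<Longrightarrow> loc_unif G g \<Longrightarrow> continuous_on UNIV f \<Longrightarrow> continuous_on UNIV g
     \<Longrightarrow> loc_unif (\<lambda>s x. F s x * G s x) (\<lambda>x. f x * g x)"
  unfolding loc_unif_def by (auto intro!: uniform_lim_mult bdd_cball)

text \<open>Locally uniform convergence suffices because all supports lie in one ball.\<close>
lemma I_lim:
  fixes F :: "real \<Rightarrow> plane \<Rightarrow> 'b::{banach,second_countable_topology}"
  assumes loc_unif: "loc_unif F f" and v: "unif_vanishes F" and c: "\<And>s. continuous_on UNIV (F s)" and cf: "continuous_on UNIV f"
  shows "((\<lambda>s. I (F s)) \<longlongrightarrow> I f) (at_right 0)"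
proof -
  obtain r where r: "\<And>s x. s\<in>{-1..1} \<Longrightarrow> norm x > r \<Longrightarrow> F s x = 0"
    using v unfolding unif_vanishes_def by blast
  have ev1: "\<forall>\<^sub>F s in at_right 0. s \<in> {0<..<1::real}"
    by (rule eventually_at_right_real) simp
  have r': "f x = 0" if "norm x > r" for x
  proof -
    have "((\<lambda>s. F s x) \<longlongrightarrow> f x) (at_right 0)"
      by (rule tendsto_uniform_limitI[where S="cball 0 (norm x)" and f=F]) (use loc_unif in \<open>auto simp: loc_unif_def\<close>)
    moreover have "\<forall>\<^sub>F s in at_right 0. F s x = 0"
      using ev1 by eventually_elim (use r that in auto)
    ultimately have "((\<lambda>s. 0) \<longlongrightarrow> f x) (at_right (0::real))"
      by (rule Lim_transform_eventually)
    then show ?thesis using tendsto_unique[OF trivial_limit_at_right_real tendsto_const] by metis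
  qed
  have vf: "vanishes_outside_ball f" using r' unfolding vanishes_outside_ball_def by blast
  define V where "V = measure lborel (cball (0::plane) r)"
  show ?thesis
  proof (rule tendstoI)
    fix e :: real assume e: "e > 0"
    define e' where "e' = e / (V + 1)"
    have V0: "V \<ge> 0" unfolding V_def by simp
    have e': "e' > 0" using e V0 unfolding e'_def by simp
    have "\<forall>\<^sub>F s in at_right 0. \<forall>x\<in>cball 0 r. dist (F s x) (f x) < e'"
      using loc_unif e' unfolding loc_unif_def by (auto dest: uniform_limitD)
    with ev1 show "\<forall>\<^sub>F s in at_right 0. dist (I (F s)) (I f) < e"
    proof eventually_elim
      case (elim s)
      have vs: "vanishes_outside_ball (F s)" using r[of s] elim(1) unfolding vanishes_outside_ball_def by auto
      have "I (F s) - I f = I (\<lambda>x. F s x - f x)"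
        by (rule Bochner_Integration.integral_diff[symmetric]) (intro integrable_cc c cf vs vf)+
      also have "norm \<dots> \<le> I (\<lambda>x. norm (F s x - f x))" by (rule integral_norm_bound)
      also have "\<dots> \<le> I (\<lambda>x. indicator (cball 0 r) x * e')"
      proof (rule integral_mono)
        show "integrable lborel (\<lambda>x. norm (F s x - f x))"
          by (intro integrable_cc continuous_intros supp c cf vs vf)
        show "integrable lborel (\<lambda>x::plane. indicator (cball 0 r) x * e')"
          by (intro integrable_mult_left integrable_real_indicator) (use emeasure_lborel_cball_finite[of "0::plane" r] in \<open>auto simp: less_top\<close>)
        show "norm (F s x - f x) \<le> indicator (cball 0 r) x * e'" for x
          using elim r'[of x] r[of s x] by (cases "norm x > r") (auto simp: dist_norm indicator_def less_imp_le)
      qed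
      also have "\<dots> = V * e'" unfolding V_def by simp
      also have "\<dots> < e" unfolding e'_def using e V0 by (simp add: field_simps)
      finally show ?case by (simp add: dist_norm)
    qed
  qed
qed

lemma supp_deriv:
  assumes C: "C1 g g'" and v: "vanishes_outside_ball g"
  shows "vanishes_outside_ball (g' j)"
proof -
  have "loc_unif (\<lambda>s. dq s j g) (g' j)" by (rule loc_unif_dq[OF C])
  obtain r where r: "\<And>s x. s\<in>{-1..1} \<Longrightarrow> norm x > r \<Longrightarrow> dq s j g x = 0"
    using uv_dq[OF v, of j] unfolding unif_vanishes_def by blast
  have "g' j x = 0" if "norm x > r" for x
  proof (rule ccontr)
    assume n: "g' j x \<noteq> 0"
    then obtain d where d: "d > 0" "\<And>s. s \<noteq> 0 \<Longrightarrow> \<bar>s\<bar> < d \<Longrightarrow> norm (dq s j g x - g' j x) < norm (g' j x)"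
      using dq_close[OF C, of "norm (g' j x)" "norm x" j] by auto
    have "dq (min (d/2) 1) j g x = 0" using d(1) by (intro r that) auto
    moreover have "min (d/2) 1 \<noteq> 0" "\<bar>min (d/2) 1\<bar> < d" using d(1) by (auto simp: min_def)
    ultimately show False using d(2)[of "min (d/2) 1"] by (metis diff_0 norm_minus_cancel less_irrefl)
  qed
  then show ?thesis unfolding vanishes_outside_ball_def by blast
qed

text \<open>The divergence theorem for compactly supported functions: the integral of \<open>dq s j g\<close> is zero for every s, and the quotient converges uniformly to the derivative.\<close>
lemma I_deriv_zero:
  fixes g :: "plane \<Rightarrow> 'b::{banach,second_countable_topology}"
  assumes C: "C1 g g'" and v: "vanishes_outside_ball g"
  shows "I (g' j) = 0"
proof -
  have "((\<lambda>s. I (dq s j g)) \<longlongrightarrow> I (g' j)) (at_right 0)"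
    by (rule I_lim) (intro loc_unif_intros continuous_intros supp C C1_cont[OF C] C1_cont'[OF C] v)+
  moreover have "(\<lambda>s. I (dq s j g)) = (\<lambda>s. 0)" using I_dq_zero[OF C1_cont[OF C] v] by simp
  ultimately show ?thesis by (metis LIM_const_eq tendsto_const tendsto_unique trivial_limit_at_right_real)
qed

section \<open>Closure properties of C1 functions\<close>

lemma C1_mult:
  fixes f g :: "plane \<Rightarrow> 'a::real_normed_algebra"
  assumes f: "C1 f f'" and g: "C1 g g'"
  shows "C1 (\<lambda>x. f x * g x) (\<lambda>j x. f' j x * g x + f x * g' j x)"
  unfolding C1_def
proof (intro conjI allI)
  fix x
  show "((\<lambda>x. f x * g x) has_derivative (\<lambda>v. v $ 1 *\<^sub>R (f' 1 x * g x + f x * g' 1 x) + v $ 2 *\<^sub>R (f' 2 x * g x + f x * g' 2 x))) (at x)"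
    using has_derivative_mult[OF f[unfolded C1_def, THEN conjunct1, rule_format, of x] g[unfolded C1_def, THEN conjunct1, rule_format, of x]]
    by (simp add: algebra_simps)
qed (intro continuous_intros C1_cont'[OF f] C1_cont'[OF g] C1_cont[OF f] C1_cont[OF g])+

lemma C1_add:
  assumes f: "C1 f f'" and g: "C1 g g'"
  shows "C1 (\<lambda>x. f x + g x) (\<lambda>j x. f' j x + g' j x)"
  unfolding C1_def
proof (intro conjI allI)
  fix x
  show "((\<lambda>x. f x + g x) has_derivative (\<lambda>v. v $ 1 *\<^sub>R (f' 1 x + g' 1 x) + v $ 2 *\<^sub>R (f' 2 x + g' 2 x))) (at x)"
    using has_derivative_add[OF f[unfolded C1_def, THEN conjunct1, rule_format, of x] g[unfolded C1_def, THEN conjunct1, rule_format, of x]]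
    by (simp add: algebra_simps)
qed (intro continuous_intros C1_cont'[OF f] C1_cont'[OF g])+

lemma C1_bl:
  assumes f: "C1 f f'" and L: "bounded_linear L"
  shows "C1 (\<lambda>x. L (f x)) (\<lambda>j x. L (f' j x))"
proof -
  interpret bounded_linear L by fact
  show ?thesis unfolding C1_def
  proof (intro conjI allI)
    fix x
    show "((\<lambda>x. L (f x)) has_derivative (\<lambda>v. v $ 1 *\<^sub>R L (f' 1 x) + v $ 2 *\<^sub>R L (f' 2 x))) (at x)"
      using has_derivative[OF f[unfolded C1_def, THEN conjunct1, rule_format, of x]]
      by (simp add: add scaleR)
  qed (intro continuous_on C1_cont'[OF f])
qed

lemmas C1_cnj = C1_bl[OF _ bounded_linear_cnj]
lemmas C1_Re = C1_bl[OF _ bounded_linear_Re]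
lemmas C1_Im = C1_bl[OF _ bounded_linear_Im]
lemma C1_of_real: "C1 f f' \<Longrightarrow> C1 (\<lambda>x. complex_of_real (f x)) (\<lambda>j x. complex_of_real (f' j x))"
  by (rule C1_bl[OF _ bounded_linear_of_real])

lemma C1_cmult:
  fixes f :: "plane \<Rightarrow> complex"
  shows "C1 f f' \<Longrightarrow> C1 (\<lambda>x. c * f x) (\<lambda>j x. c * f' j x)"
  by (rule C1_bl[OF _ bounded_linear_mult_right])

lemma C1_diff:
  assumes f: "C1 f f'" and g: "C1 g g'"
  shows "C1 (\<lambda>x. f x - g x) (\<lambda>j x. f' j x - g' j x)"
  using C1_add[OF f C1_bl[OF g bounded_linear_minus[OF bounded_linear_ident]]] by simp

lemma C1_translate:
  assumes f: "C1 f f'"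
  shows "C1 (\<lambda>x. f (x + y)) (\<lambda>j x. f' j (x + y))"
  unfolding C1_def
proof (intro conjI allI)
  fix x
  have "((\<lambda>x. x + y) has_derivative (\<lambda>v. v)) (at x)" by (auto intro!: derivative_eq_intros)
  from has_derivative_compose[OF this f[unfolded C1_def, THEN conjunct1, rule_format, of "x + y"]]
  show "((\<lambda>x. f (x + y)) has_derivative (\<lambda>v. v $ 1 *\<^sub>R f' 1 (x + y) + v $ 2 *\<^sub>R f' 2 (x + y))) (at x)" .
  fix j
  show "continuous_on UNIV (\<lambda>x. f' j (x + y))"
    by (rule continuous_on_compose2[OF C1_cont'[OF f, of j]]) (auto intro!: continuous_intros)
qed

lemma C1_sh: "C1 f f' \<Longrightarrow> C1 (sh s k f) (\<lambda>j. sh s k (f' j))"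
  unfolding sh_def[abs_def] by (rule C1_translate)

lemma C1_dq: "C1 f f' \<Longrightarrow> C1 (dq s k f) (\<lambda>j. dq s k (f' j))"
  unfolding dq_def[abs_def] by (rule C1_bl[OF C1_diff[OF C1_sh] bounded_linear_scaleR_right])

section \<open>Smooth divergence free test fields\<close>

lemma Ck_cont: 
  assumes "Ck n f"
  shows "continuous_on UNIV f"
proof (cases n)
  case 0
  then show ?thesis using assms by simp
next
  case (Suc m)
  from assms have "f differentiable (at x)" for x using Suc by simp
  then show ?thesis
    by (simp add: continuous_at_imp_continuous_on differentiable_imp_continuous_within)
qed

lemma Ck_mono: "Ck (Suc n) f \<Longrightarrow> Ck n f"
proof (induction n arbitrary: f)
  case 0
  then show ?case using Ck_cont[OF 0] by simp
next
  case (Suc n)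
  have "Ck n (\<lambda>x. frechet_derivative f (at x) v)" for v
    using Suc.prems unfolding Ck.simps(2)[of "Suc n"] by (blast intro: Suc.IH)
  then show ?case using Suc.prems by simp
qed

lemma Ck_add: "Ck n f \<Longrightarrow> Ck n g \<Longrightarrow> Ck n (\<lambda>x. f x + g x)"
proof (induction n arbitrary: f g)
  case 0 then show ?case by (simp add: continuous_on_add continuous_on_mult)
next
  case (Suc n)
  have d: "((\<lambda>x. f x + g x) has_derivative (\<lambda>v. frechet_derivative f (at x) v + frechet_derivative g (at x) v)) (at x)" for x
    using Suc.prems by (intro has_derivative_add) (simp_all flip: frechet_derivative_works)
  have "frechet_derivative (\<lambda>x. f x + g x) (at x) = (\<lambda>v. frechet_derivative f (at x) v + frechet_derivative g (at x) v)" for x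
    by (rule frechet_derivative_at[OF d, symmetric])
  then show ?case using Suc differentiableI[OF d] by simp
qed

lemma Ck_bounded_linear:
  assumes L: "bounded_linear L"
  shows "Ck n f \<Longrightarrow> Ck n (\<lambda>x. L (f x))"
proof (induction n arbitrary: f)
  case 0 then show ?case by (simp add: bounded_linear.continuous_on[OF L])
next
  case (Suc n)
  have d: "((\<lambda>x. L (f x)) has_derivative (\<lambda>v. L (frechet_derivative f (at x) v))) (at x)" for x
    using Suc.prems by (intro bounded_linear.has_derivative[OF L]) (simp flip: frechet_derivative_works)
  have e: "frechet_derivative (\<lambda>x. L (f x)) (at x) = (\<lambda>v. L (frechet_derivative f (at x) v))" for x
    by (rule frechet_derivative_at[OF d, symmetric])
  have "Ck n (\<lambda>x. L (frechet_derivative f (at x) v))" for v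
    using Suc.prems by (intro Suc.IH) simp
  then show ?case unfolding Ck.simps e by (intro conjI allI differentiableI[OF d])
qed

lemma Ck_mult:
  fixes f g :: "'a::euclidean_space \<Rightarrow> real"
  shows "Ck n f \<Longrightarrow> Ck n g \<Longrightarrow> Ck n (\<lambda>x. f x * g x)"
proof (induction n arbitrary: f g)
  case 0 then show ?case by (simp add: continuous_on_add continuous_on_mult)
next
  case (Suc n)
  have d: "((\<lambda>x. f x * g x) has_derivative (\<lambda>v. f x * frechet_derivative g (at x) v + frechet_derivative f (at x) v * g x)) (at x)" for x
    using Suc.prems by (intro has_derivative_mult) (simp_all flip: frechet_derivative_works)
  have e: "frechet_derivative (\<lambda>x. f x * g x) (at x) = (\<lambda>v. f x * frechet_derivative g (at x) v + frechet_derivative f (at x) v * g x)" for x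
    by (rule frechet_derivative_at[OF d, symmetric])
  have "Ck n (\<lambda>x. f x * frechet_derivative g (at x) v + frechet_derivative f (at x) v * g x)" for v
    using Suc.prems Ck_mono[OF Suc.prems(1)] Ck_mono[OF Suc.prems(2)] by (intro Ck_add Suc.IH) simp_all
  then show ?case unfolding Ck.simps e by (intro conjI allI differentiableI[OF d])
qed

lemma Ck_const: "Ck n (\<lambda>x. c)"
  by (induction n arbitrary: c) (simp_all add: frechet_derivative_const)

lemma Ck_linear:
  fixes v z :: "'a::euclidean_space"
  shows "Ck n (\<lambda>x. v \<bullet> (x - z))"
proof -
  have d: "((\<lambda>x. v \<bullet> (x - z)) has_derivative (\<lambda>w. v \<bullet> w)) (at x)" for x
    using has_derivative_inner_right[OF has_derivative_diff[OF has_derivative_ident has_derivative_const[of z]], of v "at x"] by simp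
  have e: "frechet_derivative (\<lambda>x. v \<bullet> (x - z)) (at x) = (\<lambda>w. v \<bullet> w)" for x
    by (rule frechet_derivative_at[OF d[of x], symmetric])
  have "Ck (Suc n) (\<lambda>x. v \<bullet> (x - z))"
    unfolding Ck.simps e by (intro conjI allI differentiableI[OF d] Ck_const)
  then show ?thesis by (rule Ck_mono)
qed

text \<open>The family \<open>t^(-k) exp (-1/t)\<close>, extended by zero, is closed under differentiation up to linear combinations; smoothness of bump functions follows by induction on the order.\<close>
definition flat :: "nat \<Rightarrow> real \<Rightarrow> real" where
  "flat k t = (if t > 0 then (1/t) ^ k * exp (- (1/t)) else 0)"

lemma flat_tendsto: "(flat k \<longlongrightarrow> 0) (at 0)"
proof -
  have "((\<lambda>t::real. (1/t)^k / exp (1/t)) \<longlongrightarrow> 0) (at_right 0)"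
    by (rule filterlim_compose[OF tendsto_power_div_exp_0])
       (simp add: filterlim_inverse_at_top_right flip: inverse_eq_divide)
  moreover have "\<forall>\<^sub>F t::real in at_right 0. (1/t)^k / exp (1/t) = flat k t"
    unfolding eventually_at_right_field by (intro exI[of _ 1]) (auto simp: flat_def exp_minus divide_inverse)
  ultimately have r: "(flat k \<longlongrightarrow> 0) (at_right 0)" by (rule Lim_transform_eventually)
  have l: "(flat k \<longlongrightarrow> 0) (at_left 0)"
  proof (rule Lim_transform_eventually[OF tendsto_const])
    show "\<forall>\<^sub>F t::real in at_left 0. 0 = flat k t"
      unfolding eventually_at_left_field by (intro exI[of _ "-1"]) (auto simp: flat_def)
  qed
  show ?thesis using l r filterlim_split_at by blast
qed

lemma flat_deriv: "(flat k has_real_derivative (flat (k+2) t - real k * flat (k+1) t)) (at t)"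
proof -
  consider "t > 0" | "t < 0" | "t = 0" by linarith
  then show ?thesis
  proof cases
    case 1
    have p: "((\<lambda>t. (1/t) ^ k) has_real_derivative (- real k * (1/t) ^ (k+1))) (at t)"
    proof -
      have "((\<lambda>t. (1/t)) has_real_derivative (- ((1/t) * (1/t)))) (at t)"
        using 1 by (auto intro!: derivative_eq_intros simp: power2_eq_square)
      moreover have "real k * (- (a * a) * a ^ (k - Suc 0)) = - real k * a ^ (k + 1)" for a :: real
        by (cases k) (simp_all add: algebra_simps)
      ultimately show ?thesis using DERIV_cong[OF DERIV_power] by blast
    qed
    have q: "((\<lambda>t. exp (- (1/t))) has_real_derivative ((1/t)^2 * exp (- (1/t)))) (at t)"
      using 1 by (auto intro!: derivative_eq_intros simp: power2_eq_square)
    have "((\<lambda>t. (1/t) ^ k * exp (- (1/t))) has_real_derivative (flat (k+2) t - real k * flat (k+1) t)) (at t)"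
      using DERIV_mult[OF p q] 1 by (simp add: flat_def algebra_simps power_add power2_eq_square)
    then show ?thesis
      by (rule has_field_derivative_transform_within_open[of _ _ _ "{0<..}"]) (use 1 in \<open>auto simp: flat_def\<close>)
  next
    case 2
    have "((\<lambda>t. 0) has_real_derivative (flat (k+2) t - real k * flat (k+1) t)) (at t)"
      using 2 by (auto simp: flat_def)
    then show ?thesis
      by (rule has_field_derivative_transform_within_open[of _ _ _ "{..<0}"]) (use 2 in \<open>auto simp: flat_def\<close>)
  next
    case 3
    have "((\<lambda>h. (flat k (0+h) - flat k 0) / h) \<longlongrightarrow> 0) (at 0)"
    proof (rule Lim_transform_eventually[OF flat_tendsto[of "k+1"]])
      show "\<forall>\<^sub>F h in at 0. flat (k+1) h = (flat k (0+h) - flat k 0) / h"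
        unfolding eventually_at by (intro exI[of _ 1]) (auto simp: flat_def)
    qed
    then show ?thesis using 3 by (simp add: DERIV_def flat_def)
  qed
qed

lemma flat_cont: "continuous_on UNIV (flat k)"
  by (rule continuous_at_imp_continuous_on) (auto intro: DERIV_isCont[OF flat_deriv])

lemma flat_comp_deriv:
  fixes x z :: "'a::euclidean_space"
  shows "((\<lambda>x. flat k (c - (x-z) \<bullet> (x-z))) has_derivative
     (\<lambda>v. (flat (k+2) (c - (x-z) \<bullet> (x-z)) - real k * flat (k+1) (c - (x-z) \<bullet> (x-z))) * (-2 * (v \<bullet> (x - z))))) (at x)"
proof -
  have "((\<lambda>x. x - z) has_derivative (\<lambda>v. v)) (at x)"
    using has_derivative_diff[OF has_derivative_ident has_derivative_const[of z]] by simp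
  from has_derivative_diff[OF has_derivative_const[of c] has_derivative_inner[OF this this]]
  have "((\<lambda>x. c - (x-z) \<bullet> (x-z)) has_derivative (\<lambda>v. 0 - ((x - z) \<bullet> v + v \<bullet> (x-z)))) (at x)" .
  moreover have "(\<lambda>v. 0 - ((x - z) \<bullet> v + v \<bullet> (x-z))) = (\<lambda>v. -2 * (v \<bullet> (x-z)))"
    by (rule ext) (subst inner_commute, linarith)
  ultimately have "((\<lambda>x. c - (x-z) \<bullet> (x-z)) has_derivative (\<lambda>v. -2 * (v \<bullet> (x-z)))) (at x)" by simp
  from has_derivative_compose[OF this flat_deriv[of k "c - (x-z) \<bullet> (x-z)", unfolded has_field_derivative_def]]
  show ?thesis .
qed

lemma Ck_flat:
  fixes z :: "'a::euclidean_space"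
  shows "Ck n (\<lambda>x. flat k (c - (x-z) \<bullet> (x-z)))"
proof (induction n arbitrary: k)
  case 0
  show ?case unfolding Ck.simps by (rule continuous_on_compose2[OF flat_cont]) (auto intro!: continuous_intros)
next
  case (Suc n)
  have e: "frechet_derivative (\<lambda>x. flat k (c - (x-z) \<bullet> (x-z))) (at x)
    = (\<lambda>v. (flat (k+2) (c - (x-z) \<bullet> (x-z)) + (- real k) * flat (k+1) (c - (x-z) \<bullet> (x-z))) * (-2 * (v \<bullet> (x - z))))" for x
    using frechet_derivative_at[OF flat_comp_deriv[of k c z x], symmetric] by (simp only: diff_conv_add_uminus mult_minus_left)
  have "Ck n (\<lambda>x. (flat (k+2) (c - (x-z) \<bullet> (x-z)) + (- real k) * flat (k+1) (c - (x-z) \<bullet> (x-z))) * (-2 * (v \<bullet> (x - z))))" for v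
    by (intro Ck_mult Ck_add Suc.IH Ck_const Ck_linear)
  then show ?case unfolding Ck.simps e by (intro conjI allI differentiableI[OF flat_comp_deriv[of k c z]])
qed

definition cpl :: "plane \<Rightarrow> complex" where "cpl x = Complex (x $ 1) (x $ 2)"

text \<open>A radial bump supported in the ball of radius \<open>sqrt c\<close>, its complex gradient and the partial derivatives of the latter.\<close>
definition bump :: "real \<Rightarrow> plane \<Rightarrow> real" where "bump c x = flat 0 (c - x \<bullet> x)"
definition bump1 :: "real \<Rightarrow> plane \<Rightarrow> complex" where "bump1 c x = - 2 * flat 2 (c - x \<bullet> x) * cpl x"
definition bump2 :: "real \<Rightarrow> 2 \<Rightarrow> plane \<Rightarrow> complex" where
  "bump2 c j x = - 2 * flat 2 (c - x \<bullet> x) * cpl (axis j 1) + 4 * (flat 4 (c - x \<bullet> x) - 2 * flat 3 (c - x \<bullet> x)) * (x $ j) * cpl x"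

lemma cpl_linear: "bounded_linear cpl"
  unfolding cpl_def by (intro linear_conv_bounded_linear[THEN iffD1] linearI) (auto simp: complex_eq_iff)

lemma cpl_cont [continuous_intros]: "continuous_on UNIV cpl"
  by (rule linear_continuous_on[OF cpl_linear])

lemma inner_plane: "(x::plane) \<bullet> y = x $ 1 * y $ 1 + x $ 2 * y $ 2"
  by (simp add: inner_vec_def sum_2)

text \<open>The gradient of the real function a is stored as the complex function \<open>b = a_1 + i a_2\<close>, and \<open>b'\<close> holds the partial derivatives of b.\<close>
definition C2 :: "(plane \<Rightarrow> real) \<Rightarrow> (plane \<Rightarrow> complex) \<Rightarrow> (2 \<Rightarrow> plane \<Rightarrow> complex) \<Rightarrow> bool" where
  "C2 a b b' \<longleftrightarrow> C1 a (\<lambda>j x. if j = 1 then Re (b x) else Im (b x)) \<and> C1 b b'"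

text \<open>Twice the Wirtinger derivative with respect to the conjugate variable. Applied to the complex gradient of a stream function, its real and imaginary parts are the entries of twice the symmetric gradient of the velocity field (up to order and sign).\<close>
definition dbar :: "(2 \<Rightarrow> plane \<Rightarrow> complex) \<Rightarrow> plane \<Rightarrow> complex" where
  "dbar b' x = b' 1 x + \<i> * b' 2 x"

lemma dbar_cont: "C1 b b' \<Longrightarrow> continuous_on UNIV (dbar b')"
  unfolding dbar_def[abs_def] by (intro continuous_intros) (auto intro: C1_cont')

lemma flat_cont' [continuous_intros]:
  "continuous_on S g \<Longrightarrow> continuous_on S (\<lambda>x. flat k (g x))"
  by (rule continuous_on_compose2[OF flat_cont]) auto

lemma C2_bump: "C2 (bump c) (bump1 c) (bump2 c)"
  unfolding C2_def
proof
  have [simp]: "(2::2) \<noteq> 1" by simp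
  show "C1 (bump c) (\<lambda>j x. if j = 1 then Re (bump1 c x) else Im (bump1 c x))"
    unfolding C1_def
  proof (intro conjI allI)
    fix x :: plane
    show "(bump c has_derivative (\<lambda>v. v $ 1 *\<^sub>R (if (1::2) = 1 then Re (bump1 c x) else Im (bump1 c x)) + v $ 2 *\<^sub>R (if (2::2) = 1 then Re (bump1 c x) else Im (bump1 c x)))) (at x)"
      using flat_comp_deriv[of 0 c 0 x] unfolding bump_def[abs_def] bump1_def cpl_def
      by (simp add: inner_plane algebra_simps numeral_2_eq_2)
    fix j :: 2
    show "continuous_on UNIV (\<lambda>x. if j = 1 then Re (bump1 c x) else Im (bump1 c x))"
      by (cases "j = 1") (auto simp: bump1_def[abs_def] intro!: continuous_intros)
  qed
  show "C1 (bump1 c) (bump2 c)"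
    unfolding C1_def
  proof (intro conjI allI)
    fix x :: plane
    have 1: "((\<lambda>x. complex_of_real (flat 2 (c - x \<bullet> x))) has_derivative
      (\<lambda>v. complex_of_real ((flat 4 (c - x \<bullet> x) - 2 * flat 3 (c - x \<bullet> x)) * (-2 * (v \<bullet> x))))) (at x)"
      using bounded_linear.has_derivative[OF bounded_linear_of_real flat_comp_deriv[of 2 c 0 x]] by simp
    have 2: "(cpl has_derivative cpl) (at x)" by (rule bounded_linear_imp_has_derivative[OF cpl_linear])
    have "- 2 * (complex_of_real (flat 2 (c - x \<bullet> x)) * cpl v + complex_of_real ((flat 4 (c - x \<bullet> x) - 2 * flat 3 (c - x \<bullet> x)) * (-2 * (v \<bullet> x))) * cpl x)
       = v $ 1 *\<^sub>R bump2 c 1 x + v $ 2 *\<^sub>R bump2 c 2 x" for v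
      unfolding bump2_def cpl_def by (simp add: complex_eq_iff axis_def inner_plane algebra_simps)
    with bounded_linear.has_derivative[OF bounded_linear_mult_right[of "- 2"] has_derivative_mult[OF 1 2]]
    show "(bump1 c has_derivative (\<lambda>v. v $ 1 *\<^sub>R bump2 c 1 x + v $ 2 *\<^sub>R bump2 c 2 x)) (at x)"
      unfolding bump1_def[abs_def] by (simp add: mult.assoc)
    fix j :: 2
    show "continuous_on UNIV (bump2 c j)"
      unfolding bump2_def[abs_def] by (intro continuous_intros)
  qed
qed

lemma bump_zero: "norm x > sqrt c \<Longrightarrow> bump c x = 0"
proof -
  assume "norm x > sqrt c"
  then have "c \<le> x \<bullet> x"
    by (metis less_imp_le norm_ge_zero order_less_le_trans power2_norm_eq_inner real_sqrt_abs real_sqrt_le_iff abs_norm_cancel)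
  then show ?thesis unfolding bump_def flat_def by simp
qed

lemma supp_Re_Im:
  assumes "vanishes_outside_ball (\<lambda>x. Re (f x))" "vanishes_outside_ball (\<lambda>x. Im (f x))"
  shows "vanishes_outside_ball f"
proof -
  have "vanishes_outside_ball (\<lambda>x. Complex (Re (f x)) (Im (f x)))"
    by (rule supp_comb[OF assms, where h=Complex]) (simp add: zero_complex.code)
  then show ?thesis by simp
qed

lemma bump_supp: "vanishes_outside_ball (bump c)" "vanishes_outside_ball (bump1 c)" "vanishes_outside_ball (bump2 c j)"
proof -
  show 0: "vanishes_outside_ball (bump c)" unfolding vanishes_outside_ball_def using bump_zero by blast
  have "vanishes_outside_ball (\<lambda>x. (if (1::2) = 1 then Re (bump1 c x) else Im (bump1 c x)))"
    using supp_deriv[OF C2_bump[unfolded C2_def, THEN conjunct1] 0, of 1] .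
  moreover have "vanishes_outside_ball (\<lambda>x. (if (2::2) = 1 then Re (bump1 c x) else Im (bump1 c x)))"
    using supp_deriv[OF C2_bump[unfolded C2_def, THEN conjunct1] 0, of 2] .
  ultimately show 1: "vanishes_outside_ball (bump1 c)" using supp_Re_Im[of "bump1 c"] by simp
  show "vanishes_outside_ball (bump2 c j)"
    using supp_deriv[OF C2_bump[unfolded C2_def, THEN conjunct2] 1, of j] .
qed

text \<open>The rotated gradient of a translated bump, hence a divergence free field.\<close>
definition curl_bump :: "real \<Rightarrow> plane \<Rightarrow> plane \<Rightarrow> plane" where
  "curl_bump c z x = Im (bump1 c (x - z)) *\<^sub>R axis 1 1 - Re (bump1 c (x - z)) *\<^sub>R axis 2 1"

lemma curl_bump_test: "test_function (curl_bump c z)"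
  unfolding test_function_def smooth_def
proof
  have sc: "bounded_linear (\<lambda>r. r *\<^sub>R (w::plane))" for w by (rule bounded_linear_scaleR_left)
  have eq: "curl_bump c z = (\<lambda>x. (-2 * (flat 2 (c - (x-z) \<bullet> (x-z)) * (axis 2 1 \<bullet> (x - z)))) *\<^sub>R axis 1 1
       + (2 * (flat 2 (c - (x-z) \<bullet> (x-z)) * (axis 1 1 \<bullet> (x - z)))) *\<^sub>R axis 2 1)"
    by (rule ext) (simp add: curl_bump_def bump1_def cpl_def inner_axis' vec_eq_iff)
  show "\<forall>n. Ck n (curl_bump c z)"
    unfolding eq by (intro allI Ck_add Ck_bounded_linear[OF sc] Ck_mult Ck_const Ck_flat Ck_linear)
  obtain r where r: "\<And>x. norm x > r \<Longrightarrow> bump1 c x = 0"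
    using bump_supp(2)[of c] unfolding vanishes_outside_ball_def by blast
  have "{x. curl_bump c z x \<noteq> 0} \<subseteq> cball z r"
  proof
    fix x assume "x \<in> {x. curl_bump c z x \<noteq> 0}"
    then have "bump1 c (x - z) \<noteq> 0" unfolding curl_bump_def by auto
    then have "norm (x - z) \<le> r" using r[of "x - z"] by (meson not_le)
    then show "x \<in> cball z r" by (simp add: dist_norm norm_minus_commute)
  qed
  then show "compact (closure {x. curl_bump c z x \<noteq> 0})"
    by (meson bounded_cball bounded_subset compact_closure)
qed

lemma curl_bump_jacobian:
  "jacobian (curl_bump c z) (at x) = vector [vector [Im (bump2 c 1 (x - z)), Im (bump2 c 2 (x - z))],
      vector [- Re (bump2 c 1 (x - z)), - Re (bump2 c 2 (x - z))]]"
proof -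
  have "C1 (\<lambda>x. bump1 c (x - z)) (\<lambda>j x. bump2 c j (x - z))"
    using C1_translate[OF C2_bump[unfolded C2_def, THEN conjunct2], where y="-z"] by simp
  then have d: "((\<lambda>x. bump1 c (x - z)) has_derivative (\<lambda>v. v $ 1 *\<^sub>R bump2 c 1 (x - z) + v $ 2 *\<^sub>R bump2 c 2 (x - z))) (at x)"
    unfolding C1_def by blast
  have "(curl_bump c z has_derivative (\<lambda>v. Im (v $ 1 *\<^sub>R bump2 c 1 (x - z) + v $ 2 *\<^sub>R bump2 c 2 (x - z)) *\<^sub>R axis 1 1
     - Re (v $ 1 *\<^sub>R bump2 c 1 (x - z) + v $ 2 *\<^sub>R bump2 c 2 (x - z)) *\<^sub>R axis 2 1)) (at x)"
    unfolding curl_bump_def[abs_def]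
    by (intro has_derivative_diff bounded_linear.has_derivative[OF bounded_linear_scaleR_left]
      bounded_linear.has_derivative[OF bounded_linear_Re d] bounded_linear.has_derivative[OF bounded_linear_Im d])
  note d' = frechet_derivative_at[OF this, symmetric]
  show ?thesis
    unfolding jacobian_def matrix_def d' by (simp add: vec_eq_iff forall_2 axis_def)
qed

lemma C1_reflect:
  assumes f: "C1 f f'"
  shows "C1 (\<lambda>z. f (x - z)) (\<lambda>j z. - f' j (x - z))"
  unfolding C1_def
proof (intro conjI allI)
  fix z :: plane
  have "((\<lambda>z. x - z) has_derivative (\<lambda>v. - v)) (at z)" by (auto intro!: derivative_eq_intros)
  from has_derivative_compose[OF this f[unfolded C1_def, THEN conjunct1, rule_format, of "x - z"]]
  show "((\<lambda>z. f (x - z)) has_derivative (\<lambda>v. v $ 1 *\<^sub>R (- f' 1 (x - z)) + v $ 2 *\<^sub>R (- f' 2 (x - z)))) (at z)"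
    by simp
  fix j
  have "continuous_on UNIV (\<lambda>z. f' j (x - z))"
    by (rule continuous_on_compose2[OF C1_cont'[OF f, of j]]) (auto intro!: continuous_intros)
  then show "continuous_on UNIV (\<lambda>z. - f' j (x - z))" by (intro continuous_intros)
qed

lemma I_dbar_zero:
  assumes C: "C1 g g'" and v: "vanishes_outside_ball g"
  shows "I (dbar g') = 0"
proof -
  have "I (dbar g') = I (g' 1) + I (\<lambda>x. \<i> * g' 2 x)"
    unfolding dbar_def[abs_def]
    by (rule Bochner_Integration.integral_add) (intro integrable_cc continuous_intros supp supp_deriv[OF C v] C1_cont'[OF C])+
  then show ?thesis using I_deriv_zero[OF C v] by simp
qed

lemma I_dbar_parts:
  assumes f: "C1 f f'" and g: "C1 g g'" and v: "vanishes_outside_ball g"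
  shows "I (\<lambda>x. dbar f' x * g x) = - I (\<lambda>x. f x * dbar g' x)"
proof -
  have vg: "vanishes_outside_ball (dbar g')" 
    unfolding dbar_def[abs_def] by (intro supp supp_deriv[OF g v])
  have "0 = I (dbar (\<lambda>j x. f' j x * g x + f x * g' j x))"
    by (rule I_dbar_zero[OF C1_mult[OF f g], symmetric]) (intro supp v)
  also have "\<dots> = I (\<lambda>x. dbar f' x * g x + f x * dbar g' x)"
    by (rule Bochner_Integration.integral_cong) (auto simp: dbar_def algebra_simps)
  also have "\<dots> = I (\<lambda>x. dbar f' x * g x) + I (\<lambda>x. f x * dbar g' x)"
    by (rule Bochner_Integration.integral_add)
      (intro integrable_cc continuous_intros C1_cont[OF f] C1_cont[OF g] dbar_cont[OF f] dbar_cont[OF g] supp v vg)+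
  finally show ?thesis by (simp add: eq_neg_iff_add_eq_0)
qed

lemma integral_pos_of_pos:
  fixes f :: "plane \<Rightarrow> real"
  assumes c: "continuous_on UNIV f" and v: "vanishes_outside_ball f" and nn: "\<And>x. f x \<ge> 0" and p: "f a > 0"
  shows "I f > 0"
proof -
  obtain d where d: "d > 0" "\<And>y. norm (y - a) < d \<Longrightarrow> norm (f y - f a) < f a / 2"
    using unif_cont_cball[OF c, of "f a / 2" "norm a"] p by (metis half_gt_zero order_refl)
  define m where "m = measure lborel (ball a d)"
  have m: "m > 0" unfolding m_def using d(1) 
    by (simp add: content_ball_pos)
  have i: "integrable lborel (\<lambda>x::plane. indicator (ball a d) x * (f a / 2))"
    using emeasure_lborel_ball_finite[of a d]
    by (intro integrable_mult_left integrable_real_indicator) (auto simp: less_top)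
  have "m * (f a / 2) = I (\<lambda>x. indicator (ball a d) x * (f a / 2))" unfolding m_def by simp
  also have "\<dots> \<le> I f"
  proof (rule integral_mono[OF i integrable_cc[OF c v]])
    fix x
    show "indicator (ball a d) x * (f a / 2) \<le> f x"
    proof (cases "x \<in> ball a d")
      case True
      then have "norm (f x - f a) < f a / 2" by (intro d) (auto simp: dist_norm norm_minus_commute)
      then have "f a / 2 \<le> f x" unfolding real_norm_def by linarith
      then show ?thesis using True by simp
    qed (use nn in auto)
  qed
  finally show ?thesis using m p by (meson half_gt_zero less_le_trans mult_pos_pos)
qed

text \<open>If the equation holds for all translates of all bumps, it holds for every C2 function F: integrating the equation for the bump centred at z against \<open>F z\<close> and moving both derivatives to F by parts gives the equation for a mollification of F, and \<open>dbar f'\<close> is uniformly continuous.\<close>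
lemma mollify:
  fixes Q :: "plane \<Rightarrow> complex"
  assumes Q: "continuous_on UNIV Q"
    and weak: "\<And>c z. c > 0 \<Longrightarrow> Re (I (\<lambda>x. Q x * dbar (bump2 c) (x - z))) = 0"
    and F: "C2 F f f'" and v: "vanishes_outside_ball F"
  shows "Re (I (\<lambda>x. Q x * dbar f' x)) = 0"
proof -
  note F1 = F[unfolded C2_def, THEN conjunct1] and F2 = F[unfolded C2_def, THEN conjunct2]
  have vf: "vanishes_outside_ball f"
  proof -
    have "vanishes_outside_ball (\<lambda>x. (if (1::2) = 1 then Re (f x) else Im (f x)))"
      using supp_deriv[OF F1 v, of 1] .
    moreover have "vanishes_outside_ball (\<lambda>x. (if (2::2) = 1 then Re (f x) else Im (f x)))"
      using supp_deriv[OF F1 v, of 2] .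
    ultimately show ?thesis using supp_Re_Im[of f] by simp
  qed
  have vf': "vanishes_outside_ball (dbar f')"
    unfolding dbar_def[abs_def] by (intro supp supp_deriv[OF F2 vf])
  have cF: "continuous_on UNIV F" by (rule C1_cont[OF F1])
  have cf': "continuous_on UNIV (dbar f')" by (rule dbar_cont[OF F2])
  obtain r where r: "r \<ge> 0" "\<And>x. norm x > r \<Longrightarrow> F x = 0" "\<And>x. norm x > r \<Longrightarrow> dbar f' x = 0"
  proof -
    obtain r1 r2 where "\<forall>x. norm x > r1 \<longrightarrow> F x = 0" "\<forall>x. norm x > r2 \<longrightarrow> dbar f' x = 0"
      using v vf' unfolding vanishes_outside_ball_def by blast
    then show ?thesis by (intro that[of "max 0 (max r1 r2)"]) auto
  qed
  define J where "J = I (\<lambda>x. Q x * dbar f' x)"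
  define A where "A = I (\<lambda>x. indicator (cball 0 (r+1)) x * norm (Q x))"
  have iA: "integrable lborel (\<lambda>x. indicator (cball 0 (r+1)) x * norm (Q x))"
    using borel_integrable_compact[of "cball 0 (r+1)" "\<lambda>x. norm (Q x)"] continuous_on_subset[OF Q]
    by (auto intro!: continuous_intros)
  have A0: "A \<ge> 0" unfolding A_def by (rule integral_nonneg_AE) auto
  have key: "\<bar>Re J\<bar> \<le> e * A" if e: "e > 0" for e
  proof -
    obtain d where d: "d > 0" "d \<le> 1" "\<And>x y. norm x \<le> r + 1 \<Longrightarrow> norm (y - x) < d \<Longrightarrow> norm (dbar f' y - dbar f' x) < e"
      using unif_cont_cball[OF cf' e, of "r + 1"] by metis
    \<comment> \<open>The bump then lives in a ball of radius d/2, on which \<open>dbar f'\<close> oscillates by less than e.\<close>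
    define c where "c = (d/2)\<^sup>2"
    have c: "c > 0" "sqrt c < d" "sqrt c \<le> 1" unfolding c_def using d by auto
    define K where "K = I (bump c)"
    have cb: "continuous_on UNIV (bump c)" using C1_cont[OF C2_bump[unfolded C2_def, THEN conjunct1]] .
    have b0: "bump c x \<ge> 0" for x unfolding bump_def flat_def by auto
    have K: "K > 0" unfolding K_def
      by (rule integral_pos_of_pos[OF cb bump_supp(1) b0, where a=0]) (use c in \<open>simp add: bump_def flat_def\<close>)
    define D where "D = dbar (bump2 c)"
    have cD: "continuous_on UNIV D" unfolding D_def by (rule dbar_cont[OF C2_bump[unfolded C2_def, THEN conjunct2]])
    have vD: "vanishes_outside_ball D" unfolding D_def dbar_def[abs_def] by (intro supp bump_supp)
    define N where "N x = I (\<lambda>z. complex_of_real (bump c (x - z)) * dbar f' z)" for x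
    \<comment> \<open>Two integrations by parts; the reflection in the argument of the bump changes the sign twice.\<close>
    have inner: "I (\<lambda>z. D (x - z) * complex_of_real (F z)) = N x" for x
    proof -
      have c1: "C1 (\<lambda>z. bump1 c (x - z)) (\<lambda>j z. - bump2 c j (x - z))"
        by (rule C1_reflect[OF C2_bump[unfolded C2_def, THEN conjunct2]])
      have cF': "C1 (\<lambda>z. complex_of_real (F z)) (\<lambda>j z. complex_of_real (if j = 1 then Re (f z) else Im (f z)))"
        by (rule C1_of_real[OF F1])
      have c0: "C1 (\<lambda>z. complex_of_real (bump c (x - z))) (\<lambda>j z. complex_of_real (- (if j = 1 then Re (bump1 c (x - z)) else Im (bump1 c (x - z)))))"
        by (rule C1_of_real[OF C1_reflect[OF C2_bump[unfolded C2_def, THEN conjunct1]]])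
      have "I (\<lambda>z. D (x - z) * complex_of_real (F z)) = - I (\<lambda>z. dbar (\<lambda>j z. - bump2 c j (x - z)) z * complex_of_real (F z))"
        unfolding D_def dbar_def by (simp flip: Bochner_Integration.integral_minus add: algebra_simps)
      also have "\<dots> = I (\<lambda>z. bump1 c (x - z) * dbar (\<lambda>j z. complex_of_real (if j = 1 then Re (f z) else Im (f z))) z)"
        by (subst I_dbar_parts[OF c1 cF']) (auto intro: supp v)
      also have "\<dots> = I (\<lambda>z. bump1 c (x - z) * f z)"
        by (rule Bochner_Integration.integral_cong) (auto simp: dbar_def complex_eq_iff)
      also have "\<dots> = - I (\<lambda>z. dbar (\<lambda>j z. complex_of_real (- (if j = 1 then Re (bump1 c (x - z)) else Im (bump1 c (x - z))))) z * f z)"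
        by (subst Bochner_Integration.integral_minus[symmetric], rule Bochner_Integration.integral_cong)
          (auto simp: dbar_def complex_eq_iff algebra_simps)
      also have "\<dots> = N x"
        unfolding N_def by (subst I_dbar_parts[OF c0 F2 vf]) simp
      finally show ?thesis .
    qed
    have int2: "integrable (lborel \<Otimes>\<^sub>M lborel) (\<lambda>(x, z). Q x * (D (x - z) * complex_of_real (F z)))"
    proof -
      obtain t where t: "\<And>x. norm x > t \<Longrightarrow> D x = 0" using vD unfolding vanishes_outside_ball_def by blast
      define S where "S = cball (0::plane) (t + r) \<times> cball (0::plane) r"
      have cc: "continuous_on S (\<lambda>(x, z). Q x * (D (x - z) * complex_of_real (F z)))"
        unfolding split_beta
        by (intro continuous_intros continuous_on_compose2[OF Q] continuous_on_compose2[OF cD] continuous_on_compose2[OF cF]) auto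
      have "integrable lborel (\<lambda>p. indicator S p *\<^sub>R (\<lambda>(x, z). Q x * (D (x - z) * complex_of_real (F z))) p)"
        by (rule borel_integrable_compact[OF _ cc]) (auto simp: S_def intro: compact_Times)
      moreover have "indicator S p *\<^sub>R (\<lambda>(x, z). Q x * (D (x - z) * complex_of_real (F z))) p = (\<lambda>(x, z). Q x * (D (x - z) * complex_of_real (F z))) p" for p
      proof (cases p)
        case (Pair x z)
        have "D (x - z) * complex_of_real (F z) = 0" if "(x, z) \<notin> S"
        proof (cases "norm z > r")
          case False
          then have "norm x > t + r" using that unfolding S_def by auto
          then have "norm (x - z) > t" using False norm_triangle_ineq2[of x z] by linarith
          then show ?thesis using t by simp
        qed (use r in simp)
        then show ?thesis using Pair by (auto simp: indicator_def)
      qed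
      ultimately have "integrable lborel (\<lambda>(x, z). Q x * (D (x - z) * complex_of_real (F z)))" by simp
      then show ?thesis by (simp only: lborel_prod)
    qed
    have fub: "I (\<lambda>z. I (\<lambda>x. Q x * (D (x - z) * complex_of_real (F z)))) = I (\<lambda>x. I (\<lambda>z. Q x * (D (x - z) * complex_of_real (F z))))"
      by (rule lborel_pair.Fubini_integral[OF int2])
    have "Re (I (\<lambda>z. I (\<lambda>x. Q x * (D (x - z) * complex_of_real (F z))))) = 0"
    proof -
      have eqz: "I (\<lambda>x. Q x * (D (x - z) * complex_of_real (F z))) = I (\<lambda>x. Q x * D (x - z)) * complex_of_real (F z)" for z
        unfolding mult.assoc[symmetric] integral_mult_left_zero ..
      have re0: "Re (I (\<lambda>x. Q x * (D (x - z) * complex_of_real (F z)))) = 0" for z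
        unfolding eqz using weak[OF c(1), of z] unfolding D_def by simp
      have iz: "integrable lborel (\<lambda>z. I (\<lambda>x. Q x * (D (x - z) * complex_of_real (F z))))"
        using lborel_pair.integrable_snd[OF int2] by simp
      have "Re (I (\<lambda>z. I (\<lambda>x. Q x * (D (x - z) * complex_of_real (F z))))) = I (\<lambda>z. Re (I (\<lambda>x. Q x * (D (x - z) * complex_of_real (F z)))))"
        by (rule integral_bounded_linear[OF bounded_linear_Re iz, symmetric])
      then show ?thesis using re0 by simp
    qed
    then have reN: "Re (I (\<lambda>x. Q x * N x)) = 0"
      unfolding fub by (simp add: inner)
    have iN: "integrable lborel (\<lambda>x. Q x * N x)"
      using lborel_pair.integrable_fst[OF int2] by (simp add: inner)
    have osc: "norm (N x - K * dbar f' x) \<le> indicator (cball 0 (r+1)) x * (K * e)" for x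
    proof -
      have cr: "continuous_on UNIV (\<lambda>z. bump c (x - z))"
        by (rule continuous_on_compose2[OF cb]) (auto intro!: continuous_intros)
      have vr: "vanishes_outside_ball (\<lambda>z. bump c (x - z))"
      proof -
        have "bump c (x - z) = 0" if "norm z > norm x + sqrt c" for z
          by (rule bump_zero) (use that norm_triangle_ineq2[of z x] in \<open>simp add: norm_minus_commute\<close>)
        then show ?thesis unfolding vanishes_outside_ball_def by blast
      qed
      have K': "I (\<lambda>z. bump c (x - z)) = K"
      proof -
        have "bump c (x - z) = bump c (z + (- x))" for z unfolding bump_def by (simp add: inner_diff_left inner_diff_right inner_commute add.commute)
        then show ?thesis unfolding K_def using I_translate[OF cb, of "-x"] by simp
      qed
      have "K * dbar f' x = I (\<lambda>z. complex_of_real (bump c (x - z)) * dbar f' x)"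
        unfolding K'[symmetric] integral_mult_left_zero
        by (simp add: integral_of_real)
      then have "N x - K * dbar f' x = I (\<lambda>z. complex_of_real (bump c (x - z)) * dbar f' z) - I (\<lambda>z. complex_of_real (bump c (x - z)) * dbar f' x)"
        unfolding N_def by simp
      also have "\<dots> = I (\<lambda>z. complex_of_real (bump c (x - z)) * dbar f' z - complex_of_real (bump c (x - z)) * dbar f' x)"
        by (rule Bochner_Integration.integral_diff[symmetric]) (intro integrable_cc continuous_intros supp vr cr cf')+
      finally have eq: "N x - K * dbar f' x = I (\<lambda>z. complex_of_real (bump c (x - z)) * dbar f' z - complex_of_real (bump c (x - z)) * dbar f' x)" .
      show ?thesis
      proof (cases "norm x \<le> r + 1")
        case True
        have "norm (N x - K * dbar f' x) \<le> I (\<lambda>z. norm (complex_of_real (bump c (x - z)) * dbar f' z - complex_of_real (bump c (x - z)) * dbar f' x))"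
          unfolding eq by (rule integral_norm_bound)
        also have "\<dots> \<le> I (\<lambda>z. bump c (x - z) * e)"
        proof (rule integral_mono)
          fix z
          show "norm (complex_of_real (bump c (x - z)) * dbar f' z - complex_of_real (bump c (x - z)) * dbar f' x) \<le> bump c (x - z) * e"
          proof (cases "norm (x - z) > sqrt c")
            case False
            then have "norm (dbar f' z - dbar f' x) < e" using True c by (intro d(3)) (auto simp: norm_minus_commute)
            moreover have "norm (complex_of_real (bump c (x - z)) * dbar f' z - complex_of_real (bump c (x - z)) * dbar f' x) = bump c (x - z) * norm (dbar f' z - dbar f' x)"
              using b0 by (simp flip: right_diff_distrib add: norm_mult)
            ultimately show ?thesis using b0 by (simp add: mult_left_mono)
          qed (use bump_zero in simp)
        qed (intro integrable_cc continuous_intros supp vr cr cf')+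
        also have "\<dots> = K * e" using K' by simp
        finally show ?thesis using True by simp
      next
        case False
        have z0: "complex_of_real (bump c (x - z)) * dbar f' z - complex_of_real (bump c (x - z)) * dbar f' x = 0" for z
        proof (cases "norm (x - z) > sqrt c")
          case False
          then have "norm z > r" using \<open>\<not> norm x \<le> r + 1\<close> c norm_triangle_ineq2[of x z] by linarith
          then show ?thesis using r \<open>\<not> norm x \<le> r + 1\<close> by simp
        qed (use bump_zero in simp)
        then have "I (\<lambda>z. complex_of_real (bump c (x - z)) * dbar f' z - complex_of_real (bump c (x - z)) * dbar f' x) = I (\<lambda>z. 0)"
          by (simp only: z0)
        then show ?thesis unfolding eq using False by simp
      qed
    qed
    have cJ: "integrable lborel (\<lambda>x. Q x * (K * dbar f' x))"
      by (intro integrable_cc continuous_intros supp vf' cf' Q)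
    have "K * J = I (\<lambda>x. Q x * (K * dbar f' x))"
      unfolding J_def mult.left_commute[of "Q _"] integral_mult_right_zero ..
    then have "I (\<lambda>x. Q x * N x) - K * J = I (\<lambda>x. Q x * N x - Q x * (K * dbar f' x))"
      using Bochner_Integration.integral_diff[OF iN cJ] by (simp only:)
    then have "norm (I (\<lambda>x. Q x * N x) - K * J) \<le> I (\<lambda>x. norm (Q x * N x - Q x * (K * dbar f' x)))"
      by (simp only: integral_norm_bound)
    also have "\<dots> \<le> I (\<lambda>x. (indicator (cball 0 (r+1)) x * norm (Q x)) * (K * e))"
    proof (rule integral_mono)
      show "integrable lborel (\<lambda>x. norm (Q x * N x - Q x * (K * dbar f' x)))"
        by (intro integrable_norm Bochner_Integration.integrable_diff iN cJ)
      show "integrable lborel (\<lambda>x. (indicator (cball 0 (r+1)) x * norm (Q x)) * (K * e))"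
        by (rule integrable_mult_left[OF iA])
      fix x
      have "norm (Q x * N x - Q x * (K * dbar f' x)) = norm (Q x) * norm (N x - K * dbar f' x)"
        by (simp flip: right_diff_distrib add: norm_mult)
      also have "\<dots> \<le> norm (Q x) * (indicator (cball 0 (r+1)) x * (K * e))"
        by (intro mult_left_mono osc) simp
      finally show "norm (Q x * N x - Q x * (K * dbar f' x)) \<le> (indicator (cball 0 (r+1)) x * norm (Q x)) * (K * e)"
        by (simp add: algebra_simps)
    qed
    also have "\<dots> = A * (K * e)" unfolding A_def by simp
    finally have "norm (I (\<lambda>x. Q x * N x) - K * J) \<le> A * (K * e)" .
    then have "\<bar>Re (I (\<lambda>x. Q x * N x) - K * J)\<bar> \<le> A * (K * e)"
      using abs_Re_le_cmod order_trans by blast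
    then have "K * \<bar>Re J\<bar> \<le> A * (K * e)" using reN K by (simp add: abs_mult)
    then have "K * \<bar>Re J\<bar> \<le> K * (e * A)" by (simp add: algebra_simps)
    then show ?thesis using K by simp
  qed
  have "\<bar>Re J\<bar> \<le> 0 + e" if "e > 0" for e
  proof -
    have "e / (A + 1) * A \<le> e" using that A0 by (simp add: field_simps)
    then show ?thesis using key[of "e / (A+1)"] that A0 by fastforce
  qed
  then have "\<bar>Re J\<bar> \<le> 0" by (rule field_le_epsilon)
  then show ?thesis unfolding J_def by simp
qed

section \<open>Products and translates of test functions\<close>

lemma C1_cong: "C1 g g' \<Longrightarrow> (\<And>j x. g' j x = h j x) \<Longrightarrow> C1 g h"
proof -
  assume a: "C1 g g'" and "\<And>j x. g' j x = h j x"
  then have "g' = h" by (intro ext)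
  then show ?thesis using a by simp
qed

lemma C2_prod:
  fixes b t :: "plane \<Rightarrow> complex" and b' t' :: "2 \<Rightarrow> plane \<Rightarrow> complex"
  assumes a: "C2 a b b'" and t: "C2 \<theta> t t'"
  shows "C2 (\<lambda>x. a x * \<theta> x) (\<lambda>x. a x * t x + \<theta> x * b x)
     (\<lambda>j x. (if j = 1 then Re (b x) else Im (b x)) * t x + a x * t' j x + ((if j = 1 then Re (t x) else Im (t x)) * b x + \<theta> x * b' j x))"
proof -
  note a1 = a[unfolded C2_def, THEN conjunct1] and a2 = a[unfolded C2_def, THEN conjunct2]
  note t1 = t[unfolded C2_def, THEN conjunct1] and t2 = t[unfolded C2_def, THEN conjunct2]
  show ?thesis unfolding C2_def
    by (rule conjI, rule C1_cong[OF C1_mult[OF a1 t1]], simp,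
        rule C1_cong[OF C1_add[OF C1_mult[OF C1_of_real[OF a1] t2] C1_mult[OF C1_of_real[OF t1] a2]]], simp)
qed

lemma C2_dq:
  assumes t: "C2 \<theta> t t'"
  shows "C2 (dq s j \<theta>) (dq s j t) (\<lambda>k. dq s j (t' k))"
  unfolding C2_def
proof
  show "C1 (dq s j \<theta>) (\<lambda>k x. if k = 1 then Re (dq s j t x) else Im (dq s j t x))"
    by (rule C1_cong[OF C1_dq[OF t[unfolded C2_def, THEN conjunct1]]]) (simp add: dq_def sh_def)
  show "C1 (dq s j t) (\<lambda>k. dq s j (t' k))"
    by (rule C1_dq[OF t[unfolded C2_def, THEN conjunct2]])
qed

lemma C2_translate:
  assumes t: "C2 \<theta> t t'"
  shows "C2 (\<lambda>x. \<theta> (x + y)) (\<lambda>x. t (x + y)) (\<lambda>k x. t' k (x + y))"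
  unfolding C2_def
  using C1_translate[OF t[unfolded C2_def, THEN conjunct1], of y] C1_translate[OF t[unfolded C2_def, THEN conjunct2], of y]
  by simp

lemma supp_C2:
  assumes t: "C2 \<theta> t t'" and v: "vanishes_outside_ball \<theta>"
  shows "vanishes_outside_ball t" "vanishes_outside_ball (t' j)" "vanishes_outside_ball (dbar t')"
proof -
  note t1 = t[unfolded C2_def, THEN conjunct1] and t2 = t[unfolded C2_def, THEN conjunct2]
  show t: "vanishes_outside_ball t"
    by (rule supp_Re_Im) (use supp_deriv[OF t1 v, of 1] supp_deriv[OF t1 v, of 2] in simp_all)
  show "vanishes_outside_ball (t' j)" by (rule supp_deriv[OF t2 t])
  show "vanishes_outside_ball (dbar t')" unfolding dbar_def[abs_def] by (intro supp supp_deriv[OF t2 t])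
qed

section \<open>Quantities that are small relative to a reference size\<close>

text \<open>The order symbol o as the step s tends to zero. The reference size \<open>\<kappa>\<close> is allowed to depend on s because it will contain the quantity that is being estimated.\<close>
definition small_o :: "(real \<Rightarrow> real) \<Rightarrow> (real \<Rightarrow> complex) \<Rightarrow> bool" where
  "small_o \<kappa> X \<longleftrightarrow> (\<forall>e>0. \<forall>\<^sub>F s in at_right 0. norm (X s) \<le> e * \<kappa> s)"

lemma small_o_add: 
  assumes "small_o \<kappa> X" "small_o \<kappa> Y" 
  shows "small_o \<kappa> (\<lambda>s. X s + Y s)"
  unfolding small_o_def
proof (intro allI impI)
  fix e :: real assume "e > 0"
  then have "\<forall>\<^sub>F s in at_right 0. norm (X s) \<le> e/2 * \<kappa> s" "\<forall>\<^sub>F s in at_right 0. norm (Y s) \<le> e/2 * \<kappa> s"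
    using assms unfolding small_o_def by (meson half_gt_zero)+
  then show "\<forall>\<^sub>F s in at_right 0. norm (X s + Y s) \<le> e * \<kappa> s"
    by eventually_elim (use norm_triangle_ineq in \<open>smt (verit) field_sum_of_halves distrib_right\<close>)
qed

lemma small_o_cmult:
  assumes "small_o \<kappa> X"
  shows "small_o \<kappa> (\<lambda>s. c * X s)"
  unfolding small_o_def
proof (intro allI impI)
  fix e :: real assume e: "e > 0"
  then have "e / (norm c + 1) > 0" by (simp add: add_nonneg_pos)
  then have "\<forall>\<^sub>F s in at_right 0. norm (X s) \<le> e / (norm c + 1) * \<kappa> s"
    using assms unfolding small_o_def by blast
  then show "\<forall>\<^sub>F s in at_right 0. norm (c * X s) \<le> e * \<kappa> s"
  proof eventually_elim
    case (elim s)
    have p: "norm c + 1 > 0" by (simp add: add_nonneg_pos)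
    have "norm (c * X s) \<le> (norm c + 1) * norm (X s)"
      by (simp add: norm_mult mult_right_mono)
    also have "\<dots> \<le> (norm c + 1) * (e / (norm c + 1) * \<kappa> s)"
      using elim p by (intro mult_left_mono) auto
    also have "\<dots> = e * \<kappa> s" using p by simp
    finally show ?case .
  qed
qed

lemma small_o_uminus: "small_o \<kappa> X \<Longrightarrow> small_o \<kappa> (\<lambda>s. - X s)"
  unfolding small_o_def by simp

lemma small_o_diff: "small_o \<kappa> X \<Longrightarrow> small_o \<kappa> Y \<Longrightarrow> small_o \<kappa> (\<lambda>s. X s - Y s)"
  using small_o_add[OF _ small_o_uminus, of \<kappa> X Y] by simp

lemma small_o_null:
  assumes "(X \<longlongrightarrow> 0) (at_right 0)" "\<And>s. \<kappa> s \<ge> 1"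
  shows "small_o \<kappa> X"
  unfolding small_o_def
proof (intro allI impI)
  fix e :: real assume e: "e > 0"
  have "\<forall>\<^sub>F s in at_right 0. norm (X s) < e"
    using tendstoD[OF assms(1) e] by simp
  then show "\<forall>\<^sub>F s in at_right 0. norm (X s) \<le> e * \<kappa> s"
  proof eventually_elim
    case (elim s)
    have "e * 1 \<le> e * \<kappa> s" using assms(2)[of s] e by (intro mult_left_mono) auto
    then show ?case using elim by simp
  qed
qed

lemma small_o_tendsto:
  assumes "(X \<longlongrightarrow> a) (at_right 0)" "\<And>s. \<kappa> s \<ge> 1"
  shows "small_o \<kappa> (\<lambda>s. X s - a)"
  by (rule small_o_null) (use assms in \<open>auto simp: LIM_zero\<close>)

lemma small_o_cong: "small_o \<kappa> X \<Longrightarrow> (\<And>s. X s = Y s) \<Longrightarrow> small_o \<kappa> Y"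
  unfolding small_o_def by simp

section \<open>The equation for the stream function\<close>

text \<open>Here \<open>\<psi>\<close> is the stream function, f its complex gradient, \<open>f'\<close> the partial derivatives of f and M the viscosity.
The condition \<open>curl\<close> is the equality of the mixed second derivatives. The condition \<open>mono\<close> is the monotonicity of the
stress, quantified by the mean of the two viscosities, and \<open>lip\<close> makes difference quotients of the
stress comparable with those of E.\<close>
locale flow =
  fixes \<psi> :: "plane \<Rightarrow> real" and f :: "plane \<Rightarrow> complex" and f' :: "2 \<Rightarrow> plane \<Rightarrow> complex"
    and M :: "plane \<Rightarrow> real" and m c0 :: real
  assumes psi: "C2 \<psi> f f'"
    and curl: "\<And>x. Im (f' 1 x) = Re (f' 2 x)"
    and f_bdd: "\<And>x. norm (f x) \<le> m"
    and psi_bdd: "\<And>x. \<bar>\<psi> x\<bar> \<le> m * norm x"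
    and M_cont: "continuous_on UNIV M"
    and c0: "c0 > 0" "\<And>x. M x \<ge> c0"
    and weak: "\<And>F g g'. C2 F g g' \<Longrightarrow> vanishes_outside_ball F \<Longrightarrow>
       Re (I (\<lambda>x. (M x * cnj (dbar f' x) - \<i> * (cnj (f x) * cnj (f x))) * dbar g' x)) = 0"
    and mono: "\<And>x y. Re ((M y * cnj (dbar f' y) - M x * cnj (dbar f' x)) * (dbar f' y - dbar f' x))
       \<ge> (M y + M x) / 2 * (norm (dbar f' y - dbar f' x))\<^sup>2"
    and lip: "\<And>r. \<exists>K\<ge>0. \<forall>x y. norm x \<le> r \<longrightarrow> norm y \<le> r \<longrightarrow>
        norm (M y * cnj (dbar f' y) - M x * cnj (dbar f' x)) \<le> K * norm (dbar f' y - dbar f' x)"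
begin

abbreviation "E \<equiv> dbar f'"
text \<open>The stress p and the convective term n, in the form in which they are paired with \<open>dbar (dbar F)\<close>; \<open>n'\<close> are the partial derivatives of n.\<close>
definition p :: "plane \<Rightarrow> complex" where "p x = M x * cnj (E x)"
definition n :: "plane \<Rightarrow> complex" where "n x = \<i> * (cnj (f x) * cnj (f x))"
definition n' :: "2 \<Rightarrow> plane \<Rightarrow> complex" where "n' j x = 2 * \<i> * (cnj (f x) * cnj (f' j x))"

lemmas f_C1 = psi[unfolded C2_def, THEN conjunct2]
lemmas psi_C1 = psi[unfolded C2_def, THEN conjunct1]

lemma n_C1: "C1 n n'"
  unfolding n_def[abs_def]
  by (rule C1_cong[OF C1_cmult[OF C1_mult[OF C1_cnj[OF f_C1] C1_cnj[OF f_C1]]]]) (simp add: n'_def algebra_simps)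

lemma cts_E: "continuous_on UNIV E" by (rule dbar_cont[OF f_C1])
lemma cts_p: "continuous_on UNIV p" unfolding p_def[abs_def] by (intro continuous_intros cts_E M_cont)

lemmas cts = cts_E cts_p C1_cont[OF f_C1] C1_cont'[OF f_C1] C1_cont[OF psi_C1] M_cont C1_cont[OF n_C1] C1_cont'[OF n_C1]

definition D :: "real \<Rightarrow> plane \<Rightarrow> real" where "D s x = norm (dq s 1 E x) + norm (dq s 2 E x)"

text \<open>The reference size for errors. The summand 1 absorbs quantities that tend to zero outright.\<close>
definition \<kappa> :: "(plane \<Rightarrow> real) \<Rightarrow> real \<Rightarrow> real" where "\<kappa> w s = 1 + I (\<lambda>x. w x * D s x)"

text \<open>Functions whose difference quotient, paired with a locally uniformly vanishing factor, is negligible. For a C1 function this is clear; the point is that it also holds for the stress p, whose quotients are bounded by those of E and not by a constant (\<open>good_p\<close>).\<close>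
definition good :: "(plane \<Rightarrow> real) \<Rightarrow> (plane \<Rightarrow> complex) \<Rightarrow> bool" where
  "good w G \<longleftrightarrow> continuous_on UNIV G \<and> vanishes_outside_ball G \<and>
     (\<forall>j F. loc_unif F (\<lambda>_. 0) \<longrightarrow> (\<forall>s. continuous_on UNIV (F s)) \<longrightarrow> small_o (\<kappa> w) (\<lambda>s. I (\<lambda>x. dq s j G x * F s x)))"

definition weight :: "(plane \<Rightarrow> real) \<Rightarrow> bool" where
  "weight w \<longleftrightarrow> continuous_on UNIV w \<and> vanishes_outside_ball w \<and> (\<forall>x. w x \<ge> 0)"

lemma D_cont [continuous_intros]: "continuous_on UNIV (D s)"
  unfolding D_def[abs_def] by (intro continuous_intros cts)

lemma D_nonneg: "D s x \<ge> 0" unfolding D_def by simp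

lemma dq_le_D: "norm (dq s j E x) \<le> D s x"
  using exhaust_2[of j] unfolding D_def by auto

lemma kappa_ge: "weight w \<Longrightarrow> \<kappa> w s \<ge> 1"
proof -
  assume "weight w"
  then have "I (\<lambda>x. w x * D s x) \<ge> 0"
    unfolding weight_def by (intro integral_nonneg_AE) (auto simp: D_nonneg)
  then show ?thesis unfolding \<kappa>_def by simp
qed

lemma dq_p_small:
  assumes w: "weight w" and c: "continuous_on UNIV c" "\<And>x. norm (c x) \<le> w x"
    and F: "loc_unif F (\<lambda>_. 0)" "\<And>s. continuous_on UNIV (F s)"
  shows "small_o (\<kappa> w) (\<lambda>s. I (\<lambda>x. dq s j p x * (c x * F s x)))"
  unfolding small_o_def
proof (intro allI impI)
  fix e :: real assume e: "e > 0"
  obtain r where r: "\<And>x. norm x > r \<Longrightarrow> w x = 0" using w unfolding weight_def vanishes_outside_ball_def by blast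
  have cv: "vanishes_outside_ball c"
    unfolding vanishes_outside_ball_def using r c(2) by (metis norm_le_zero_iff)
  obtain K where K: "K \<ge> 0" "\<And>x y. norm x \<le> r + 1 \<Longrightarrow> norm y \<le> r + 1 \<Longrightarrow> norm (p y - p x) \<le> K * norm (E y - E x)"
    using lip[of "r+1"] unfolding p_def by blast
  have e': "e / (K + 1) > 0" using e K by simp
  have "\<forall>\<^sub>F s in at_right 0. \<forall>x\<in>cball 0 r. dist (F s x) 0 < e / (K + 1)"
    using F(1) e' unfolding loc_unif_def by (blast dest: uniform_limitD)
  moreover have "\<forall>\<^sub>F s in at_right 0. s \<in> {0<..<1::real}"
    by (rule eventually_at_right_real) simp
  ultimately show "\<forall>\<^sub>F s in at_right 0. norm (I (\<lambda>x. dq s j p x * (c x * F s x))) \<le> e * \<kappa> w s"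
  proof eventually_elim
    case (elim s)
    have "norm (I (\<lambda>x. dq s j p x * (c x * F s x))) \<le> I (\<lambda>x. norm (dq s j p x * (c x * F s x)))"
      by (rule integral_norm_bound)
    also have "\<dots> \<le> I (\<lambda>x. e * (w x * D s x))"
    proof (rule integral_mono)
      have "vanishes_outside_ball (\<lambda>x. c x * F s x)" by (rule supp_mult(1)[OF cv])
      from supp_mult(2)[OF this, of "dq s j p"]
      show "integrable lborel (\<lambda>x. norm (dq s j p x * (c x * F s x)))"
        by (intro integrable_cc supp(6) continuous_intros c F cts) (auto intro: supp)
      show "integrable lborel (\<lambda>x. e * (w x * D s x))"
      proof (rule integrable_cc)
        show "continuous_on UNIV (\<lambda>x. e * (w x * D s x))"
          using w unfolding weight_def by (intro continuous_intros) auto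
        show "vanishes_outside_ball (\<lambda>x. e * (w x * D s x))"
          using w unfolding weight_def by (intro supp_mult(2)[OF supp_mult(1)]) auto
      qed
      fix x
      show "norm (dq s j p x * (c x * F s x)) \<le> e * (w x * D s x)"
      proof (cases "norm x > r")
        case True
        then show ?thesis using r[OF True] c(2)[of x] by simp
      next
        case False
        have b: "norm (sh s j p x - p x) \<le> K * norm (sh s j E x - E x)"
          unfolding sh_def
        proof (rule K(2))
          show "norm x \<le> r + 1" using False by simp
          have "norm (x + s *\<^sub>R axis j 1) \<le> norm x + norm (s *\<^sub>R axis j 1 :: plane)" by (rule norm_triangle_ineq)
          then show "norm (x + s *\<^sub>R axis j 1) \<le> r + 1" using False elim by simp
        qed
        have "norm (dq s j p x) \<le> K * norm (dq s j E x)"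
          using mult_left_mono[OF b, of "\<bar>1/s\<bar>"] unfolding dq_def norm_scaleR by (simp only: abs_ge_zero mult.left_commute)
        then have "norm (dq s j p x) \<le> K * D s x"
          using mult_left_mono[OF dq_le_D[of s j x] K(1)] by linarith
        moreover have "norm (c x * F s x) \<le> w x * (e / (K+1))"
          unfolding norm_mult using c(2)[of x] elim(1) False e'
          by (intro mult_mono) (auto simp: dist_norm less_imp_le order_trans[OF norm_ge_zero c(2)])
        ultimately have "norm (dq s j p x * (c x * F s x)) \<le> (K * D s x) * (w x * (e / (K+1)))"
          unfolding norm_mult[of "dq s j p x"] using K(1) D_nonneg by (intro mult_mono) auto
        also have "\<dots> = (K / (K+1)) * (e * (w x * D s x))" by (simp add: algebra_simps)
        also have "\<dots> \<le> 1 * (e * (w x * D s x))"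
          using K(1) e D_nonneg[of s x] w unfolding weight_def by (intro mult_right_mono) auto
        finally show ?thesis by simp
      qed
    qed
    also have "\<dots> = e * I (\<lambda>x. w x * D s x)" by simp
    also have "\<dots> \<le> e * \<kappa> w s" unfolding \<kappa>_def using e by simp
    finally show ?case .
  qed
qed

lemma good_C1:
  assumes w: "weight w" and G: "C1 G G'" and v: "vanishes_outside_ball G"
  shows "good w G"
  unfolding good_def
proof (intro conjI allI impI)
  show cG: "continuous_on UNIV G" by (rule C1_cont[OF G])
  show "vanishes_outside_ball G" by fact
  fix j F assume F: "loc_unif F (\<lambda>_. 0)" "\<forall>s. continuous_on UNIV (F s :: plane \<Rightarrow> complex)"
  have "((\<lambda>s. I (\<lambda>x. dq s j G x * F s x)) \<longlongrightarrow> I (\<lambda>x. G' j x * 0)) (at_right 0)"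
    by (rule I_lim) (intro loc_unif_intros loc_unif_dq[OF G] continuous_intros supp v F F(2)[rule_format] cG C1_cont'[OF G])+
  then show "small_o (\<kappa> w) (\<lambda>s. I (\<lambda>x. dq s j G x * F s x))"
    by (intro small_o_null kappa_ge w) simp
qed

lemma good_p:
  assumes w: "weight w" and c: "C1 c c'" and v: "vanishes_outside_ball c" and b: "\<And>x. norm (c x) \<le> w x"
  shows "good w (\<lambda>x. c x * p x)"
  unfolding good_def
proof (intro conjI allI impI)
  show "continuous_on UNIV (\<lambda>x. c x * p x)" by (intro continuous_intros cts C1_cont[OF c])
  show "vanishes_outside_ball (\<lambda>x. c x * p x)" by (intro supp v)
  fix j F assume F: "loc_unif F (\<lambda>_. 0)" "\<forall>s. continuous_on UNIV (F s :: plane \<Rightarrow> complex)"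
  have F2: "continuous_on UNIV (F s)" for s using F by blast
  have "((\<lambda>s. I (\<lambda>x. dq s j c x * (sh s j p x * F s x))) \<longlongrightarrow> I (\<lambda>x. c' j x * (p x * 0))) (at_right 0)"
    by (rule I_lim) (intro loc_unif_intros loc_unif_dq[OF c] continuous_intros supp v F F2 cts C1_cont[OF c] C1_cont'[OF c])+
  then have "((\<lambda>s. I (\<lambda>x. dq s j c x * (sh s j p x * F s x))) \<longlongrightarrow> 0) (at_right 0)" by simp
  from small_o_null[OF this kappa_ge[OF w]] have 1: "small_o (\<kappa> w) (\<lambda>s. I (\<lambda>x. dq s j c x * (sh s j p x * F s x)))" .
  have 2: "small_o (\<kappa> w) (\<lambda>s. I (\<lambda>x. dq s j p x * (c x * F s x)))"
    by (rule dq_p_small[OF w C1_cont[OF c] b F(1) F2])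
  show "small_o (\<kappa> w) (\<lambda>s. I (\<lambda>x. dq s j (\<lambda>x. c x * p x) x * F s x))"
  proof (rule small_o_cong[OF small_o_add[OF 1 2]])
    fix s
    have vv: "vanishes_outside_ball (\<lambda>x. dq s j p x * (c x * F s x))"
      by (rule supp_mult(2)[OF supp_mult(1)[OF v]])
    have "I (\<lambda>x. dq s j c x * (sh s j p x * F s x)) + I (\<lambda>x. dq s j p x * (c x * F s x))
      = I (\<lambda>x. dq s j c x * (sh s j p x * F s x) + dq s j p x * (c x * F s x))"
      by (rule Bochner_Integration.integral_add[symmetric]) 
         (intro integrable_cc vv continuous_intros supp v F2 cts C1_cont[OF c])+
    also have "\<dots> = I (\<lambda>x. dq s j (\<lambda>x. c x * p x) x * F s x)"
      by (rule Bochner_Integration.integral_cong) (auto simp: dq_mult' algebra_simps)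
    finally show "I (\<lambda>x. dq s j c x * (sh s j p x * F s x)) + I (\<lambda>x. dq s j p x * (c x * F s x))
      = I (\<lambda>x. dq s j (\<lambda>x. c x * p x) x * F s x)" .
  qed
qed

text \<open>Difference on one factor against difference on the other: the two sides differ by the translation of g, which vanishes uniformly in the limit.\<close>
lemma good_move:
  assumes G: "good w G" and g: "continuous_on UNIV g"
  shows "small_o (\<kappa> w) (\<lambda>s. I (\<lambda>x. dq s j G x * g x) + I (\<lambda>x. G x * dq s j g x))"
proof -
  have cG: "continuous_on UNIV G" and vG: "vanishes_outside_ball G" using G unfolding good_def by auto
  have "loc_unif (\<lambda>s x. sh s j g x - g x) (\<lambda>x. g x - g x)" by (intro loc_unif_intros g)
  then have "loc_unif (\<lambda>s x. sh s j g x - g x) (\<lambda>_. 0)" by simp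
  moreover have "continuous_on UNIV (\<lambda>x. sh s j g x - g x)" for s by (intro continuous_intros g)
  ultimately have *: "small_o (\<kappa> w) (\<lambda>s. I (\<lambda>x. dq s j G x * (sh s j g x - g x)))"
    using G[unfolded good_def, THEN conjunct2, THEN conjunct2, rule_format, of "\<lambda>s x. sh s j g x - g x"] by blast
  show ?thesis
  proof (rule small_o_cong[OF small_o_uminus[OF *]])
    fix s
    have a: "I (\<lambda>x. dq s j G x * g x) = - I (\<lambda>x. sh s j G x * dq s j g x)"
      by (rule I_parts[OF cG g]) (use vG in blast)
    have b: "I (\<lambda>x. sh s j G x * dq s j g x - G x * dq s j g x) = I (\<lambda>x. sh s j G x * dq s j g x) - I (\<lambda>x. G x * dq s j g x)"
      by (rule Bochner_Integration.integral_diff) (intro integrable_cc continuous_intros supp cG vG g)+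
    have c: "(\<lambda>x. dq s j G x * (sh s j g x - g x)) = (\<lambda>x. sh s j G x * dq s j g x - G x * dq s j g x)"
      by (rule ext) (simp add: dq_def algebra_simps)
    show "- I (\<lambda>x. dq s j G x * (sh s j g x - g x)) = I (\<lambda>x. dq s j G x * g x) + I (\<lambda>x. G x * dq s j g x)"
      unfolding a b c by simp
  qed
qed

lemma dq_commute: "dq s j (dq t k g) = dq t k (dq s j g)"
  by (rule ext) (simp add: dq_def sh_def algebra_simps)

text \<open>An integral of a Jacobian determinant is a null Lagrangian. For differences, \<open>dq 1\<close> and \<open>dq 2\<close> commute exactly, and replacing \<open>g'\<close> by backward differences of g costs a negligible error.\<close>
lemma good_swap:
  assumes G: "good w G" and g: "C1 g g'"
  shows "small_o (\<kappa> w) (\<lambda>s. I (\<lambda>x. dq s 1 G x * g' 2 x) - I (\<lambda>x. dq s 2 G x * g' 1 x))"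
proof -
  have cG: "continuous_on UNIV G" and vG: "vanishes_outside_ball G" using G unfolding good_def by auto
  have *: "small_o (\<kappa> w) (\<lambda>s. I (\<lambda>x. dq s j G x * (g' k x - dq (-s) k g x)))" for j k
  proof -
    have "loc_unif (\<lambda>s x. g' k x - dq (-s) k g x) (\<lambda>x. g' k x - g' k x)" by (intro loc_unif_intros loc_unif_dq(2)[OF g])
    then have "loc_unif (\<lambda>s x. g' k x - dq (-s) k g x) (\<lambda>_. 0)" by simp
    moreover have "continuous_on UNIV (\<lambda>x. g' k x - dq (-s) k g x)" for s by (intro continuous_intros C1_cont'[OF g] C1_cont[OF g])
    ultimately show ?thesis
      using G[unfolded good_def, THEN conjunct2, THEN conjunct2, rule_format, of "\<lambda>s x. g' k x - dq (-s) k g x"] by blast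
  qed
  have eq: "I (\<lambda>x. dq s j G x * g' k x) = I (\<lambda>x. dq s j G x * (g' k x - dq (-s) k g x)) - I (\<lambda>x. dq s k (dq s j G) x * g x)" for s j k
  proof -
    have "I (\<lambda>x. dq s k (dq s j G) x * g x) = - I (\<lambda>x. dq s j G x * dq (-s) k g x)"
      by (rule I_parts_back) (use vG in \<open>auto intro!: continuous_intros cG C1_cont[OF g] supp\<close>)
    moreover have "I (\<lambda>x. dq s j G x * (g' k x - dq (-s) k g x)) = I (\<lambda>x. dq s j G x * g' k x - dq s j G x * dq (-s) k g x)"
      by (simp add: right_diff_distrib)
    moreover have "\<dots> = I (\<lambda>x. dq s j G x * g' k x) - I (\<lambda>x. dq s j G x * dq (-s) k g x)"
      by (rule Bochner_Integration.integral_diff) (intro integrable_cc continuous_intros supp cG vG C1_cont[OF g] C1_cont'[OF g])+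
    ultimately show ?thesis by simp
  qed
  show ?thesis
    by (rule small_o_cong[OF small_o_diff[OF *[of 1 2] *[of 2 1]]]) (simp add: eq dq_commute[of _ 1 _ 2 G])
qed

text \<open>The full gradient of g is reduced to \<open>dbar g'\<close>: the operator \<open>\<partial>_1 - i \<partial>_2\<close> applied to \<open>dbar g'\<close> is the Laplacian of g. This is how derivatives of f are traded for difference quotients of E.\<close>
lemma good_laplace:
  assumes G: "good w G" and g: "C1 g g'"
  shows "small_o (\<kappa> w) (\<lambda>s. I (\<lambda>x. dq s 1 G x * g' 1 x) + I (\<lambda>x. dq s 2 G x * g' 2 x)
      + I (\<lambda>x. G x * (dq s 1 (dbar g') x - \<i> * dq s 2 (dbar g') x)))"
proof -
  have cG: "continuous_on UNIV G" and vG: "vanishes_outside_ball G" using G unfolding good_def by auto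
  note cg = dbar_cont[OF g] C1_cont'[OF g]
  note s1 = good_move[OF G cg(1), of 1] and s2 = good_move[OF G cg(1), of 2] and s3 = good_swap[OF G g]
  show ?thesis
  proof (rule small_o_cong[OF small_o_diff[OF small_o_diff[OF s1 small_o_cmult[OF s2, of \<i>]] small_o_cmult[OF s3, of \<i>]]])
    fix s
    have i: "integrable lborel (\<lambda>x. dq s j G x * g' k x)" for j k
      by (intro integrable_cc continuous_intros supp cG vG cg)
    have "I (\<lambda>x. dq s j G x * dbar g' x) = I (\<lambda>x. dq s j G x * g' 1 x + \<i> * (dq s j G x * g' 2 x))" for j
      by (rule Bochner_Integration.integral_cong) (auto simp: dbar_def algebra_simps)
    moreover have "\<dots> j = I (\<lambda>x. dq s j G x * g' 1 x) + I (\<lambda>x. \<i> * (dq s j G x * g' 2 x))" for j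
      by (rule Bochner_Integration.integral_add) (use i in \<open>auto intro: integrable_mult_right\<close>)
    ultimately have a: "I (\<lambda>x. dq s j G x * dbar g' x) = I (\<lambda>x. dq s j G x * g' 1 x) + \<i> * I (\<lambda>x. dq s j G x * g' 2 x)" for j
      by simp
    have "I (\<lambda>x. G x * (dq s 1 (dbar g') x - \<i> * dq s 2 (dbar g') x)) = I (\<lambda>x. G x * dq s 1 (dbar g') x - \<i> * (G x * dq s 2 (dbar g') x))"
      by (rule Bochner_Integration.integral_cong) (auto simp: algebra_simps)
    also have "\<dots> = I (\<lambda>x. G x * dq s 1 (dbar g') x) - I (\<lambda>x. \<i> * (G x * dq s 2 (dbar g') x))"
      by (rule Bochner_Integration.integral_diff) (intro integrable_mult_right integrable_cc continuous_intros supp cG vG cg)+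
    finally have b: "I (\<lambda>x. G x * (dq s 1 (dbar g') x - \<i> * dq s 2 (dbar g') x)) = I (\<lambda>x. G x * dq s 1 (dbar g') x) - \<i> * I (\<lambda>x. G x * dq s 2 (dbar g') x)"
      by simp
    show "I (\<lambda>x. dq s 1 G x * dbar g' x) + I (\<lambda>x. G x * dq s 1 (dbar g') x)
      - \<i> * (I (\<lambda>x. dq s 2 G x * dbar g' x) + I (\<lambda>x. G x * dq s 2 (dbar g') x))
      - \<i> * (I (\<lambda>x. dq s 1 G x * g' 2 x) - I (\<lambda>x. dq s 2 G x * g' 1 x))
      = I (\<lambda>x. dq s 1 G x * g' 1 x) + I (\<lambda>x. dq s 2 G x * g' 2 x)
      + I (\<lambda>x. G x * (dq s 1 (dbar g') x - \<i> * dq s 2 (dbar g') x))"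
      unfolding a b by (simp add: algebra_simps)
  qed
qed

end

section \<open>Testing with differences of the stream function\<close>

context flow begin

definition \<psi>' :: "2 \<Rightarrow> plane \<Rightarrow> real" where "\<psi>' j x = (if j = 1 then Re (f x) else Im (f x))"

lemma psi'_C1: "C1 (\<psi>' k) (\<lambda>j x. if k = 1 then Re (f' j x) else Im (f' j x))"
  unfolding \<psi>'_def[abs_def] using C1_Re[OF f_C1] C1_Im[OF f_C1] by (cases "k = 1") auto

lemma psi_C1': "C1 \<psi> \<psi>'"
  by (rule C1_cong[OF psi_C1]) (simp add: \<psi>'_def)

lemma psi'_bdd: "\<bar>\<psi>' j x\<bar> \<le> m"
  unfolding \<psi>'_def using abs_Re_le_cmod[of "f x"] abs_Im_le_cmod[of "f x"] f_bdd[of x] by auto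

text \<open>The weak equation tested with the product of a cutoff a and a function \<open>\<theta>\<close>, translated by y. The three summands come from \<open>dbar (dbar (a \<theta>))\<close>.\<close>
lemma weak_prod:
  assumes a: "C2 a b b'" and va: "vanishes_outside_ball a" and t: "C2 \<theta> t t'"
  shows "Re (I (\<lambda>x. (a x * dbar t' x + 2 * b x * t x + dbar b' x * \<theta> x) * (p (x + y) - n (x + y)))) = 0"
proof -
  let ?L = "\<lambda>x. a x * dbar t' x + 2 * b x * t x + dbar b' x * \<theta> x"
  note pr = C2_translate[OF C2_prod[OF a t], of "-y"]
  have v: "vanishes_outside_ball (\<lambda>x. a (x + - y) * \<theta> (x + - y))"
  proof -
    obtain r where r: "\<And>x. norm x > r \<Longrightarrow> a x = 0" using va unfolding vanishes_outside_ball_def by blast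
    have "a (x + - y) = 0" if "norm x > r + norm y" for x
      by (rule r) (use that norm_triangle_ineq2[of x y] in simp)
    then show ?thesis unfolding vanishes_outside_ball_def by (metis mult_zero_left)
  qed
  have cL: "continuous_on UNIV ?L"
    by (intro continuous_intros dbar_cont[OF a[unfolded C2_def, THEN conjunct2]] dbar_cont[OF t[unfolded C2_def, THEN conjunct2]]
       C1_cont[OF a[unfolded C2_def, THEN conjunct2]] C1_cont[OF t[unfolded C2_def, THEN conjunct2]]
       C1_cont[OF a[unfolded C2_def, THEN conjunct1]] C1_cont[OF t[unfolded C2_def, THEN conjunct1]])
  have cpn: "continuous_on UNIV (\<lambda>x. p (x + y) - n (x + y))"
    by (rule continuous_on_compose2[of UNIV "\<lambda>x. p x - n x"]) (auto intro!: continuous_intros cts)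
  have "I (\<lambda>x. ?L x * (p (x + y) - n (x + y))) = I (\<lambda>x. ?L (x + - y) * (p (x + - y + y) - n (x + - y + y)))"
    by (rule I_translate[symmetric]) (intro continuous_intros cL cpn)
  also have "\<dots> = I (\<lambda>x. (M x * cnj (dbar f' x) - \<i> * (cnj (f x) * cnj (f x))) * dbar (\<lambda>j x. (if j = 1 then Re (b (x + - y)) else Im (b (x + - y))) * t (x + - y) + a (x + - y) * t' j (x + - y) + ((if j = 1 then Re (t (x + - y)) else Im (t (x + - y))) * b (x + - y) + \<theta> (x + - y) * b' j (x + - y))) x)"
    by (rule Bochner_Integration.integral_cong) (auto simp: p_def n_def dbar_def complex_eq_iff algebra_simps)
  finally show ?thesis using weak[OF pr v] by simp
qed

end

text \<open>The cutoff \<open>\<eta>\<close> has complex gradient e, and \<open>S = dbar e'\<close> is differentiated once more because \<open>\<eta>_k\<close> is itself used as a cutoff. The weight w dominates the factors by which difference quotients of the stress get multiplied.\<close>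
locale flow_cutoff = flow +
  fixes \<eta> :: "plane \<Rightarrow> real" and e :: "plane \<Rightarrow> complex" and e' :: "2 \<Rightarrow> plane \<Rightarrow> complex"
    and e'' :: "2 \<Rightarrow> 2 \<Rightarrow> plane \<Rightarrow> complex" and S' :: "2 \<Rightarrow> plane \<Rightarrow> complex" and w :: "plane \<Rightarrow> real"
  assumes eta: "C2 \<eta> e e'" and eta_curl: "\<And>x. Im (e' 1 x) = Re (e' 2 x)"
    and e'_C1: "\<And>k. C1 (e' k) (e'' k)" and S_C1: "C1 (dbar e') S'" and S'_eq: "\<And>k x. dbar (e'' k) x = S' k x"
    and eta_v: "vanishes_outside_ball \<eta>" and eta_nonneg: "\<And>x. \<eta> x \<ge> 0"
    and w: "weight w" and w1: "\<And>x. norm (2 * e x) \<le> w x" and w2: "\<And>x. norm (dbar e' x) \<le> w x"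
begin

abbreviation "S \<equiv> dbar e'"
definition \<eta>' :: "2 \<Rightarrow> plane \<Rightarrow> real" where "\<eta>' k x = (if k = 1 then Re (e x) else Im (e x))"

lemmas e_C1 = eta[unfolded C2_def, THEN conjunct2]

lemma eta_C1: "C1 \<eta> \<eta>'"
  by (rule C1_cong[OF eta[unfolded C2_def, THEN conjunct1]]) (simp add: \<eta>'_def)

lemma eta'_C1: "C1 (\<eta>' k) (\<lambda>j x. if j = 1 then Re (e' k x) else Im (e' k x))"
proof (cases "k = 1")
  case True
  then have "\<eta>' k = (\<lambda>x. Re (e x))" by (simp add: \<eta>'_def fun_eq_iff)
  moreover have "Re (e' j x) = (if j = 1 then Re (e' k x) else Im (e' k x))" for j x
    using True eta_curl exhaust_2[of j] by auto
  ultimately show ?thesis using C1_cong[OF C1_Re[OF e_C1]] by simp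
next
  case False
  then have k: "k = 2" using exhaust_2[of k] by auto
  then have "\<eta>' k = (\<lambda>x. Im (e x))" by (simp add: \<eta>'_def fun_eq_iff)
  moreover have "Im (e' j x) = (if j = 1 then Re (e' k x) else Im (e' k x))" for j x
    using k eta_curl exhaust_2[of j] by auto
  ultimately show ?thesis using C1_cong[OF C1_Im[OF e_C1]] by simp
qed

lemma eta'_C2: "C2 (\<eta>' k) (e' k) (e'' k)"
  unfolding C2_def using eta'_C1 e'_C1 by blast

lemma v_e: "vanishes_outside_ball e" and v_e': "vanishes_outside_ball (e' j)" and v_S: "vanishes_outside_ball S"
  using supp_C2[OF eta eta_v] by auto

lemma v_eta': "vanishes_outside_ball (\<eta>' k)" by (rule supp_deriv[OF eta_C1 eta_v])
lemma v_S': "vanishes_outside_ball (S' k)" by (rule supp_deriv[OF S_C1 v_S])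

lemmas vs = eta_v v_e v_e' v_S v_eta' v_S'
lemmas ctc = C1_cont[OF eta_C1] C1_cont[OF e_C1] C1_cont'[OF e_C1] C1_cont[OF S_C1] C1_cont'[OF S_C1] C1_cont[OF eta'_C1] 
  C1_cont[OF psi'_C1]

text \<open>The integrals that arise from testing with \<open>\<eta> dq_j \<psi>\<close> (T1, T2, T3, after differencing the equation) and with \<open>\<eta>_k dq_k \<psi>\<close> (T4, T5, T6); z will be the stress p or the convective term n.\<close>
definition "T1 z s j = I (\<lambda>x. complex_of_real (\<eta> x) * (dq s j z x * dq s j E x))"
definition "T2 z s j = I (\<lambda>x. 2 * e x * (dq s j z x * dq s j f x))"
definition "T3 z s j = I (\<lambda>x. S x * (dq s j z x * complex_of_real (dq s j \<psi> x)))"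
definition "T4 z s k = I (\<lambda>x. complex_of_real (\<eta>' k x) * (z x * dq s k E x))"
definition "T5 z s k = I (\<lambda>x. 2 * e' k x * (z x * dq s k f x))"
definition "T6 z s k = I (\<lambda>x. S' k x * (z x * complex_of_real (dq s k \<psi> x)))"

lemma dbar_dq: "dbar (\<lambda>k. dq s j (f' k)) x = dq s j E x"
  unfolding dbar_def dq_def sh_def by (simp add: algebra_simps)

text \<open>The equation with test function \<open>\<eta>_k dq_k \<psi>\<close>.\<close>
lemma test_second:
  "Re (T4 p s k + T5 p s k + T6 p s k) = Re (T4 n s k + T5 n s k + T6 n s k)"
proof -
  let ?L = "\<lambda>x. complex_of_real (\<eta>' k x) * dq s k E x + 2 * e' k x * dq s k f x + S' k x * complex_of_real (dq s k \<psi> x)"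
  have w0: "Re (I (\<lambda>x. ?L x * (p x - n x))) = 0"
    using weak_prod[OF eta'_C2 v_eta' C2_dq[OF psi], of k s k 0] by (simp add: dbar_dq S'_eq)
  have sum: "I (\<lambda>x. ?L x * z x) = T4 z s k + T5 z s k + T6 z s k" if z: "continuous_on UNIV z" for z
  proof -
    have "I (\<lambda>x. ?L x * z x) = I (\<lambda>x. complex_of_real (\<eta>' k x) * (z x * dq s k E x) + 2 * e' k x * (z x * dq s k f x) + S' k x * (z x * complex_of_real (dq s k \<psi> x)))"
      by (rule Bochner_Integration.integral_cong) (auto simp: algebra_simps)
    also have "\<dots> = I (\<lambda>x. complex_of_real (\<eta>' k x) * (z x * dq s k E x) + 2 * e' k x * (z x * dq s k f x)) + T6 z s k"
      unfolding T6_def by (rule Bochner_Integration.integral_add) (intro integrable_cc continuous_intros cts ctc z supp(1,2,5,8) supp vs supp_mult(1) supp_mult(2)[OF v_e'])+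
    also have "I (\<lambda>x. complex_of_real (\<eta>' k x) * (z x * dq s k E x) + 2 * e' k x * (z x * dq s k f x)) = T4 z s k + T5 z s k"
      unfolding T4_def T5_def by (rule Bochner_Integration.integral_add) (intro integrable_cc continuous_intros cts ctc z supp vs supp_mult(1) supp_mult(2)[OF v_e'])+
    finally show ?thesis .
  qed
  have vL: "vanishes_outside_ball ?L" by (intro supp_add supp_mult(1) supp_mult(2)[OF v_e'] supp vs)
  have "I (\<lambda>x. ?L x * (p x - n x)) = I (\<lambda>x. ?L x * p x - ?L x * n x)" by (simp only: right_diff_distrib)
  also have "\<dots> = I (\<lambda>x. ?L x * p x) - I (\<lambda>x. ?L x * n x)"
    by (rule Bochner_Integration.integral_diff) (intro integrable_cc supp_mult(1)[OF vL] continuous_intros cts ctc)+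
  finally show ?thesis using w0 unfolding sum[OF cts(2)] sum[OF C1_cont[OF n_C1]] by simp
qed

text \<open>The difference quotient of the equation with test function \<open>\<eta> dq_j \<psi>\<close>, obtained by testing at x and at the translated point.\<close>
lemma test_first:
  "Re (T1 p s j + T2 p s j + T3 p s j) = Re (T1 n s j + T2 n s j + T3 n s j)"
proof -
  let ?L = "\<lambda>x. complex_of_real (\<eta> x) * dq s j E x + 2 * e x * dq s j f x + S x * complex_of_real (dq s j \<psi> x)"
  let ?Q = "\<lambda>x. p x - n x"
  have w0: "Re (I (\<lambda>x. ?L x * ?Q x)) = 0"
    using weak_prod[OF eta eta_v C2_dq[OF psi], of s j 0] by (simp add: dbar_dq)
  have w1: "Re (I (\<lambda>x. ?L x * sh s j ?Q x)) = 0"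
    using weak_prod[OF eta eta_v C2_dq[OF psi], of s j "s *\<^sub>R axis j 1"] by (simp add: dbar_dq sh_def)
  have sum: "I (\<lambda>x. ?L x * dq s j z x) = T1 z s j + T2 z s j + T3 z s j" if z: "continuous_on UNIV z" for z
  proof -
    have "I (\<lambda>x. ?L x * dq s j z x) = I (\<lambda>x. complex_of_real (\<eta> x) * (dq s j z x * dq s j E x) + 2 * e x * (dq s j z x * dq s j f x) + S x * (dq s j z x * complex_of_real (dq s j \<psi> x)))"
      by (rule Bochner_Integration.integral_cong) (auto simp: algebra_simps)
    also have "\<dots> = I (\<lambda>x. complex_of_real (\<eta> x) * (dq s j z x * dq s j E x) + 2 * e x * (dq s j z x * dq s j f x)) + T3 z s j"
      unfolding T3_def by (rule Bochner_Integration.integral_add) (intro integrable_cc continuous_intros cts ctc z supp_add supp_mult(1) supp_mult(2)[OF v_e] supp vs)+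
    also have "I (\<lambda>x. complex_of_real (\<eta> x) * (dq s j z x * dq s j E x) + 2 * e x * (dq s j z x * dq s j f x)) = T1 z s j + T2 z s j"
      unfolding T1_def T2_def by (rule Bochner_Integration.integral_add) (intro integrable_cc continuous_intros cts ctc z supp_add supp_mult(1) supp_mult(2)[OF v_e] supp vs)+
    finally show ?thesis .
  qed
  have vL: "vanishes_outside_ball ?L" by (intro supp_add supp_mult(1) supp_mult(2)[OF v_e] supp vs)
  have cL: "continuous_on UNIV ?L" by (intro continuous_intros cts ctc)
  have pt: "l * dq s j p x - l * dq s j n x = (1/s) *\<^sub>R (l * sh s j ?Q x - l * ?Q x)" for l x
    by (simp add: dq_def sh_def scaleR_conv_of_real algebra_simps)
  have "I (\<lambda>x. ?L x * dq s j p x) - I (\<lambda>x. ?L x * dq s j n x) = I (\<lambda>x. ?L x * dq s j p x - ?L x * dq s j n x)"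
    by (rule Bochner_Integration.integral_diff[symmetric]) (intro integrable_cc supp_mult(1)[OF vL] continuous_intros cL cts)+
  also have "\<dots> = I (\<lambda>x. (1/s) *\<^sub>R (?L x * sh s j ?Q x - ?L x * ?Q x))"
    by (simp only: pt)
  also have "\<dots> = (1/s) *\<^sub>R (I (\<lambda>x. ?L x * sh s j ?Q x - ?L x * ?Q x))" by (rule integral_scaleR_right)
  also have "I (\<lambda>x. ?L x * sh s j ?Q x - ?L x * ?Q x) = I (\<lambda>x. ?L x * sh s j ?Q x) - I (\<lambda>x. ?L x * ?Q x)"
    by (rule Bochner_Integration.integral_diff) (intro integrable_cc supp_mult(1)[OF vL] continuous_intros cL cts)+
  finally have fin: "T1 p s j + T2 p s j + T3 p s j - (T1 n s j + T2 n s j + T3 n s j)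
     = (1/s) *\<^sub>R (I (\<lambda>x. ?L x * sh s j ?Q x) - I (\<lambda>x. ?L x * ?Q x))"
    unfolding sum[OF cts(2)] sum[OF C1_cont[OF n_C1]] .
  have "Re (T1 p s j + T2 p s j + T3 p s j - (T1 n s j + T2 n s j + T3 n s j)) = 0"
    unfolding fin scaleR_complex.sel minus_complex.sel w0 w1 by simp
  then show ?thesis by simp
qed

text \<open>The conjugate operator \<open>\<partial>_1 - i \<partial>_2\<close>. The limits cA, cB, cC are the lower order terms in which the test terms end up; cB contains \<open>dh f'\<close>, the Laplacian of \<open>\<psi>\<close>, which E does not control.\<close>
definition "dh g' x = g' 1 x - \<i> * g' 2 (x::plane) "

definition "cA = I (\<lambda>x. dh e' x * (E x * p x))"
definition "cB = I (\<lambda>x. S x * (dh f' x * p x))"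
definition "cC = I (\<lambda>x. (S' 1 x * complex_of_real (\<psi>' 1 x) + S' 2 x * complex_of_real (\<psi>' 2 x)) * p x)"
definition "J s = I (\<lambda>x. 2 * e x * p x * (dq s 1 E x - \<i> * dq s 2 E x))"

lemma dh_cont: "(\<And>k. continuous_on UNIV (g' k)) \<Longrightarrow> continuous_on UNIV (dh g')"
  unfolding dh_def[abs_def] by (intro continuous_intros)

lemma dh_supp: "(\<And>k. vanishes_outside_ball (g' k)) \<Longrightarrow> vanishes_outside_ball (dh g')"
  unfolding dh_def[abs_def] by (intro supp)

lemmas dhs = dh_cont[OF C1_cont'[OF e_C1]] dh_cont[OF C1_cont'[OF f_C1]]
lemmas vdh = dh_supp[OF v_e']

lemmas kap = kappa_ge[OF w]

lemma pair_identity: "2 * e' 1 x * (p x * f' 1 x) + 2 * e' 2 x * (p x * f' 2 x) = dh e' x * (E x * p x) + S x * (dh f' x * p x)"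
  unfolding dh_def dbar_def by (simp add: algebra_simps)

lemma sum_pair: "I (\<lambda>x. 2 * e' 1 x * (p x * f' 1 x)) + I (\<lambda>x. 2 * e' 2 x * (p x * f' 2 x)) = cA + cB"
proof -
  have "I (\<lambda>x. 2 * e' 1 x * (p x * f' 1 x)) + I (\<lambda>x. 2 * e' 2 x * (p x * f' 2 x)) = I (\<lambda>x. dh e' x * (E x * p x) + S x * (dh f' x * p x))"
    unfolding pair_identity[symmetric]
    by (rule Bochner_Integration.integral_add[symmetric]) (intro integrable_cc continuous_intros cts ctc supp_mult(1) supp_mult(2)[OF v_e'])+
  also have "\<dots> = cA + cB" unfolding cA_def cB_def
    by (rule Bochner_Integration.integral_add) (intro integrable_cc continuous_intros cts ctc dhs supp_mult(1) vdh vs)+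
  finally show ?thesis .
qed

text \<open>Replace the quotient of f by its derivative, move e inside the difference, and apply \<open>good_laplace\<close> to the good function \<open>2 e p\<close>.\<close>
lemma T2_expansion: "small_o (\<kappa> w) (\<lambda>s. T2 p s 1 + T2 p s 2 + J s + cA + cB)"
proof -
  have C: "C1 (\<lambda>x. 2 * e x) (\<lambda>j x. 2 * e' j x)" by (rule C1_cmult[OF e_C1])
  have v2: "vanishes_outside_ball (\<lambda>x. 2 * e x)" by (intro supp_mult(2) vs)
  have G: "good w (\<lambda>x. 2 * e x * p x)" by (rule good_p[OF w C v2 w1])
  have a: "small_o (\<kappa> w) (\<lambda>s. T2 p s j - I (\<lambda>x. dq s j p x * (2 * e x * f' j x)))" for j
  proof -
    have "loc_unif (\<lambda>s x. dq s j f x - f' j x) (\<lambda>x. f' j x - f' j x)" by (intro loc_unif_intros loc_unif_dq[OF f_C1])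
    then have l: "loc_unif (\<lambda>s x. dq s j f x - f' j x) (\<lambda>x. 0)" by simp
    have "small_o (\<kappa> w) (\<lambda>s. I (\<lambda>x. dq s j p x * (2 * e x * (dq s j f x - f' j x))))"
      by (rule dq_p_small[OF w _ w1 l]) (intro continuous_intros cts ctc)+
    then show ?thesis
    proof (rule small_o_cong)
      fix s
      have "T2 p s j - I (\<lambda>x. dq s j p x * (2 * e x * f' j x)) = I (\<lambda>x. 2 * e x * (dq s j p x * dq s j f x) - dq s j p x * (2 * e x * f' j x))"
        unfolding T2_def by (rule Bochner_Integration.integral_diff[symmetric]) 
          (intro integrable_cc continuous_intros cts ctc supp_mult(1)[OF v2] supp_mult(2)[OF supp_mult(1)[OF v2]])+
      then show "I (\<lambda>x. dq s j p x * (2 * e x * (dq s j f x - f' j x))) = T2 p s j - I (\<lambda>x. dq s j p x * (2 * e x * f' j x))"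
        by (simp add: algebra_simps)
    qed
  qed
  have b: "small_o (\<kappa> w) (\<lambda>s. I (\<lambda>x. dq s j p x * (2 * e x * f' j x)) - I (\<lambda>x. dq s j (\<lambda>x. 2 * e x * p x) x * f' j x) + I (\<lambda>x. 2 * e' j x * (p x * f' j x)))" for j
  proof -
    have "((\<lambda>s. I (\<lambda>x. dq s j (\<lambda>x. 2 * e x) x * (sh s j p x * f' j x))) \<longlongrightarrow> I (\<lambda>x. 2 * e' j x * (p x * f' j x))) (at_right 0)"
      by (rule I_lim) (intro loc_unif_intros loc_unif_dq[OF C] continuous_intros supp_mult uv_mult uv_dq v2 cts ctc)+
    from small_o_tendsto[OF this kap] have "small_o (\<kappa> w) (\<lambda>s. I (\<lambda>x. dq s j (\<lambda>x. 2 * e x) x * (sh s j p x * f' j x)) - I (\<lambda>x. 2 * e' j x * (p x * f' j x)))" .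
    from small_o_uminus[OF this] show ?thesis
    proof (rule small_o_cong)
      fix s
      have "I (\<lambda>x. dq s j (\<lambda>x. 2 * e x * p x) x * f' j x) = I (\<lambda>x. dq s j (\<lambda>x. 2 * e x) x * (sh s j p x * f' j x) + dq s j p x * (2 * e x * f' j x))"
        by (rule Bochner_Integration.integral_cong[OF refl], subst dq_mult') (simp add: algebra_simps)
      also have "\<dots> = I (\<lambda>x. dq s j (\<lambda>x. 2 * e x) x * (sh s j p x * f' j x)) + I (\<lambda>x. dq s j p x * (2 * e x * f' j x))"
        by (rule Bochner_Integration.integral_add) 
          (intro integrable_cc continuous_intros cts ctc supp_mult(1)[OF supp_dq[OF v2]] supp_mult(2)[OF supp_mult(1)[OF v2]])+
      finally show "- (I (\<lambda>x. dq s j (\<lambda>x. 2 * e x) x * (sh s j p x * f' j x)) - I (\<lambda>x. 2 * e' j x * (p x * f' j x)))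
        = I (\<lambda>x. dq s j p x * (2 * e x * f' j x)) - I (\<lambda>x. dq s j (\<lambda>x. 2 * e x * p x) x * f' j x) + I (\<lambda>x. 2 * e' j x * (p x * f' j x))"
        by simp
    qed
  qed
  note c = good_laplace[OF G f_C1]
  show ?thesis
  proof (rule small_o_cong[OF small_o_add[OF small_o_add[OF small_o_add[OF a[of 1] b[of 1]] small_o_add[OF a[of 2] b[of 2]]] c]])
    fix s
    show "T2 p s 1 - I (\<lambda>x. dq s 1 p x * (2 * e x * f' 1 x)) +
         (I (\<lambda>x. dq s 1 p x * (2 * e x * f' 1 x)) - I (\<lambda>x. dq s 1 (\<lambda>x. 2 * e x * p x) x * f' 1 x) + I (\<lambda>x. 2 * e' 1 x * (p x * f' 1 x))) +
         (T2 p s 2 - I (\<lambda>x. dq s 2 p x * (2 * e x * f' 2 x)) +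
          (I (\<lambda>x. dq s 2 p x * (2 * e x * f' 2 x)) - I (\<lambda>x. dq s 2 (\<lambda>x. 2 * e x * p x) x * f' 2 x) + I (\<lambda>x. 2 * e' 2 x * (p x * f' 2 x)))) +
         (I (\<lambda>x. dq s 1 (\<lambda>x. 2 * e x * p x) x * f' 1 x) + I (\<lambda>x. dq s 2 (\<lambda>x. 2 * e x * p x) x * f' 2 x) +
          I (\<lambda>x. 2 * e x * p x * (dq s 1 E x - \<i> * dq s 2 E x))) = T2 p s 1 + T2 p s 2 + J s + cA + cB"
      unfolding add.assoc[of _ cA cB] sum_pair[symmetric] J_def by simp
  qed
qed

lemma psi_lap: "complex_of_real (Re (f' 1 x)) + complex_of_real (Im (f' 2 x)) = dh f' x"
  unfolding dh_def using curl[of x] by (simp add: complex_eq_iff)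

text \<open>Here the difference is moved backward onto \<open>S \<psi>_j\<close>, which is C1, so a limit exists. It again contains cB.\<close>
lemma T3_expansion: "small_o (\<kappa> w) (\<lambda>s. T3 p s 1 + T3 p s 2 + cC + cB)"
proof -
  have a: "small_o (\<kappa> w) (\<lambda>s. T3 p s j - I (\<lambda>x. dq s j p x * (S x * complex_of_real (\<psi>' j x))))" for j
  proof -
    have "loc_unif (\<lambda>s x. complex_of_real (dq s j \<psi> x) - complex_of_real (\<psi>' j x)) (\<lambda>x. complex_of_real (\<psi>' j x) - complex_of_real (\<psi>' j x))" by (intro loc_unif_intros loc_unif_dq[OF psi_C1'])
    then have l: "loc_unif (\<lambda>s x. complex_of_real (dq s j \<psi> x) - complex_of_real (\<psi>' j x)) (\<lambda>x. 0)" by simp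
    have "small_o (\<kappa> w) (\<lambda>s. I (\<lambda>x. dq s j p x * (S x * (complex_of_real (dq s j \<psi> x) - complex_of_real (\<psi>' j x)))))"
      by (rule dq_p_small[OF w _ w2 l]) (intro continuous_intros cts ctc)+
    then show ?thesis
    proof (rule small_o_cong)
      fix s
      have "T3 p s j - I (\<lambda>x. dq s j p x * (S x * complex_of_real (\<psi>' j x))) = I (\<lambda>x. S x * (dq s j p x * complex_of_real (dq s j \<psi> x)) - dq s j p x * (S x * complex_of_real (\<psi>' j x)))"
        unfolding T3_def by (rule Bochner_Integration.integral_diff[symmetric]) 
          (intro integrable_cc continuous_intros cts ctc supp_mult(1)[OF v_S] supp_mult(2)[OF supp_mult(1)[OF v_S]])+
      then show "I (\<lambda>x. dq s j p x * (S x * (complex_of_real (dq s j \<psi> x) - complex_of_real (\<psi>' j x)))) = T3 p s j - I (\<lambda>x. dq s j p x * (S x * complex_of_real (\<psi>' j x)))"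
        by (simp add: algebra_simps)
    qed
  qed
  define W where "W j x = S' j x * complex_of_real (\<psi>' j x) + S x * complex_of_real (if j = 1 then Re (f' j x) else Im (f' j x))" for j x
  have CW: "C1 (\<lambda>x. S x * complex_of_real (\<psi>' j x)) (\<lambda>k x. S' k x * complex_of_real (\<psi>' j x) + S x * complex_of_real (if j = 1 then Re (f' k x) else Im (f' k x)))" for j
    by (rule C1_mult[OF S_C1 C1_of_real[OF psi'_C1]])
  have vW: "vanishes_outside_ball (\<lambda>x. S x * complex_of_real (\<psi>' j x))" for j by (intro supp_mult(1) vs)
  have cW: "continuous_on UNIV (W j)" for j using C1_cont'[OF CW[of j], of j] unfolding W_def .
  have vW': "vanishes_outside_ball (W j)" for j using supp_deriv[OF CW[of j] vW[of j], of j] unfolding W_def .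
  have b: "small_o (\<kappa> w) (\<lambda>s. I (\<lambda>x. dq s j p x * (S x * complex_of_real (\<psi>' j x))) + I (\<lambda>x. p x * W j x))" for j
  proof -
    have luw: "loc_unif (\<lambda>s. dq (-s) j (\<lambda>x. S x * complex_of_real (\<psi>' j x))) (W j)"
      using loc_unif_dq(2)[OF CW[of j], of j] unfolding W_def .
    have uvm: "unif_vanishes (\<lambda>s. dq (-s) j (\<lambda>x. S x * complex_of_real (\<psi>' j x)))"
      using uv_dq[OF vW[of j], of j] unfolding unif_vanishes_def by (metis atLeastAtMost_iff minus_le_iff neg_le_iff_le add.inverse_inverse)
    have "((\<lambda>s. I (\<lambda>x. p x * dq (-s) j (\<lambda>x. S x * complex_of_real (\<psi>' j x)) x)) \<longlongrightarrow> I (\<lambda>x. p x * W j x)) (at_right 0)"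
      by (rule I_lim) (intro loc_unif_intros luw uv_mult(2)[OF uvm] continuous_intros cts ctc cW)+
    from small_o_uminus[OF small_o_tendsto[OF this kap]] show ?thesis
      by (rule small_o_cong) (simp add: I_parts_back[OF cts(2) C1_cont[OF CW] disjI2[OF vW]])
  qed
  have c: "I (\<lambda>x. p x * W 1 x) + I (\<lambda>x. p x * W 2 x) = cC + cB"
  proof -
    have "I (\<lambda>x. p x * W 1 x) + I (\<lambda>x. p x * W 2 x) = I (\<lambda>x. p x * W 1 x + p x * W 2 x)"
      by (rule Bochner_Integration.integral_add[symmetric]) (intro integrable_cc continuous_intros cts cW supp_mult(2) vW')+
    also have "\<dots> = I (\<lambda>x. (S' 1 x * complex_of_real (\<psi>' 1 x) + S' 2 x * complex_of_real (\<psi>' 2 x)) * p x + S x * (dh f' x * p x))"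
      by (rule Bochner_Integration.integral_cong) (auto simp: W_def psi_lap[symmetric] algebra_simps)
    also have "\<dots> = cC + cB" unfolding cC_def cB_def
      by (rule Bochner_Integration.integral_add) (intro integrable_cc continuous_intros cts ctc dhs supp_mult(1) supp_add(1) vs)+
    finally show ?thesis .
  qed
  show ?thesis
    by (rule small_o_cong[OF small_o_add[OF small_o_add[OF a[of 1] b[of 1]] small_o_add[OF a[of 2] b[of 2]]]])
       (unfold add.assoc[of _ cC cB] c[symmetric], simp)
qed

lemma T5_T6_expansion: "small_o (\<kappa> w) (\<lambda>s. T5 p s 1 + T5 p s 2 + T6 p s 1 + T6 p s 2 - (cA + cB + cC))"
proof -
  have 5: "((\<lambda>s. T5 p s k) \<longlongrightarrow> I (\<lambda>x. 2 * e' k x * (p x * f' k x))) (at_right 0)" for k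
    unfolding T5_def by (rule I_lim) (intro loc_unif_intros loc_unif_dq[OF f_C1] continuous_intros uv_mult(1) unif_vanishes_const supp_mult(2)[OF v_e'] cts ctc)+
  have 6: "((\<lambda>s. T6 p s k) \<longlongrightarrow> I (\<lambda>x. S' k x * (p x * complex_of_real (\<psi>' k x)))) (at_right 0)" for k
    unfolding T6_def by (rule I_lim) (intro loc_unif_intros loc_unif_dq[OF psi_C1'] continuous_intros uv_mult(1) unif_vanishes_const vs cts ctc)+
  have c: "I (\<lambda>x. S' 1 x * (p x * complex_of_real (\<psi>' 1 x))) + I (\<lambda>x. S' 2 x * (p x * complex_of_real (\<psi>' 2 x))) = cC"
  proof -
    have "I (\<lambda>x. S' 1 x * (p x * complex_of_real (\<psi>' 1 x))) + I (\<lambda>x. S' 2 x * (p x * complex_of_real (\<psi>' 2 x))) 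
      = I (\<lambda>x. S' 1 x * (p x * complex_of_real (\<psi>' 1 x)) + S' 2 x * (p x * complex_of_real (\<psi>' 2 x)))"
      by (rule Bochner_Integration.integral_add[symmetric]) (intro integrable_cc continuous_intros cts ctc supp_mult(1) vs)+
    then show ?thesis unfolding cC_def by (simp add: algebra_simps)
  qed
  have "((\<lambda>s. T5 p s 1 + T5 p s 2 + T6 p s 1 + T6 p s 2) \<longlongrightarrow> cA + cB + cC) (at_right 0)"
    using tendsto_add[OF tendsto_add[OF 5[of 1] 5[of 2]] tendsto_add[OF 6[of 1] 6[of 2]]] unfolding sum_pair c
    by (simp add: add.assoc)
  from small_o_tendsto[OF this kap] show ?thesis .
qed

definition "Tn z s = T1 z s 1 + T2 z s 1 + T3 z s 1 + (T1 z s 2 + T2 z s 2 + T3 z s 2)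
   + 2 * (T4 z s 1 + T5 z s 1 + T6 z s 1) + 2 * (T4 z s 2 + T5 z s 2 + T6 z s 2)"

text \<open>T2 and T3 each contribute one copy of cB, and the second test contributes one copy with the opposite sign: taken twice, it cancels them. This explains the factor 2 in \<open>Tn\<close>.\<close>
lemma main_identity:
  "\<exists>Z. small_o (\<kappa> w) Z \<and> (\<forall>s. Re (T1 p s 1 + T1 p s 2) = Re (J s) - 2 * Re (T4 p s 1 + T4 p s 2) - Re (cA + cC) + Re (Tn n s) + Re (Z s))"
proof -
  have "small_o (\<kappa> w) (\<lambda>s. - ((T2 p s 1 + T2 p s 2 + J s + cA + cB) + (T3 p s 1 + T3 p s 2 + cC + cB) + 2 * (T5 p s 1 + T5 p s 2 + T6 p s 1 + T6 p s 2 - (cA + cB + cC))))"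
    by (intro small_o_uminus small_o_add small_o_cmult T2_expansion T3_expansion T5_T6_expansion)
  moreover have "Re (Tn p s) = Re (Tn n s)" for s
    unfolding Tn_def using test_first[of s 1] test_first[of s 2] test_second[of s 1] test_second[of s 2] by simp
  ultimately show ?thesis
  proof (intro exI conjI allI)
    fix s
    assume *: "\<And>s. Re (Tn p s) = Re (Tn n s)"
    show "Re (T1 p s 1 + T1 p s 2) = Re (J s) - 2 * Re (T4 p s 1 + T4 p s 2) - Re (cA + cC) + Re (Tn n s) +
       Re (- ((T2 p s 1 + T2 p s 2 + J s + cA + cB) + (T3 p s 1 + T3 p s 2 + cC + cB) + 2 * (T5 p s 1 + T5 p s 2 + T6 p s 1 + T6 p s 2 - (cA + cB + cC))))"
      using *[of s] unfolding Tn_def by simp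
  qed
qed

end

section \<open>The convective terms\<close>

lemma norm_mult_le: "norm (a::complex) \<le> A \<Longrightarrow> norm b \<le> B \<Longrightarrow> norm (a * b) \<le> A * B"
  unfolding norm_mult by (rule mult_mono) (auto intro: order_trans[OF norm_ge_zero])

lemma norm_I_le:
  fixes g :: "plane \<Rightarrow> 'b::{banach,second_countable_topology}"
  assumes "continuous_on UNIV g" "vanishes_outside_ball g" "continuous_on UNIV B" "vanishes_outside_ball B"
    and "\<And>x. norm (g x) \<le> B x"
  shows "norm (I g) \<le> I B"
proof -
  have "norm (I g) \<le> I (\<lambda>x. norm (g x))" by (rule integral_norm_bound)
  also have "\<dots> \<le> I B"
    by (rule integral_mono) (intro integrable_cc continuous_intros supp assms)+
  finally show ?thesis .
qed

lemma I_mono: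
  fixes f g :: "plane \<Rightarrow> real"
  assumes "continuous_on UNIV f" "vanishes_outside_ball f" "continuous_on UNIV g" "vanishes_outside_ball g"
    and "\<And>x. f x \<le> g x"
  shows "I f \<le> I g"
  by (rule integral_mono) (intro integrable_cc assms)+

lemma Re_I:
  assumes "continuous_on UNIV g" "vanishes_outside_ball g"
  shows "Re (I g) = I (\<lambda>x. Re (g x))"
  by (rule integral_bounded_linear[OF bounded_linear_Re integrable_cc[OF assms], symmetric])

context flow begin

definition "D2 s x = (norm (dq s 1 E x))\<^sup>2 + (norm (dq s 2 E x))\<^sup>2"

lemma D2_cont: "continuous_on UNIV (D2 s)" unfolding D2_def[abs_def] by (intro continuous_intros cts)

definition H :: "plane \<Rightarrow> real" where "H x = norm (f' 1 x) + norm (f' 2 x)"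

lemma H_nonneg: "H x \<ge> 0" and f'_le_H: "norm (f' j x) \<le> H x" and E_le_H: "norm (E x) \<le> H x"
  and cts_H [continuous_intros]: "continuous_on UNIV H"
proof -
  show "H x \<ge> 0" unfolding H_def by simp
  show "norm (f' j x) \<le> H x" using exhaust_2[of j] unfolding H_def by auto
  show "norm (E x) \<le> H x" unfolding H_def dbar_def
    using norm_triangle_ineq[of "f' 1 x" "\<i> * f' 2 x"] by (simp add: norm_mult)
  show "continuous_on UNIV H" unfolding H_def[abs_def] by (intro continuous_intros cts)
qed

lemma m_nonneg: "m \<ge> 0" using f_bdd[of 0] norm_ge_zero order_trans by blast

lemma n_le: "norm (n x) \<le> m * m"
  unfolding n_def using norm_mult_le[of "cnj (f x)" m "cnj (f x)" m] f_bdd[of x] by (simp add: norm_mult)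

lemma n'_le: "norm (n' j x) \<le> 2 * m * H x"
  unfolding n'_def using norm_mult_le[of "cnj (f x)" m "cnj (f' j x)" "H x"] f_bdd[of x] f'_le_H[of j x] by (simp add: norm_mult)

text \<open>All second derivatives of \<open>\<psi>\<close> in the weighted mean square are controlled by the first differences of E and the bound m for f: apply \<open>good_laplace\<close> to \<open>g cnj f\<close>, whose derivative paired with that of f is the squared gradient up to a term with the derivative of g.\<close>
lemma hessian_bound:
  assumes g: "C1 g g'" and v: "vanishes_outside_ball g" and gn: "\<And>x. g x \<ge> 0" and \<epsilon>: "\<epsilon> > 0"
  shows "\<forall>\<^sub>F s in at_right 0. I (\<lambda>x. g x * ((norm (f' 1 x))\<^sup>2 + (norm (f' 2 x))\<^sup>2))
     \<le> m * I (\<lambda>x. g x * D s x) + m * I (\<lambda>x. (\<bar>g' 1 x\<bar> + \<bar>g' 2 x\<bar>) * H x) + \<epsilon>"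
proof -
  have wt: "weight (\<lambda>_. 0)" unfolding weight_def vanishes_outside_ball_def by auto
  have kap1: "\<kappa> (\<lambda>_. 0) s = 1" for s unfolding \<kappa>_def by simp
  define G where "G x = complex_of_real (g x) * cnj (f x)" for x
  define G' where "G' j x = complex_of_real (g' j x) * cnj (f x) + complex_of_real (g x) * cnj (f' j x)" for j x
  have G: "C1 G G'" unfolding G_def[abs_def] G'_def[abs_def] by (rule C1_mult[OF C1_of_real[OF g] C1_cnj[OF f_C1]])
  have vG: "vanishes_outside_ball G" unfolding G_def[abs_def] by (intro supp_mult(1) supp v)
  note ct = C1_cont[OF g] C1_cont'[OF g] C1_cont[OF G] C1_cont'[OF G] cts
  have vg': "vanishes_outside_ball (g' j)" "vanishes_outside_ball (G' j)" for j 
    using supp_deriv[OF g v] supp_deriv[OF G vG] by auto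
  have t: "((\<lambda>s. I (\<lambda>x. dq s j G x * f' j x)) \<longlongrightarrow> I (\<lambda>x. G' j x * f' j x)) (at_right 0)" for j
    by (rule I_lim) (intro loc_unif_intros loc_unif_dq[OF G] continuous_intros uv_mult(1) uv_dq vG ct)+
  define Z where "Z s = I (\<lambda>x. G' 1 x * f' 1 x) + I (\<lambda>x. G' 2 x * f' 2 x) + I (\<lambda>x. G x * (dq s 1 E x - \<i> * dq s 2 E x))" for s
  have "small_o (\<kappa> (\<lambda>_. 0)) Z"
  proof -
    note a = good_laplace[OF good_C1[OF wt G vG] f_C1]
    have k: "\<And>s. \<kappa> (\<lambda>_. 0) s \<ge> 1" by (simp add: kap1)
    note b = small_o_tendsto[OF t[of 1] k] and c = small_o_tendsto[OF t[of 2] k]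
    show ?thesis
      by (rule small_o_cong[OF small_o_diff[OF small_o_diff[OF a b] c]]) (simp add: Z_def)
  qed
  then have "\<forall>\<^sub>F s in at_right 0. norm (Z s) \<le> \<epsilon>"
    using \<epsilon> unfolding small_o_def kap1 by (metis mult.right_neutral)
  then show ?thesis
  proof eventually_elim
    case (elim s)
    define R where "R = I (\<lambda>x. (complex_of_real (g' 1 x) * f' 1 x + complex_of_real (g' 2 x) * f' 2 x) * cnj (f x))"
    have main: "I (\<lambda>x. G' 1 x * f' 1 x) + I (\<lambda>x. G' 2 x * f' 2 x) = complex_of_real (I (\<lambda>x. g x * ((norm (f' 1 x))\<^sup>2 + (norm (f' 2 x))\<^sup>2))) + R"
    proof -
      have "I (\<lambda>x. G' 1 x * f' 1 x) + I (\<lambda>x. G' 2 x * f' 2 x) = I (\<lambda>x. G' 1 x * f' 1 x + G' 2 x * f' 2 x)"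
        by (rule Bochner_Integration.integral_add[symmetric]) (intro integrable_cc continuous_intros ct supp_mult(1) vg')+
      also have "\<dots> = I (\<lambda>x. complex_of_real (g x * ((norm (f' 1 x))\<^sup>2 + (norm (f' 2 x))\<^sup>2)) + (complex_of_real (g' 1 x) * f' 1 x + complex_of_real (g' 2 x) * f' 2 x) * cnj (f x))"
        by (rule Bochner_Integration.integral_cong[OF refl])
           (simp add: G'_def of_real_add of_real_mult complex_norm_square algebra_simps del: of_real_power)
      also have "\<dots> = I (\<lambda>x. complex_of_real (g x * ((norm (f' 1 x))\<^sup>2 + (norm (f' 2 x))\<^sup>2))) + R"
        unfolding R_def by (rule Bochner_Integration.integral_add) (intro integrable_cc continuous_intros ct supp(8) supp_add supp_mult(1) supp_map(6) vg' v)+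
      finally show ?thesis by (simp only: integral_complex_of_real)
    qed
    have R: "norm R \<le> m * I (\<lambda>x. (\<bar>g' 1 x\<bar> + \<bar>g' 2 x\<bar>) * H x)"
    proof -
      have "norm R \<le> I (\<lambda>x. ((\<bar>g' 1 x\<bar> + \<bar>g' 2 x\<bar>) * H x) * m)"
        unfolding R_def
      proof (rule norm_I_le)
        fix x
        have "norm (complex_of_real (g' 1 x) * f' 1 x + complex_of_real (g' 2 x) * f' 2 x) \<le> \<bar>g' 1 x\<bar> * norm (f' 1 x) + \<bar>g' 2 x\<bar> * norm (f' 2 x)"
          by (rule order_trans[OF norm_triangle_ineq]) (simp add: norm_mult)
        also have "\<dots> \<le> (\<bar>g' 1 x\<bar> + \<bar>g' 2 x\<bar>) * H x"
          unfolding distrib_right by (intro add_mono mult_left_mono f'_le_H) auto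
        finally show "norm ((complex_of_real (g' 1 x) * f' 1 x + complex_of_real (g' 2 x) * f' 2 x) * cnj (f x)) \<le> ((\<bar>g' 1 x\<bar> + \<bar>g' 2 x\<bar>) * H x) * m"
          by (rule norm_mult_le) (simp add: f_bdd)
      qed (intro continuous_intros ct supp_add supp_mult(1) supp_map vg')+
      then show ?thesis by (simp add: mult.commute)
    qed
    have Q: "norm (I (\<lambda>x. G x * (dq s 1 E x - \<i> * dq s 2 E x))) \<le> m * I (\<lambda>x. g x * D s x)"
    proof -
      have "norm (I (\<lambda>x. G x * (dq s 1 E x - \<i> * dq s 2 E x))) \<le> I (\<lambda>x. (g x * m) * D s x)"
      proof (rule norm_I_le)
        fix x
        have "norm (dq s 1 E x - \<i> * dq s 2 E x) \<le> D s x"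
          unfolding D_def by (rule order_trans[OF norm_triangle_ineq4]) (simp add: norm_mult)
        moreover have "norm (G x) \<le> g x * m"
          unfolding G_def by (rule norm_mult_le) (simp_all add: gn f_bdd)
        ultimately show "norm (G x * (dq s 1 E x - \<i> * dq s 2 E x)) \<le> (g x * m) * D s x" by (intro norm_mult_le)
      qed (intro continuous_intros ct supp_mult(1) vG v)+
      moreover have "(\<lambda>x. (g x * m) * D s x) = (\<lambda>x. m * (g x * D s x))" by (simp add: fun_eq_iff)
      ultimately show ?thesis by simp
    qed
    let ?X = "I (\<lambda>x. g x * ((norm (f' 1 x))\<^sup>2 + (norm (f' 2 x))\<^sup>2))"
    have "complex_of_real ?X = Z s - R - I (\<lambda>x. G x * (dq s 1 E x - \<i> * dq s 2 E x))"
      unfolding Z_def main by simp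
    then have "norm (complex_of_real ?X) \<le> norm (Z s) + norm R + norm (I (\<lambda>x. G x * (dq s 1 E x - \<i> * dq s 2 E x)))"
      using norm_triangle_ineq4[of "Z s - R" "I (\<lambda>x. G x * (dq s 1 E x - \<i> * dq s 2 E x))"] norm_triangle_ineq4[of "Z s" R] by simp
    then show ?case using elim R Q by simp
  qed
qed

end

lemma I_dh_zero:
  assumes C: "C1 g g'" and v: "vanishes_outside_ball g"
  shows "I (\<lambda>x. g' 1 x - \<i> * g' 2 x) = 0"
proof -
  have "I (\<lambda>x. g' 1 x - \<i> * g' 2 x) = I (g' 1) - I (\<lambda>x. \<i> * g' 2 x)"
    by (rule Bochner_Integration.integral_diff) (intro integrable_cc continuous_intros supp supp_deriv[OF C v] C1_cont'[OF C])+
  then show ?thesis using I_deriv_zero[OF C v] by simp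
qed

text \<open>The Leibniz rule behind \<open>convection_identity\<close>: the expression that occurs in T1 equals a quadratic form in q, with q undifferentiated, plus the derivatives of compactly supported functions.\<close>
lemma conv_alg:
  fixes Y Y1 Y2 q qc a1 a2 b1 b2 :: complex
  shows "2 * \<i> * Y * (((a1 * qc + q * b1) + \<i> * (a2 * qc + q * b2)) - q * (a1 - \<i> * a2))
    = - (2 * \<i> * (Y1 + \<i> * Y2)) * (q * qc) + \<i> * (Y1 - \<i> * Y2) * (q * q)
     + (2 * \<i> * ((Y1 * (q * qc) + Y * (a1 * qc + q * b1)) + \<i> * (Y2 * (q * qc) + Y * (a2 * qc + q * b2)))
       + (- \<i>) * ((Y1 * (q * q) + Y * (a1 * q + q * a1)) - \<i> * (Y2 * (q * q) + Y * (a2 * q + q * a2))))"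
  by (simp add: algebra_simps)

lemma dbar_alg:
  fixes a b c h d1 d2 :: complex
  shows "a * c + h * d1 + \<i> * (b * c + h * d2) = (a + \<i> * b) * c + h * (d1 + \<i> * d2)"
    "a * c + h * d1 - \<i> * (b * c + h * d2) = (a - \<i> * b) * c + h * (d1 - \<i> * d2)"
  by (simp_all add: algebra_simps)

text \<open>The difference of a square is exactly twice the mean times the difference, which is why the averages of f and its translate appear in \<open>convection_identity\<close>.\<close>
lemma square_dq_alg:
  fixes a b :: complex
  shows "c *\<^sub>R (\<i> * (b * b) - \<i> * (a * a)) = 2 * \<i> * ((a + b) / 2) * (c *\<^sub>R (b - a))"
proof -
  have "\<i> * (b * b) - \<i> * (a * a) = 2 * \<i> * ((a + b) / 2) * (b - a)" by (simp add: algebra_simps)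
  then show ?thesis by (simp only: mult_scaleR_right)
qed

text \<open>The cubic terms in the second derivatives of \<open>\<psi>\<close> have vanishing real part: absence of vortex stretching in two dimensions. It uses only that mixed derivatives agree.\<close>
lemma trace_cancel:
  assumes "Im F1 = Re F2"
  shows "Re (2 * \<i> * complex_of_real h * (- (cnj F1 + \<i> * cnj F2) * (F1 * cnj F1 + F2 * cnj F2) + (1/2) * ((cnj F1 - \<i> * cnj F2) * (F1 * F1 + F2 * F2)))) = 0"
proof -
  obtain a b c where F: "F1 = Complex a b" "F2 = Complex b c"
    using assms by (metis complex.exhaust complex.sel)
  show ?thesis unfolding F by (simp add: algebra_simps power2_eq_square)
qed

context flow_cutoff begin

text \<open>T1 for the convective term contains a difference of E, which has no limit. For a complex gradient q, \<open>cnj q * dbar q\<close> is \<open>dbar |q|^2\<close> minus half of \<open>(\<partial>_1 - i \<partial>_2) q^2\<close>; integrating by parts leaves only differences of f, for which the limit exists.\<close>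
lemma convection_identity:
  "T1 n s j = I (\<lambda>x. - (2 * \<i> * ((e x * cnj ((f x + sh s j f x) / 2)) + \<eta> x * (cnj ((f' 1 x + sh s j (f' 1) x) / 2) + \<i> * cnj ((f' 2 x + sh s j (f' 2) x) / 2)))) * (dq s j f x * cnj (dq s j f x))
     + \<i> * ((cnj (e x) * cnj ((f x + sh s j f x) / 2)) + \<eta> x * (cnj ((f' 1 x + sh s j (f' 1) x) / 2) - \<i> * cnj ((f' 2 x + sh s j (f' 2) x) / 2))) * (dq s j f x * dq s j f x))"
  (is "_ = I ?V")
proof -
  define g where "g x = (f x + sh s j f x) / 2" for x
  define g' where "g' k x = (f' k x + sh s j (f' k) x) / 2" for k x
  have gC: "C1 g g'" unfolding g_def[abs_def] g'_def[abs_def]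
    by (rule C1_bl[OF C1_add[OF f_C1 C1_sh[OF f_C1]] bounded_linear_divide])
  define Y where "Y x = complex_of_real (\<eta> x) * cnj (g x)" for x
  define Y' where "Y' k x = complex_of_real (\<eta>' k x) * cnj (g x) + complex_of_real (\<eta> x) * cnj (g' k x)" for k x
  have YC: "C1 Y Y'" unfolding Y_def[abs_def] Y'_def[abs_def] by (rule C1_mult[OF C1_of_real[OF eta_C1] C1_cnj[OF gC]])
  have vY: "vanishes_outside_ball Y" unfolding Y_def[abs_def] by (intro supp vs)
  define q where "q = dq s j f"
  define q' where "q' k = dq s j (f' k)" for k
  have qC: "C1 q q'" unfolding q_def q'_def[abs_def] by (rule C1_dq[OF f_C1])
  have qcurl: "Im (q' 1 x) = Re (q' 2 x)" for x
    unfolding q'_def dq_def sh_def using curl by simp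
  note X1C = C1_mult[OF qC C1_cnj[OF qC]] and X2C = C1_mult[OF qC qC]
  note Z1 = C1_mult[OF YC X1C] and Z2 = C1_mult[OF YC X2C]
  have vZ1: "vanishes_outside_ball (\<lambda>x. Y x * (q x * cnj (q x)))" and vZ2: "vanishes_outside_ball (\<lambda>x. Y x * (q x * q x))"
    by (intro supp_mult(1) vY)+
  let ?V' = "\<lambda>x. - (2 * \<i> * (Y' 1 x + \<i> * Y' 2 x)) * (q x * cnj (q x)) + \<i> * (Y' 1 x - \<i> * Y' 2 x) * (q x * q x)"
  let ?z1 = "\<lambda>k x. Y' k x * (q x * cnj (q x)) + Y x * (q' k x * cnj (q x) + q x * cnj (q' k x))"
  let ?z2 = "\<lambda>k x. Y' k x * (q x * q x) + Y x * (q' k x * q x + q x * q' k x)"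
  have ev: "e x = \<eta>' 1 x + \<i> * \<eta>' 2 x" for x by (simp add: \<eta>'_def complex_eq_iff)
  have VV: "?V' = ?V"
  proof (rule ext)
    fix x
    have ev': "cnj (e x) = \<eta>' 1 x - \<i> * \<eta>' 2 x" by (simp add: \<eta>'_def complex_eq_iff)
    have y1: "Y' 1 x + \<i> * Y' 2 x = e x * cnj (g x) + \<eta> x * (cnj (g' 1 x) + \<i> * cnj (g' 2 x))"
      unfolding Y'_def dbar_alg(1) ev[symmetric] ..
    have y2: "Y' 1 x - \<i> * Y' 2 x = cnj (e x) * cnj (g x) + \<eta> x * (cnj (g' 1 x) - \<i> * cnj (g' 2 x))"
      unfolding Y'_def dbar_alg(2) ev'[symmetric] ..
    show "?V' x = ?V x" unfolding y1 y2 g'_def g_def q_def ..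
  qed
  have key: "complex_of_real (\<eta> x) * (dq s j n x * dq s j E x) = ?V' x + (2 * \<i> * dbar ?z1 x + (- \<i>) * (?z2 1 x - \<i> * ?z2 2 x))" for x
  proof -
    have n: "dq s j n x = 2 * \<i> * cnj (g x) * cnj (q x)"
      unfolding n_def q_def g_def dq_def sh_def complex_cnj_divide complex_cnj_scaleR complex_cnj_add complex_cnj_diff complex_cnj_numeral
      by (rule square_dq_alg)
    have E: "dq s j E x = dbar q' x" unfolding q'_def using dbar_dq[of s j x] by simp
    have r: "cnj (q' 1 x) + \<i> * cnj (q' 2 x) = q' 1 x - \<i> * q' 2 x"
      using qcurl[of x] by (simp add: complex_eq_iff)
    have "cnj (q x) * dbar q' x = dbar (\<lambda>k x. q' k x * cnj (q x) + q x * cnj (q' k x)) x - q x * (cnj (q' 1 x) + \<i> * cnj (q' 2 x))"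
      unfolding dbar_def by (simp add: algebra_simps)
    then have kk: "cnj (q x) * dbar q' x = dbar (\<lambda>k x. q' k x * cnj (q x) + q x * cnj (q' k x)) x - q x * (q' 1 x - \<i> * q' 2 x)"
      unfolding r .
    have "complex_of_real (\<eta> x) * (dq s j n x * dq s j E x) = 2 * \<i> * Y x * (cnj (q x) * dbar q' x)"
      unfolding n E Y_def by (simp only: mult_ac)
    also have "\<dots> = ?V' x + (2 * \<i> * dbar ?z1 x + (- \<i>) * (?z2 1 x - \<i> * ?z2 2 x))"
      unfolding kk unfolding dbar_def by (rule conv_alg)
    finally show ?thesis .
  qed
  note cc = C1_cont[OF YC] C1_cont'[OF YC] C1_cont[OF qC] C1_cont'[OF qC]
  have vY': "vanishes_outside_ball (Y' k)" for k by (rule supp_deriv[OF YC vY])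
  have "vanishes_outside_ball (\<lambda>x. norm (Y x) + (norm (Y' 1 x) + norm (Y' 2 x)))" by (intro supp_add(1) supp_map(1) vY vY')
  then obtain r where "\<And>x. norm x > r \<Longrightarrow> norm (Y x) + (norm (Y' 1 x) + norm (Y' 2 x)) = 0" unfolding vanishes_outside_ball_def by blast
  then have r: "Y x = 0" "Y' 1 x = 0" "Y' 2 x = 0" if "norm x > r" for x
    using that by (smt (verit) norm_ge_zero norm_eq_zero)+
  have vv: "vanishes_outside_ball ?V'" "vanishes_outside_ball (\<lambda>x. 2 * \<i> * dbar ?z1 x)" "vanishes_outside_ball (\<lambda>x. (- \<i>) * (?z2 1 x - \<i> * ?z2 2 x))"
    unfolding vanishes_outside_ball_def dbar_def by (intro exI[of _ r], simp add: r)+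
  have cv: "continuous_on UNIV ?V'" "continuous_on UNIV (\<lambda>x. 2 * \<i> * dbar ?z1 x)" "continuous_on UNIV (\<lambda>x. (- \<i>) * (?z2 1 x - \<i> * ?z2 2 x))"
    unfolding dbar_def by (intro continuous_intros cc)+
  have "T1 n s j = I (\<lambda>x. ?V' x + (2 * \<i> * dbar ?z1 x + (- \<i>) * (?z2 1 x - \<i> * ?z2 2 x)))"
    unfolding T1_def by (rule Bochner_Integration.integral_cong[OF refl key])
  also have "\<dots> = I ?V' + I (\<lambda>x. 2 * \<i> * dbar ?z1 x + (- \<i>) * (?z2 1 x - \<i> * ?z2 2 x))"
    by (intro Bochner_Integration.integral_add Bochner_Integration.integrable_add integrable_cc vv cv)
  also have "I (\<lambda>x. 2 * \<i> * dbar ?z1 x + (- \<i>) * (?z2 1 x - \<i> * ?z2 2 x)) = I (\<lambda>x. 2 * \<i> * dbar ?z1 x) + I (\<lambda>x. (- \<i>) * (?z2 1 x - \<i> * ?z2 2 x))"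
    by (intro Bochner_Integration.integral_add integrable_cc vv cv)
  also have "I (\<lambda>x. 2 * \<i> * dbar ?z1 x) = 0"
    unfolding integral_mult_right_zero using I_dbar_zero[OF Z1 vZ1] by (simp only: mult_zero_right)
  also have "I (\<lambda>x. (- \<i>) * (?z2 1 x - \<i> * ?z2 2 x)) = 0"
    unfolding integral_mult_right_zero using I_dh_zero[OF Z2 vZ2] by (simp only: mult_zero_right)
  finally show ?thesis unfolding VV by simp
qed

definition "B1 x = m * norm (e x) * (H x)\<^sup>2"
definition "B2 x = m\<^sup>2 * (norm (e' 1 x) + norm (e' 2 x)) * H x"
definition "B3 x = m ^ 3 * (norm (S' 1 x) + norm (S' 2 x))"
definition "B x = B1 x + B2 x + B3 x"

lemma B_nonneg: "B1 x \<ge> 0" "B2 x \<ge> 0" "B3 x \<ge> 0" "B x \<ge> 0"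
  unfolding B_def B1_def B2_def B3_def using m_nonneg H_nonneg by auto

lemma B_cont: "continuous_on UNIV B" unfolding B_def[abs_def] B1_def B2_def B3_def
  by (intro continuous_intros cts ctc)

lemma B_supp: "vanishes_outside_ball B" unfolding B_def[abs_def] B1_def B2_def B3_def
  by (intro supp_add supp_mult(1)[OF supp_mult(2)] supp_mult(2) supp_map(1) supp_add(1) vs)+

text \<open>After the cubic terms have cancelled, only terms with the gradient e of the cutoff remain.\<close>
lemma convection_density_bound:
  "\<bar>Re ((- (2 * \<i> * (e x * cnj (f x) + \<eta> x * (cnj (f' 1 x) + \<i> * cnj (f' 2 x)))) * (f' 1 x * cnj (f' 1 x)) + \<i> * (cnj (e x) * cnj (f x) + \<eta> x * (cnj (f' 1 x) - \<i> * cnj (f' 2 x))) * (f' 1 x * f' 1 x))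
      + (- (2 * \<i> * (e x * cnj (f x) + \<eta> x * (cnj (f' 1 x) + \<i> * cnj (f' 2 x)))) * (f' 2 x * cnj (f' 2 x)) + \<i> * (cnj (e x) * cnj (f x) + \<eta> x * (cnj (f' 1 x) - \<i> * cnj (f' 2 x))) * (f' 2 x * f' 2 x)))\<bar> \<le> 3 * B x"
  (is "\<bar>Re ?v\<bar> \<le> _")
proof -
  let ?h = "f' 1 x * cnj (f' 1 x) + f' 2 x * cnj (f' 2 x)" and ?k = "f' 1 x * f' 1 x + f' 2 x * f' 2 x"
  have eq: "?v = (- 2 * \<i>) * (e x * cnj (f x)) * ?h + \<i> * (cnj (e x) * cnj (f x)) * ?k
     + 2 * \<i> * complex_of_real (\<eta> x) * (- (cnj (f' 1 x) + \<i> * cnj (f' 2 x)) * ?h + (1/2) * ((cnj (f' 1 x) - \<i> * cnj (f' 2 x)) * ?k))"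
    by (simp add: algebra_simps)
  have R: "Re ?v = Re ((- 2 * \<i>) * (e x * cnj (f x)) * ?h + \<i> * (cnj (e x) * cnj (f x)) * ?k)"
    unfolding eq plus_complex.sel trace_cancel[OF curl] by simp
  have "\<bar>Re ?v\<bar> \<le> norm ((- 2 * \<i>) * (e x * cnj (f x)) * ?h + \<i> * (cnj (e x) * cnj (f x)) * ?k)"
    unfolding R by (rule abs_Re_le_cmod)
  also have "\<dots> \<le> norm ((- 2 * \<i>) * (e x * cnj (f x)) * ?h) + norm (\<i> * (cnj (e x) * cnj (f x)) * ?k)"
    by (rule norm_triangle_ineq)
  also have "\<dots> \<le> 2 * (norm (e x) * m) * (H x)\<^sup>2 + 1 * (norm (e x) * m) * (H x)\<^sup>2"
  proof -
    have hh: "norm (f' 1 x) * norm (f' 1 x) + norm (f' 2 x) * norm (f' 2 x) \<le> (H x)\<^sup>2"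
      unfolding H_def by (simp add: power2_eq_square distrib_left distrib_right)
    have h: "norm ?h \<le> (H x)\<^sup>2"
      by (rule order_trans[OF norm_triangle_ineq]) (use hh in \<open>simp only: norm_mult complex_mod_cnj\<close>)
    have k: "norm ?k \<le> (H x)\<^sup>2"
      by (rule order_trans[OF norm_triangle_ineq]) (use hh in \<open>simp only: norm_mult\<close>)
    have ef: "norm (e x * cnj (f x)) \<le> norm (e x) * m" "norm (cnj (e x) * cnj (f x)) \<le> norm (e x) * m"
      by (rule norm_mult_le; simp add: f_bdd)+
    have "norm (- 2 * \<i> :: complex) \<le> 2" "norm (\<i> :: complex) \<le> 1" by (simp_all add: norm_mult)
    then show ?thesis by (intro add_mono norm_mult_le h k ef)
  qed
  also have "\<dots> = 3 * B1 x" unfolding B1_def by simp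
  also have "\<dots> \<le> 3 * B x" using B_nonneg[of x] unfolding B_def by simp
  finally show ?thesis .
qed

lemma e_psi_bounds: "norm (complex_of_real (\<psi>' j x)) \<le> m" "norm (complex_of_real (\<eta>' j x)) \<le> norm (e x)"
  "norm (e' j x) \<le> norm (e' 1 x) + norm (e' 2 x)" "norm (S x) \<le> norm (e' 1 x) + norm (e' 2 x)"
  "norm (S' j x) \<le> norm (S' 1 x) + norm (S' 2 x)" "\<bar>if j = 1 then Re (e' j x) else Im (e' j x)\<bar> \<le> norm (e' 1 x) + norm (e' 2 x)"
proof -
  show "norm (complex_of_real (\<psi>' j x)) \<le> m" using psi'_bdd by simp
  show "norm (complex_of_real (\<eta>' j x)) \<le> norm (e x)" unfolding \<eta>'_def using abs_Re_le_cmod abs_Im_le_cmod by auto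
  show a: "norm (e' j x) \<le> norm (e' 1 x) + norm (e' 2 x)" using exhaust_2[of j] by auto
  show "norm (S x) \<le> norm (e' 1 x) + norm (e' 2 x)" unfolding dbar_def
    by (rule order_trans[OF norm_triangle_ineq]) (simp add: norm_mult)
  show "norm (S' j x) \<le> norm (S' 1 x) + norm (S' 2 x)" using exhaust_2[of j] by auto
  show "\<bar>if j = 1 then Re (e' j x) else Im (e' j x)\<bar> \<le> norm (e' 1 x) + norm (e' 2 x)"
    by (rule order_trans[OF _ a]) (simp add: abs_Re_le_cmod abs_Im_le_cmod)
qed

text \<open>The constant 35 collects 3 from T1, twice 4 from T2, twice 2 from T3, and, with the factor 2 of \<open>Tn\<close>, 2 + 2 + 1 for each k from T4, T5 and T6. The names v, x, y, w, z, u stand for these terms.\<close>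
lemma convection_sum_le:
  fixes v1 v2 x1 x2 y1 y2 w1 w2 z1 z2 u1 u2 b :: real
  assumes "\<bar>v1 + v2\<bar> \<le> 3 * b" "\<bar>x1\<bar> \<le> 4 * b" "\<bar>x2\<bar> \<le> 4 * b" "\<bar>y1\<bar> \<le> 2 * b" "\<bar>y2\<bar> \<le> 2 * b"
    "\<bar>w1\<bar> \<le> 2 * b" "\<bar>w2\<bar> \<le> 2 * b" "\<bar>z1\<bar> \<le> 2 * b" "\<bar>z2\<bar> \<le> 2 * b" "\<bar>u1\<bar> \<le> 1 * b" "\<bar>u2\<bar> \<le> 1 * b" "b \<ge> 0"
  shows "\<bar>v1 + x1 + y1 + (v2 + x2 + y2) + 2 * (- w1 + z1 + u1) + 2 * (- w2 + z2 + u2)\<bar> \<le> 35 * b"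
proof -
  have a: "v1 + v2 \<le> 3 * b" "x1 \<le> 4 * b" "x2 \<le> 4 * b" 
    "y1 \<le> 2 * b" "y2 \<le> 2 * b" "- w1 \<le> 2 * b" "- w2 \<le> 2 * b" "z1 \<le> 2 * b" "z2 \<le> 2 * b" "u1 \<le> 1 * b" "u2 \<le> 1 * b"
   and c: "- (v1 + v2) \<le> 3 * b" "- x1 \<le> 4 * b" "- x2 \<le> 4 * b" "- y1 \<le> 2 * b" "- y2 \<le> 2 * b" "w1 \<le> 2 * b" "w2 \<le> 2 * b" "- z1 \<le> 2 * b" "- z2 \<le> 2 * b" "- u1 \<le> 1 * b"  "- u2 \<le> 1 * b"
    using assms unfolding abs_le_iff by blast+
  show ?thesis unfolding abs_le_iff
  proof
    show "v1 + x1 + y1 + (v2 + x2 + y2) + 2 * (- w1 + z1 + u1) + 2 * (- w2 + z2 + u2) \<le> 35 * b" using a by argo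
    show "- (v1 + x1 + y1 + (v2 + x2 + y2) + 2 * (- w1 + z1 + u1) + 2 * (- w2 + z2 + u2)) \<le> 35 * b" using c by argo
  qed
qed

text \<open>All convective terms together have a limit as the step tends to zero, since \<open>convection_identity\<close> has removed the differences of E, and the limit carries at least one derivative of the cutoff.\<close>
lemma Tn_limit: "\<exists>\<Lambda>. ((\<lambda>s. Re (Tn n s)) \<longlongrightarrow> \<Lambda>) (at_right 0) \<and> \<bar>\<Lambda>\<bar> \<le> 35 * I B"
proof -
  define V where "V j x = - (2 * \<i> * (e x * cnj (f x) + \<eta> x * (cnj (f' 1 x) + \<i> * cnj (f' 2 x)))) * (f' j x * cnj (f' j x)) + \<i> * (cnj (e x) * cnj (f x) + \<eta> x * (cnj (f' 1 x) - \<i> * cnj (f' 2 x))) * (f' j x * f' j x)" for j x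
  have V_cont: "continuous_on UNIV (V j)" for j unfolding V_def[abs_def] by (intro continuous_intros cts ctc)
  obtain r1 r2 where rr: "\<And>x. norm x > r1 \<Longrightarrow> e x = 0" "\<And>x. norm x > r2 \<Longrightarrow> \<eta> x = 0"
    using v_e eta_v unfolding vanishes_outside_ball_def by blast
  have V_supp: "vanishes_outside_ball (V j)" for j 
    unfolding V_def vanishes_outside_ball_def by (intro exI[of _ "max r1 r2"]) (simp add: rr)
  have half: "loc_unif (\<lambda>s x. (h x + sh s j h x) / 2) h" if h: "continuous_on UNIV (h :: plane \<Rightarrow> complex)" for h j
  proof -
    have "loc_unif (\<lambda>s x. (h x + sh s j h x) * (1/2)) (\<lambda>x. (h x + h x) * (1/2))" by (intro loc_unif_intros continuous_intros h)
    then show ?thesis by simp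
  qed
  have chalf: "continuous_on UNIV (\<lambda>x. (h x + sh s j h x) / 2)" if h: "continuous_on UNIV (h :: plane \<Rightarrow> complex)" for h j s
    by (intro continuous_intros h) simp_all
  have t1: "((\<lambda>s. T1 n s j) \<longlongrightarrow> I (V j)) (at_right 0)" for j
    unfolding convection_identity
  proof (rule I_lim)
    show "unif_vanishes (\<lambda>s x. - (2 * \<i> * (e x * cnj ((f x + sh s j f x) / 2) + complex_of_real (\<eta> x) * (cnj ((f' 1 x + sh s j (f' 1) x) / 2) + \<i> * cnj ((f' 2 x + sh s j (f' 2) x) / 2)))) * (dq s j f x * cnj (dq s j f x)) +
        \<i> * (cnj (e x) * cnj ((f x + sh s j f x) / 2) + complex_of_real (\<eta> x) * (cnj ((f' 1 x + sh s j (f' 1) x) / 2) - \<i> * cnj ((f' 2 x + sh s j (f' 2) x) / 2))) * (dq s j f x * dq s j f x))"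
      unfolding unif_vanishes_def by (intro exI[of _ "max r1 r2"]) (simp add: rr)
    show "continuous_on UNIV (V j)" by (rule V_cont)
    show "continuous_on UNIV (\<lambda>x. - (2 * \<i> * (e x * cnj ((f x + sh s j f x) / 2) + complex_of_real (\<eta> x) * (cnj ((f' 1 x + sh s j (f' 1) x) / 2) + \<i> * cnj ((f' 2 x + sh s j (f' 2) x) / 2)))) * (dq s j f x * cnj (dq s j f x)) +
        \<i> * (cnj (e x) * cnj ((f x + sh s j f x) / 2) + complex_of_real (\<eta> x) * (cnj ((f' 1 x + sh s j (f' 1) x) / 2) - \<i> * cnj ((f' 2 x + sh s j (f' 2) x) / 2))) * (dq s j f x * dq s j f x))" for s
      by (intro chalf continuous_intros cts ctc)
    have l1: "loc_unif (\<lambda>s x. cnj ((f x + sh s j f x) / 2)) (\<lambda>x. cnj (f x))" by (rule loc_unif_cnj[OF half[OF cts(3)]])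
    have l2: "loc_unif (\<lambda>s x. cnj ((f' k x + sh s j (f' k) x) / 2)) (\<lambda>x. cnj (f' k x))" for k by (rule loc_unif_cnj[OF half[OF C1_cont'[OF f_C1]]])
    have l3: "loc_unif (\<lambda>s x. 2 * \<i> * (e x * cnj ((f x + sh s j f x) / 2) + complex_of_real (\<eta> x) * (cnj ((f' 1 x + sh s j (f' 1) x) / 2) + \<i> * cnj ((f' 2 x + sh s j (f' 2) x) / 2))))
        (\<lambda>x. 2 * \<i> * (e x * cnj (f x) + complex_of_real (\<eta> x) * (cnj (f' 1 x) + \<i> * cnj (f' 2 x))))"
      by (intro loc_unif_mult loc_unif_add loc_unif_const l1 l2 continuous_intros cts ctc)
    have l4: "loc_unif (\<lambda>s x. \<i> * (cnj (e x) * cnj ((f x + sh s j f x) / 2) + complex_of_real (\<eta> x) * (cnj ((f' 1 x + sh s j (f' 1) x) / 2) - \<i> * cnj ((f' 2 x + sh s j (f' 2) x) / 2))))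
        (\<lambda>x. \<i> * (cnj (e x) * cnj (f x) + complex_of_real (\<eta> x) * (cnj (f' 1 x) - \<i> * cnj (f' 2 x))))"
      by (intro loc_unif_mult loc_unif_add loc_unif_diff loc_unif_const l1 l2 continuous_intros cts ctc)
    have l5: "loc_unif (\<lambda>s. dq s j f) (f' j)" by (rule loc_unif_dq[OF f_C1])
    show "loc_unif (\<lambda>s x. - (2 * \<i> * (e x * cnj ((f x + sh s j f x) / 2) + complex_of_real (\<eta> x) * (cnj ((f' 1 x + sh s j (f' 1) x) / 2) + \<i> * cnj ((f' 2 x + sh s j (f' 2) x) / 2)))) * (dq s j f x * cnj (dq s j f x)) +
        \<i> * (cnj (e x) * cnj ((f x + sh s j f x) / 2) + complex_of_real (\<eta> x) * (cnj ((f' 1 x + sh s j (f' 1) x) / 2) - \<i> * cnj ((f' 2 x + sh s j (f' 2) x) / 2))) * (dq s j f x * dq s j f x)) (V j)"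
      unfolding V_def
      by (rule loc_unif_add[OF loc_unif_mult[OF loc_unif_uminus[OF l3] loc_unif_mult[OF l5 loc_unif_cnj[OF l5]]] loc_unif_mult[OF l4 loc_unif_mult[OF l5 l5]]])
         (intro continuous_intros cts ctc)+
  qed
  have t2: "((\<lambda>s. T2 n s j) \<longlongrightarrow> I (\<lambda>x. 2 * e x * (n' j x * f' j x))) (at_right 0)" for j
    unfolding T2_def by (rule I_lim) (intro loc_unif_intros loc_unif_dq[OF f_C1] loc_unif_dq[OF n_C1] continuous_intros uv_mult(1) unif_vanishes_const supp_mult(2)[OF v_e] cts ctc)+
  have t3: "((\<lambda>s. T3 n s j) \<longlongrightarrow> I (\<lambda>x. S x * (n' j x * complex_of_real (\<psi>' j x)))) (at_right 0)" for j
    unfolding T3_def by (rule I_lim) (intro loc_unif_intros loc_unif_dq[OF psi_C1'] loc_unif_dq[OF n_C1] continuous_intros uv_mult(1) unif_vanishes_const vs cts ctc)+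
  have t5: "((\<lambda>s. T5 n s k) \<longlongrightarrow> I (\<lambda>x. 2 * e' k x * (n x * f' k x))) (at_right 0)" for k
    unfolding T5_def by (rule I_lim) (intro loc_unif_intros loc_unif_dq[OF f_C1] continuous_intros uv_mult(1) unif_vanishes_const supp_mult(2)[OF v_e'] cts ctc)+
  have t6: "((\<lambda>s. T6 n s k) \<longlongrightarrow> I (\<lambda>x. S' k x * (n x * complex_of_real (\<psi>' k x)))) (at_right 0)" for k
    unfolding T6_def by (rule I_lim) (intro loc_unif_intros loc_unif_dq[OF psi_C1'] continuous_intros uv_mult(1) unif_vanishes_const vs cts ctc)+
  define W where "W k x = complex_of_real (if k = 1 then Re (e' k x) else Im (e' k x)) * n x + complex_of_real (\<eta>' k x) * n' k x" for k x
  have t4: "((\<lambda>s. T4 n s k) \<longlongrightarrow> - I (\<lambda>x. E x * W k x)) (at_right 0)" for k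
  proof -
    note C = C1_mult[OF C1_of_real[OF eta'_C1[of k]] n_C1]
    have vC: "vanishes_outside_ball (\<lambda>x. complex_of_real (\<eta>' k x) * n x)" by (intro supp vs)
    have luw: "loc_unif (\<lambda>s. dq (-s) k (\<lambda>x. complex_of_real (\<eta>' k x) * n x)) (W k)"
      using loc_unif_dq(2)[OF C, of k] unfolding W_def .
    have cW: "continuous_on UNIV (W k)" using C1_cont'[OF C, of k] unfolding W_def .
    have uvm: "unif_vanishes (\<lambda>s. dq (-s) k (\<lambda>x. complex_of_real (\<eta>' k x) * n x))"
      using uv_dq[OF vC, of k] unfolding unif_vanishes_def by (metis atLeastAtMost_iff minus_le_iff neg_le_iff_le add.inverse_inverse)
    have "((\<lambda>s. I (\<lambda>x. E x * dq (-s) k (\<lambda>x. complex_of_real (\<eta>' k x) * n x) x)) \<longlongrightarrow> I (\<lambda>x. E x * W k x)) (at_right 0)"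
      by (rule I_lim) (intro loc_unif_intros luw uv_mult(2)[OF uvm] continuous_intros cts ctc cW)+
    moreover have "T4 n s k = - I (\<lambda>x. E x * dq (-s) k (\<lambda>x. complex_of_real (\<eta>' k x) * n x) x)" for s
    proof -
      have "T4 n s k = I (\<lambda>x. dq s k E x * (complex_of_real (\<eta>' k x) * n x))"
        unfolding T4_def by (rule Bochner_Integration.integral_cong[OF refl]) (simp only: mult_ac)
      also have "\<dots> = - I (\<lambda>x. E x * dq (-s) k (\<lambda>x. complex_of_real (\<eta>' k x) * n x) x)"
        by (rule I_parts_back[OF cts(1) C1_cont[OF C] disjI2[OF vC]])
      finally show ?thesis .
    qed
    ultimately show ?thesis by (simp only: tendsto_minus)
  qed
  let ?L = "I (V 1) + I (\<lambda>x. 2 * e x * (n' 1 x * f' 1 x)) + I (\<lambda>x. S x * (n' 1 x * complex_of_real (\<psi>' 1 x)))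
     + (I (V 2) + I (\<lambda>x. 2 * e x * (n' 2 x * f' 2 x)) + I (\<lambda>x. S x * (n' 2 x * complex_of_real (\<psi>' 2 x))))
     + 2 * (- I (\<lambda>x. E x * W 1 x) + I (\<lambda>x. 2 * e' 1 x * (n x * f' 1 x)) + I (\<lambda>x. S' 1 x * (n x * complex_of_real (\<psi>' 1 x))))
     + 2 * (- I (\<lambda>x. E x * W 2 x) + I (\<lambda>x. 2 * e' 2 x * (n x * f' 2 x)) + I (\<lambda>x. S' 2 x * (n x * complex_of_real (\<psi>' 2 x))))"
  have lim: "((\<lambda>s. Tn n s) \<longlongrightarrow> ?L) (at_right 0)"
    unfolding Tn_def by (intro tendsto_add tendsto_mult tendsto_const t1 t2 t3 t4 t5 t6)
  have b: "norm (I g) \<le> c * I B" if "continuous_on UNIV g" "vanishes_outside_ball g" "\<And>x. norm (g x) \<le> c * B x" for g :: "plane \<Rightarrow> complex" and c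
  proof -
    have "norm (I g) \<le> I (\<lambda>x. c * B x)"
      by (rule norm_I_le) (intro that continuous_intros B_cont supp_mult(2)[OF B_supp])+
    then show ?thesis by simp
  qed
  note Bn = B_nonneg
  have b1: "\<bar>Re (I (V 1) + I (V 2))\<bar> \<le> 3 * I B"
  proof -
    have "I (V 1) + I (V 2) = I (\<lambda>x. V 1 x + V 2 x)"
      by (rule Bochner_Integration.integral_add[symmetric]) (intro integrable_cc V_cont V_supp)+
    moreover have "Re (I (\<lambda>x. V 1 x + V 2 x)) = I (\<lambda>x. Re (V 1 x + V 2 x))"
      by (rule Re_I) (intro continuous_intros V_cont supp_add V_supp)+
    moreover have "norm (I (\<lambda>x. Re (V 1 x + V 2 x))) \<le> I (\<lambda>x. 3 * B x)"
    proof (rule norm_I_le)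
      show "norm (Re (V 1 x + V 2 x)) \<le> 3 * B x" for x
        using convection_density_bound[of x] unfolding V_def real_norm_def .
    qed (intro continuous_intros V_cont supp_map(2) supp_add V_supp B_cont supp_mult(2)[OF B_supp])+
    ultimately show ?thesis by simp
  qed
  have b2: "norm (I (\<lambda>x. 2 * e x * (n' j x * f' j x))) \<le> 4 * I B" for j
  proof (rule b)
    fix x
    have "norm (2 * e x * (n' j x * f' j x)) \<le> (2 * norm (e x)) * ((2 * m * H x) * H x)"
      by (intro norm_mult_le n'_le f'_le_H) auto
    also have "\<dots> = 4 * B1 x" unfolding B1_def by (simp add: power2_eq_square)
    also have "\<dots> \<le> 4 * B x" using Bn[of x] unfolding B_def by simp
    finally show "norm (2 * e x * (n' j x * f' j x)) \<le> 4 * B x" .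
  qed (intro continuous_intros cts ctc supp_mult(1) supp_mult(2)[OF v_e])+
  have b3: "norm (I (\<lambda>x. S x * (n' j x * complex_of_real (\<psi>' j x)))) \<le> 2 * I B" for j
  proof (rule b)
    fix x
    have "norm (S x * (n' j x * complex_of_real (\<psi>' j x))) \<le> (norm (e' 1 x) + norm (e' 2 x)) * ((2 * m * H x) * m)"
      by (intro norm_mult_le n'_le e_psi_bounds)
    also have "\<dots> = 2 * B2 x" unfolding B2_def by (simp add: power2_eq_square)
    also have "\<dots> \<le> 2 * B x" using Bn[of x] unfolding B_def by simp
    finally show "norm (S x * (n' j x * complex_of_real (\<psi>' j x))) \<le> 2 * B x" .
  qed (intro continuous_intros cts ctc supp_mult(1) vs)+
  have cW: "continuous_on UNIV (W k)" for k
    using C1_cont'[OF C1_mult[OF C1_of_real[OF eta'_C1[of k]] n_C1], of k] unfolding W_def .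
  have vW: "vanishes_outside_ball (W k)" for k
    using supp_deriv[OF C1_mult[OF C1_of_real[OF eta'_C1[of k]] n_C1] supp_mult(1)[OF supp_map(6)[OF v_eta'[of k]]], of k] unfolding W_def .
  have b4: "norm (I (\<lambda>x. E x * W k x)) \<le> 2 * I B" for k
  proof (rule b)
    fix x
    have "norm (W k x) \<le> (norm (e' 1 x) + norm (e' 2 x)) * (m * m) + norm (e x) * (2 * m * H x)"
      unfolding W_def by (rule order_trans[OF norm_triangle_ineq], intro add_mono norm_mult_le n_le n'_le e_psi_bounds)
        (use e_psi_bounds(6)[of k x] in simp)
    then have "norm (E x * W k x) \<le> H x * ((norm (e' 1 x) + norm (e' 2 x)) * (m * m) + norm (e x) * (2 * m * H x))"
      by (intro norm_mult_le E_le_H)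
    also have "\<dots> = B2 x + 2 * B1 x" unfolding B2_def B1_def by (simp add: power2_eq_square algebra_simps)
    also have "\<dots> \<le> 2 * B x" using Bn[of x] unfolding B_def by simp
    finally show "norm (E x * W k x) \<le> 2 * B x" .
  qed (intro continuous_intros cts ctc cW supp_mult(2) vW)+
  have b5: "norm (I (\<lambda>x. 2 * e' k x * (n x * f' k x))) \<le> 2 * I B" for k
  proof (rule b)
    fix x
    have "norm (2 * e' k x * (n x * f' k x)) \<le> (2 * (norm (e' 1 x) + norm (e' 2 x))) * ((m * m) * H x)"
      by (intro norm_mult_le n_le f'_le_H e_psi_bounds) simp
    also have "\<dots> = 2 * B2 x" unfolding B2_def by (simp add: power2_eq_square)
    also have "\<dots> \<le> 2 * B x" using Bn[of x] unfolding B_def by simp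
    finally show "norm (2 * e' k x * (n x * f' k x)) \<le> 2 * B x" .
  qed (intro continuous_intros cts ctc supp_mult(1) supp_mult(2)[OF v_e'])+
  have b6: "norm (I (\<lambda>x. S' k x * (n x * complex_of_real (\<psi>' k x)))) \<le> 1 * I B" for k
  proof (rule b)
    fix x
    have "norm (S' k x * (n x * complex_of_real (\<psi>' k x))) \<le> (norm (S' 1 x) + norm (S' 2 x)) * ((m * m) * m)"
      by (intro norm_mult_le n_le e_psi_bounds)
    also have "\<dots> = B3 x" unfolding B3_def by (simp add: power3_eq_cube)
    also have "\<dots> \<le> 1 * B x" using Bn[of x] unfolding B_def by simp
    finally show "norm (S' k x * (n x * complex_of_real (\<psi>' k x))) \<le> 1 * B x" .
  qed (intro continuous_intros cts ctc supp_mult(1) vs)+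
  have r: "\<bar>Re z\<bar> \<le> c" if "norm z \<le> c" for z c
    by (rule order_trans[OF abs_Re_le_cmod that])
  have IB: "I B \<ge> 0" by (rule integral_nonneg_AE) (simp add: B_nonneg)
  have re2: "Re (2 * z) = 2 * Re z" for z by simp
  have "\<bar>Re ?L\<bar> \<le> 35 * I B"
    unfolding plus_complex.sel re2 uminus_complex.sel
    by (rule convection_sum_le[OF b1[unfolded plus_complex.sel] r[OF b2] r[OF b2] r[OF b3] r[OF b3] r[OF b4] r[OF b4]
      r[OF b5] r[OF b5] r[OF b6] r[OF b6] IB])
  then show ?thesis using tendsto_Re[OF lim] by blast
qed

text \<open>Monotonicity of the stress gives the mean of the viscosities at x and at the translated point; the latter is bounded below by c0 only.\<close>
lemma T1_lower: "s > 0 \<Longrightarrow> Re (T1 p s 1 + T1 p s 2) \<ge> I (\<lambda>x. \<eta> x * (M x * D2 s x)) / 2 + c0 / 2 * I (\<lambda>x. \<eta> x * D2 s x)"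
proof -
  assume s: "s > 0"
  have one: "Re (dq s j p x * dq s j E x) \<ge> (M x / 2 + c0 / 2) * (norm (dq s j E x))\<^sup>2" for j x
  proof -
    let ?y = "x + s *\<^sub>R axis j 1"
    have a: "dq s j p x * dq s j E x = (1/s\<^sup>2) *\<^sub>R ((p ?y - p x) * (E ?y - E x))"
      unfolding dq_def sh_def by (simp add: power2_eq_square)
    have b: "(norm (dq s j E x))\<^sup>2 = (1/s\<^sup>2) * (norm (E ?y - E x))\<^sup>2"
      unfolding dq_def sh_def norm_scaleR power_mult_distrib by (simp add: power_divide)
    have "(M x / 2 + c0 / 2) * (norm (E ?y - E x))\<^sup>2 \<le> (M ?y + M x) / 2 * (norm (E ?y - E x))\<^sup>2"
      using c0(2)[of ?y] by (intro mult_right_mono) auto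
    also have "\<dots> \<le> Re ((p ?y - p x) * (E ?y - E x))" using mono[of ?y x] unfolding p_def .
    finally have "(1/s\<^sup>2) * ((M x / 2 + c0 / 2) * (norm (E ?y - E x))\<^sup>2) \<le> (1/s\<^sup>2) * Re ((p ?y - p x) * (E ?y - E x))"
      by (rule mult_left_mono) simp
    then show ?thesis unfolding a b scaleR_complex.sel by (subst mult.left_commute)
  qed
  have v1: "vanishes_outside_ball (\<lambda>x. \<eta> x * (M x * D2 s x) / 2 + c0 / 2 * (\<eta> x * D2 s x))"
    by (intro supp_add(1) supp_map(9) supp_mult(1)[OF eta_v] supp_mult(2)[OF supp_mult(1)[OF eta_v]])
  have c1: "continuous_on UNIV (\<lambda>x. \<eta> x * (M x * D2 s x) / 2 + c0 / 2 * (\<eta> x * D2 s x))"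
    by (intro continuous_intros cts ctc D2_cont) simp
  have c2: "continuous_on UNIV (\<lambda>x. Re (complex_of_real (\<eta> x) * (dq s 1 p x * dq s 1 E x) + complex_of_real (\<eta> x) * (dq s 2 p x * dq s 2 E x)))"
    by (intro continuous_intros cts ctc)
  have v2: "vanishes_outside_ball (\<lambda>x. Re (complex_of_real (\<eta> x) * (dq s 1 p x * dq s 1 E x) + complex_of_real (\<eta> x) * (dq s 2 p x * dq s 2 E x)))"
    by (intro supp_map(2) supp_add(1) supp_mult(1) supp_map(6) eta_v)
  have "Re (T1 p s 1 + T1 p s 2) = Re (I (\<lambda>x. complex_of_real (\<eta> x) * (dq s 1 p x * dq s 1 E x) + complex_of_real (\<eta> x) * (dq s 2 p x * dq s 2 E x)))"
    unfolding T1_def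
    by (rule arg_cong[where f=Re], rule Bochner_Integration.integral_add[symmetric]) (intro integrable_cc continuous_intros cts ctc supp vs)+
  also have "\<dots> = I (\<lambda>x. Re (complex_of_real (\<eta> x) * (dq s 1 p x * dq s 1 E x) + complex_of_real (\<eta> x) * (dq s 2 p x * dq s 2 E x)))"
    by (rule Re_I) (intro continuous_intros cts ctc supp vs)+
  also have "\<dots> \<ge> I (\<lambda>x. \<eta> x * (M x * D2 s x) / 2 + c0 / 2 * (\<eta> x * D2 s x))"
  proof (rule I_mono)
    fix x
    have "Re (complex_of_real (\<eta> x) * (dq s 1 p x * dq s 1 E x) + complex_of_real (\<eta> x) * (dq s 2 p x * dq s 2 E x))
       = \<eta> x * (Re (dq s 1 p x * dq s 1 E x) + Re (dq s 2 p x * dq s 2 E x))" by (simp add: algebra_simps)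
    also have "\<dots> \<ge> \<eta> x * ((M x / 2 + c0 / 2) * (norm (dq s 1 E x))\<^sup>2 + (M x / 2 + c0 / 2) * (norm (dq s 2 E x))\<^sup>2)"
      by (intro mult_left_mono add_mono one eta_nonneg)
    finally show "\<eta> x * (M x * D2 s x) / 2 + c0 / 2 * (\<eta> x * D2 s x) \<le> Re (complex_of_real (\<eta> x) * (dq s 1 p x * dq s 1 E x) + complex_of_real (\<eta> x) * (dq s 2 p x * dq s 2 E x))"
      unfolding D2_def by (simp add: algebra_simps add_divide_distrib)
  qed (fact c1 c2 v1 v2)+
  also have "I (\<lambda>x. \<eta> x * (M x * D2 s x) / 2 + c0 / 2 * (\<eta> x * D2 s x)) = I (\<lambda>x. \<eta> x * (M x * D2 s x) / 2) + I (\<lambda>x. c0 / 2 * (\<eta> x * D2 s x))"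
    by (rule Bochner_Integration.integral_add) 
       (intro integrable_cc continuous_intros cts ctc D2_cont supp_map(9) supp_mult(1)[OF eta_v] supp_mult(2)[OF supp_mult(1)[OF eta_v]] | simp)+
  also have "\<dots> = I (\<lambda>x. \<eta> x * (M x * D2 s x)) / 2 + c0 / 2 * I (\<lambda>x. \<eta> x * D2 s x)"
    by simp
  finally show ?thesis .
qed

text \<open>The identity \<open>main_identity\<close> with the lower bound for T1 and norms on the right. The last term is the price for u being merely C1.\<close>
lemma second_order_inequality:
  assumes \<epsilon>: "\<epsilon> > 0"
  shows "\<forall>\<^sub>F s in at_right 0. I (\<lambda>x. \<eta> x * (M x * D2 s x)) / 2 + c0 / 2 * I (\<lambda>x. \<eta> x * D2 s x)
     \<le> 6 * I (\<lambda>x. norm (e x) * (norm (p x) * D s x)) + I (\<lambda>x. (norm (e' 1 x) + norm (e' 2 x)) * (norm (E x) * norm (p x)))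
       + m * I (\<lambda>x. (norm (S' 1 x) + norm (S' 2 x)) * norm (p x)) + 35 * I B + \<epsilon> * \<kappa> w s"
proof -
  obtain Z where Z: "small_o (\<kappa> w) Z" and id: "\<And>s. Re (T1 p s 1 + T1 p s 2) = Re (J s) - 2 * Re (T4 p s 1 + T4 p s 2) - Re (cA + cC) + Re (Tn n s) + Re (Z s)"
    using main_identity by blast
  obtain \<Lambda> where L: "((\<lambda>s. Re (Tn n s)) \<longlongrightarrow> \<Lambda>) (at_right 0)" "\<bar>\<Lambda>\<bar> \<le> 35 * I B" using Tn_limit by blast
  have "\<forall>\<^sub>F s in at_right 0. dist (Re (Tn n s)) \<Lambda> < \<epsilon> / 2" using tendstoD[OF L(1)] \<epsilon> half_gt_zero by blast
  moreover have "\<forall>\<^sub>F s in at_right 0. norm (Z s) \<le> \<epsilon> / 2 * \<kappa> w s" using Z \<epsilon> half_gt_zero unfolding small_o_def by blast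
  moreover have "\<forall>\<^sub>F s in at_right (0::real). s > 0" by (simp add: eventually_at_right_less)
  ultimately show ?thesis
  proof eventually_elim
    case (elim s)
    let ?X = "I (\<lambda>x. norm (e x) * (norm (p x) * D s x))"
    have vX: "vanishes_outside_ball (\<lambda>x. norm (e x) * (norm (p x) * D s x))" by (intro supp_mult(1) supp_map(1) vs)
    have cX: "continuous_on UNIV (\<lambda>x. norm (e x) * (norm (p x) * D s x))" by (intro continuous_intros cts ctc)
    have j: "norm (J s) \<le> 2 * ?X"
    proof -
      have "norm (J s) \<le> I (\<lambda>x. 2 * (norm (e x) * (norm (p x) * D s x)))"
        unfolding J_def
      proof (rule norm_I_le)
        fix x
        have "norm (dq s 1 E x - \<i> * dq s 2 E x) \<le> D s x"
          unfolding D_def by (rule order_trans[OF norm_triangle_ineq4]) (simp add: norm_mult)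
        then have "norm (2 * e x * p x * (dq s 1 E x - \<i> * dq s 2 E x)) \<le> 2 * norm (e x) * norm (p x) * D s x"
          by (intro norm_mult_le) auto
        then show "norm (2 * e x * p x * (dq s 1 E x - \<i> * dq s 2 E x)) \<le> 2 * (norm (e x) * (norm (p x) * D s x))"
          by (simp add: algebra_simps)
      qed (intro continuous_intros cts ctc supp_mult(1) supp_mult(2)[OF v_e] supp_mult(2)[OF vX])+
      then show ?thesis by simp
    qed
    have t4: "norm (T4 p s k) \<le> ?X" for k
      unfolding T4_def
      by (rule norm_I_le) (intro continuous_intros cts ctc supp vs vX cX norm_mult_le e_psi_bounds order_refl dq_le_D)+
    have a: "norm cA \<le> I (\<lambda>x. (norm (e' 1 x) + norm (e' 2 x)) * (norm (E x) * norm (p x)))"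
      unfolding cA_def
    proof (rule norm_I_le)
      fix x
      have "norm (dh e' x) \<le> norm (e' 1 x) + norm (e' 2 x)"
        unfolding dh_def by (rule order_trans[OF norm_triangle_ineq4]) (simp add: norm_mult)
      then show "norm (dh e' x * (E x * p x)) \<le> (norm (e' 1 x) + norm (e' 2 x)) * (norm (E x) * norm (p x))"
        by (intro norm_mult_le) auto
    qed (intro continuous_intros cts ctc dhs supp_mult(1) supp_add(1) supp_map(1) vs vdh)+
    have c: "norm cC \<le> m * I (\<lambda>x. (norm (S' 1 x) + norm (S' 2 x)) * norm (p x))"
    proof -
      have "norm cC \<le> I (\<lambda>x. (norm (S' 1 x) * m + norm (S' 2 x) * m) * norm (p x))"
        unfolding cC_def
      proof (rule norm_I_le)
        fix x
        have "norm (S' 1 x * complex_of_real (\<psi>' 1 x) + S' 2 x * complex_of_real (\<psi>' 2 x)) \<le> norm (S' 1 x) * m + norm (S' 2 x) * m"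
          by (rule order_trans[OF norm_triangle_ineq], intro add_mono norm_mult_le e_psi_bounds order_refl)
        then show "norm ((S' 1 x * complex_of_real (\<psi>' 1 x) + S' 2 x * complex_of_real (\<psi>' 2 x)) * p x) \<le> (norm (S' 1 x) * m + norm (S' 2 x) * m) * norm (p x)"
          by (rule norm_mult_le) simp
      qed (intro continuous_intros cts ctc supp_mult(1) supp_add(1) supp_map(1) vs)+
      also have "\<dots> = m * I (\<lambda>x. (norm (S' 1 x) + norm (S' 2 x)) * norm (p x))"
        unfolding integral_mult_right_zero[symmetric] by (simp add: algebra_simps)
      finally show ?thesis .
    qed
    have r: "\<bar>Re z\<bar> \<le> c" if "norm z \<le> c" for z c using that abs_Re_le_cmod order_trans by blast
    have k: "\<epsilon> / 2 \<le> \<epsilon> / 2 * \<kappa> w s" using kap[of s] \<epsilon> by simp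
    have l: "\<bar>Re (Tn n s)\<bar> \<le> 35 * I B + \<epsilon> / 2" using elim(1) L(2) unfolding dist_real_def by linarith
    have "Re (T1 p s 1 + T1 p s 2) \<le> 2 * ?X + 4 * ?X + I (\<lambda>x. (norm (e' 1 x) + norm (e' 2 x)) * (norm (E x) * norm (p x))) + m * I (\<lambda>x. (norm (S' 1 x) + norm (S' 2 x)) * norm (p x)) + (35 * I B + \<epsilon> / 2) + \<epsilon> / 2 * \<kappa> w s"
      unfolding id using r[OF j] r[OF t4[of 1]] r[OF t4[of 2]] r[OF a] r[OF c] l r[OF elim(2)]
      unfolding plus_complex.sel by argo
    then have "Re (T1 p s 1 + T1 p s 2) \<le> 6 * ?X + I (\<lambda>x. (norm (e' 1 x) + norm (e' 2 x)) * (norm (E x) * norm (p x))) + m * I (\<lambda>x. (norm (S' 1 x) + norm (S' 2 x)) * norm (p x)) + 35 * I B + (\<epsilon> / 2 * \<kappa> w s + \<epsilon> / 2 * \<kappa> w s)"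
      using k by argo
    then show ?case using T1_lower[OF elim(3)] by (simp add: field_simps)
  qed
qed

end

section \<open>Chain rule and coordinates\<close>

lemma C1_scaleR:
  fixes a :: "plane \<Rightarrow> real" and g :: "plane \<Rightarrow> 'b::real_normed_vector"
  assumes a: "C1 a a'" and g: "C1 g g'"
  shows "C1 (\<lambda>x. a x *\<^sub>R g x) (\<lambda>j x. a' j x *\<^sub>R g x + a x *\<^sub>R g' j x)"
  unfolding C1_def
proof (intro conjI allI)
  fix x
  show "((\<lambda>x. a x *\<^sub>R g x) has_derivative (\<lambda>v. v $ 1 *\<^sub>R (a' 1 x *\<^sub>R g x + a x *\<^sub>R g' 1 x) + v $ 2 *\<^sub>R (a' 2 x *\<^sub>R g x + a x *\<^sub>R g' 2 x))) (at x)"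
    using has_derivative_scaleR[OF a[unfolded C1_def, THEN conjunct1, rule_format, of x] g[unfolded C1_def, THEN conjunct1, rule_format, of x]]
    by (simp add: algebra_simps)
qed (intro continuous_intros C1_cont'[OF a] C1_cont'[OF g] C1_cont[OF a] C1_cont[OF g])+

lemma C1_linear:
  fixes g :: "plane \<Rightarrow> 'b::real_normed_vector"
  assumes "bounded_linear g"
  shows "C1 g (\<lambda>j x. g (axis j 1))"
  unfolding C1_def
proof (intro conjI allI)
  fix x
  interpret bounded_linear g by fact
  have "g v = v $ 1 *\<^sub>R g (axis 1 1) + v $ 2 *\<^sub>R g (axis 2 1)" for v
  proof -
    have "v = v $ 1 *\<^sub>R axis 1 1 + v $ 2 *\<^sub>R axis 2 1" by (simp add: vec_eq_iff forall_2 axis_def)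
    then have "g v = g (v $ 1 *\<^sub>R axis 1 1 + v $ 2 *\<^sub>R axis 2 1)" by (rule arg_cong)
    then show ?thesis by (simp only: add scaleR)
  qed
  then have "g = (\<lambda>v. v $ 1 *\<^sub>R g (axis 1 1) + v $ 2 *\<^sub>R g (axis 2 1))" by (rule ext)
  with bounded_linear_imp_has_derivative[OF assms, of "at x"]
  show "(g has_derivative (\<lambda>v. v $ 1 *\<^sub>R g (axis 1 1) + v $ 2 *\<^sub>R g (axis 2 1))) (at x)" by metis
qed (intro continuous_intros)

lemmas C1_cpl = C1_linear[OF cpl_linear]

lemma C1_coord: "C1 (\<lambda>x. x $ k) (\<lambda>j x. if j = k then 1 else 0)"
  by (rule C1_cong[OF C1_linear[OF bounded_linear_vec_nth]]) (simp add: axis_def)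

lemma C1_chain:
  assumes g: "C1 g g'" and \<phi>: "\<And>x. (\<phi> has_real_derivative \<phi>' (g x)) (at (g x))" and c: "continuous_on UNIV (\<lambda>x. \<phi>' (g x))"
  shows "C1 (\<lambda>x. \<phi> (g x)) (\<lambda>j x. \<phi>' (g x) * g' j x)"
  unfolding C1_def
proof (intro conjI allI)
  fix x
  show "((\<lambda>x. \<phi> (g x)) has_derivative (\<lambda>v. v $ 1 *\<^sub>R (\<phi>' (g x) * g' 1 x) + v $ 2 *\<^sub>R (\<phi>' (g x) * g' 2 x))) (at x)"
    using has_derivative_compose[OF g[unfolded C1_def, THEN conjunct1, rule_format, of x] \<phi>[unfolded has_field_derivative_def]]
    by (simp add: algebra_simps)
qed (intro continuous_intros c C1_cont'[OF g])+

section \<open>Radial cutoffs\<close>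

text \<open>For a radial \<open>\<eta>\<close> with \<open>\<partial>_j \<eta> = - x_j A\<close>, where A and B have the same form with B and G in place of A, these are the complex gradient of \<open>\<eta>\<close>, its first and second partial derivatives, \<open>dbar (rad_e' A B)\<close>, and the partial derivatives of the latter. Iterating the ansatz avoids any explicit formula for third derivatives.\<close>
definition "rad_e A x = - (A x *\<^sub>R cpl x)"
definition "rad_e' A B j x = (x $ j * B x) *\<^sub>R cpl x - A x *\<^sub>R cpl (axis j 1)"
definition "rad_e'' B G k j x = B x *\<^sub>R (x $ j *\<^sub>R cpl (axis k 1) + x $ k *\<^sub>R cpl (axis j 1) + (if j = k then cpl x else 0)) - (x $ k * x $ j * G x) *\<^sub>R cpl x"
definition "rad_S B x = B x *\<^sub>R (cpl x * cpl x)"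
definition "rad_S' B G k x = (2 * B x) *\<^sub>R (cpl x * cpl (axis k 1)) - (x $ k * G x) *\<^sub>R (cpl x * cpl x)"

lemma rad_C1_e:
  assumes A: "C1 A (\<lambda>j x. - (x $ j * B x))"
  shows "C1 (rad_e A) (rad_e' A B)"
  unfolding rad_e_def[abs_def]
  by (rule C1_cong[OF C1_bl[OF C1_scaleR[OF A C1_cpl] bounded_linear_minus[OF bounded_linear_ident]]]) (simp add: rad_e'_def)

lemma rad_C2:
  assumes \<eta>: "C1 \<eta> (\<lambda>j x. - (x $ j * A x))" and A: "C1 A (\<lambda>j x. - (x $ j * B x))"
  shows "C2 \<eta> (rad_e A) (rad_e' A B)"
  unfolding C2_def
proof
  show "C1 \<eta> (\<lambda>j x. if j = 1 then Re (rad_e A x) else Im (rad_e A x))"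
  proof (rule C1_cong[OF \<eta>])
    fix j :: 2 and x :: plane
    show "- (x $ j * A x) = (if j = 1 then Re (rad_e A x) else Im (rad_e A x))"
      using exhaust_2[of j] by (auto simp: rad_e_def cpl_def)
  qed
qed (rule rad_C1_e[OF A])

lemma rad_dbar: "dbar (rad_e' A B) = rad_S B"
  by (rule ext) (simp add: dbar_def rad_e'_def rad_S_def cpl_def axis_def complex_eq_iff algebra_simps)

lemma rad_curl: "Im (rad_e' A B 1 x) = Re (rad_e' A B 2 x)"
  by (simp add: rad_e'_def cpl_def axis_def)

lemma rad_C1_e':
  assumes A: "C1 A (\<lambda>j x. - (x $ j * B x))" and B: "C1 B (\<lambda>j x. - (x $ j * G x))"
  shows "C1 (rad_e' A B k) (rad_e'' B G k)"
  unfolding rad_e'_def[abs_def]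
proof (rule C1_cong[OF C1_diff[OF C1_scaleR[OF C1_mult[OF C1_coord B] C1_cpl] C1_bl[OF A bounded_linear_scaleR_left]]])
  fix j :: 2 and x :: plane
  show "((if j = k then 1 else 0) * B x + x $ k * - (x $ j * G x)) *\<^sub>R cpl x + (x $ k * B x) *\<^sub>R cpl (axis j 1) - - (x $ j * B x) *\<^sub>R cpl (axis k 1) = rad_e'' B G k j x"
    unfolding rad_e''_def by (simp add: algebra_simps)
qed

lemma rad_C1_S:
  assumes B: "C1 B (\<lambda>j x. - (x $ j * G x))"
  shows "C1 (rad_S B) (rad_S' B G)"
  unfolding rad_S_def[abs_def]
proof (rule C1_cong[OF C1_scaleR[OF B C1_mult[OF C1_cpl C1_cpl]]])
  fix j :: 2 and x :: plane
  show "- (x $ j * G x) *\<^sub>R (cpl x * cpl x) + B x *\<^sub>R (cpl (axis j 1) * cpl x + cpl x * cpl (axis j 1)) = rad_S' B G j x"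
    unfolding rad_S'_def by (simp add: scaleR_conv_of_real algebra_simps)
qed

lemma rad_dbar'': "dbar (rad_e'' B G k) x = rad_S' B G k x"
proof (cases "k = 1")
  case True
  then show ?thesis
    by (simp add: dbar_def rad_e''_def rad_S'_def cpl_def axis_def complex_eq_iff algebra_simps)
next
  case False
  then have "k = 2" using exhaust_2[of k] by auto
  then show ?thesis
    by (simp add: dbar_def rad_e''_def rad_S'_def cpl_def axis_def complex_eq_iff algebra_simps)
qed

section \<open>The logarithmic cutoff\<close>

text \<open>The logarithmic profile is chosen so that the cutoff \<open>lam\<close> has Dirichlet energy of order \<open>1/L\<close> in the plane, while the powers of
\<open>rho\<close> record the gain from derivatives. The family \<open>q L a b\<close> is closed under differentiation up to factors \<open>x_j\<close>.\<close>
definition rho :: "plane \<Rightarrow> real" where "rho x = 1 / sqrt (1 + x \<bullet> x)"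
definition lam :: "real \<Rightarrow> plane \<Rightarrow> real" where "lam L x = max 0 (1 - ln (1 + x \<bullet> x) / L)"
definition q :: "real \<Rightarrow> nat \<Rightarrow> nat \<Rightarrow> plane \<Rightarrow> real" where "q L a b x = lam L x ^ a * rho x ^ b"

lemma rho_pos: "rho x > 0" and rho_le: "rho x \<le> 1" and rho_sq: "rho x ^ 2 * (1 + x \<bullet> x) = 1"
proof -
  have p: "1 + x \<bullet> x \<ge> 1" by simp
  then have s: "sqrt (1 + x \<bullet> x) \<ge> 1" by (simp only: real_sqrt_ge_one)
  have "1 + x \<bullet> x > 0" using p by linarith
  then show "rho x > 0" unfolding rho_def by simp
  have "sqrt (1 + x \<bullet> x) * 1 > 0" using s by linarith
  from divide_left_mono[OF s _ this, of 1] show "rho x \<le> 1" unfolding rho_def by simp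
  have "1 + x \<bullet> x \<ge> 0" "1 + x \<bullet> x \<noteq> 0" using p by linarith+
  then show "rho x ^ 2 * (1 + x \<bullet> x) = 1" unfolding rho_def by (simp add: power_divide)
qed

lemma norm_rho: "norm x * rho x \<le> 1"
proof -
  have "(norm x * rho x)\<^sup>2 = rho x ^ 2 * (1 + x \<bullet> x) - rho x ^ 2"
    by (simp add: power_mult_distrib power2_norm_eq_inner algebra_simps)
  also have "\<dots> \<le> 1\<^sup>2" unfolding rho_sq by simp
  finally show ?thesis by (rule power2_le_imp_le) simp
qed

lemma lam_nonneg: "lam L x \<ge> 0" unfolding lam_def by simp
lemma lam_le: "L > 0 \<Longrightarrow> lam L x \<le> 1" unfolding lam_def by simp

lemma q_nonneg: "q L a b x \<ge> 0" unfolding q_def using lam_nonneg rho_pos[of x] by (simp add: less_imp_le)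

lemma q_mono:
  assumes "L > 0" "a' \<le> a" "b' \<le> b"
  shows "q L a b x \<le> q L a' b' x"
  unfolding q_def
  by (intro mult_mono power_decreasing assms lam_nonneg lam_le rho_le zero_le_power) (use rho_pos[of x] in auto)

lemma lam_zero: "L > 0 \<Longrightarrow> norm x > exp L \<Longrightarrow> lam L x = 0"
proof -
  assume L: "L > 0" and x: "norm x > exp L"
  have "exp L > 1" using L by simp
  then have "norm x > 1" using x by linarith
  then have "norm x \<le> x \<bullet> x" by (metis power2_norm_eq_inner less_imp_le self_le_power zero_less_numeral)
  then have "exp L \<le> 1 + x \<bullet> x" using x by linarith
  then have "L \<le> ln (1 + x \<bullet> x)" by (metis exp_gt_zero ln_exp ln_mono order_less_le_trans)
  then show ?thesis unfolding lam_def using L by (simp add: field_simps)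
qed

lemma q_supp: "L > 0 \<Longrightarrow> a > 0 \<Longrightarrow> vanishes_outside_ball (q L a b)"
  unfolding vanishes_outside_ball_def q_def using lam_zero by (metis mult_zero_left zero_power)

lemma C1_inner: "C1 (\<lambda>x::plane. x \<bullet> x) (\<lambda>j x. 2 * x $ j)"
  unfolding inner_plane
proof (rule C1_cong[OF C1_add[OF C1_mult[OF C1_coord C1_coord] C1_mult[OF C1_coord C1_coord]]])
  fix j :: 2 and x :: plane
  show "(if j = 1 then 1 else 0) * x $ 1 + x $ 1 * (if j = 1 then 1 else 0) + ((if j = 2 then 1 else 0) * x $ 2 + x $ 2 * (if j = 2 then 1 else 0)) = 2 * x $ j"
    using exhaust_2[of j] by auto
qed

lemma rho_cont: "continuous_on UNIV rho"
proof -
  have "1 + x \<bullet> x \<noteq> 0" for x :: plane using inner_ge_zero[of x] by linarith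
  then show ?thesis unfolding rho_def[abs_def] by (intro continuous_intros) auto
qed

lemma lam_cont: "continuous_on UNIV (lam L)"
proof (cases "L = 0")
  case True then show ?thesis unfolding lam_def[abs_def] by (simp add: continuous_on_const)
next
  case False
  have "1 + x \<bullet> x \<noteq> 0" for x :: plane using inner_ge_zero[of x] by linarith
  then show ?thesis unfolding lam_def[abs_def] using False by (intro continuous_intros) auto
qed

lemma q_cont [continuous_intros]: "continuous_on UNIV (q L a b)"
  unfolding q_def[abs_def] by (intro continuous_intros lam_cont rho_cont)

lemma C1_rho: "C1 rho (\<lambda>j x. - (x $ j * rho x ^ 3))"
  unfolding rho_def[abs_def]
proof (rule C1_cong[OF C1_chain[OF C1_inner, where \<phi>="\<lambda>t. 1 / sqrt (1 + t)" and \<phi>'="\<lambda>t. - (1/2) * (1 / sqrt (1 + t)) ^ 3"]])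
  fix x :: plane
  have p: "1 + x \<bullet> x > 0" using inner_ge_zero[of x] by linarith
  show "((\<lambda>t. 1 / sqrt (1 + t)) has_real_derivative - (1/2) * (1 / sqrt (1 + x \<bullet> x)) ^ 3) (at (x \<bullet> x))"
    using p by (auto intro!: derivative_eq_intros simp: field_simps power3_eq_cube power2_eq_square)
  show "continuous_on UNIV (\<lambda>x::plane. - (1/2) * (1 / sqrt (1 + x \<bullet> x)) ^ 3)"
    by (intro continuous_on_mult continuous_on_const continuous_on_power rho_cont[unfolded rho_def[abs_def]])
qed simp

text \<open>Powers at least 2 of a positive part are C1, so cutting off at zero costs no smoothness.\<close>
lemma DERIV_max_power:
  fixes t :: real
  assumes "a \<ge> 2"
  shows "((\<lambda>t. max 0 t ^ a) has_real_derivative (real a * max 0 t ^ (a - 1))) (at t)"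
proof -
  consider "t > 0" | "t < 0" | "t = 0" by linarith
  then show ?thesis
  proof cases
    case 1
    have "((\<lambda>t. t ^ a) has_real_derivative (real a * max 0 t ^ (a - 1))) (at t)"
      using 1 by (auto intro!: derivative_eq_intros)
    then show ?thesis
      by (rule has_field_derivative_transform_within_open[of _ _ _ "{0<..}"]) (use 1 in auto)
  next
    case 2
    have "((\<lambda>t. 0) has_real_derivative (real a * max 0 t ^ (a - 1))) (at t)"
      using 2 assms by (simp add: max_def power_0_left)
    then show ?thesis
      by (rule has_field_derivative_transform_within_open[of _ _ _ "{..<0}"]) (use 2 assms in auto)
  next
    case 3
    have "((\<lambda>h. (max 0 (0+h) ^ a - max 0 0 ^ a) / h) \<longlongrightarrow> 0) (at (0::real))"
    proof (rule Lim_null_comparison)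
      show "\<forall>\<^sub>F h in at (0::real). norm ((max 0 (0+h) ^ a - max 0 0 ^ a) / h) \<le> \<bar>h\<bar> ^ (a - 1)"
      proof (rule always_eventually, rule allI)
        fix h :: real
        obtain n where a: "a = Suc n" "n > 0" using assms by (cases a) auto
        show "norm ((max 0 (0+h) ^ a - max 0 0 ^ a) / h) \<le> \<bar>h\<bar> ^ (a - 1)"
          by (cases "h > 0") (auto simp: a max_def)
      qed
      have "((\<lambda>h. \<bar>h\<bar> ^ (a - 1)) \<longlongrightarrow> \<bar>0::real\<bar> ^ (a - 1)) (at 0)" by (intro tendsto_intros)
      moreover have "\<bar>0::real\<bar> ^ (a - 1) = 0" using assms by simp
      ultimately show "((\<lambda>h. \<bar>h\<bar> ^ (a - 1)) \<longlongrightarrow> (0::real)) (at 0)" by (simp only:)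
    qed
    moreover have z: "real a * max 0 (0::real) ^ (a - 1) = 0" using assms by (simp add: power_0_left)
    ultimately show ?thesis unfolding 3 DERIV_def z by (simp only:)
  qed
qed

lemma C1_q:
  assumes L: "L > 0" and a: "a \<ge> 2"
  shows "C1 (q L a b) (\<lambda>j x. - (x $ j * ((2 * real a / L) * q L (a - 1) (b + 2) x + real b * q L a (b + 2) x)))"
proof -
  have p: "1 + x \<bullet> x > 0" for x :: plane using inner_ge_zero[of x] by linarith
  have r2: "1 / (1 + x \<bullet> x) = rho x ^ 2" for x using rho_sq[of x] p[of x] by (simp add: field_simps)
  have l: "C1 (\<lambda>x. 1 - ln (1 + x \<bullet> x) / L) (\<lambda>j x. - (2 * x $ j * rho x ^ 2 / L))"
  proof (rule C1_cong[OF C1_chain[OF C1_inner, where \<phi>="\<lambda>t. 1 - ln (1 + t) / L" and \<phi>'="\<lambda>t. - (1 / (1 + t)) / L"]])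
    show "((\<lambda>t. 1 - ln (1 + t) / L) has_real_derivative - (1 / (1 + x \<bullet> x)) / L) (at (x \<bullet> x))" for x :: plane
    proof -
      have "((\<lambda>t. ln (1 + t)) has_real_derivative 1 / (1 + x \<bullet> x)) (at (x \<bullet> x))"
        using p[of x] by (auto intro!: derivative_eq_intros)
      from DERIV_diff[OF DERIV_const[of 1] DERIV_cdivide[OF this, of L]] show ?thesis by simp
    qed
    show "continuous_on UNIV (\<lambda>x::plane. - (1 / (1 + x \<bullet> x)) / L)"
      unfolding r2 using L by (intro continuous_intros rho_cont) auto
    show "- (1 / (1 + x \<bullet> x)) / L * (2 * x $ j) = - (2 * x $ j * rho x ^ 2 / L)" for x :: plane and j
      unfolding r2 by simp
  qed
  have la: "C1 (\<lambda>x. lam L x ^ a) (\<lambda>j x. (real a * lam L x ^ (a - 1)) * - (2 * x $ j * rho x ^ 2 / L))"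
    unfolding lam_def
    by (rule C1_chain[OF l DERIV_max_power[OF a]]) (use lam_cont[of L] in \<open>auto intro!: continuous_intros simp: lam_def[abs_def]\<close>)
  have rb: "C1 (\<lambda>x. rho x ^ b) (\<lambda>j x. (real b * rho x ^ (b - 1)) * - (x $ j * rho x ^ 3))"
    by (rule C1_chain[OF C1_rho]) (auto intro!: derivative_eq_intros continuous_intros rho_cont)
  show ?thesis unfolding q_def[abs_def]
  proof (rule C1_cong[OF C1_mult[OF la rb]])
    fix j :: 2 and x :: plane
    have pw: "real b * rho x ^ (b - 1) * rho x ^ 3 = real b * rho x ^ (b + 2)"
      by (cases b) (simp_all add: power_add power2_eq_square power3_eq_cube)
    have "real a * lam L x ^ (a - 1) * - (2 * x $ j * (rho x)\<^sup>2 / L) * rho x ^ b + lam L x ^ a * (real b * rho x ^ (b - 1) * - (x $ j * rho x ^ 3))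
      = - (x $ j * (2 * real a / L * (lam L x ^ (a - 1) * (rho x ^ b * (rho x)\<^sup>2)) + lam L x ^ a * (real b * rho x ^ (b - 1) * rho x ^ 3)))"
      by (simp add: algebra_simps power2_eq_square)
    also have "\<dots> = - (x $ j * (2 * real a / L * (lam L x ^ (a - 1) * rho x ^ (b + 2)) + real b * (lam L x ^ a * rho x ^ (b + 2))))"
      unfolding pw by (simp add: power_add power2_eq_square algebra_simps)
    finally show "real a * lam L x ^ (a - 1) * - (2 * x $ j * (rho x)\<^sup>2 / L) * rho x ^ b + lam L x ^ a * (real b * rho x ^ (b - 1) * - (x $ j * rho x ^ 3))
      = - (x $ j * (2 * real a / L * (lam L x ^ (a - 1) * rho x ^ (b + 2)) + real b * (lam L x ^ a * rho x ^ (b + 2))))" .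
  qed
qed

lemma norm_q: "norm x * q L a (Suc b) x \<le> q L a b x"
proof -
  have "norm x * q L a (Suc b) x = (norm x * rho x) * q L a b x" unfolding q_def by (simp add: algebra_simps)
  also have "\<dots> \<le> 1 * q L a b x" by (intro mult_right_mono norm_rho q_nonneg)
  finally show ?thesis by simp
qed

section \<open>Integrals of the weights\<close>

text \<open>The divergence theorem for the vector field \<open>x q L a b\<close>. It replaces integration in polar coordinates.\<close>
lemma q_divergence:
  assumes L: "L > 0" and a: "a \<ge> 2"
  shows "I (\<lambda>x. (2 - real b) * q L a b x + real b * q L a (b + 2) x - (2 * real a / L) * (q L (a - 1) b x - q L (a - 1) (b + 2) x)) = 0"
proof -
  let ?T = "\<lambda>x. (2 * real a / L) * q L (a - 1) (b + 2) x + real b * q L a (b + 2) x"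
  have C: "C1 (\<lambda>x. x $ k * q L a b x) (\<lambda>j x. (if j = k then 1 else 0) * q L a b x + x $ k * - (x $ j * ?T x))" for k
    by (rule C1_mult[OF C1_coord C1_q[OF L a]])
  have v: "vanishes_outside_ball (\<lambda>x. x $ k * q L a b x)" for k by (intro supp_mult(2) q_supp L) (use a in simp)
  have z: "I (\<lambda>x. (if k = k then 1 else 0) * q L a b x + x $ k * - (x $ k * ?T x)) = 0" for k :: 2
    by (rule I_deriv_zero[OF C v])
  have i: "integrable lborel (\<lambda>x. (if k = k then 1 else 0) * q L a b x + x $ k * - (x $ k * ?T x))" for k :: 2
    by (rule integrable_cc[OF C1_cont'[OF C] supp_deriv[OF C v]])
  have "0 = I (\<lambda>x. ((if (1::2) = 1 then 1 else 0) * q L a b x + x $ 1 * - (x $ 1 * ?T x)) + ((if (2::2) = 2 then 1 else 0) * q L a b x + x $ 2 * - (x $ 2 * ?T x)))"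
    using Bochner_Integration.integral_add[OF i[of 1] i[of 2]] z[of 1] z[of 2] by simp
  also have "\<dots> = I (\<lambda>x. (2 - real b) * q L a b x + real b * q L a (b + 2) x - (2 * real a / L) * (q L (a - 1) b x - q L (a - 1) (b + 2) x))"
  proof (rule Bochner_Integration.integral_cong[OF refl])
    fix x :: plane
    have xx: "x $ 1 * x $ 1 + x $ 2 * x $ 2 = x \<bullet> x" by (simp add: inner_plane)
    have r: "(x \<bullet> x) * q L c (b + 2) x = q L c b x - q L c (b + 2) x" for c
    proof -
      have "(x \<bullet> x) * q L c (b + 2) x + q L c (b + 2) x = q L c b x * (rho x ^ 2 * (1 + x \<bullet> x))"
        unfolding q_def by (simp add: power_add power2_eq_square algebra_simps)
      then show ?thesis unfolding rho_sq by simp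
    qed
    have "((if (1::2) = 1 then 1 else 0) * q L a b x + x $ 1 * - (x $ 1 * ?T x)) + ((if (2::2) = 2 then 1 else 0) * q L a b x + x $ 2 * - (x $ 2 * ?T x))
       = 2 * q L a b x - (x \<bullet> x) * ?T x" unfolding xx[symmetric] by (simp add: algebra_simps add_divide_distrib)
    also have "\<dots> = 2 * q L a b x - ((2 * real a / L) * ((x \<bullet> x) * q L (a - 1) (b + 2) x) + real b * ((x \<bullet> x) * q L a (b + 2) x))"
      by (simp add: algebra_simps)
    also have "\<dots> = (2 - real b) * q L a b x + real b * q L a (b + 2) x - (2 * real a / L) * (q L (a - 1) b x - q L (a - 1) (b + 2) x)"
      unfolding r by (simp add: algebra_simps)
    finally show "((if (1::2) = 1 then 1 else 0) * q L a b x + x $ 1 * - (x $ 1 * ?T x)) + ((if (2::2) = 2 then 1 else 0) * q L a b x + x $ 2 * - (x $ 2 * ?T x)) = (2 - real b) * q L a b x + real b * q L a (b + 2) x - (2 * real a / L) * (q L (a - 1) b x - q L (a - 1) (b + 2) x)" .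
  qed
  finally show ?thesis by simp
qed

lemma q_int: "L > 0 \<Longrightarrow> a > 0 \<Longrightarrow> integrable lborel (q L a b)"
  by (intro integrable_cc q_cont q_supp)

text \<open>For b = 3 the identity expresses the integral of \<open>lam^a rho^3\<close> by that of \<open>lam^a rho^5\<close> and a term of favourable sign, and \<open>rho^5\<close> is a small multiple of \<open>rho^3\<close> outside a fixed ball.\<close>
lemma I_q3: "\<exists>C\<ge>0. \<forall>L\<ge>1. I (q L 2 3) \<le> C"
proof (intro exI[of _ "6 * measure lborel (cball (0::plane) 3)"] conjI allI impI)
  fix L :: real assume L1: "L \<ge> 1"
  then have L: "L > 0" by simp
  have ind: "integrable lborel (\<lambda>x::plane. 3 * indicator (cball 0 3) x :: real)"
    using emeasure_lborel_cball_finite[of "0::plane" 3]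
    by (intro integrable_mult_right integrable_real_indicator) (auto simp: less_top)
  note iq = q_int[OF L, of 2 3]
  have "0 = I (\<lambda>x. (2 - real 3) * q L 2 3 x + real 3 * q L 2 (3 + 2) x - (2 * real 2 / L) * (q L (2 - 1) 3 x - q L (2 - 1) (3 + 2) x))"
    using q_divergence[OF L, of 2 3] by simp
  also have "\<dots> \<le> I (\<lambda>x. 3 * indicator (cball 0 3) x - q L 2 3 x / 2)"
  proof (rule integral_mono)
    show "integrable lborel (\<lambda>x. (2 - real 3) * q L 2 3 x + real 3 * q L 2 (3 + 2) x - (2 * real 2 / L) * (q L (2 - 1) 3 x - q L (2 - 1) (3 + 2) x))"
      by (intro Bochner_Integration.integrable_add Bochner_Integration.integrable_diff integrable_mult_right q_int L) auto
    show "integrable lborel (\<lambda>x. 3 * indicator (cball 0 3) x - q L 2 3 x / 2)"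
      using ind iq by (intro Bochner_Integration.integrable_diff) auto
    fix x :: plane
    have a: "q L (2 - 1) (3 + 2) x \<le> q L (2 - 1) 3 x" by (rule q_mono[OF L]) auto
    then have b: "(2 * real 2 / L) * (q L (2 - 1) 3 x - q L (2 - 1) (3 + 2) x) \<ge> 0" using L by simp
    have c: "3 * q L 2 5 x \<le> 3 * indicator (cball 0 3) x + q L 2 3 x / 2"
    proof (cases "norm x \<le> 3")
      case True
      have "q L 2 5 x \<le> 1" using q_mono[OF L, of 0 2 0 5 x] by (simp add: q_def)
      then show ?thesis using True q_nonneg[of L 2 3 x] by simp
    next
      case False
      then have "9 \<le> x \<bullet> x" using power_mono[of 3 "norm x" 2] by (simp add: power2_norm_eq_inner)
      have "rho x ^ 2 * 6 \<le> rho x ^ 2 * (1 + x \<bullet> x)" using \<open>9 \<le> x \<bullet> x\<close> by (intro mult_left_mono) auto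
      then have "rho x ^ 2 \<le> 1/6" unfolding rho_sq by simp
      then have "q L 2 3 x * rho x ^ 2 \<le> q L 2 3 x * (1/6)" by (intro mult_left_mono q_nonneg)
      moreover have "q L 2 5 x = q L 2 3 x * rho x ^ 2" unfolding q_def by (simp add: power_numeral_reduce)
      ultimately show ?thesis using False by simp
    qed
    show "(2 - real 3) * q L 2 3 x + real 3 * q L 2 (3 + 2) x - (2 * real 2 / L) * (q L (2 - 1) 3 x - q L (2 - 1) (3 + 2) x) \<le> 3 * indicator (cball 0 3) x - q L 2 3 x / 2"
      using b c by simp
  qed
  also have "\<dots> = I (\<lambda>x::plane. 3 * indicator (cball 0 3) x) - I (\<lambda>x. q L 2 3 x / 2)"
    using ind iq by (intro Bochner_Integration.integral_diff) auto
  finally show "I (q L 2 3) \<le> 6 * measure lborel (cball (0::plane) 3)" by simp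
qed simp

lemma I_q_mono: "L > 0 \<Longrightarrow> 0 < a' \<Longrightarrow> a' \<le> a \<Longrightarrow> b' \<le> b \<Longrightarrow> I (q L a b) \<le> I (q L a' b')"
  by (intro integral_mono q_int q_mono) auto

text \<open>For b = 2 the leading coefficient 2 - b vanishes, and the identity gives the integral of \<open>lam^2 rho^2\<close> as L/3 times an integral that \<open>I_q3\<close> bounds, up to a bounded term.\<close>
lemma I_q2: "\<exists>C\<ge>0. \<forall>L\<ge>1. I (q L 2 2) \<le> C * L"
proof -
  obtain C where C: "C \<ge> 0" "\<And>L. L \<ge> 1 \<Longrightarrow> I (q L 2 3) \<le> C" using I_q3 by blast
  have "I (q L 2 2) \<le> (2 * C) * L" if L1: "L \<ge> 1" for L
  proof -
    have L: "L > 0" using L1 by simp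
    have e: "(\<lambda>x. (2 - real 2) * q L 3 2 x + real 2 * q L 3 (2 + 2) x - (2 * real 3 / L) * (q L (3 - 1) 2 x - q L (3 - 1) (2 + 2) x))
       = (\<lambda>x. 2 * q L 3 4 x - (6 / L) * (q L 2 2 x - q L 2 4 x))" by simp
    have "I (\<lambda>x. 2 * q L 3 4 x - (6 / L) * (q L 2 2 x - q L 2 4 x)) = 0"
      using q_divergence[OF L, of 3 2] unfolding e by simp
    moreover have "I (\<lambda>x. 2 * q L 3 4 x - (6 / L) * (q L 2 2 x - q L 2 4 x)) = 2 * I (q L 3 4) - (6 / L) * (I (q L 2 2) - I (q L 2 4))"
      by (subst Bochner_Integration.integral_diff, (intro integrable_mult_right Bochner_Integration.integrable_diff q_int L; simp)+)
         (subst integral_mult_right_zero, subst integral_mult_right_zero, subst Bochner_Integration.integral_diff, (intro q_int L; simp)+, rule refl)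
    ultimately have "(6 / L) * (I (q L 2 2) - I (q L 2 4)) = 2 * I (q L 3 4)" by simp
    then have "I (q L 2 2) = L / 3 * I (q L 3 4) + I (q L 2 4)" using L by (simp add: field_simps)
    moreover have "I (q L 3 4) \<le> C" "I (q L 2 4) \<le> C"
      using I_q_mono[OF L, of 2 3 3 4] I_q_mono[OF L, of 2 2 3 4] C(2)[OF L1] by simp_all
    ultimately have "I (q L 2 2) \<le> L / 3 * C + C" using L by (simp add: mult_left_mono add_mono)
    also have "\<dots> \<le> (2 * C) * L"
    proof -
      have "C * 1 \<le> C * L" using C L1 by (intro mult_left_mono) auto
      then show ?thesis using C(1) L by (simp add: algebra_simps)
    qed
    finally show ?thesis .
  qed
  then show ?thesis using C(1) by (intro exI[of _ "2 * C"]) auto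
qed

section \<open>The energy estimate\<close>

lemma test_product_split:
  fixes a E u v p n :: complex
  shows "(a * E + u + v) * (p - n) = (a * (E * p) - a * (E * n)) + (u + v) * (p - n)"
  by (simp add: algebra_simps)

lemma I_le2:
  fixes f g h :: "plane \<Rightarrow> real"
  assumes "continuous_on UNIV f" "vanishes_outside_ball f" "continuous_on UNIV g" "vanishes_outside_ball g"
    "continuous_on UNIV h" "vanishes_outside_ball h" and le: "\<And>x. f x \<le> a * g x + b * h x"
  shows "I f \<le> a * I g + b * I h"
proof -
  have i: "integrable lborel g" "integrable lborel h" by (intro integrable_cc assms)+
  have "I f \<le> I (\<lambda>x. a * g x + b * h x)"
    by (rule integral_mono) (use i le in \<open>auto intro!: integrable_cc assms\<close>)
  also have "\<dots> = a * I g + b * I h" using i by simp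
  finally show ?thesis .
qed

lemma young: "c * (X * Y) \<le> X\<^sup>2 / 4 + c\<^sup>2 * (Y::real)\<^sup>2"
proof -
  have "0 \<le> (X / 2 - c * Y)\<^sup>2" by simp
  then show ?thesis by (simp add: power2_diff power_mult_distrib power_divide algebra_simps)
qed

text \<open>The factor A in \<open>\<partial>_j (q L a b) = - x_j A\<close>.\<close>
definition tq :: "real \<Rightarrow> nat \<Rightarrow> nat \<Rightarrow> plane \<Rightarrow> real" where
  "tq L a b x = (2 * real a / L) * q L (a - 1) (b + 2) x + real b * q L a (b + 2) x"

lemma C1_q': "L > 0 \<Longrightarrow> a \<ge> 2 \<Longrightarrow> C1 (q L a b) (\<lambda>j x. - (x $ j * tq L a b x))"
  unfolding tq_def by (rule C1_q)

lemma tq_nonneg: "L > 0 \<Longrightarrow> tq L a b x \<ge> 0"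
  unfolding tq_def using q_nonneg[of L _ _ x] by simp

lemma tq_le: "L \<ge> 1 \<Longrightarrow> tq L a b x \<le> (2 * real a + real b) * q L (a - 1) (b + 2) x"
proof -
  assume L1: "L \<ge> 1"
  have "(2 * real a / L) * q L (a - 1) (b + 2) x \<le> (2 * real a) * q L (a - 1) (b + 2) x"
    using L1 by (intro mult_right_mono q_nonneg) (simp add: divide_le_eq mult_le_cancel_left1)
  moreover have "real b * q L a (b + 2) x \<le> real b * q L (a - 1) (b + 2) x"
    using L1 by (intro mult_left_mono q_mono) auto
  ultimately show ?thesis unfolding tq_def by (simp add: distrib_right)
qed

lemma tq_cont [continuous_intros]: "continuous_on UNIV (tq L a b)"
  unfolding tq_def[abs_def] by (intro continuous_intros)

lemma C1_tq:
  assumes "L > 0" "a \<ge> 3"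
  shows "C1 (tq L a b) (\<lambda>j x. - (x $ j * ((2 * real a / L) * tq L (a - 1) (b + 2) x + real b * tq L a (b + 2) x)))"
  unfolding tq_def[of L a b, abs_def]
  by (rule C1_cong[OF C1_add[OF C1_bl[OF C1_q' bounded_linear_mult_right] C1_bl[OF C1_q' bounded_linear_mult_right]]])
     (use assms in \<open>auto simp: algebra_simps\<close>)

lemma norm_cpl [simp]: "norm (cpl x) = norm x"
  unfolding cpl_def by (simp add: cmod_def norm_vec_def L2_set_def sum_2)

lemma abs_coord: "\<bar>(x::plane) $ j\<bar> \<le> norm x"
  by (rule component_le_norm_cart)

lemma norm_rad_e: "A x \<ge> 0 \<Longrightarrow> norm (rad_e A x) = norm x * A x"
  unfolding rad_e_def by (simp add: mult.commute)

lemma norm_rad_S: "B x \<ge> 0 \<Longrightarrow> norm (rad_S B x) = norm x * (norm x * B x)"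
  unfolding rad_S_def by (simp add: norm_mult)

lemma norm_rad_e': "A x \<ge> 0 \<Longrightarrow> B x \<ge> 0 \<Longrightarrow> norm (rad_e' A B j x) \<le> norm x * (norm x * B x) + A x"
proof -
  assume a: "A x \<ge> 0" "B x \<ge> 0"
  have "norm (rad_e' A B j x) \<le> norm ((x $ j * B x) *\<^sub>R cpl x) + norm (A x *\<^sub>R cpl (axis j 1))"
    unfolding rad_e'_def by (rule norm_triangle_ineq4)
  also have "\<dots> = (\<bar>x $ j\<bar> * B x) * norm x + A x" using a by (simp add: abs_mult)
  also have "\<dots> \<le> (norm x * B x) * norm x + A x"
    using a by (intro add_right_mono mult_right_mono abs_coord) auto
  finally show ?thesis by (simp add: mult_ac)
qed

lemma norm_rad_S': "B x \<ge> 0 \<Longrightarrow> G x \<ge> 0 \<Longrightarrow> norm (rad_S' B G j x) \<le> 2 * (norm x * B x) + norm x * (norm x * (norm x * G x))"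
proof -
  assume a: "B x \<ge> 0" "G x \<ge> 0"
  have "norm (rad_S' B G j x) \<le> norm ((2 * B x) *\<^sub>R (cpl x * cpl (axis j 1))) + norm ((x $ j * G x) *\<^sub>R (cpl x * cpl x))"
    unfolding rad_S'_def by (rule norm_triangle_ineq4)
  also have "\<dots> = 2 * (norm x * B x) + (\<bar>x $ j\<bar> * G x) * (norm x * norm x)" using a by (simp add: norm_mult abs_mult)
  also have "\<dots> \<le> 2 * (norm x * B x) + (norm x * G x) * (norm x * norm x)"
    using a by (intro add_left_mono mult_right_mono abs_coord) auto
  finally show ?thesis by (simp add: mult_ac)
qed

context flow begin

lemma p_norm: "norm (p x) = M x * norm (E x)"
  unfolding p_def using c0(1) c0(2)[of x] by (simp add: norm_mult)

lemma M_pos: "M x > 0" using c0(1) c0(2)[of x] by linarith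

lemma dh_real: "cnj (f' 1 x) + \<i> * cnj (f' 2 x) = complex_of_real (Re (f' 1 x) + Im (f' 2 x))"
  using curl[of x] by (simp add: complex_eq_iff)

text \<open>The convective term in the first order estimate: \<open>E (cnj f)^2\<close> is \<open>dbar\<close> of the cubic \<open>f (cnj f)^2\<close> minus a real function, and the factor i makes the latter imaginary.\<close>
lemma energy_convection:
  assumes z: "C2 \<zeta> z z'" and v: "vanishes_outside_ball \<zeta>"
  shows "\<bar>Re (I (\<lambda>x. complex_of_real (\<zeta> x) * (E x * n x)))\<bar> \<le> m ^ 3 * I (\<lambda>x. norm (z x))"
proof -
  note z1 = z[unfolded C2_def, THEN conjunct1] and z2 = z[unfolded C2_def, THEN conjunct2]
  have XC: "C1 (\<lambda>x. f x * (cnj (f x) * cnj (f x))) (\<lambda>j x. f' j x * (cnj (f x) * cnj (f x)) + f x * (cnj (f' j x) * cnj (f x) + cnj (f x) * cnj (f' j x)))"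
    by (rule C1_mult[OF f_C1 C1_mult[OF C1_cnj[OF f_C1] C1_cnj[OF f_C1]]])
  let ?X = "\<lambda>x. f x * (cnj (f x) * cnj (f x))"
  let ?X' = "\<lambda>j x. f' j x * (cnj (f x) * cnj (f x)) + f x * (cnj (f' j x) * cnj (f x) + cnj (f x) * cnj (f' j x))"
  let ?r = "\<lambda>x. 2 * (norm (f x))\<^sup>2 * (Re (f' 1 x) + Im (f' 2 x))"
  have alg: "a * (c * c) + b * (d1 * c + c * d1) + \<i> * (a2 * (c * c) + b * (d2 * c + c * d2)) = (a + \<i> * a2) * (c * c) + 2 * (b * c) * (d1 + \<i> * d2)" for a a2 b c d1 d2 :: complex
    by (simp add: algebra_simps)
  have dX: "dbar ?X' x = E x * (cnj (f x) * cnj (f x)) + complex_of_real (?r x)" for x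
    unfolding dbar_def alg dh_real by (simp add: complex_norm_square[symmetric] del: of_real_power)
  have pt: "complex_of_real (\<zeta> x) * (E x * n x) = \<i> * (dbar ?X' x * complex_of_real (\<zeta> x)) - \<i> * complex_of_real (\<zeta> x * ?r x)" for x
    unfolding dX n_def of_real_mult[of "\<zeta> x"] by (simp only: distrib_right distrib_left mult_ac add_diff_cancel_right' )
  note ct = C1_cont[OF z1] C1_cont[OF z2] C1_cont[OF XC] dbar_cont[OF XC] cts
  have i1: "integrable lborel (\<lambda>x. dbar ?X' x * complex_of_real (\<zeta> x))"
    by (intro integrable_cc supp_mult(2) supp_map(6) v continuous_on_mult continuous_on_of_real ct)
  have i2: "integrable lborel (\<lambda>x. \<zeta> x * ?r x)"
    by (intro integrable_cc supp_mult(1) v continuous_intros ct)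
  have "I (\<lambda>x. complex_of_real (\<zeta> x) * (E x * n x)) = \<i> * I (\<lambda>x. dbar ?X' x * complex_of_real (\<zeta> x)) - \<i> * complex_of_real (I (\<lambda>x. \<zeta> x * ?r x))"
  proof -
    have "I (\<lambda>x. complex_of_real (\<zeta> x) * (E x * n x)) = I (\<lambda>x. \<i> * (dbar ?X' x * complex_of_real (\<zeta> x)) - \<i> * complex_of_real (\<zeta> x * ?r x))"
      by (rule Bochner_Integration.integral_cong[OF refl pt])
    also have "\<dots> = I (\<lambda>x. \<i> * (dbar ?X' x * complex_of_real (\<zeta> x))) - I (\<lambda>x. \<i> * complex_of_real (\<zeta> x * ?r x))"
      by (rule Bochner_Integration.integral_diff) (intro integrable_mult_right i1 integrable_of_real i2)+
    finally show ?thesis by (simp only: integral_mult_right_zero integral_complex_of_real)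
  qed
  moreover have "I (\<lambda>x. dbar ?X' x * complex_of_real (\<zeta> x)) = - I (\<lambda>x. ?X x * z x)"
  proof -
    have "dbar (\<lambda>j x. complex_of_real (if j = 1 then Re (z x) else Im (z x))) x = z x" for x
      by (simp add: dbar_def complex_eq_iff)
    then show ?thesis using I_dbar_parts[OF XC C1_of_real[OF z1] supp_map(6)[OF v]] by simp
  qed
  ultimately have "I (\<lambda>x. complex_of_real (\<zeta> x) * (E x * n x)) = - (\<i> * I (\<lambda>x. ?X x * z x)) - \<i> * complex_of_real (I (\<lambda>x. \<zeta> x * ?r x))"
    by simp
  then have "Re (I (\<lambda>x. complex_of_real (\<zeta> x) * (E x * n x))) = Im (I (\<lambda>x. ?X x * z x))" by simp
  also have "\<bar>\<dots>\<bar> \<le> norm (I (\<lambda>x. ?X x * z x))" by (rule abs_Im_le_cmod)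
  also have "\<dots> \<le> I (\<lambda>x. m ^ 3 * norm (z x))"
  proof (rule norm_I_le)
    fix x
    have "norm (?X x * z x) \<le> (m * (m * m)) * norm (z x)"
      by (intro norm_mult_le order_refl) (simp_all add: f_bdd)
    then show "norm (?X x * z x) \<le> m ^ 3 * norm (z x)" by (simp add: power3_eq_cube mult.assoc)
  qed (intro continuous_intros ct supp_mult(2) supp_map(1) supp_C2[OF z v])+
  finally show ?thesis by simp
qed

end

locale flow_growth = flow +
  fixes Cg :: real and k :: nat
  assumes Cg: "Cg \<ge> 0" and growth: "\<And>x. M x \<le> Cg * (1 + norm (E x)) ^ k"
begin

abbreviation "N \<equiv> 2 * k + 6"

text \<open>The stress occurs linearly with the weight \<open>lam^(N-2) rho^3\<close>. Where \<open>lam^2 |E|\<close> is large the energy density dominates it.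
Elsewhere the growth condition bounds the stress by \<open>(1 + |E|)^(k+1)\<close>, and the power \<open>lam^(2 (k+1))\<close> compensates it, leaving \<open>lam^2\<close>;
this forces N = 2 k + 6.\<close>
lemma energy_pointwise:
  assumes L: "L > 0" and K: "K \<ge> 0"
  shows "K * q L (N - 2) 3 x * norm (p x) \<le> (1/2) * (q L N 2 x * (M x * (norm (E x))\<^sup>2)) + (K * Cg * (1 + 2 * K) ^ (k + 1)) * q L 2 3 x"
proof -
  let ?W = "norm (E x)" and ?l = "lam L x" and ?r = "rho x"
  have l: "?l \<ge> 0" "?l \<le> 1" using lam_nonneg lam_le[OF L] by auto
  have r: "?r > 0" "?r \<le> 1" using rho_pos rho_le by auto
  have q1: "q L (N - 2) 3 x = ?l ^ (2 * k + 4) * ?r ^ 3" unfolding q_def by (simp add: numeral_eq_Suc)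
  have q2: "q L N 2 x = ?l ^ (2 * k + 4) * ?l\<^sup>2 * ?r\<^sup>2" 
  proof -
    have "?l ^ N = ?l ^ (2 * k + 4) * ?l ^ 2"
      by (subst power_add[symmetric]) (rule arg_cong[where f="(^) ?l"], simp)
    then show ?thesis unfolding q_def by simp
  qed
  show ?thesis
  proof (cases "?l\<^sup>2 * ?W \<ge> 2 * K")
    case True
    have "K * q L (N - 2) 3 x * norm (p x) = (K * ?r) * (?l ^ (2 * k + 4) * ?r\<^sup>2 * (M x * ?W))"
      unfolding q1 p_norm by (simp add: power3_eq_cube power2_eq_square)
    also have "\<dots> \<le> (?l\<^sup>2 * ?W / 2) * (?l ^ (2 * k + 4) * ?r\<^sup>2 * (M x * ?W))"
    proof (rule mult_right_mono)
      have "K * ?r \<le> K * 1" using r K by (intro mult_left_mono) auto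
      then show "K * ?r \<le> ?l\<^sup>2 * ?W / 2" using True by simp
      show "0 \<le> ?l ^ (2 * k + 4) * ?r\<^sup>2 * (M x * ?W)" using l M_pos[of x] by simp
    qed
    also have "\<dots> = (1/2) * (q L N 2 x * (M x * ?W\<^sup>2))" unfolding q2 by (simp add: power2_eq_square)
    also have "\<dots> \<le> (1/2) * (q L N 2 x * (M x * ?W\<^sup>2)) + (K * Cg * (1 + 2 * K) ^ (k + 1)) * q L 2 3 x"
      using K Cg q_nonneg[of L 2 3 x] by simp
    finally show ?thesis .
  next
    case False
    have "?l\<^sup>2 * (1 + ?W) \<le> 1 + 2 * K"
      using False power_le_one[OF l, of 2] by (simp add: distrib_left)
    then have a: "(?l\<^sup>2 * (1 + ?W)) ^ (k + 1) \<le> (1 + 2 * K) ^ (k + 1)"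
      using l by (intro power_mono) auto
    have "M x * ?W \<le> (Cg * (1 + ?W) ^ k) * (1 + ?W)" using growth[of x] M_pos[of x] Cg by (intro mult_mono) auto
    then have b: "M x * ?W \<le> Cg * (1 + ?W) ^ (k + 1)" by (simp add: mult_ac)
    have e: "?l ^ (2 * k + 4) = ?l ^ 2 * (?l\<^sup>2) ^ (k + 1)"
      by (subst power_mult[symmetric], subst power_add[symmetric], rule arg_cong[where f="(^) ?l"], simp)
    have "K * q L (N - 2) 3 x * norm (p x) = (K * ?l ^ 2 * ?r ^ 3) * ((?l\<^sup>2) ^ (k + 1) * (M x * ?W))"
      unfolding q1 p_norm e by simp
    also have "\<dots> \<le> (K * ?l ^ 2 * ?r ^ 3) * ((?l\<^sup>2) ^ (k + 1) * (Cg * (1 + ?W) ^ (k + 1)))"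
      using b l r K by (intro mult_left_mono) auto
    also have "\<dots> = (K * ?l ^ 2 * ?r ^ 3 * Cg) * (?l\<^sup>2 * (1 + ?W)) ^ (k + 1)"
      by (simp only: power_mult_distrib mult_ac)
    also have "\<dots> \<le> (K * ?l ^ 2 * ?r ^ 3 * Cg) * (1 + 2 * K) ^ (k + 1)"
      using a l r K Cg by (intro mult_left_mono) auto
    also have "\<dots> = (K * Cg * (1 + 2 * K) ^ (k + 1)) * q L 2 3 x" unfolding q_def by (simp only: mult_ac)
    also have "\<dots> \<le> (1/2) * (q L N 2 x * (M x * ?W\<^sup>2)) + (K * Cg * (1 + 2 * K) ^ (k + 1)) * q L 2 3 x"
      using q_nonneg[of L N 2 x] M_pos[of x] by simp
    finally show ?thesis .
  qed
qed

text \<open>Test function \<open>lam^N rho^2 \<psi>\<close>. The factor \<open>rho^2\<close> compensates the linear growth of \<open>\<psi>\<close>: every term with a derivative of the cutoff carries \<open>rho^3\<close> after the factors f and \<open>\<psi>\<close> have been bounded.\<close>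
lemma energy: "\<exists>C\<ge>0. \<forall>L\<ge>1. I (\<lambda>x. q L N 2 x * (M x * (norm (E x))\<^sup>2)) \<le> C"
proof -
  obtain C3 where C3: "C3 \<ge> 0" "\<And>L. L \<ge> 1 \<Longrightarrow> I (q L 2 3) \<le> C3" using I_q3 by blast
  define K1 where "K1 = 2 * real N + 2"
  define K2 where "K2 = (2 * real N + 2) * (2 * real N + 4)"
  define K where "K = m * (2 * K1 + K2)"
  define c where "c = K * Cg * (1 + 2 * K) ^ (k + 1) + K * m\<^sup>2"
  have K0: "K1 \<ge> 0" "K2 \<ge> 0" unfolding K1_def K2_def by simp_all
  have K: "K \<ge> 0" unfolding K_def using m_nonneg K0 by simp
  have "I (\<lambda>x. q L N 2 x * (M x * (norm (E x))\<^sup>2)) \<le> 2 * ((c + m ^ 3 * K1) * C3)" if L1: "L \<ge> 1" for L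
  proof -
    have L: "L > 0" using L1 by simp
    define A where "A = tq L N 2"
    define B where "B x = (2 * real N / L) * tq L (N - 1) 4 x + real 2 * tq L N 4 x" for x
    have A0: "A x \<ge> 0" for x unfolding A_def by (rule tq_nonneg[OF L])
    have B0: "B x \<ge> 0" for x unfolding B_def using tq_nonneg[OF L] L by simp
    have zC: "C1 (q L N 2) (\<lambda>j x. - (x $ j * A x))" unfolding A_def by (rule C1_q'[OF L]) simp
    have AC: "C1 A (\<lambda>j x. - (x $ j * B x))" unfolding A_def B_def
      by (rule C1_cong[OF C1_tq[OF L]]) simp_all
    note z = rad_C2[OF zC AC]
    have v: "vanishes_outside_ball (q L N 2)" by (rule q_supp[OF L]) simp
    have Ale: "A x \<le> K1 * q L (N - 1) 4 x" for x
      using tq_le[OF L1, of N 2 x] unfolding A_def K1_def by simp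
    have Ble: "B x \<le> K2 * q L (N - 2) 6 x" for x
    proof -
      have t1: "tq L (N - 1) 4 x \<le> (2 * real N + 4) * q L (N - 2) 6 x"
        using tq_le[OF L1, of "N - 1" 4 x] q_nonneg[of L "N - 2" 6 x]
        by (simp add: numeral_eq_Suc algebra_simps)
      have t2: "tq L N 4 x \<le> (2 * real N + 4) * q L (N - 2) 6 x"
      proof -
        have "tq L N 4 x \<le> (2 * real N + 4) * q L (N - 1) 6 x" using tq_le[OF L1, of N 4 x] by simp
        also have "\<dots> \<le> (2 * real N + 4) * q L (N - 2) 6 x" by (intro mult_left_mono q_mono L) auto
        finally show ?thesis .
      qed
      have "2 * real N / L \<le> 2 * real N" using L1 by (simp add: divide_le_eq mult_le_cancel_left1)
      then have "(2 * real N / L) * tq L (N - 1) 4 x \<le> (2 * real N) * ((2 * real N + 4) * q L (N - 2) 6 x)"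
        using t1 tq_nonneg[OF L, of "N - 1" 4 x] by (intro mult_mono) auto
      moreover have "real 2 * tq L N 4 x \<le> 2 * ((2 * real N + 4) * q L (N - 2) 6 x)" using t2 by simp
      ultimately show ?thesis unfolding B_def K2_def by (simp only: distrib_right mult.assoc)
    qed
    let ?z = "rad_e A" and ?Z = "rad_S B"
    have zle: "norm (?z x) \<le> K1 * q L (N - 1) 3 x" for x
    proof -
      have "norm (?z x) = norm x * A x" by (rule norm_rad_e[OF A0])
      also have "\<dots> \<le> norm x * (K1 * q L (N - 1) (Suc 3) x)" using Ale[of x] by (intro mult_left_mono) (simp_all add: numeral_eq_Suc)
      also have "\<dots> = K1 * (norm x * q L (N - 1) (Suc 3) x)" by simp
      also have "\<dots> \<le> K1 * q L (N - 1) 3 x" by (intro mult_left_mono norm_q K0)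
      finally show ?thesis .
    qed
    have Zle: "norm (complex_of_real (\<psi> x)) * norm (?Z x) \<le> m * K2 * q L (N - 2) 3 x" for x
    proof -
      have "norm (complex_of_real (\<psi> x)) * norm (?Z x) \<le> (m * norm x) * (norm x * (norm x * B x))"
        unfolding norm_rad_S[OF B0] using psi_bdd[of x] B0[of x] by (intro mult_right_mono) auto
      also have "\<dots> \<le> (m * norm x) * (norm x * (norm x * (K2 * q L (N - 2) 6 x)))"
        using m_nonneg by (intro mult_left_mono Ble) auto
      also have "\<dots> = m * K2 * (norm x * (norm x * (norm x * q L (N - 2) (Suc 5) x)))" by (simp add: mult_ac)
      also have "\<dots> \<le> m * K2 * (norm x * (norm x * q L (N - 2) (Suc 4) x))"
        using norm_q[of x L "N - 2" 5] m_nonneg K0 by (intro mult_left_mono) (simp_all add: numeral_eq_Suc)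
      also have "\<dots> \<le> m * K2 * (norm x * q L (N - 2) (Suc 3) x)"
        using norm_q[of x L "N - 2" 4] m_nonneg K0 by (intro mult_left_mono) (simp_all add: numeral_eq_Suc)
      also have "\<dots> \<le> m * K2 * q L (N - 2) 3 x"
        using m_nonneg K0 by (intro mult_left_mono norm_q) simp_all
      finally show ?thesis .
    qed
    define R where "R x = 2 * ?z x * f x + ?Z x * complex_of_real (\<psi> x)" for x
    have Rle: "norm (R x) \<le> K * q L (N - 2) 3 x" for x
    proof -
      have "norm (R x) \<le> norm (2 * ?z x * f x) + norm (?Z x * complex_of_real (\<psi> x))"
        unfolding R_def by (rule norm_triangle_ineq)
      also have "norm (2 * ?z x * f x) \<le> (2 * (K1 * q L (N - 1) 3 x)) * m"
        by (intro norm_mult_le zle f_bdd) simp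
      also have "norm (?Z x * complex_of_real (\<psi> x)) \<le> m * K2 * q L (N - 2) 3 x"
        using Zle[of x] by (simp add: norm_mult mult.commute)
      also have "(2 * (K1 * q L (N - 1) 3 x)) * m \<le> (2 * (K1 * q L (N - 2) 3 x)) * m"
        using m_nonneg K0 by (intro mult_right_mono mult_left_mono q_mono L) auto
      finally show ?thesis unfolding K_def by (simp add: algebra_simps)
    qed
    note zC2 = z[unfolded C2_def, THEN conjunct2]
    have cS: "continuous_on UNIV ?Z" using dbar_cont[OF zC2] unfolding rad_dbar .
    note ct = C1_cont[OF zC2] cS cts q_cont
    have vz: "vanishes_outside_ball ?z" "vanishes_outside_ball ?Z"
      using supp_C2[OF z v] unfolding rad_dbar by auto
    have vR: "vanishes_outside_ball R" unfolding R_def[abs_def] by (intro supp_add(1) supp_mult(1) supp_mult(2)[OF vz(1)] vz)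
    have cR: "continuous_on UNIV R" unfolding R_def[abs_def] by (intro continuous_intros ct)
    let ?X = "I (\<lambda>x. q L N 2 x * (M x * (norm (E x))\<^sup>2))"
    have w0: "Re (I (\<lambda>x. (complex_of_real (q L N 2 x) * E x + 2 * ?z x * f x + ?Z x * complex_of_real (\<psi> x)) * (p x - n x))) = 0"
      using weak_prod[OF z v psi, of 0] unfolding rad_dbar by simp
    have pE: "E x * p x = complex_of_real (M x * (norm (E x))\<^sup>2)" for x
      unfolding p_def of_real_mult complex_norm_square by (simp only: mult_ac)
    have split: "I (\<lambda>x. (complex_of_real (q L N 2 x) * E x + 2 * ?z x * f x + ?Z x * complex_of_real (\<psi> x)) * (p x - n x))
       = complex_of_real ?X - I (\<lambda>x. complex_of_real (q L N 2 x) * (E x * n x)) + I (\<lambda>x. R x * (p x - n x))"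
    proof -
      have "I (\<lambda>x. (complex_of_real (q L N 2 x) * E x + 2 * ?z x * f x + ?Z x * complex_of_real (\<psi> x)) * (p x - n x))
        = I (\<lambda>x. (complex_of_real (q L N 2 x) * (E x * p x) - complex_of_real (q L N 2 x) * (E x * n x)) + R x * (p x - n x))"
        unfolding R_def test_product_split ..
      also have "\<dots> = I (\<lambda>x. complex_of_real (q L N 2 x) * (E x * p x) - complex_of_real (q L N 2 x) * (E x * n x)) + I (\<lambda>x. R x * (p x - n x))"
        by (rule Bochner_Integration.integral_add) (intro integrable_cc continuous_intros ct cR supp_mult(1) supp_add supp_map(6) v vR)+
      also have "I (\<lambda>x. complex_of_real (q L N 2 x) * (E x * p x) - complex_of_real (q L N 2 x) * (E x * n x)) = I (\<lambda>x. complex_of_real (q L N 2 x) * (E x * p x)) - I (\<lambda>x. complex_of_real (q L N 2 x) * (E x * n x))"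
        by (rule Bochner_Integration.integral_diff) (intro integrable_cc continuous_intros ct supp_mult(1) supp_map(6) v)+
      also have "I (\<lambda>x. complex_of_real (q L N 2 x) * (E x * p x)) = complex_of_real ?X"
        unfolding pE of_real_mult[symmetric] by (rule integral_complex_of_real)
      finally show ?thesis .
    qed
    have b1: "\<bar>Re (I (\<lambda>x. complex_of_real (q L N 2 x) * (E x * n x)))\<bar> \<le> m ^ 3 * (K1 * C3)"
    proof -
      have "I (\<lambda>x. norm (?z x)) \<le> I (\<lambda>x. K1 * q L 2 3 x)"
      proof (rule I_mono)
        fix x
        have "K1 * q L (N - 1) 3 x \<le> K1 * q L 2 3 x" by (intro mult_left_mono q_mono L K0) auto
        then show "norm (?z x) \<le> K1 * q L 2 3 x" using zle[of x] by linarith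
      qed (intro continuous_intros ct supp_map(1) vz supp_mult(2) q_supp L | simp)+
      also have "\<dots> = K1 * I (q L 2 3)" by simp
      also have "\<dots> \<le> K1 * C3" by (intro mult_left_mono C3 L1 K0)
      finally have "m ^ 3 * I (\<lambda>x. norm (?z x)) \<le> m ^ 3 * (K1 * C3)" using m_nonneg by (intro mult_left_mono) auto
      then show ?thesis using energy_convection[OF z v] by linarith
    qed
    have b2: "norm (I (\<lambda>x. R x * (p x - n x))) \<le> (1/2) * ?X + c * C3"
    proof -
      have "norm (I (\<lambda>x. R x * (p x - n x))) \<le> I (\<lambda>x. norm (R x * (p x - n x)))" by (rule integral_norm_bound)
      also have "\<dots> \<le> (1/2) * ?X + c * I (q L 2 3)"
      proof (rule I_le2)
        fix x
        have "norm (p x - n x) \<le> norm (p x) + m * m" using norm_triangle_ineq4[of "p x" "n x"] n_le[of x] by linarith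
        then have "norm (R x * (p x - n x)) \<le> (K * q L (N - 2) 3 x) * (norm (p x) + m * m)" by (intro norm_mult_le Rle)
        also have "\<dots> = K * q L (N - 2) 3 x * norm (p x) + (K * (m * m)) * q L (N - 2) 3 x" by (simp add: algebra_simps)
        also have "(K * (m * m)) * q L (N - 2) 3 x \<le> (K * (m * m)) * q L 2 3 x"
          using K by (intro mult_left_mono q_mono L) auto
        also have "K * q L (N - 2) 3 x * norm (p x) \<le> (1/2) * (q L N 2 x * (M x * (norm (E x))\<^sup>2)) + (K * Cg * (1 + 2 * K) ^ (k + 1)) * q L 2 3 x"
          by (rule energy_pointwise[OF L K])
        finally show "norm (R x * (p x - n x)) \<le> (1/2) * (q L N 2 x * (M x * (norm (E x))\<^sup>2)) + c * q L 2 3 x"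
          unfolding c_def by (simp add: algebra_simps power2_eq_square)
      qed (intro continuous_intros ct cR supp_map(1) supp_mult(1) vR v q_supp L | simp)+
      also have "c * I (q L 2 3) \<le> c * C3"
        using K Cg m_nonneg unfolding c_def by (intro mult_left_mono C3 L1) auto
      finally show ?thesis by simp
    qed
    have "?X = Re (I (\<lambda>x. complex_of_real (q L N 2 x) * (E x * n x))) - Re (I (\<lambda>x. R x * (p x - n x)))"
      using w0 unfolding split by simp
    then have "?X \<le> m ^ 3 * (K1 * C3) + ((1/2) * ?X + c * C3)"
      using b1 order_trans[OF abs_Re_le_cmod b2] by linarith
    then show ?thesis by (simp add: algebra_simps)
  qed
  moreover have "2 * ((c + m ^ 3 * K1) * C3) \<ge> 0" 
    unfolding c_def using K Cg m_nonneg K0 C3(1) by simp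
  ultimately show ?thesis by blast
qed

end

section \<open>Decay of the second differences\<close>

context flow_growth begin

abbreviation "m' \<equiv> N + 3"

lemma D_sq_le: "(D s x)\<^sup>2 \<le> 2 * D2 s x"
proof -
  have "0 \<le> (norm (dq s 1 E x) - norm (dq s 2 E x))\<^sup>2" by simp
  then show ?thesis unfolding D_def D2_def by (simp add: power2_diff power2_sum)
qed

definition "H2 x = (norm (f' 1 x))\<^sup>2 + (norm (f' 2 x))\<^sup>2"

lemma H_sq_le: "(H x)\<^sup>2 \<le> 2 * H2 x"
proof -
  have "0 \<le> (norm (f' 1 x) - norm (f' 2 x))\<^sup>2" by simp
  then show ?thesis unfolding H_def H2_def by (simp add: power2_diff power2_sum)
qed

lemma H2_cont: "continuous_on UNIV H2" unfolding H2_def[abs_def] by (intro continuous_intros cts)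
lemma D2_nonneg: "D2 s x \<ge> 0" unfolding D2_def by simp
lemma H2_nonneg: "H2 x \<ge> 0" unfolding H2_def by simp

text \<open>The stress is linear in E for small E, so the energy density controls it only up to a constant.\<close>
lemma p_norm_le: "norm (p x) \<le> Cg * 2 ^ k + M x * (norm (E x))\<^sup>2"
proof (cases "norm (E x) \<le> 1")
  case True
  have "M x * norm (E x) \<le> M x * 1" using True M_pos[of x] by (intro mult_left_mono) auto
  also have "\<dots> \<le> Cg * (1 + norm (E x)) ^ k" using growth[of x] by simp
  also have "\<dots> \<le> Cg * 2 ^ k" using True Cg by (intro mult_left_mono power_mono) auto
  finally show ?thesis unfolding p_norm using M_pos[of x] by (smt (verit) mult_nonneg_nonneg zero_le_power2)
next
  case False
  have "M x * norm (E x) \<le> M x * (norm (E x))\<^sup>2"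
  proof (rule mult_left_mono)
    have "norm (E x) * 1 \<le> norm (E x) * norm (E x)" using False by (intro mult_left_mono) auto
    then show "norm (E x) \<le> (norm (E x))\<^sup>2" by (simp add: power2_eq_square)
  qed (use M_pos[of x] in simp)
  then show ?thesis unfolding p_norm using Cg by (smt (verit) mult_nonneg_nonneg zero_le_power)
qed


text \<open>Young's inequality, with the weight split so that the factor X gets one power of \<open>lam\<close> more than the weight on the left and Y one less.\<close>
lemma weight_young:
  assumes "X \<ge> 0" "Y \<ge> 0"
  shows "c * (q L (Suc a) (b + b') x * (X * Y)) \<le> q L (a + 2) b x * X\<^sup>2 / 4 + c\<^sup>2 * (q L a (b + 2 * b') x * Y\<^sup>2)"
proof -
  let ?l = "lam L x" and ?r = "rho x"
  have w: "?l ^ a * ?r ^ b \<ge> 0" using lam_nonneg[of L x] rho_pos[of x] by simp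
  have "c * (q L (Suc a) (b + b') x * (X * Y)) = (?l ^ a * ?r ^ b) * (c * ((?l * X) * (?r ^ b' * Y)))"
    unfolding q_def by (simp add: power_add mult_ac)
  also have "\<dots> \<le> (?l ^ a * ?r ^ b) * ((?l * X)\<^sup>2 / 4 + c\<^sup>2 * (?r ^ b' * Y)\<^sup>2)"
    by (intro mult_left_mono young w)
  also have "\<dots> = q L (a + 2) b x * X\<^sup>2 / 4 + c\<^sup>2 * (q L a (b + 2 * b') x * Y\<^sup>2)"
    unfolding q_def by (simp add: power_add power_mult_distrib power2_eq_square power_mult algebra_simps)
  finally show ?thesis .
qed

lemma hess_weight:
  assumes "c \<ge> 0"
  shows "c * (q L (m' - 2) 2 x * H x) \<le> q L (m' - 1) 1 x * H2 x / 2 + c\<^sup>2 * q L N 3 x"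
proof -
  have e: "m' - 2 = Suc N" "m' - 1 = N + 2" by simp_all
  have "c * (q L (Suc N) (1 + 1) x * (H x * 1)) \<le> q L (N + 2) 1 x * (H x)\<^sup>2 / 4 + c\<^sup>2 * (q L N (1 + 2 * 1) x * 1\<^sup>2)"
    by (rule weight_young) (simp_all add: H_nonneg)
  moreover have "q L (N + 2) 1 x * (H x)\<^sup>2 \<le> q L (N + 2) 1 x * (2 * H2 x)"
    by (intro mult_left_mono H_sq_le q_nonneg)
  ultimately show ?thesis unfolding e by (simp add: numeral_eq_Suc)
qed

lemma lam_young: "0 \<le> (l::real) \<Longrightarrow> l ^ (a + 2) * d \<le> l ^ (a + 4) * d\<^sup>2 / 2 + l ^ a / 2"
proof -
  assume l: "0 \<le> l"
  have "0 \<le> l ^ a * (l\<^sup>2 * d - 1)\<^sup>2" using l by simp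
  also have "\<dots> = l ^ (a + 4) * d\<^sup>2 - 2 * (l ^ (a + 2) * d) + l ^ a"
    by (simp add: power_add power2_eq_square power4_eq_xxxx algebra_simps)
  finally show ?thesis by simp
qed

text \<open>The bookkeeping of the next proof, with X the weighted square of the differences times c0/2 and Y a sixteenth of the square times c0; stated for bare numbers to keep linear arithmetic away from the terms.\<close>
lemma combine_estimates:
  "Q / 2 + X \<le> x1 + x2 + x3 + x4 + x5 \<Longrightarrow> x1 \<le> 1/2 * Q + y1 \<Longrightarrow> x2 \<le> y2 \<Longrightarrow> x3 \<le> y3 \<Longrightarrow> x4 \<le> z + y4 \<Longrightarrow>
   x5 \<le> Y + y5 \<Longrightarrow> z \<le> Y + y6 + y7 + y8 \<Longrightarrow> X \<le> Y + Y + (y1 + y2 + y3 + y4 + y6 + y7 + y8 + (y5::real))"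
  by linarith

text \<open>Every term on the right of \<open>second_order_inequality\<close> is either bounded by a multiple of \<open>1/L\<close> or absorbed into the left hand side.
The constants are independent of L; the threshold for s is not, which is harmless as s tends to zero first.\<close>
lemma second_order_decay: "\<exists>C. \<forall>L\<ge>1. \<forall>\<^sub>F s in at_right 0. I (\<lambda>x. q L m' 0 x * D2 s x) \<le> C / L"
proof -
  obtain C3 where C3: "C3 \<ge> 0" "\<And>L. L \<ge> 1 \<Longrightarrow> I (q L 2 3) \<le> C3" using I_q3 by blast
  obtain Cq where Cq: "Cq \<ge> 0" "\<And>L. L \<ge> 1 \<Longrightarrow> I (q L 2 2) \<le> Cq * L" using I_q2 by blast
  obtain CE where CE: "CE \<ge> 0" "\<And>L. L \<ge> 1 \<Longrightarrow> I (\<lambda>x. q L N 2 x * (M x * (norm (E x))\<^sup>2)) \<le> CE" using energy by blast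
  define \<kappa>0 where "\<kappa>0 = 2 * real m' + 4"
  define K where "K = \<kappa>0 ^ 3"
  define K6 where "K6 = 6 * K"
  define Cp where "Cp = Cg * 2 ^ k"
  \<comment> \<open>35 from \<open>Tn_limit\<close>; the bracket comes from the three parts of B.\<close>
  define K7 where "K7 = 35 * K6 * (2 * m + m\<^sup>2 + m ^ 3)"
  define ch where "ch = 2 * m * \<kappa>0"
  define cd where "cd = 2 * m * K7"
  have k0: "\<kappa>0 \<ge> 1" unfolding \<kappa>0_def by simp
  have kp: "\<kappa>0 \<le> K" "\<kappa>0 ^ 2 \<le> K" unfolding K_def using power_increasing[of 1 3 \<kappa>0] power_increasing[of 2 3 \<kappa>0] k0 by auto
  have K: "K \<ge> 1" "K6 \<ge> 0" using kp k0 unfolding K6_def by linarith+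
  have m0: "m \<ge> 0" by (rule m_nonneg)
  have Cp: "Cp \<ge> 0" unfolding Cp_def using Cg by simp
  have K7: "K7 \<ge> 0" unfolding K7_def using K m0 by simp
  have cd: "cd \<ge> 0" "ch \<ge> 0" unfolding cd_def ch_def using K7 m0 k0 by auto
  define CC where "CC = 36 * K6\<^sup>2 * CE + K6 * CE + m * K6 * (Cp * C3 + CE) + K7 * C3 + 8 * cd\<^sup>2 / c0 * Cq + 2 * K7 * ch\<^sup>2 * C3 + 2"
  have CC0: "CC \<ge> 0" unfolding CC_def using K CE(1) m0 Cp C3(1) K7 Cq(1) c0(1) by simp
  have "\<forall>\<^sub>F s in at_right 0. I (\<lambda>x. q L m' 0 x * D2 s x) \<le> (4 * CC / c0) / L" if L1: "L \<ge> 1" for L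
  proof -
    have L: "L > 0" using L1 by simp
    have L2: "1 / L\<^sup>2 \<le> 1 / L" using L1 by (simp add: power2_eq_square divide_simps)
    have vq: "vanishes_outside_ball (q L a b)" if "a > 0" for a b using q_supp[OF L that] .
    define h where "h = 2 * real m' / L"
    have h0: "h \<ge> 0" "h \<le> \<kappa>0 / L" unfolding h_def \<kappa>0_def using L by (auto simp: divide_right_mono)
    have hK: "h \<le> K / L" by (rule order_trans[OF h0(2)]) (use kp L in \<open>simp add: divide_right_mono\<close>)
    define A where "A x = h * q L (m' - 1) 2 x" for x
    define B where "B x = h * tq L (m' - 1) 2 x" for x
    define G where "G x = h * ((2 * real (m' - 1) / L) * tq L (m' - 2) 4 x + real 2 * tq L (m' - 1) 4 x)" for x
    have etaC: "C1 (q L m' 0) (\<lambda>j x. - (x $ j * A x))"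
      by (rule C1_cong[OF C1_q'[OF L]]) (simp_all add: tq_def A_def h_def numeral_eq_Suc)
    have AC: "C1 A (\<lambda>j x. - (x $ j * B x))" unfolding A_def[abs_def] B_def
      by (rule C1_cong[OF C1_bl[OF C1_q'[OF L] bounded_linear_mult_right]]) simp_all
    have BC: "C1 B (\<lambda>j x. - (x $ j * G x))" unfolding B_def[abs_def] G_def
      by (rule C1_cong[OF C1_bl[OF C1_tq[OF L] bounded_linear_mult_right]]) simp_all
    have A0: "A x \<ge> 0" and B0: "B x \<ge> 0" and G0: "G x \<ge> 0" for x
      unfolding A_def B_def G_def using h0(1) q_nonneg tq_nonneg[OF L] L by auto
    have Ale: "A x \<le> (K / L) * q L (m' - 1) 2 x" for x
      unfolding A_def by (intro mult_right_mono q_nonneg hK)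
    have Ble: "B x \<le> (K / L) * q L (m' - 2) 4 x" for x
    proof -
      have "tq L (m' - 1) 2 x \<le> \<kappa>0 * q L (m' - 2) 4 x"
      proof -
        have "tq L (m' - 1) 2 x \<le> (2 * real (m' - 1) + 2) * q L (m' - 2) 4 x" using tq_le[OF L1, of "m' - 1" 2 x] by (simp add: numeral_eq_Suc)
        also have "\<dots> \<le> \<kappa>0 * q L (m' - 2) 4 x" unfolding \<kappa>0_def by (intro mult_right_mono q_nonneg) simp
        finally show ?thesis .
      qed
      then have "B x \<le> (\<kappa>0 / L) * (\<kappa>0 * q L (m' - 2) 4 x)"
        unfolding B_def using h0 tq_nonneg[OF L] L k0 by (intro mult_mono) auto
      also have "\<dots> = (\<kappa>0 ^ 2 / L) * q L (m' - 2) 4 x" by (simp add: power2_eq_square)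
      also have "\<dots> \<le> (K / L) * q L (m' - 2) 4 x" using kp L by (intro mult_right_mono divide_right_mono q_nonneg) auto
      finally show ?thesis .
    qed
    have Gle: "G x \<le> (K / L) * q L N 6 x" for x
    proof -
      have t1: "tq L (m' - 2) 4 x \<le> \<kappa>0 * q L N 6 x"
      proof -
        have "tq L (m' - 2) 4 x \<le> (2 * real (m' - 2) + 4) * q L N 6 x" using tq_le[OF L1, of "m' - 2" 4 x] by (simp add: numeral_eq_Suc)
        also have "\<dots> \<le> \<kappa>0 * q L N 6 x" unfolding \<kappa>0_def by (intro mult_right_mono q_nonneg) simp
        finally show ?thesis .
      qed
      have t2: "tq L (m' - 1) 4 x \<le> \<kappa>0 * q L N 6 x"
      proof -
        have "tq L (m' - 1) 4 x \<le> (2 * real (m' - 1) + 4) * q L (m' - 2) 6 x" using tq_le[OF L1, of "m' - 1" 4 x] by (simp add: numeral_eq_Suc)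
        also have "\<dots> \<le> \<kappa>0 * q L N 6 x" unfolding \<kappa>0_def by (intro mult_mono q_mono L q_nonneg) auto
        finally show ?thesis .
      qed
      have d: "2 * real (m' - 1) / L \<le> 2 * real (m' - 1)" using L1 by (simp add: divide_le_eq mult_le_cancel_left1)
      have "(2 * real (m' - 1) / L) * tq L (m' - 2) 4 x + real 2 * tq L (m' - 1) 4 x \<le> (2 * real (m' - 1)) * (\<kappa>0 * q L N 6 x) + 2 * (\<kappa>0 * q L N 6 x)"
        using d t1 t2 tq_nonneg[OF L] by (intro add_mono mult_mono) auto
      also have "\<dots> = (2 * real (m' - 1) + 2) * (\<kappa>0 * q L N 6 x)" by (simp add: distrib_right)
      also have "\<dots> \<le> \<kappa>0 * (\<kappa>0 * q L N 6 x)" using k0 q_nonneg[of L N 6 x] by (intro mult_right_mono) (auto simp: \<kappa>0_def)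
      finally have "G x \<le> (\<kappa>0 / L) * (\<kappa>0 * (\<kappa>0 * q L N 6 x))"
        unfolding G_def using h0 tq_nonneg[OF L] L k0 by (intro mult_mono) auto
      also have "\<dots> = (K / L) * q L N 6 x" unfolding K_def by (simp add: power3_eq_cube)
      finally show ?thesis .
    qed
    let ?e = "rad_e A" and ?e' = "rad_e' A B" and ?e'' = "rad_e'' B G" and ?S' = "rad_S' B G"
    have nm: "N + 1 + 2 = m'" by simp
    have KL: "K / L \<ge> 0" "K6 / L \<ge> 0" using K L by auto
    have e_le: "norm (?e x) \<le> (K / L) * q L (m' - 1) 1 x" for x
    proof -
      have "norm (?e x) \<le> norm x * ((K / L) * q L (m' - 1) (Suc 1) x)"
        unfolding norm_rad_e[OF A0] using Ale[of x] by (intro mult_left_mono) (simp_all add: numeral_eq_Suc)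
      also have "\<dots> = (K / L) * (norm x * q L (m' - 1) (Suc 1) x)" by simp
      also have "\<dots> \<le> (K / L) * q L (m' - 1) 1 x" by (intro mult_left_mono norm_q KL)
      finally show ?thesis .
    qed
    have x2: "norm x * (norm x * q L a (b + 2) x) \<le> q L a b x" for a b x
    proof -
      have "norm x * (norm x * q L a (Suc (Suc b)) x) \<le> norm x * q L a (Suc b) x" by (intro mult_left_mono norm_q) simp
      also have "\<dots> \<le> q L a b x" by (rule norm_q)
      finally show ?thesis by simp
    qed
    have B2le: "norm x * (norm x * B x) \<le> (K / L) * q L (m' - 2) 2 x" for x
    proof -
      have "norm x * (norm x * B x) \<le> norm x * (norm x * ((K / L) * q L (m' - 2) (2 + 2) x))"
        using Ble[of x] by (intro mult_left_mono) (simp_all add: numeral_eq_Suc)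
      also have "\<dots> = (K / L) * (norm x * (norm x * q L (m' - 2) (2 + 2) x))" by simp
      also have "\<dots> \<le> (K / L) * q L (m' - 2) 2 x" by (intro mult_left_mono x2 KL)
      finally show ?thesis .
    qed
    have e'_le: "norm (?e' 1 x) + norm (?e' 2 x) \<le> (K6 / L) * q L (m' - 2) 2 x" for x
    proof -
      have "A x \<le> (K / L) * q L (m' - 2) 2 x"
        using Ale[of x] mult_left_mono[OF q_mono[OF L, of "m' - 2" "m' - 1" 2 2 x] KL(1)] by simp
      then have "norm (?e' j x) \<le> 2 * ((K / L) * q L (m' - 2) 2 x)" for j
        using norm_rad_e'[of A x B j] A0[of x] B0[of x] B2le[of x] by simp
      from this[of 1] this[of 2] have "norm (?e' 1 x) + norm (?e' 2 x) \<le> 4 * ((K / L) * q L (m' - 2) 2 x)" by simp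
      also have "\<dots> \<le> 6 * ((K / L) * q L (m' - 2) 2 x)" by (rule mult_right_mono) (simp, intro mult_nonneg_nonneg KL q_nonneg)
      finally show ?thesis unfolding K6_def by simp
    qed
    have S'_le: "norm (?S' 1 x) + norm (?S' 2 x) \<le> (K6 / L) * q L N 3 x" for x
    proof -
      have b: "norm x * B x \<le> (K / L) * q L N 3 x"
      proof -
        have "norm x * B x \<le> norm x * ((K / L) * q L (m' - 2) (Suc 3) x)"
          using Ble[of x] by (intro mult_left_mono) (simp_all add: numeral_eq_Suc)
        also have "\<dots> = (K / L) * (norm x * q L (m' - 2) (Suc 3) x)" by simp
        also have "\<dots> \<le> (K / L) * q L (m' - 2) 3 x" by (intro mult_left_mono norm_q KL)
        also have "\<dots> \<le> (K / L) * q L N 3 x" by (intro mult_left_mono q_mono L KL) auto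
        finally show ?thesis .
      qed
      have g: "norm x * (norm x * (norm x * G x)) \<le> (K / L) * q L N 3 x"
      proof -
        have "norm x * (norm x * (norm x * G x)) \<le> norm x * (norm x * (norm x * ((K / L) * q L N (Suc 5) x)))"
          using Gle[of x] by (intro mult_left_mono) (simp_all add: numeral_eq_Suc)
        also have "\<dots> = (K / L) * (norm x * (norm x * (norm x * q L N (Suc 5) x)))" by simp
        also have "\<dots> \<le> (K / L) * (norm x * (norm x * q L N (3 + 2) x))"
          using norm_q[of x L N 5] KL by (intro mult_left_mono) (simp_all add: numeral_eq_Suc)
        also have "\<dots> \<le> (K / L) * q L N 3 x" by (intro mult_left_mono x2 KL)
        finally show ?thesis .
      qed
      have "norm (?S' j x) \<le> 3 * ((K / L) * q L N 3 x)" for j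
        using norm_rad_S'[of B x G j] B0[of x] G0[of x] b g by simp
      from this[of 1] this[of 2] show ?thesis unfolding K6_def by simp
    qed
    define w where "w x = (2 * K) * q L (m' - 2) 0 x" for x
    have wt: "weight w" unfolding weight_def w_def[abs_def]
      using K q_nonneg by (auto intro!: continuous_intros supp_mult(2) vq)
    have w1: "norm (2 * ?e x) \<le> w x" for x
    proof -
      have "K / L \<le> K" using K L1 by (simp add: divide_le_eq mult_le_cancel_left1)
      then have "(K / L) * q L (m' - 1) 1 x \<le> K * q L (m' - 2) 0 x"
        using K by (intro mult_mono q_mono L q_nonneg) auto
      then show ?thesis unfolding w_def using e_le[of x] by (simp add: norm_mult)
    qed
    have w2: "norm (rad_S B x) \<le> w x" for x
    proof -
      have "K / L \<le> K" using K L1 by (simp add: divide_le_eq mult_le_cancel_left1)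
      then have "(K / L) * q L (m' - 2) 2 x \<le> K * q L (m' - 2) 0 x"
        using K by (intro mult_mono q_mono L q_nonneg) auto
      moreover have "K * q L (m' - 2) 0 x \<ge> 0" using K q_nonneg by simp
      ultimately show ?thesis unfolding w_def norm_rad_S[OF B0] using B2le[of x] by linarith
    qed
    interpret fc: flow_cutoff \<psi> f f' M m c0 "q L m' 0" ?e ?e' ?e'' ?S' w
    proof
      show "C2 (q L m' 0) ?e ?e'" by (rule rad_C2[OF etaC AC])
      show "Im (?e' 1 x) = Re (?e' 2 x)" for x by (rule rad_curl)
      show "C1 (?e' k) (?e'' k)" for k by (rule rad_C1_e'[OF AC BC])
      show "C1 (dbar ?e') ?S'" unfolding rad_dbar by (rule rad_C1_S[OF BC])
      show "dbar (?e'' k) x = ?S' k x" for k x by (rule rad_dbar'')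
      show "vanishes_outside_ball (q L m' 0)" by (rule vq) simp
      show "q L m' 0 x \<ge> 0" for x by (rule q_nonneg)
      show "weight w" "\<And>x. norm (2 * ?e x) \<le> w x" "\<And>x. norm (dbar ?e' x) \<le> w x" using wt w1 w2 unfolding rad_dbar by auto
    qed
    define g where "g x = (1 / L) * q L (m' - 1) 1 x" for x
    have gC: "C1 g (\<lambda>j x. (1 / L) * - (x $ j * tq L (m' - 1) 1 x))" unfolding g_def[abs_def]
      by (rule C1_bl[OF C1_q'[OF L] bounded_linear_mult_right]) simp
    have vg: "vanishes_outside_ball g" unfolding g_def[abs_def] by (intro supp_mult(2) vq) simp
    have g0: "g x \<ge> 0" for x unfolding g_def using q_nonneg L by simp
    note ct = cts D2_cont H2_cont cts_H D_cont q_cont tq_cont C1_cont[OF gC] C1_cont'[OF gC]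
       C1_cont[OF fc.e_C1] C1_cont'[OF fc.e_C1] C1_cont'[OF fc.S_C1]
    let ?Q = "\<lambda>s. I (\<lambda>x. q L m' 0 x * (M x * D2 s x))" and ?A = "\<lambda>s. I (\<lambda>x. q L m' 0 x * D2 s x)"
    let ?EN = "\<lambda>x. q L N 2 x * (M x * (norm (E x))\<^sup>2)"
    have vEN: "vanishes_outside_ball ?EN" and cEN: "continuous_on UNIV ?EN"
      by (intro supp_mult(1) vq, simp) (intro continuous_intros ct)
    have IEN: "I ?EN \<le> CE" by (rule CE(2)[OF L1])
    have I3: "I (q L 2 3) \<le> C3" by (rule C3(2)[OF L1])
    have A_nonneg: "?A s \<ge> 0" for s by (rule integral_nonneg_AE) (simp add: q_nonneg D2_nonneg)
    \<comment> \<open>Stress against the first derivatives of the cutoff. The viscosity is kept on both sides of Young's inequality, so that half of the weighted square with viscosity and the energy suffice.\<close>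
    have i: "6 * I (\<lambda>x. norm (?e x) * (norm (p x) * D s x)) \<le> 1/2 * ?Q s + 36 * K6\<^sup>2 * CE / L" for s
    proof -
      have "I (\<lambda>x. norm (?e x) * (norm (p x) * D s x)) \<le> (1/12) * ?Q s + (6 * K6\<^sup>2 / L) * I ?EN"
      proof (rule I_le2)
        fix x
        let ?c = "6 * K / L"
        have "6 * (norm (?e x) * (norm (p x) * D s x)) \<le> 6 * (((K / L) * q L (m' - 1) 1 x) * (norm (p x) * D s x))"
          using e_le[of x] D_nonneg[of s x] by (intro mult_left_mono mult_right_mono) auto
        also have "\<dots> = M x * (?c * (q L (Suc (N + 1)) (0 + 1) x * (D s x * norm (E x))))"
          unfolding p_norm by (simp add: numeral_eq_Suc)
        also have "\<dots> \<le> M x * (q L (N + 1 + 2) 0 x * (D s x)\<^sup>2 / 4 + ?c\<^sup>2 * (q L (N + 1) (0 + 2 * 1) x * (norm (E x))\<^sup>2))"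
          using M_pos[of x] by (intro mult_left_mono weight_young D_nonneg) auto
        also have "\<dots> \<le> M x * (q L m' 0 x * (2 * D2 s x) / 4 + (36 * K6\<^sup>2 / L) * (q L N 2 x * (norm (E x))\<^sup>2))"
        proof (intro mult_left_mono add_mono)
          show "q L (N + 1 + 2) 0 x * (D s x)\<^sup>2 / 4 \<le> q L m' 0 x * (2 * D2 s x) / 4"
            unfolding nm by (intro divide_right_mono mult_left_mono D_sq_le q_nonneg) simp
          have "?c\<^sup>2 = 36 * K\<^sup>2 * (1 / L\<^sup>2)" by (simp add: power_divide power_mult_distrib)
          also have "\<dots> \<le> 36 * K6\<^sup>2 * (1 / L)"
            using L2 K power_mono[of K K6 2] unfolding K6_def by (intro mult_mono) auto
          finally have "?c\<^sup>2 \<le> 36 * K6\<^sup>2 / L" by simp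
          moreover have "q L (N + 1) (0 + 2 * 1) x \<le> q L N 2 x" by (rule q_mono[OF L]) auto
          ultimately show "?c\<^sup>2 * (q L (N + 1) (0 + 2 * 1) x * (norm (E x))\<^sup>2) \<le> (36 * K6\<^sup>2 / L) * (q L N 2 x * (norm (E x))\<^sup>2)"
            using L q_nonneg by (intro mult_mono) auto
        qed (use M_pos[of x] in simp)
        finally show "norm (?e x) * (norm (p x) * D s x) \<le> (1/12) * (q L m' 0 x * (M x * D2 s x)) + (6 * K6\<^sup>2 / L) * ?EN x"
          by (simp add: algebra_simps add_divide_distrib)
      qed (intro continuous_intros ct cEN vEN supp_mult(1) supp_map(1) fc.vs vq | simp)+
      moreover have "(6 * K6\<^sup>2 / L) * I ?EN \<le> (6 * K6\<^sup>2 / L) * CE" using L by (intro mult_left_mono IEN) auto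
      ultimately show ?thesis by simp
    qed
    \<comment> \<open>Second derivatives of the cutoff have the weight of the energy.\<close>
    have ii: "I (\<lambda>x. (norm (?e' 1 x) + norm (?e' 2 x)) * (norm (E x) * norm (p x))) \<le> K6 * CE / L"
    proof -
      have "I (\<lambda>x. (norm (?e' 1 x) + norm (?e' 2 x)) * (norm (E x) * norm (p x))) \<le> (K6 / L) * I ?EN + 0 * I ?EN"
      proof (rule I_le2)
        fix x
        have "(norm (?e' 1 x) + norm (?e' 2 x)) * (norm (E x) * norm (p x)) \<le> ((K6 / L) * q L (m' - 2) 2 x) * (norm (E x) * norm (p x))"
          by (intro mult_right_mono e'_le) auto
        also have "\<dots> \<le> ((K6 / L) * q L N 2 x) * (norm (E x) * norm (p x))"
          by (intro mult_right_mono mult_left_mono q_mono L KL) auto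
        finally show "(norm (?e' 1 x) + norm (?e' 2 x)) * (norm (E x) * norm (p x)) \<le> (K6 / L) * ?EN x + 0 * ?EN x"
          unfolding p_norm by (simp add: power2_eq_square mult_ac)
      qed (intro continuous_intros ct cEN vEN supp_mult(1) supp_add(1) supp_map(1) fc.vs)+
      moreover have "(K6 / L) * I ?EN \<le> (K6 / L) * CE" by (intro mult_left_mono IEN KL)
      ultimately show ?thesis by simp
    qed
    \<comment> \<open>Third derivatives of the cutoff meet the stress linearly; their weight \<open>rho^3\<close> is integrable uniformly in L.\<close>
    have iii: "m * I (\<lambda>x. (norm (?S' 1 x) + norm (?S' 2 x)) * norm (p x)) \<le> m * K6 * (Cp * C3 + CE) / L"
    proof -
      have "I (\<lambda>x. (norm (?S' 1 x) + norm (?S' 2 x)) * norm (p x)) \<le> (K6 / L * Cp) * I (q L 2 3) + (K6 / L) * I ?EN"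
      proof (rule I_le2)
        fix x
        have "(norm (?S' 1 x) + norm (?S' 2 x)) * norm (p x) \<le> ((K6 / L) * q L N 3 x) * (Cp + M x * (norm (E x))\<^sup>2)"
          unfolding Cp_def by (intro mult_mono S'_le p_norm_le mult_nonneg_nonneg KL q_nonneg norm_ge_zero)
        also have "\<dots> = (K6 / L * Cp) * q L N 3 x + (K6 / L) * (q L N 3 x * (M x * (norm (E x))\<^sup>2))" by (simp add: algebra_simps add_divide_distrib)
        also have "\<dots> \<le> (K6 / L * Cp) * q L 2 3 x + (K6 / L) * ?EN x"
          by (intro add_mono mult_left_mono mult_right_mono q_mono L mult_nonneg_nonneg KL Cp zero_le_power2 less_imp_le[OF M_pos]) auto
        finally show "(norm (?S' 1 x) + norm (?S' 2 x)) * norm (p x) \<le> (K6 / L * Cp) * q L 2 3 x + (K6 / L) * ?EN x" .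
      qed (intro continuous_intros ct cEN vEN supp_mult(1) supp_add(1) supp_map(1) fc.vs vq | simp)+
      also have "\<dots> \<le> (K6 / L * Cp) * C3 + (K6 / L) * CE"
        by (intro add_mono mult_left_mono IEN I3 mult_nonneg_nonneg KL Cp)
      finally have "m * I (\<lambda>x. (norm (?S' 1 x) + norm (?S' 2 x)) * norm (p x)) \<le> m * ((K6 / L * Cp) * C3 + (K6 / L) * CE)"
        using m0 by (rule mult_left_mono)
      then show ?thesis by (simp add: algebra_simps add_divide_distrib)
    qed
    \<comment> \<open>The convective remainder is controlled by the weighted squares of the second derivatives of the stream function.\<close>
    have iv: "35 * I fc.B \<le> K7 * I (\<lambda>x. g x * H2 x) + K7 * C3 / L"
    proof -
      have "I fc.B \<le> (K7 / 35) * I (\<lambda>x. g x * H2 x) + (K7 / 35 / L) * I (q L 2 3)"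
      proof (rule I_le2)
        fix x
        have b1: "fc.B1 x \<le> (2 * m * K6) * (g x * H2 x)"
        proof -
          have "fc.B1 x \<le> m * ((K / L) * q L (m' - 1) 1 x) * (2 * H2 x)"
            unfolding fc.B1_def by (intro mult_mono e_le H_sq_le mult_nonneg_nonneg m0 KL q_nonneg order_refl norm_ge_zero zero_le_power2)
          also have "\<dots> = (2 * m * K) * (g x * H2 x)" unfolding g_def by simp
          also have "\<dots> \<le> (2 * m * K6) * (g x * H2 x)"
            using m0 K g0[of x] H2_nonneg[of x] unfolding K6_def by (intro mult_right_mono) (auto simp: mult_left_mono)
          finally show ?thesis .
        qed
        have b2: "fc.B2 x \<le> (m\<^sup>2 * K6) * (g x * H2 x) + (m\<^sup>2 * K6 / L) * q L 2 3 x"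
        proof -
          have "fc.B2 x \<le> m\<^sup>2 * ((K6 / L) * q L (m' - 2) 2 x) * H x"
            unfolding fc.B2_def using m0 by (intro mult_right_mono mult_left_mono e'_le H_nonneg) auto
          also have "\<dots> = (m\<^sup>2 * (K6 / L)) * (1 * (q L (m' - 2) 2 x * H x))" by simp
          also have "\<dots> \<le> (m\<^sup>2 * (K6 / L)) * (q L (m' - 1) 1 x * H2 x / 2 + 1\<^sup>2 * q L N 3 x)"
            by (intro mult_left_mono hess_weight mult_nonneg_nonneg KL zero_le_power m0) simp
          also have "\<dots> \<le> (m\<^sup>2 * (K6 / L)) * (q L (m' - 1) 1 x * H2 x + q L 2 3 x)"
          proof (rule mult_left_mono)
            have "0 \<le> q L (m' - 1) 1 x * H2 x" by (intro mult_nonneg_nonneg q_nonneg H2_nonneg)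
            moreover have "q L N 3 x \<le> q L 2 3 x" by (intro q_mono L) simp_all
            ultimately show "q L (m' - 1) 1 x * H2 x / 2 + 1\<^sup>2 * q L N 3 x \<le> q L (m' - 1) 1 x * H2 x + q L 2 3 x" by simp
          qed (intro mult_nonneg_nonneg KL zero_le_power m0)
          finally show ?thesis unfolding g_def by (simp add: algebra_simps add_divide_distrib)
        qed
        have b3: "fc.B3 x \<le> (m ^ 3 * K6 / L) * q L 2 3 x"
        proof -
          have "fc.B3 x \<le> m ^ 3 * ((K6 / L) * q L N 3 x)"
            unfolding fc.B3_def using m0 by (intro mult_left_mono S'_le) auto
          also have "\<dots> \<le> m ^ 3 * ((K6 / L) * q L 2 3 x)"
            by (intro mult_left_mono q_mono L KL zero_le_power m0) simp_all
          finally show ?thesis by simp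
        qed
        have n1: "0 \<le> (m ^ 3 * K6) * (g x * H2 x)" by (intro mult_nonneg_nonneg zero_le_power m0 K(2) g0 H2_nonneg)
        have n2: "0 \<le> (2 * m * K6 / L) * q L 2 3 x" by (intro mult_nonneg_nonneg divide_nonneg_pos m0 K(2) q_nonneg L) simp
        have e1: "K7 / 35 = 2 * m * K6 + m\<^sup>2 * K6 + m ^ 3 * K6" unfolding K7_def by (simp add: algebra_simps)
        have e2: "K7 / 35 / L = 2 * m * K6 / L + m\<^sup>2 * K6 / L + m ^ 3 * K6 / L" unfolding e1 by (simp only: add_divide_distrib)
        show "fc.B x \<le> (K7 / 35) * (g x * H2 x) + (K7 / 35 / L) * q L 2 3 x"
          using b1 b2 b3 n1 n2 unfolding fc.B_def e2 unfolding e1 distrib_right by linarith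
      qed (intro continuous_intros ct fc.B_cont fc.B_supp supp_mult(1) vg vq | simp)+
      moreover have "(K7 / L) * I (q L 2 3) \<le> (K7 / L) * C3" using K7 L by (intro mult_left_mono I3) auto
      ultimately show ?thesis by simp
    qed
    \<comment> \<open>These squares are in turn controlled by differences of E. The tolerance is chosen so that, multiplied by 2 K7, it stays below 1/L.\<close>
    define \<epsilon>1 where "\<epsilon>1 = (1 / L) / (2 * (K7 + 1))"
    have e1: "\<epsilon>1 > 0" "2 * K7 * \<epsilon>1 \<le> 1 / L" 
    proof -
      show "\<epsilon>1 > 0" unfolding \<epsilon>1_def using K7 L by simp
      have "2 * (K7 + 1) \<noteq> 0" using K7 by simp
      then have "\<epsilon>1 * (2 * (K7 + 1)) = 1 / L" unfolding \<epsilon>1_def by (metis nonzero_divide_eq_eq)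
      moreover have "\<epsilon>1 * (2 * K7) \<le> \<epsilon>1 * (2 * (K7 + 1))" using \<open>\<epsilon>1 > 0\<close> by (intro mult_left_mono) auto
      ultimately show "2 * K7 * \<epsilon>1 \<le> 1 / L" by (simp add: mult_ac)
    qed
    have v: "\<forall>\<^sub>F s in at_right 0. I (\<lambda>x. g x * H2 x) \<le> 2 * m * I (\<lambda>x. g x * D s x) + 2 * ch\<^sup>2 * C3 / L + 2 * \<epsilon>1"
      using hessian_bound[OF gC vg g0 e1(1)]
    proof eventually_elim
      case (elim s)
      let ?gr = "\<lambda>x. (\<bar>(1 / L) * - (x $ 1 * tq L (m' - 1) 1 x)\<bar> + \<bar>(1 / L) * - (x $ 2 * tq L (m' - 1) 1 x)\<bar>) * H x"
      have "I (\<lambda>x. m * ?gr x) \<le> (1/2) * I (\<lambda>x. g x * H2 x) + (ch\<^sup>2 / L) * I (q L 2 3)"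
      proof (rule I_le2)
        fix x :: plane
        have t: "\<bar>(1 / L) * - (x $ j * tq L (m' - 1) 1 x)\<bar> \<le> (\<kappa>0 / L) * q L (m' - 2) 2 x" for j
        proof -
          have "\<bar>(1 / L) * - (x $ j * tq L (m' - 1) 1 x)\<bar> = (1 / L) * (\<bar>x $ j\<bar> * tq L (m' - 1) 1 x)"
            using L tq_nonneg[OF L] by (simp add: abs_mult)
          also have "\<dots> \<le> (1 / L) * (norm x * (\<kappa>0 * q L (m' - 2) (Suc 2) x))"
          proof (intro mult_left_mono mult_mono abs_coord)
            have "tq L (m' - 1) 1 x \<le> (2 * real (m' - 1) + 1) * q L (m' - 2) (Suc 2) x" using tq_le[OF L1, of "m' - 1" 1 x] by (simp add: numeral_eq_Suc)
            also have "\<dots> \<le> \<kappa>0 * q L (m' - 2) (Suc 2) x" unfolding \<kappa>0_def by (intro mult_right_mono q_nonneg) simp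
            finally show "tq L (m' - 1) 1 x \<le> \<kappa>0 * q L (m' - 2) (Suc 2) x" .
          qed (use L tq_nonneg[OF L] in auto)
          also have "\<dots> = (\<kappa>0 / L) * (norm x * q L (m' - 2) (Suc 2) x)" by simp
          also have "\<dots> \<le> (\<kappa>0 / L) * q L (m' - 2) 2 x" using k0 L by (intro mult_left_mono norm_q) auto
          finally show ?thesis .
        qed
        have "m * ?gr x \<le> m * (((\<kappa>0 / L) * q L (m' - 2) 2 x + (\<kappa>0 / L) * q L (m' - 2) 2 x) * H x)"
          by (intro mult_left_mono mult_right_mono add_mono t H_nonneg m0)
        also have "\<dots> = (1 / L) * (ch * (q L (m' - 2) 2 x * H x))" unfolding ch_def by simp
        also have "\<dots> \<le> (1 / L) * (q L (m' - 1) 1 x * H2 x / 2 + ch\<^sup>2 * q L N 3 x)"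
          using L cd by (intro mult_left_mono hess_weight) auto
        also have "\<dots> \<le> (1 / L) * (q L (m' - 1) 1 x * H2 x / 2 + ch\<^sup>2 * q L 2 3 x)"
          using L by (intro mult_left_mono add_left_mono q_mono) auto
        finally show "m * ?gr x \<le> (1/2) * (g x * H2 x) + (ch\<^sup>2 / L) * q L 2 3 x"
          unfolding g_def by (simp add: algebra_simps add_divide_distrib)
      next
        have vd: "vanishes_outside_ball (\<lambda>x. (1 / L) * - (x $ j * tq L (m' - 1) 1 x))" for j
          by (rule supp_deriv[OF gC vg])
        show "vanishes_outside_ball (\<lambda>x. m * ?gr x)"
          by (rule supp_mult(2), rule supp_mult(1), intro supp_add(1) supp_map(8) vd)
      qed (intro continuous_intros ct supp_mult(1) vg vq | simp)+
      moreover have "(ch\<^sup>2 / L) * I (q L 2 3) \<le> (ch\<^sup>2 / L) * C3" using L by (intro mult_left_mono I3) auto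
      ultimately have "m * I ?gr \<le> (1/2) * I (\<lambda>x. g x * H2 x) + ch\<^sup>2 * C3 / L" by simp
      then show ?case using elim unfolding H2_def[symmetric] by simp
    qed
    \<comment> \<open>The linear term in the differences is absorbed; the remainder has size L in the integral against 1/L^2 in front.\<close>
    have vi: "K7 * (2 * m * I (\<lambda>x. g x * D s x)) \<le> c0 / 16 * ?A s + 8 * cd\<^sup>2 / c0 * Cq / L" for s
    proof -
      have "I (\<lambda>x. cd * (g x * D s x)) \<le> (c0 / 16) * ?A s + (8 * cd\<^sup>2 / c0 / L\<^sup>2) * I (q L 2 2)"
      proof (rule I_le2)
        fix x
        let ?c = "8 * cd / (c0 * L)"
        have "?c * (q L (Suc (N + 1)) (0 + 1) x * (D s x * 1)) \<le> q L (N + 1 + 2) 0 x * (D s x)\<^sup>2 / 4 + ?c\<^sup>2 * (q L (N + 1) (0 + 2 * 1) x * 1\<^sup>2)"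
          by (rule weight_young) (simp_all add: D_nonneg)
        also have "\<dots> \<le> q L m' 0 x * (2 * D2 s x) / 4 + ?c\<^sup>2 * q L 2 2 x"
        proof (rule add_mono)
          show "q L (N + 1 + 2) 0 x * (D s x)\<^sup>2 / 4 \<le> q L m' 0 x * (2 * D2 s x) / 4"
            unfolding nm by (intro divide_right_mono mult_left_mono D_sq_le q_nonneg) simp
          show "?c\<^sup>2 * (q L (N + 1) (0 + 2 * 1) x * 1\<^sup>2) \<le> ?c\<^sup>2 * q L 2 2 x"
          proof (rule mult_left_mono)
            have "q L (N + 1) (0 + 2 * 1) x \<le> q L 2 2 x" by (rule q_mono[OF L]) simp_all
            then show "q L (N + 1) (0 + 2 * 1) x * 1\<^sup>2 \<le> q L 2 2 x" by (simp only: power_one mult_1_right)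
          qed simp
        qed
        finally have "(c0 / 8) * (?c * (q L (m' - 1) 1 x * D s x)) \<le> (c0 / 8) * (q L m' 0 x * (2 * D2 s x) / 4 + ?c\<^sup>2 * q L 2 2 x)"
          using c0(1) by (intro mult_left_mono) (simp_all add: numeral_eq_Suc)
        moreover have "(c0 / 8) * (?c * (q L (m' - 1) 1 x * D s x)) = cd * (g x * D s x)"
          unfolding g_def using c0(1) L by (simp add: field_simps)
        moreover have "(c0 / 8) * (q L m' 0 x * (2 * D2 s x) / 4 + ?c\<^sup>2 * q L 2 2 x) = (c0 / 16) * (q L m' 0 x * D2 s x) + (8 * cd\<^sup>2 / c0 / L\<^sup>2) * q L 2 2 x"
          using c0(1) L by (simp add: field_simps power2_eq_square)
        ultimately show "cd * (g x * D s x) \<le> (c0 / 16) * (q L m' 0 x * D2 s x) + (8 * cd\<^sup>2 / c0 / L\<^sup>2) * q L 2 2 x" by linarith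
      qed (intro continuous_intros ct supp_mult(2)[OF supp_mult(1)[OF vg]] supp_mult(1) vq | simp)+
      also have "(8 * cd\<^sup>2 / c0 / L\<^sup>2) * I (q L 2 2) \<le> (8 * cd\<^sup>2 / c0 / L\<^sup>2) * (Cq * L)"
        using c0(1) by (intro mult_left_mono Cq(2) L1) auto
      also have "(8 * cd\<^sup>2 / c0 / L\<^sup>2) * (Cq * L) = 8 * cd\<^sup>2 / c0 * Cq / L" using L by (simp add: power2_eq_square)
      finally have "cd * I (\<lambda>x. g x * D s x) \<le> c0 / 16 * ?A s + 8 * cd\<^sup>2 / c0 * Cq / L" by simp
      moreover have "K7 * (2 * m * I (\<lambda>x. g x * D s x)) = cd * I (\<lambda>x. g x * D s x)" unfolding cd_def by simp
      ultimately show ?thesis by (simp only:)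
    qed
    \<comment> \<open>The reference size of the errors is bounded by the square to be estimated, with a constant depending on L; the tolerance \<open>\<epsilon>\<close> is fixed afterwards.\<close>
    define \<kappa>1 where "\<kappa>1 = 1 + K * I (q L (m' - 4) 0)"
    have k1: "\<kappa>1 \<ge> 1" unfolding \<kappa>1_def using K integral_nonneg_AE[of "q L (m' - 4) 0" lborel] q_nonneg by simp
    have vii: "\<kappa> w s \<le> \<kappa>1 + 2 * K * ?A s" for s
    proof -
      have "I (\<lambda>x. w x * D s x) \<le> (2 * K) * ?A s + K * I (q L (m' - 4) 0)"
      proof (rule I_le2)
        fix x
        let ?l = "lam L x"
        have "?l ^ (N + 1) * D s x \<le> ?l ^ (N + 3) * (D s x)\<^sup>2 / 2 + ?l ^ (N - 1) / 2"
        proof -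
          have n: "N - 1 + 2 = N + 1" "N - 1 + 4 = N + 3" by simp_all
          show ?thesis using lam_young[OF lam_nonneg, of L x "N - 1" "D s x"] unfolding n .
        qed
        also have "?l ^ (N + 3) * (D s x)\<^sup>2 / 2 \<le> ?l ^ (N + 3) * (2 * D2 s x) / 2"
          using lam_nonneg[of L x] by (intro divide_right_mono mult_left_mono D_sq_le) auto
        finally have "(2 * K) * (?l ^ (N + 1) * D s x) \<le> (2 * K) * (?l ^ (N + 3) * D2 s x + ?l ^ (N - 1) / 2)"
          using K by (intro mult_left_mono) auto
        then show "w x * D s x \<le> (2 * K) * (q L m' 0 x * D2 s x) + K * q L (m' - 4) 0 x"
          unfolding w_def q_def by (simp add: algebra_simps numeral_eq_Suc)
      qed (use wt[unfolded weight_def] in \<open>(intro continuous_intros ct supp_mult(1) vq | simp)+\<close>)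
      then show ?thesis unfolding \<kappa>_def \<kappa>1_def by simp
    qed
    define \<epsilon> where "\<epsilon> = min (c0 / (32 * K)) (1 / (\<kappa>1 * L))"
    have e: "\<epsilon> > 0" "\<epsilon> * (2 * K) \<le> c0 / 16" "\<epsilon> * \<kappa>1 \<le> 1 / L"
    proof -
      show "\<epsilon> > 0" unfolding \<epsilon>_def using c0(1) K k1 L by auto
      have "\<epsilon> * (2 * K) \<le> c0 / (32 * K) * (2 * K)" unfolding \<epsilon>_def using K by (intro mult_right_mono) auto
      then show "\<epsilon> * (2 * K) \<le> c0 / 16" using K by simp
      have "\<epsilon> * \<kappa>1 \<le> 1 / (\<kappa>1 * L) * \<kappa>1" unfolding \<epsilon>_def using k1 by (intro mult_right_mono) auto
      then show "\<epsilon> * \<kappa>1 \<le> 1 / L" using k1 by simp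
    qed
    have "\<forall>\<^sub>F s in at_right 0. c0 / 2 * ?A s \<le> c0 / 16 * ?A s + c0 / 16 * ?A s + CC / L"
      using fc.second_order_inequality[OF e(1)] v
    proof eventually_elim
      case (elim s)
      have a: "\<epsilon> * \<kappa> w s \<le> c0 / 16 * ?A s + 1 / L"
      proof -
        have "\<epsilon> * \<kappa> w s \<le> \<epsilon> * (\<kappa>1 + 2 * K * ?A s)" using e(1) by (intro mult_left_mono vii) auto
        also have "\<dots> = \<epsilon> * \<kappa>1 + (\<epsilon> * (2 * K)) * ?A s" by (simp add: algebra_simps add_divide_distrib)
        also have "\<dots> \<le> 1 / L + c0 / 16 * ?A s" using e A_nonneg[of s] by (intro add_mono mult_right_mono) auto
        finally show ?thesis by simp
      qed
      have b: "K7 * I (\<lambda>x. g x * H2 x) \<le> c0 / 16 * ?A s + 8 * cd\<^sup>2 / c0 * Cq / L + 2 * K7 * ch\<^sup>2 * C3 / L + 1 / L"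
      proof -
        have "K7 * I (\<lambda>x. g x * H2 x) \<le> K7 * (2 * m * I (\<lambda>x. g x * D s x) + 2 * ch\<^sup>2 * C3 / L + 2 * \<epsilon>1)"
          using K7 elim(2) by (intro mult_left_mono) auto
        also have "\<dots> = K7 * (2 * m * I (\<lambda>x. g x * D s x)) + 2 * K7 * ch\<^sup>2 * C3 / L + 2 * K7 * \<epsilon>1" by (simp add: algebra_simps add_divide_distrib)
        finally show ?thesis using vi[of s] e1(2) by linarith
      qed
      have cc: "CC / L = 36 * K6\<^sup>2 * CE / L + K6 * CE / L + m * K6 * (Cp * C3 + CE) / L + K7 * C3 / L + 8 * cd\<^sup>2 / c0 * Cq / L + 2 * K7 * ch\<^sup>2 * C3 / L + 1 / L + 1 / L"
        unfolding CC_def by (simp add: add_divide_distrib)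
      show ?case unfolding cc by (rule combine_estimates[OF elim(1) i ii iii iv a b])
    qed
    then show ?thesis
    proof eventually_elim
      case (elim s)
      have "0 \<le> c0 * ?A s" using A_nonneg[of s] c0(1) by simp
      moreover have "c0 / 2 * ?A s = (c0 * ?A s) / 2" "c0 / 16 * ?A s = (c0 * ?A s) / 16" by simp_all
      ultimately have "c0 * ?A s \<le> 4 * (CC / L)" using elim by linarith
      then show ?case using c0(1) L by (simp add: pos_le_divide_eq mult_ac)
    qed
  qed
  then show ?thesis by blast
qed

end

section \<open>From a constant strain rate to a constant velocity\<close>

lemma C1_unique:
  assumes "C1 g g'" "C1 g g''"
  shows "g' j x = g'' j x"
proof -
  have "(\<lambda>v::plane. v $ 1 *\<^sub>R g' 1 x + v $ 2 *\<^sub>R g' 2 x) = (\<lambda>v. v $ 1 *\<^sub>R g'' 1 x + v $ 2 *\<^sub>R g'' 2 x)"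
    using assms unfolding C1_def by (intro has_derivative_unique[where f=g and x=x]) blast+
  from fun_cong[OF this, of "axis j 1"] show ?thesis using exhaust_2[of j] by (auto simp: axis_def)
qed

text \<open>Used along lines: a bounded affine function is constant.\<close>
lemma bounded_affine_slope_zero:
  fixes g :: "real \<Rightarrow> real"
  assumes d: "\<And>t. (g has_real_derivative c) (at t)" and b: "\<And>t. \<bar>g t\<bar> \<le> B"
  shows "c = 0"
proof (rule ccontr)
  assume c: "c \<noteq> 0"
  have "((\<lambda>t. g t - c * t) has_real_derivative 0) (at t)" for t
    by (auto intro!: derivative_eq_intros d)
  then have "g t - c * t = g 0 - c * 0" for t by (intro DERIV_isconst_all) blast
  from this[of "(2 * B + 1) / c"] have "g ((2 * B + 1) / c) - g 0 = 2 * B + 1" using c by simp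
  then show False using b[of "(2 * B + 1) / c"] b[of 0] by linarith
qed

definition chi :: "real \<Rightarrow> plane \<Rightarrow> real" where "chi r x = max 0 (min 1 (r + 1 - norm x))"

lemma chi_cont: "continuous_on UNIV (chi r)" unfolding chi_def[abs_def] by (intro continuous_intros)
lemma chi_supp: "vanishes_outside_ball (chi r)"
  unfolding vanishes_outside_ball_def chi_def by (intro exI[of _ "r + 1"]) auto
lemma chi_bounds: "0 \<le> chi r x" "chi r x \<le> 1" unfolding chi_def by auto

lemma sum_translates:
  fixes G :: "plane \<Rightarrow> real"
  assumes c: "continuous_on UNIV G" and v: "vanishes_outside_ball G"
  shows "continuous_on UNIV (\<lambda>x. \<Sum>i<k. sh (t i) j G x)" "vanishes_outside_ball (\<lambda>x. \<Sum>i<(k::nat). sh (t i) j G x)"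
    "I (\<lambda>x. \<Sum>i<k. sh (t i) j G x) = real k * I G"
proof -
  have ci: "continuous_on UNIV (sh (t i) j G)" "vanishes_outside_ball (sh (t i) j G)" for i
    by (intro continuous_intros c supp_sh v)+
  show "continuous_on UNIV (\<lambda>x. \<Sum>i<k. sh (t i) j G x)" by (intro continuous_on_sum ci)
  show "vanishes_outside_ball (\<lambda>x. \<Sum>i<k. sh (t i) j G x)"
  proof (induction k)
    case 0 then show ?case by (simp add: vanishes_outside_ball_def)
  next
    case (Suc k)
    have "vanishes_outside_ball (\<lambda>x. (\<Sum>i<k. sh (t i) j G x) + sh (t k) j G x)" by (rule supp_add(1)[OF Suc ci(2)])
    then show ?case by simp
  qed
  have "I (\<lambda>x. \<Sum>i<k. sh (t i) j G x) = (\<Sum>i<k. I (sh (t i) j G))"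
    by (rule Bochner_Integration.integral_sum) (intro integrable_cc ci)
  then show "I (\<lambda>x. \<Sum>i<k. sh (t i) j G x) = real k * I G" by (simp add: I_sh[OF c])
qed

context flow_growth begin

text \<open>On a fixed ball \<open>lam\<close> is at least 1/2 once L is large, so the decay in L forces the local integral of the squared differences below any tolerance.\<close>
lemma local_energy_vanishes:
  assumes e: "\<epsilon> > 0" and r: "r \<ge> 0"
  shows "\<forall>\<^sub>F s in at_right 0. I (\<lambda>x. chi r x * D2 s x) \<le> \<epsilon>"
proof -
  obtain C where C: "\<And>L. L \<ge> 1 \<Longrightarrow> \<forall>\<^sub>F s in at_right 0. I (\<lambda>x. q L m' 0 x * D2 s x) \<le> C / L"
    using second_order_decay by blast
  define A where "A = ln (1 + (r + 1)\<^sup>2)"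
  define L where "L = max 1 (max (2 * A) (2 ^ m' * C / \<epsilon>))"
  have L: "L \<ge> 1" "L \<ge> 2 * A" "L \<ge> 2 ^ m' * C / \<epsilon>" unfolding L_def by simp_all
  have le: "chi r x \<le> 2 ^ m' * q L m' 0 x" for x
  proof (cases "norm x \<ge> r + 1")
    case True then show ?thesis using q_nonneg[of L m' 0 x] by (simp add: chi_def)
  next
    case False
    have "(norm x)\<^sup>2 \<le> (r + 1)\<^sup>2" using False by (intro power_mono) auto
    then have "ln (1 + x \<bullet> x) \<le> A" unfolding A_def power2_norm_eq_inner[symmetric]
      by (subst ln_le_cancel_iff) (auto simp: add_pos_nonneg)
    then have "ln (1 + x \<bullet> x) / L \<le> 1 / 2" using L by (simp add: divide_le_eq)
    then have "1 / 2 \<le> 1 - ln (1 + x \<bullet> x) / L" by linarith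
    then have "1 / 2 \<le> lam L x" unfolding lam_def by (rule max.coboundedI2)
    then have "1 \<le> 2 * lam L x" by simp
    then have "1 \<le> (2 * lam L x) ^ m'" by (rule one_le_power)
    also have "\<dots> = 2 ^ m' * q L m' 0 x" unfolding q_def by (simp only: power_mult_distrib power_0 mult_1_right)
    finally show ?thesis using chi_bounds(2)[of r x] by linarith
  qed
  show ?thesis using C[OF L(1)]
  proof eventually_elim
    case (elim s)
    have L0: "L > 0" "m' > 0" using L by simp_all
    have "I (\<lambda>x. chi r x * D2 s x) \<le> 2 ^ m' * I (\<lambda>x. q L m' 0 x * D2 s x) + 0 * I (\<lambda>x. q L m' 0 x * D2 s x)"
    proof (rule I_le2)
      fix x show "chi r x * D2 s x \<le> 2 ^ m' * (q L m' 0 x * D2 s x) + 0 * (q L m' 0 x * D2 s x)"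
        using mult_right_mono[OF le[of x] D2_nonneg[of s x]] by (simp only: mult.assoc mult_zero_left add_0_right)
    qed (intro continuous_on_mult chi_cont q_cont D2_cont supp_mult(1) chi_supp q_supp L0)+
    also have "\<dots> \<le> 2 ^ m' * (C / L)" using elim by (simp only: mult_zero_left add_0_right) (intro mult_left_mono; simp)
    also have "\<dots> = (2 ^ m' * C / \<epsilon>) * (\<epsilon> / L)" using e by simp
    also have "\<dots> \<le> L * (\<epsilon> / L)" using L e by (intro mult_right_mono) auto
    finally show ?case using L by simp
  qed
qed

text \<open>A shift by a fixed \<open>\<tau>\<close> is a sum of k shifts by \<open>s = \<tau>/k\<close>. By Cauchy-Schwarz the squared increment is at most \<open>k s^2\<close> times the sum of the squared quotients at the intermediate points, and each of the k integrals is small; \<open>k s^2 k = \<tau>^2\<close> stays bounded.\<close>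
lemma E_shift:
  assumes \<tau>: "\<tau> > 0"
  shows "sh \<tau> j E a = E a"
proof (rule ccontr)
  assume ne: "sh \<tau> j E a \<noteq> E a"
  define h where "h x = (norm (sh \<tau> j E x - E x))\<^sup>2" for x
  define R where "R = norm a"
  have ch: "continuous_on UNIV h" unfolding h_def[abs_def] by (intro continuous_intros cts)
  define J where "J = I (\<lambda>x. chi R x * h x)"
  have J: "J > 0" unfolding J_def
  proof (rule integral_pos_of_pos[where a=a])
    show "continuous_on UNIV (\<lambda>x. chi R x * h x)" "vanishes_outside_ball (\<lambda>x. chi R x * h x)"
      by (intro continuous_on_mult chi_cont ch supp_mult(1) chi_supp)+
    show "chi R x * h x \<ge> 0" for x unfolding h_def by (simp add: chi_bounds)
    show "chi R a * h a > 0" using ne unfolding h_def chi_def R_def by simp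
  qed
  have "\<forall>\<^sub>F s in at_right 0. I (\<lambda>x. chi (R + \<tau>) x * D2 s x) \<le> J / (2 * \<tau>\<^sup>2)"
    using J \<tau> by (intro local_energy_vanishes) (auto simp: R_def)
  then obtain b where b: "b > 0" "\<And>s. 0 < s \<Longrightarrow> s < b \<Longrightarrow> I (\<lambda>x. chi (R + \<tau>) x * D2 s x) \<le> J / (2 * \<tau>\<^sup>2)"
    unfolding eventually_at_right_field by auto
  obtain k :: nat where k: "real k > \<tau> / b" using reals_Archimedean2 by blast
  have k0: "real k > 0" using k \<tau> b(1) by (smt (verit) divide_pos_pos)
  define s where "s = \<tau> / real k"
  have s: "s > 0" "s < b" "real k * s = \<tau>" using k0 k \<tau> b(1) unfolding s_def by (auto simp: field_simps)
  define G where "G x = chi (R + \<tau>) x * D2 s x" for x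
  have G: "continuous_on UNIV G" "vanishes_outside_ball G" unfolding G_def[abs_def]
    by (intro continuous_on_mult chi_cont D2_cont supp_mult(1) chi_supp)+
  let ?S = "\<lambda>x. \<Sum>i<k. sh (real i * s) j G x"
  have "J \<le> (real k * s\<^sup>2) * I ?S + 0 * I ?S" unfolding J_def
  proof (rule I_le2)
    fix x
    define y where "y i = E (x + (real i * s) *\<^sub>R axis j 1)" for i
    have step: "norm (y (Suc i) - y i) = s * norm (sh (real i * s) j (dq s j E) x)" for i
    proof -
      let ?z = "x + (real i * s) *\<^sub>R axis j 1"
      have "y (Suc i) = E (?z + s *\<^sub>R axis j 1)" unfolding y_def by (simp add: algebra_simps)
      then show ?thesis using s(1) unfolding dq_def sh_def y_def[of i] norm_scaleR by simp
    qed
    have "sh \<tau> j E x - E x = (\<Sum>i<k. y (Suc i) - y i)"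
    proof -
      have "y k = E (x + \<tau> *\<^sub>R axis j 1)" "y 0 = E x" unfolding y_def s(3) by simp_all
      then show ?thesis using sum_lessThan_telescope[of y k] unfolding sh_def by simp
    qed
    then have "norm (sh \<tau> j E x - E x) \<le> (\<Sum>i<k. norm (y (Suc i) - y i))" by (simp only: norm_sum)
    then have "h x \<le> (\<Sum>i<k. norm (y (Suc i) - y i))\<^sup>2" unfolding h_def by (intro power_mono) auto
    also have "\<dots> \<le> (\<Sum>i<k. (norm (y (Suc i) - y i))\<^sup>2) * real (card {..<k})"
      by (rule sum_squared_le_sum_of_squares) 
    also have "\<dots> = (real k * s\<^sup>2) * (\<Sum>i<k. (norm (sh (real i * s) j (dq s j E) x))\<^sup>2)"
      unfolding step by (simp add: power_mult_distrib sum_distrib_left mult_ac)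
    finally have "chi R x * h x \<le> chi R x * ((real k * s\<^sup>2) * (\<Sum>i<k. (norm (sh (real i * s) j (dq s j E) x))\<^sup>2))"
      by (intro mult_left_mono chi_bounds)
    also have "\<dots> = (real k * s\<^sup>2) * (\<Sum>i<k. chi R x * (norm (sh (real i * s) j (dq s j E) x))\<^sup>2)"
      by (simp add: sum_distrib_left mult_ac)
    also have "\<dots> \<le> (real k * s\<^sup>2) * ?S x"
    proof (intro mult_left_mono sum_mono)
      fix i assume i: "i \<in> {..<k}"
      let ?z = "x + (real i * s) *\<^sub>R axis j 1 :: plane"
      have "real i * s \<le> real k * s" using i s(1) by (intro mult_right_mono) auto
      then have "norm ?z \<le> norm x + \<tau>"
        using norm_triangle_ineq[of x "(real i * s) *\<^sub>R axis j 1"] s by simp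
      then have 1: "chi R x \<le> chi (R + \<tau>) ?z" unfolding chi_def by auto
      have 2: "(norm (dq s j E ?z))\<^sup>2 \<le> D2 s ?z" using exhaust_2[of j] unfolding D2_def by auto
      show "chi R x * (norm (sh (real i * s) j (dq s j E) x))\<^sup>2 \<le> sh (real i * s) j G x"
        using mult_mono[OF 1 2 chi_bounds(1)] unfolding sh_def G_def by simp
    qed simp
    finally show "chi R x * h x \<le> (real k * s\<^sup>2) * ?S x + 0 * ?S x" by simp
  qed (intro continuous_on_mult chi_cont ch supp_mult(1) chi_supp sum_translates[OF G])+
  also have "\<dots> = \<tau>\<^sup>2 * I G" unfolding sum_translates(3)[OF G] s(3)[symmetric] by (simp add: power2_eq_square)
  also have "\<dots> \<le> \<tau>\<^sup>2 * (J / (2 * \<tau>\<^sup>2))" using b(2)[OF s(1,2)] unfolding G_def by (intro mult_left_mono) auto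
  also have "\<dots> = J / 2" using \<tau> by simp
  finally show False using J by simp
qed

lemma shift_invariant_const:
  fixes g :: "plane \<Rightarrow> 'b"
  assumes "\<And>t j x. t > 0 \<Longrightarrow> sh t j g x = g x"
  shows "g x = g y"
proof -
  have sh: "g (x + t *\<^sub>R axis j 1) = g x" for t j x
  proof -
    consider "t > 0" | "t = 0" | "- t > 0" by linarith
    then show ?thesis
    proof cases
      case 3
      from assms[OF this, of j "x + t *\<^sub>R axis j 1"] show ?thesis unfolding sh_def by simp
    qed (use assms[of t j x] in \<open>auto simp: sh_def\<close>)
  qed
  have "x = (y + (x $ 1 - y $ 1) *\<^sub>R axis 1 1) + (x $ 2 - y $ 2) *\<^sub>R axis 2 1"
    by (simp add: vec_eq_iff forall_2 axis_def)
  then show ?thesis using sh by metis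
qed

lemma E_const: "E x = E y"
  by (rule shift_invariant_const) (rule E_shift)

lemma f_line:
  assumes l: "bounded_linear l"
  shows "((\<lambda>t. l (f (x + t *\<^sub>R w))) has_real_derivative l (w $ 1 *\<^sub>R f' 1 (x + t *\<^sub>R w) + w $ 2 *\<^sub>R f' 2 (x + t *\<^sub>R w))) (at t)"
proof -
  have d: "(f has_derivative (\<lambda>v. v $ 1 *\<^sub>R f' 1 (x + t *\<^sub>R w) + v $ 2 *\<^sub>R f' 2 (x + t *\<^sub>R w))) (at (x + t *\<^sub>R w))"
    using f_C1 unfolding C1_def by blast
  have g: "((\<lambda>t. x + t *\<^sub>R w) has_derivative (\<lambda>h. h *\<^sub>R w)) (at t)" by (auto intro!: derivative_eq_intros)
  from bounded_linear.has_derivative[OF l has_derivative_compose[OF g d]]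
  have "((\<lambda>t. l (f (x + t *\<^sub>R w))) has_derivative (\<lambda>h. l ((h *\<^sub>R w) $ 1 *\<^sub>R f' 1 (x + t *\<^sub>R w) + (h *\<^sub>R w) $ 2 *\<^sub>R f' 2 (x + t *\<^sub>R w)))) (at t)" .
  moreover have "l ((h *\<^sub>R w) $ 1 *\<^sub>R a + (h *\<^sub>R w) $ 2 *\<^sub>R b) = l (w $ 1 *\<^sub>R a + w $ 2 *\<^sub>R b) * h" for h a b
  proof -
    have "(h *\<^sub>R w) $ 1 *\<^sub>R a + (h *\<^sub>R w) $ 2 *\<^sub>R b = h *\<^sub>R (w $ 1 *\<^sub>R a + w $ 2 *\<^sub>R b)"
      by (simp add: scaleR_add_right)
    then show ?thesis using linear_cmul[OF bounded_linear.linear[OF l]] by simp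
  qed
  ultimately show ?thesis unfolding has_field_derivative_def by simp
qed

lemma f_slope:
  fixes c :: real
  assumes l: "bounded_linear l"
    and c: "\<And>t. l (w $ 1 *\<^sub>R f' 1 (x + t *\<^sub>R w) + w $ 2 *\<^sub>R f' 2 (x + t *\<^sub>R w)) = c"
  shows "c = 0"
proof -
  obtain B where B: "B > 0" "\<And>z. norm (l z) \<le> norm z * B" using bounded_linear.pos_bounded[OF l] by blast
  show ?thesis
  proof (rule bounded_affine_slope_zero)
    show "((\<lambda>t. l (f (x + t *\<^sub>R w))) has_real_derivative c) (at t)" for t
      using f_line[OF l, of x w t] unfolding c .
    show "\<bar>l (f (x + t *\<^sub>R w))\<bar> \<le> m * B" for t
      using B(2)[of "f (x + t *\<^sub>R w)"] mult_right_mono[OF f_bdd[of "x + t *\<^sub>R w"], of B] B(1) unfolding real_norm_def by linarith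
  qed
qed

text \<open>With E constant, each line argument kills one combination of derivatives: along the second axis it kills the mixed derivative, and along the diagonal,
applied to \<open>Re f - Im f\<close>, the real part of E. Then \<open>Re f\<close> depends on the first coordinate only and \<open>Im f\<close> on the second only, while
\<open>\<partial>_1 Re f = \<partial>_2 Im f\<close>, so this common value is constant as well.\<close>
lemma f_const: "f x = f y"
proof -
  define e where "e = E 0"
  have E: "f' 1 x + \<i> * f' 2 x = e" for x unfolding e_def using E_const[of x 0] unfolding dbar_def by simp
  have r1: "Re (f' 1 x) - Im (f' 2 x) = Re e" and r2: "Im (f' 1 x) = Im e / 2" "Re (f' 2 x) = Im e / 2" for x
    using E[of x] curl[of x] by (auto simp: complex_eq_iff)
  have l: "bounded_linear (\<lambda>z. Re z - Im z)" by (intro bounded_linear_sub bounded_linear_Re bounded_linear_Im)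
  have ie: "Im e / 2 = 0"
    by (rule f_slope[OF bounded_linear_Re, of "axis 2 1"]) (use r2 in \<open>simp add: axis_def\<close>)
  define w :: plane where "w = axis 1 1 + axis 2 1"
  have w: "w $ 1 = 1" "w $ 2 = 1" unfolding w_def by (simp_all add: axis_def)
  have re: "Re e = 0"
  proof (rule f_slope[OF l, of w 0])
    fix t
    show "Re (w $ 1 *\<^sub>R f' 1 (0 + t *\<^sub>R w) + w $ 2 *\<^sub>R f' 2 (0 + t *\<^sub>R w)) - Im (w $ 1 *\<^sub>R f' 1 (0 + t *\<^sub>R w) + w $ 2 *\<^sub>R f' 2 (0 + t *\<^sub>R w)) = Re e"
      unfolding w scaleR_one plus_complex.simps using r1[of "0 + t *\<^sub>R w"] r2[of "0 + t *\<^sub>R w"] by linarith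
  qed
  have u: "Re (f (x + t *\<^sub>R axis 2 1)) = Re (f x)" and v: "Im (f (x + t *\<^sub>R axis 1 1)) = Im (f x)" for x t
  proof -
    have "((\<lambda>t. Re (f (x + t *\<^sub>R axis 2 1))) has_real_derivative 0) (at t)" for t
      using f_line[OF bounded_linear_Re, of x "axis 2 1" t] r2 ie by (simp add: axis_def)
    from DERIV_isconst_all[OF allI[OF this], of t 0] show "Re (f (x + t *\<^sub>R axis 2 1)) = Re (f x)" by simp
    have "((\<lambda>t. Im (f (x + t *\<^sub>R axis 1 1))) has_real_derivative 0) (at t)" for t
      using f_line[OF bounded_linear_Im, of x "axis 1 1" t] r2 ie by (simp add: axis_def)
    from DERIV_isconst_all[OF allI[OF this], of t 0] show "Im (f (x + t *\<^sub>R axis 1 1)) = Im (f x)" by simp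
  qed
  have "sh t j (\<lambda>x. Re (f' 1 x)) x = Re (f' 1 x)" for t j x
  proof (cases "j = 1")
    case True
    have "C1 (\<lambda>x. Im (f (x + t *\<^sub>R axis 1 1))) (\<lambda>j x. Im (f' j (x + t *\<^sub>R axis 1 1)))"
      by (rule C1_translate[OF C1_Im[OF f_C1]])
    then have "Im (f' 2 (x + t *\<^sub>R axis 1 1)) = Im (f' 2 x)" unfolding v by (rule C1_unique[OF _ C1_Im[OF f_C1]])
    then show ?thesis using True r1[of x] r1[of "x + t *\<^sub>R axis 1 1"] unfolding sh_def by simp
  next
    case False
    then have j: "j = 2" using exhaust_2 by blast
    have "C1 (\<lambda>x. Re (f (x + t *\<^sub>R axis 2 1))) (\<lambda>j x. Re (f' j (x + t *\<^sub>R axis 2 1)))"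
      by (rule C1_translate[OF C1_Re[OF f_C1]])
    then have "Re (f' 1 (x + t *\<^sub>R axis 2 1)) = Re (f' 1 x)" unfolding u by (rule C1_unique[OF _ C1_Re[OF f_C1]])
    then show ?thesis using j unfolding sh_def by simp
  qed
  then have a: "Re (f' 1 x) = Re (f' 1 0)" for x by (rule shift_invariant_const)
  have "Re (f' 1 0) = 0"
    by (rule f_slope[OF bounded_linear_Re, of "axis 1 1"]) (use a in \<open>simp add: axis_def\<close>)
  then have z: "f' j x = 0" for j x
    using exhaust_2[of j] a[of x] r1[of x] r2[of x] re ie by (auto simp: complex_eq_iff)
  have "(f has_derivative (\<lambda>v. 0)) (at x within UNIV)" for x
    using f_C1 unfolding C1_def z by simp
  from has_derivative_zero_unique[OF convex_UNIV this, of y x] show ?thesis by simp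
qed

end

section \<open>The potential of the stress\<close>

lemma half_line_vector_derivative:
  assumes "h differentiable_on {0..}" "t \<ge> 0"
  shows "(h has_real_derivative half_deriv h t) (at t within {0..})"
proof -
  have "h differentiable (at t within {0..})" using assms unfolding differentiable_on_def by simp
  then show ?thesis unfolding has_real_derivative_iff_has_vector_derivative half_deriv_def
    by (simp only: vector_derivative_works)
qed

locale potential =
  fixes h :: "real \<Rightarrow> real"
  assumes nonneg: "\<And>t. t \<ge> 0 \<Longrightarrow> h t \<ge> 0" and C2h: "C2_half_line h" and a1: "A1 h" and a2: "A2 h" and a3: "A3 h"
begin

abbreviation "g \<equiv> half_deriv h"
abbreviation "g' \<equiv> half_deriv g"
abbreviation "\<mu> \<equiv> mu h"

lemma h_deriv: "t \<ge> 0 \<Longrightarrow> (h has_real_derivative g t) (at t within {0..})"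
  and g_deriv: "t \<ge> 0 \<Longrightarrow> (g has_real_derivative g' t) (at t within {0..})"
  using C2h half_line_vector_derivative unfolding C2_half_line_def by blast+

lemma h_mono: "0 \<le> s \<Longrightarrow> s \<le> t \<Longrightarrow> h s \<le> h t"
  using a1 strict_mono_onD[of "{0..}" h s t] unfolding A1_def by (cases "s = t") auto

text \<open>The condition \<open>h t / t \<longlongrightarrow> 0\<close> contains both statements.\<close>
lemma h_zero: "h 0 = 0" and g_zero: "g 0 = 0"
proof -
  have lim: "((\<lambda>t. h t / t) \<longlongrightarrow> 0) (at_right 0)" using a1 unfolding A1_def by blast
  have le: "at_right (0::real) \<le> at 0 within {0..}" by (intro at_le) auto
  have nz: "\<forall>\<^sub>F t in at_right (0::real). t \<noteq> 0" by (auto simp: eventually_at_filter)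
  have "((\<lambda>t. h t / t * t) \<longlongrightarrow> 0 * 0) (at_right 0)" by (intro tendsto_mult lim tendsto_ident_at)
  from this[unfolded mult_zero_left] have 1: "(h \<longlongrightarrow> 0) (at_right 0)"
    by (rule Lim_transform_eventually) (rule eventually_mono[OF nz], simp)
  have "(h \<longlongrightarrow> h 0) (at 0 within {0..})"
    using DERIV_continuous[OF h_deriv[of 0]] by (simp add: continuous_within)
  from tendsto_mono[OF le this] 1 show z: "h 0 = 0" by (intro tendsto_unique[of "at_right 0" h]) auto
  have "((\<lambda>y. (h y - h 0) / (y - 0)) \<longlongrightarrow> g 0) (at 0 within {0..})"
    using h_deriv[of 0] unfolding has_field_derivative_iff by simp
  from tendsto_mono[OF le this] have "((\<lambda>t. h t / t) \<longlongrightarrow> g 0) (at_right 0)" unfolding z by simp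
  with lim show "g 0 = 0" by (intro tendsto_unique[of "at_right 0" "\<lambda>t. h t / t"]) auto
qed

lemma mu_zero_pos: "\<mu> 0 > 0" using a1 unfolding A1_def mu_def by simp

lemma g_eq: "g t = t * \<mu> t" unfolding mu_def using g_zero by auto

text \<open>The derivative of \<open>g t / t\<close>; its sign is condition \<open>A3\<close>.\<close>
lemma mu_deriv:
  assumes "t > 0"
  shows "(\<mu> has_real_derivative (g' t - \<mu> t) / t) (at t)"
proof -
  have "at t within {0..} = at t" using assms by (intro at_within_interior) (simp add: interior_real_atLeast)
  then have "(g has_real_derivative g' t) (at t)" using g_deriv[of t] assms by simp
  then have "((\<lambda>t. g t / t) has_real_derivative (g' t * t - g t * 1) / (t * t)) (at t)"
    using assms by (intro DERIV_divide DERIV_ident) auto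
  moreover have "(a * t - (t * b) * 1) / (t * t) = (a - b) / t" for a b using assms by (simp add: field_simps)
  ultimately have "((\<lambda>t. g t / t) has_real_derivative (g' t - \<mu> t) / t) (at t)"
    using g_eq[of t] by simp
  then show ?thesis
    by (rule has_field_derivative_transform_within_open[where S="{0<..}"]) (use assms in \<open>auto simp: mu_def\<close>)
qed

lemma mu_lim: "(\<mu> \<longlongrightarrow> \<mu> 0) (at 0 within {0..})"
proof -
  have "((\<lambda>y. (g y - g 0) / (y - 0)) \<longlongrightarrow> g' 0) (at 0 within {0..})"
    using g_deriv[of 0] unfolding has_field_derivative_iff by simp
  moreover have "\<forall>\<^sub>F y in at 0 within {0..}. (g y - g 0) / (y - 0) = \<mu> y"
    by (auto simp: eventually_at_filter mu_def g_zero)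
  ultimately have "(\<mu> \<longlongrightarrow> g' 0) (at 0 within {0..})" by (rule Lim_transform_eventually)
  then show ?thesis by (simp add: mu_def)
qed

lemma mu_cont: "continuous_on {0..} \<mu>"
  unfolding continuous_on_eq_continuous_within
proof
  fix t :: real assume "t \<in> {0..}"
  then consider "t = 0" | "t > 0" by force
  then show "continuous (at t within {0..}) \<mu>"
  proof cases
    case 1 then show ?thesis using mu_lim by (simp add: continuous_within)
  next
    case 2 then show ?thesis using DERIV_isCont[OF mu_deriv] continuous_at_imp_continuous_at_within by blast
  qed
qed

text \<open>On the open half-line \<open>A3\<close> says that the derivative is nonnegative; the point 0 is reached by continuity.\<close>
lemma mu_mono:
  assumes "0 \<le> s" "s \<le> t"
  shows "\<mu> s \<le> \<mu> t"
proof -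
  have pos: "\<mu> a \<le> \<mu> b" if "0 < a" "a \<le> b" for a b
  proof (rule DERIV_nonneg_imp_nondecreasing[OF that(2)])
    fix x assume "a \<le> x" "x \<le> b"
    then have x: "x > 0" using that by simp
    moreover have "\<mu> x \<le> g' x" using a3 x unfolding A3_def by simp
    ultimately show "\<exists>y. (\<mu> has_real_derivative y) (at x) \<and> 0 \<le> y" using mu_deriv[OF x] by force
  qed
  consider "s = t" | "s > 0" | "s = 0" "t > 0" using assms by force
  then show ?thesis
  proof cases
    case 3
    have "(\<mu> \<longlongrightarrow> \<mu> 0) (at_right 0)" by (rule tendsto_mono[OF _ mu_lim]) (intro at_le, auto)
    moreover have "\<forall>\<^sub>F a in at_right 0. \<mu> a \<le> \<mu> t"
      unfolding eventually_at_right_field using 3 pos by (intro exI[of _ t]) auto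
    ultimately show ?thesis unfolding 3(1) by (intro tendsto_upperbound) auto
  qed (use pos assms in auto)
qed

lemma mu_pos: "t \<ge> 0 \<Longrightarrow> \<mu> t \<ge> \<mu> 0" by (rule mu_mono) auto
lemma mu_nonneg: "t \<ge> 0 \<Longrightarrow> \<mu> t \<ge> 0" using mu_pos[of t] mu_zero_pos by linarith

lemma g_mono: "0 \<le> s \<Longrightarrow> s \<le> t \<Longrightarrow> g s \<le> g t"
  unfolding g_eq by (intro mult_mono mu_mono mu_nonneg) auto

text \<open>Induction over dyadic ranges. For t above 1 the ratio of \<open>1 + t\<close> to \<open>1 + t/2\<close> is at least 4/3, so an exponent K with \<open>(4/3)^K\<close> above the doubling constant makes the induction close.\<close>
lemma h_growth: "\<exists>K. \<forall>t\<ge>0. h t \<le> h 1 * (1 + t) ^ K"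
proof -
  obtain a where a: "a \<ge> 1" "\<And>t. t \<ge> 0 \<Longrightarrow> h (2 * t) \<le> a * h t" using a2 unfolding A2_def by blast
  obtain K where K: "a < (4/3) ^ K" using real_arch_pow[of "4/3" a] by auto
  have "h t \<le> h 1 * (1 + t) ^ K" if "0 \<le> t" "t \<le> 2 ^ n" for n t
    using that
  proof (induction n arbitrary: t)
    case 0
    then have "h t \<le> h 1 * 1" using h_mono[of t 1] by simp
    also have "\<dots> \<le> h 1 * (1 + t) ^ K" using 0 nonneg[of 1] by (intro mult_left_mono one_le_power) auto
    finally show ?case .
  next
    case (Suc n)
    show ?case
    proof (cases "t \<le> 1")
      case True
      then have "h t \<le> h 1 * 1" using Suc.prems h_mono[of t 1] by simp
      also have "\<dots> \<le> h 1 * (1 + t) ^ K" using Suc.prems nonneg[of 1] by (intro mult_left_mono one_le_power) auto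
      finally show ?thesis .
    next
      case False
      have "h t \<le> a * h (t / 2)" using a(2)[of "t / 2"] Suc.prems by simp
      also have "\<dots> \<le> a * (h 1 * (1 + t / 2) ^ K)" using a(1) Suc.prems by (intro mult_left_mono Suc.IH) auto
      also have "\<dots> \<le> (4/3) ^ K * (h 1 * (1 + t / 2) ^ K)" using K Suc.prems nonneg[of 1] by (intro mult_right_mono) auto
      also have "\<dots> = h 1 * (4/3 * (1 + t / 2)) ^ K" by (simp only: power_mult_distrib mult_ac)
      also have "\<dots> \<le> h 1 * (1 + t) ^ K" using False nonneg[of 1] by (intro mult_left_mono power_mono) auto
      finally show ?thesis .
    qed
  qed
  moreover have "\<exists>n. t \<le> 2 ^ n" for t :: real using real_arch_pow[of 2 t] by (auto intro: less_imp_le)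
  ultimately show ?thesis by blast
qed

text \<open>Since g is nondecreasing, \<open>t g t \<le> h (2 t)\<close> by the mean value theorem.\<close>
lemma mu_growth: "\<exists>C\<ge>0. \<exists>K. \<forall>t\<ge>0. \<mu> t \<le> C * (1 + t) ^ K"
proof -
  obtain K where K: "\<And>t. t \<ge> 0 \<Longrightarrow> h t \<le> h 1 * (1 + t) ^ K" using h_growth by blast
  have b: "t * g t \<le> h 1 * 2 ^ K * (1 + t) ^ K" if t: "t \<ge> 0" for t
  proof -
    have "\<exists>x\<in>{t..2 * t}. h (2 * t) - h t = g x * (2 * t - t)"
    proof (rule mvt_very_simple)
      fix x assume "t \<le> x" "x \<le> 2 * t"
      then have "(h has_real_derivative g x) (at x within {t..2*t})"
        using t by (intro DERIV_subset[OF h_deriv]) auto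
      then show "(h has_derivative (*) (g x)) (at x within {t..2*t})" unfolding has_field_derivative_def .
    qed (use t in simp)
    then obtain x where x: "x \<ge> t" "h (2 * t) - h t = g x * t" by auto
    have "t * g t \<le> t * g x" using t x(1) by (intro mult_left_mono g_mono)
    also have "\<dots> \<le> h (2 * t)" using x(2) nonneg[OF t] by (simp add: mult.commute)
    also have "\<dots> \<le> h 1 * (1 + 2 * t) ^ K" using K[of "2 * t"] t by simp
    also have "\<dots> \<le> h 1 * (2 * (1 + t)) ^ K" using nonneg[of 1] t by (intro mult_left_mono power_mono) auto
    finally show ?thesis by (simp only: power_mult_distrib mult.assoc)
  qed
  have h1: "h 1 \<ge> 0" by (simp add: nonneg)
  define C where "C = h 1 * 2 ^ K * 2 ^ K"
  have "\<mu> t \<le> C * (1 + t) ^ K" if t: "t \<ge> 0" for t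
  proof (cases "t \<le> 1")
    case True
    have "\<mu> t \<le> \<mu> 1" using t True by (rule mu_mono)
    also have "\<dots> \<le> C * 1" using b[of 1] unfolding g_eq C_def by simp
    also have "\<dots> \<le> C * (1 + t) ^ K" using t h1 unfolding C_def by (intro mult_left_mono one_le_power) auto
    finally show ?thesis .
  next
    case False
    have "1 * 1 * \<mu> t \<le> t * t * \<mu> t" using False mu_nonneg[OF t] by (intro mult_right_mono mult_mono) auto
    then have "\<mu> t \<le> t * g t" unfolding g_eq by (simp only: mult.assoc mult_1_left)
    also have "\<dots> \<le> h 1 * 2 ^ K * (1 + t) ^ K" by (rule b[OF t])
    also have "\<dots> \<le> C * (1 + t) ^ K" 
    proof (rule mult_right_mono)
      have "h 1 * 2 ^ K * 1 \<le> h 1 * 2 ^ K * 2 ^ K" using h1 by (intro mult_left_mono one_le_power) auto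
      then show "h 1 * 2 ^ K \<le> C" unfolding C_def by (simp only: mult_1_right)
    qed (use t in simp)
    finally show ?thesis .
  qed
  moreover have "C \<ge> 0" unfolding C_def using h1 by simp
  ultimately show ?thesis by blast
qed

lemma g_lipschitz: "\<exists>K\<ge>0. \<forall>a\<in>{0..r}. \<forall>b\<in>{0..r}. \<bar>g a - g b\<bar> \<le> K * \<bar>a - b\<bar>"
proof -
  have "continuous_on {0..r} g'" using C2h unfolding C2_half_line_def by (auto elim: continuous_on_subset)
  then have "compact (g' ` {0..r})" by (intro compact_continuous_image) auto
  then have "bounded (g' ` {0..r})" by (rule compact_imp_bounded)
  then obtain K where K: "K > 0" "\<And>x. x \<in> {0..r} \<Longrightarrow> norm (g' x) \<le> K" unfolding bounded_pos by auto
  have "norm (g a - g b) \<le> K * norm (a - b)" if "a \<in> {0..r}" "b \<in> {0..r}" for a b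
  proof (rule field_differentiable_bound[where S="{0..r}" and f'=g'])
    show "(g has_field_derivative g' z) (at z within {0..r})" if "z \<in> {0..r}" for z
      using that by (intro DERIV_subset[OF g_deriv]) auto
  qed (use K that in auto)
  then show ?thesis using K(1) by (intro exI[of _ K]) auto
qed

text \<open>Monotonicity of \<open>\<mu>\<close> lets the difference of viscosities be estimated through \<open>g t = t \<mu> t\<close>, so that only the derivative of g and not that of \<open>\<mu>\<close>, which may blow up at 0, enters.\<close>
lemma mu_diff_le:
  assumes "0 \<le> a" "0 \<le> b"
  shows "\<bar>\<mu> a - \<mu> b\<bar> * b \<le> \<bar>g a - g b\<bar>"
proof (cases "b \<le> a")
  case True
  have "b * \<mu> a \<le> a * \<mu> a" using True mu_nonneg[OF assms(1)] by (intro mult_right_mono)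
  then show ?thesis using mu_mono[OF assms(2) True] g_mono[OF assms(2) True] unfolding g_eq by (simp add: algebra_simps)
next
  case False
  have "a * \<mu> a \<le> b * \<mu> a" using False mu_nonneg[OF assms(1)] by (intro mult_right_mono) auto
  then show ?thesis using mu_mono[OF assms(1), of b] g_mono[OF assms(1), of b] False unfolding g_eq by (simp add: algebra_simps)
qed

text \<open>The stress as a function of E; the factor \<open>sqrt 2\<close> converts the modulus of E into the norm of the symmetric gradient.\<close>
definition P :: "complex \<Rightarrow> complex" where "P A = complex_of_real (\<mu> (norm A / sqrt 2)) * cnj A"

lemma P_lipschitz: "\<exists>K\<ge>0. \<forall>A B. norm A \<le> r \<longrightarrow> norm B \<le> r \<longrightarrow> norm (P A - P B) \<le> K * norm (A - B)"
proof -
  obtain K where K: "K \<ge> 0" "\<And>a b. a \<in> {0..r} \<Longrightarrow> b \<in> {0..r} \<Longrightarrow> \<bar>g a - g b\<bar> \<le> K * \<bar>a - b\<bar>"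
    using g_lipschitz by blast
  have "norm (P A - P B) \<le> (\<bar>\<mu> r\<bar> + K) * norm (A - B)" if AB: "norm A \<le> r" "norm B \<le> r" for A B
  proof -
    let ?a = "norm A / sqrt 2" and ?b = "norm B / sqrt 2"
    have s2: "sqrt 2 \<ge> (1::real)" by simp
    have le: "norm z / sqrt 2 \<le> norm z" for z :: complex
      using s2 mult_left_mono[OF s2, of "norm z"] by (simp add: divide_le_eq)
    have ab: "0 \<le> ?a" "?a \<le> r" "0 \<le> ?b" "?b \<le> r" using AB le[of A] le[of B] by simp_all
    have "P A - P B = complex_of_real (\<mu> ?a) * (cnj A - cnj B) + complex_of_real (\<mu> ?a - \<mu> ?b) * cnj B"
      unfolding P_def by (simp add: left_diff_distrib right_diff_distrib)
    then have "norm (P A - P B) \<le> \<bar>\<mu> ?a\<bar> * norm (A - B) + \<bar>\<mu> ?a - \<mu> ?b\<bar> * norm B"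
      using norm_triangle_ineq[of "complex_of_real (\<mu> ?a) * (cnj A - cnj B)" "complex_of_real (\<mu> ?a - \<mu> ?b) * cnj B"]
      by (simp only: norm_mult norm_of_real complex_mod_cnj complex_cnj_diff[symmetric])
    moreover have "\<bar>\<mu> ?a\<bar> * norm (A - B) \<le> \<bar>\<mu> r\<bar> * norm (A - B)"
      using mu_mono[OF ab(1,2)] mu_nonneg[OF ab(1)] by (intro mult_right_mono) auto
    moreover have "\<bar>\<mu> ?a - \<mu> ?b\<bar> * norm B \<le> K * norm (A - B)"
    proof -
      have "\<bar>\<mu> ?a - \<mu> ?b\<bar> * norm B = sqrt 2 * (\<bar>\<mu> ?a - \<mu> ?b\<bar> * ?b)" by simp
      also have "\<dots> \<le> sqrt 2 * (K * \<bar>?a - ?b\<bar>)"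
        using mu_diff_le[OF ab(1,3)] K(2)[of ?a ?b] ab by (intro mult_left_mono) auto
      also have "\<dots> = K * \<bar>norm A - norm B\<bar>" by (simp add: diff_divide_distrib[symmetric] abs_divide)
      also have "\<dots> \<le> K * norm (A - B)" using K(1) by (intro mult_left_mono norm_triangle_ineq3)
      finally show ?thesis .
    qed
    ultimately show ?thesis by (simp only: distrib_right) 
  qed
  then show ?thesis using K(1) by (intro exI[of _ "\<bar>\<mu> r\<bar> + K"]) auto
qed

text \<open>The difference of the two sides is half of \<open>(\<mu> a - \<mu> b) (|A|^2 - |B|^2)\<close>, which is nonnegative as \<open>\<mu>\<close> is nondecreasing.\<close>
lemma P_monotone:
  "(\<mu> (norm A / sqrt 2) + \<mu> (norm B / sqrt 2)) / 2 * (norm (A - B))\<^sup>2 \<le> Re ((P A - P B) * (A - B))"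
proof -
  let ?a = "\<mu> (norm A / sqrt 2)" and ?b = "\<mu> (norm B / sqrt 2)"
  have id: "Re ((complex_of_real x * cnj A - complex_of_real y * cnj B) * (A - B)) - (x + y) / 2 * (norm (A - B))\<^sup>2
     = (x - y) * ((norm A)\<^sup>2 - (norm B)\<^sup>2) / 2" for x y
    unfolding cmod_power2 by (simp add: power2_eq_square field_simps)
  have "0 \<le> (?a - ?b) * ((norm A)\<^sup>2 - (norm B)\<^sup>2)"
  proof (cases "norm A \<le> norm B")
    case True
    then have "?a \<le> ?b" "(norm A)\<^sup>2 \<le> (norm B)\<^sup>2" by (auto intro!: mu_mono divide_right_mono power_mono)
    then show ?thesis by (intro mult_nonpos_nonpos) auto
  next
    case False
    then have "?b \<le> ?a" "(norm B)\<^sup>2 \<le> (norm A)\<^sup>2" by (auto intro!: mu_mono divide_right_mono power_mono)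
    then show ?thesis by (intro mult_nonneg_nonneg) auto
  qed
  then show ?thesis unfolding P_def using id[of ?a ?b] by linarith
qed

end

section \<open>Stream function and weak equation\<close>

text \<open>The Poincare lemma on the plane. Differentiating under the integral gives an integrand that, by closedness, is the t-derivative of \<open>t \<omega> (t x)\<close>.\<close>
lemma has_derivative_line_integral:
  assumes w: "C1 \<omega> \<omega>'" and closed: "\<And>x. \<omega>' 1 x $ 2 = \<omega>' 2 x $ 1"
  shows "((\<lambda>x::plane. integral (cbox 0 1) (\<lambda>t. \<omega> (t *\<^sub>R x) \<bullet> x)) has_derivative (\<lambda>v. \<omega> x \<bullet> v)) (at x)"
proof -
  define G where "G x t = \<omega> (t *\<^sub>R x) + t *\<^sub>R (x $ 1 *\<^sub>R \<omega>' 1 (t *\<^sub>R x) + x $ 2 *\<^sub>R \<omega>' 2 (t *\<^sub>R x))" for x t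
  have dw: "(\<omega> has_derivative (\<lambda>v. v $ 1 *\<^sub>R \<omega>' 1 y + v $ 2 *\<^sub>R \<omega>' 2 y)) (at y)" for y using w unfolding C1_def by blast
  note cw = C1_cont[OF w] C1_cont'[OF w]
  have cw': "continuous_on S (\<lambda>z. \<omega> (g z))" "continuous_on S (\<lambda>z. \<omega>' j (g z))" if "continuous_on S g" for S g j
    by (rule continuous_on_compose2[OF _ that], rule cw, simp)+
  have "((\<lambda>x::plane. integral (cbox 0 1) (\<lambda>t. \<omega> (t *\<^sub>R x) \<bullet> x)) has_derivative
     blinfun_apply (integral (cbox 0 1) (\<lambda>t. blinfun_inner_right (G x t)))) (at x within UNIV)"
  proof (rule leibniz_rule[where U=UNIV])
    fix x :: plane and t :: real
    have "((\<lambda>x. t *\<^sub>R x) has_derivative (\<lambda>v. t *\<^sub>R v)) (at x)" by (auto intro!: derivative_eq_intros)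
    from has_derivative_compose[OF this dw]
    have "((\<lambda>x. \<omega> (t *\<^sub>R x) \<bullet> x) has_derivative (\<lambda>v. \<omega> (t *\<^sub>R x) \<bullet> v + ((t *\<^sub>R v) $ 1 *\<^sub>R \<omega>' 1 (t *\<^sub>R x) + (t *\<^sub>R v) $ 2 *\<^sub>R \<omega>' 2 (t *\<^sub>R x)) \<bullet> x)) (at x)"
      by (intro has_derivative_inner has_derivative_ident)
    moreover have "\<omega> (t *\<^sub>R x) \<bullet> v + ((t *\<^sub>R v) $ 1 *\<^sub>R \<omega>' 1 (t *\<^sub>R x) + (t *\<^sub>R v) $ 2 *\<^sub>R \<omega>' 2 (t *\<^sub>R x)) \<bullet> x = G x t \<bullet> v" for v
      unfolding G_def inner_plane by (simp add: closed algebra_simps)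
    ultimately show "((\<lambda>x. \<omega> (t *\<^sub>R x) \<bullet> x) has_derivative blinfun_apply (blinfun_inner_right (G x t))) (at x within UNIV)"
      by simp
  next
    show "(\<lambda>t. \<omega> (t *\<^sub>R x) \<bullet> x) integrable_on cbox 0 1" for x
      by (intro integrable_continuous continuous_intros cw')
    show "continuous_on (UNIV \<times> cbox 0 1) (\<lambda>(x, t). blinfun_inner_right (G x t))"
      unfolding G_def split_beta
      by (intro bounded_linear.continuous_on[OF bounded_linear_blinfun_inner_right] continuous_intros cw')
  qed auto
  moreover have "integral (cbox 0 1) (\<lambda>t. blinfun_inner_right (G x t)) = blinfun_inner_right (\<omega> x)"
  proof -
    have "(G x has_integral (1 *\<^sub>R \<omega> (1 *\<^sub>R x) - 0 *\<^sub>R \<omega> (0 *\<^sub>R x))) {0..1}"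
    proof (rule fundamental_theorem_of_calculus)
      fix t :: real
      have "((\<lambda>t. t *\<^sub>R x) has_derivative (\<lambda>h. h *\<^sub>R x)) (at t)" by (auto intro!: derivative_eq_intros)
      from has_derivative_compose[OF this dw]
      have "((\<lambda>t. t *\<^sub>R \<omega> (t *\<^sub>R x)) has_derivative (\<lambda>h. t *\<^sub>R ((h *\<^sub>R x) $ 1 *\<^sub>R \<omega>' 1 (t *\<^sub>R x) + (h *\<^sub>R x) $ 2 *\<^sub>R \<omega>' 2 (t *\<^sub>R x)) + h *\<^sub>R \<omega> (t *\<^sub>R x))) (at t)"
        by (intro has_derivative_scaleR has_derivative_ident)
      moreover have "t *\<^sub>R ((h *\<^sub>R x) $ 1 *\<^sub>R \<omega>' 1 (t *\<^sub>R x) + (h *\<^sub>R x) $ 2 *\<^sub>R \<omega>' 2 (t *\<^sub>R x)) + h *\<^sub>R \<omega> (t *\<^sub>R x) = h *\<^sub>R G x t" for h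
        unfolding G_def by (simp add: algebra_simps)
      ultimately have "((\<lambda>t. t *\<^sub>R \<omega> (t *\<^sub>R x)) has_vector_derivative G x t) (at t)"
        unfolding has_vector_derivative_def by simp
      then show "((\<lambda>t. t *\<^sub>R \<omega> (t *\<^sub>R x)) has_vector_derivative G x t) (at t within {0..1})"
        by (rule has_vector_derivative_at_within)
    qed simp
    then have "(G x has_integral \<omega> x) (cbox 0 1)" by simp
    from integral_unique[OF has_integral_linear[OF this bounded_linear_blinfun_inner_right]]
    show ?thesis by (simp add: o_def)
  qed
  ultimately show ?thesis by simp
qed

text \<open>For a continuous function the exceptional set is open, and an open null set is empty.\<close>
lemma L_infinity_continuous_bounded:
  fixes u :: "plane \<Rightarrow> plane"
  assumes "L_infinity u" and c: "continuous_on UNIV u"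
  shows "\<exists>C\<ge>0. \<forall>x. norm (u x) \<le> C"
proof -
  obtain C where C: "AE x in lebesgue. norm (u x) \<le> C" using assms(1) unfolding L_infinity_def by blast
  define S where "S = {x. norm (u x) > C}"
  have op: "open S" unfolding S_def by (intro open_Collect_less continuous_intros c)
  then have "S \<in> sets lebesgue" by (intro sets_completionI_sets) simp
  then have "S \<in> null_sets lebesgue \<longleftrightarrow> (AE x in lebesgue. x \<notin> S)" by (rule AE_iff_null_sets)
  moreover have "AE x in lebesgue. x \<notin> S" using C unfolding S_def by (simp add: not_less)
  ultimately have "negligible S" by (simp add: negligible_iff_null_sets)
  then have "S = {}" using open_not_negligible[OF op] by blast
  then have "norm (u x) \<le> \<bar>C\<bar>" for x unfolding S_def by (metis (mono_tags, lifting) abs_ge_self empty_Collect_eq not_le order_trans)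
  then show ?thesis by (intro exI[of _ "\<bar>C\<bar>"]) simp
qed

text \<open>The Jacobian matrix of a planar field in terms of the partial derivatives a, b of its complex gradient; used for u and for the test fields alike.\<close>
definition jmat :: "complex \<Rightarrow> complex \<Rightarrow> real^2^2" where
  "jmat a b = vector [vector [Im a, Im b], vector [- Re a, - Re b]]"

lemma sym_grad_jmat:
  assumes "jacobian u (at x) = jmat a b"
  shows "sym_grad u x $ i $ j = (jmat a b $ i $ j + jmat a b $ j $ i) / 2"
  unfolding sym_grad_def assms by (simp add: transpose_def)

lemma inner_mat: "(A :: real^2^2) \<bullet> B = A $ 1 $ 1 * B $ 1 $ 1 + A $ 1 $ 2 * B $ 1 $ 2 + A $ 2 $ 1 * B $ 2 $ 1 + A $ 2 $ 2 * B $ 2 $ 2"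
  by (simp add: inner_vec_def sum_2)

text \<open>This turns the scalar product of symmetric gradients into the pairing of the stress equation; the factor 1/2 reflects that the modulus of E is \<open>sqrt 2\<close> times the norm.\<close>
lemma sym_grad_inner:
  assumes "jacobian u (at x) = jmat a b" "Im a = Re b" "jacobian v (at x) = jmat c d" "Im c = Re d"
  shows "sym_grad u x \<bullet> sym_grad v x = Re (cnj (a + \<i> * b) * (c + \<i> * d)) / 2"
  unfolding inner_mat sym_grad_jmat[OF assms(1)] sym_grad_jmat[OF assms(3)]
  using assms(2,4) by (simp add: jmat_def field_simps)

lemma norm_sym_grad:
  assumes "jacobian u (at x) = jmat a b" "Im a = Re b"
  shows "norm (sym_grad u x) = norm (a + \<i> * b) / sqrt 2"
proof -
  have "(norm (sym_grad u x))\<^sup>2 = Re (cnj (a + \<i> * b) * (a + \<i> * b)) / 2"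
    unfolding power2_norm_eq_inner by (rule sym_grad_inner[OF assms assms])
  also have "\<dots> = (norm (a + \<i> * b) / sqrt 2)\<^sup>2"
  proof -
    have w: "Re (cnj w * w) = (norm w)\<^sup>2" for w using cmod_power2[of w] by (simp add: power2_eq_square)
    show ?thesis unfolding power_divide w by simp
  qed
  finally show ?thesis by (rule power2_eq_imp_eq) auto
qed

lemma lebesgue_I:
  fixes g :: "plane \<Rightarrow> real"
  assumes "continuous_on UNIV g"
  shows "integral\<^sup>L lebesgue g = I g"
  by (rule integral_completion) (use borel_measurable_continuous_onI[OF assms] in simp)

locale bounded_solution = potential h for h +
  fixes u :: "plane \<Rightarrow> plane"
  assumes u_C1: "Ck 1 u" and u_bounded: "L_infinity u" and u_sol: "entire_weak_solution h u"
begin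

definition u' :: "2 \<Rightarrow> plane \<Rightarrow> plane" where "u' j x = frechet_derivative u (at x) (axis j 1)"
text \<open>As \<open>u = (\<psi>_2, -\<psi>_1)\<close>, the complex gradient \<open>\<psi>_1 + i \<psi>_2\<close> is \<open>-u_2 + i u_1\<close>.\<close>
definition cx :: "plane \<Rightarrow> complex" where "cx v = Complex (- (v $ 2)) (v $ 1)"
definition f :: "plane \<Rightarrow> complex" where "f x = cx (u x)"
definition f' :: "2 \<Rightarrow> plane \<Rightarrow> complex" where "f' j x = cx (u' j x)"

lemma u_C1': "C1 u u'"
  unfolding C1_def
proof (intro conjI allI)
  fix x
  have u: "u differentiable (at x)" "continuous_on UNIV (\<lambda>x. frechet_derivative u (at x) v)" for x v
    using u_C1 unfolding One_nat_def Ck.simps by blast+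
  let ?D = "frechet_derivative u (at x)"
  have lin: "linear ?D" by (rule linear_frechet_derivative[OF u(1)])
  have "?D v = v $ 1 *\<^sub>R u' 1 x + v $ 2 *\<^sub>R u' 2 x" for v
  proof -
    have "v = v $ 1 *\<^sub>R axis 1 1 + v $ 2 *\<^sub>R axis 2 1" by (simp add: vec_eq_iff forall_2 axis_def)
    then have "?D v = ?D (v $ 1 *\<^sub>R axis 1 1 + v $ 2 *\<^sub>R axis 2 1)" by simp
    then show ?thesis unfolding u'_def by (simp add: linear_add[OF lin] linear_cmul[OF lin])
  qed
  then have "?D = (\<lambda>v. v $ 1 *\<^sub>R u' 1 x + v $ 2 *\<^sub>R u' 2 x)" by (rule ext)
  then show "(u has_derivative (\<lambda>v. v $ 1 *\<^sub>R u' 1 x + v $ 2 *\<^sub>R u' 2 x)) (at x)"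
    using u(1)[of x] unfolding frechet_derivative_works by simp
  show "continuous_on UNIV (u' j)" for j unfolding u'_def[abs_def] by (rule u(2))
qed

lemma cx_linear: "bounded_linear cx"
  unfolding cx_def by (intro linear_conv_bounded_linear[THEN iffD1] linearI) (auto simp: complex_eq_iff)

lemma f_C1: "C1 f f'" unfolding f_def[abs_def] f'_def[abs_def] by (rule C1_bl[OF u_C1' cx_linear])

lemma jacobian_u: "jacobian u (at x) = jmat (f' 1 x) (f' 2 x)"
  unfolding jacobian_def matrix_def jmat_def f'_def cx_def u'_def by (simp add: vec_eq_iff forall_2)

lemma f_curl: "Im (f' 1 x) = Re (f' 2 x)"
proof -
  have "divergence u x = 0" using u_sol unfolding entire_weak_solution_def by blast
  then show ?thesis unfolding divergence_def jacobian_u trace_def sum_2 by (simp add: jmat_def)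
qed

lemma norm_f: "norm (f x) = norm (u x)"
  unfolding f_def cx_def cmod_def norm_eq_sqrt_inner[of "u x"] inner_plane by (simp add: power2_eq_square add.commute)

definition \<psi> :: "plane \<Rightarrow> real" where
  "\<psi> x = integral (cbox 0 1) (\<lambda>t. vector [- u (t *\<^sub>R x) $ 2, u (t *\<^sub>R x) $ 1] \<bullet> x)"

lemma rot_linear: "bounded_linear (\<lambda>v::plane. vector [- v $ 2, v $ 1] :: plane)"
  by (intro linear_conv_bounded_linear[THEN iffD1] linearI) (auto simp: vec_eq_iff forall_2)

lemma psi_C2: "C2 \<psi> f f'"
  unfolding C2_def
proof (intro conjI f_C1)
  have d: "(\<psi> has_derivative (\<lambda>v. vector [- u x $ 2, u x $ 1] \<bullet> v)) (at x)" for x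
    unfolding \<psi>_def[abs_def]
    by (rule has_derivative_line_integral[OF C1_bl[OF u_C1' rot_linear]])
       (use f_curl in \<open>simp add: f'_def cx_def\<close>)
  show "C1 \<psi> (\<lambda>j x. if j = 1 then Re (f x) else Im (f x))"
    unfolding C1_def
  proof (intro conjI allI)
    fix x
    show "(\<psi> has_derivative (\<lambda>v. v $ 1 *\<^sub>R (if (1::2) = 1 then Re (f x) else Im (f x)) + v $ 2 *\<^sub>R (if (2::2) = 1 then Re (f x) else Im (f x)))) (at x)"
      using d[of x] unfolding inner_plane f_def cx_def by (simp add: mult.commute)
    fix j :: 2
    show "continuous_on UNIV (\<lambda>x. if j = 1 then Re (f x) else Im (f x))"
      using C1_cont[OF f_C1] by (cases "j = 1") (auto intro!: continuous_intros)
  qed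
qed

lemma psi_bound:
  assumes "\<And>x. norm (f x) \<le> m"
  shows "\<bar>\<psi> x\<bar> \<le> m * norm x"
proof -
  let ?w = "\<lambda>t. vector [- u (t *\<^sub>R x) $ 2, u (t *\<^sub>R x) $ 1] :: plane"
  have "norm (integral {0..1} (\<lambda>t. ?w t \<bullet> x)) \<le> m * norm x * (1 - 0)"
  proof (rule integral_bound)
    have "continuous_on UNIV (\<lambda>x. vector [- u x $ 2, u x $ 1] :: plane)"
      by (rule C1_cont[OF C1_bl[OF u_C1' rot_linear]])
    then have "continuous_on {0..1} (\<lambda>t. ?w t)"
      by (rule continuous_on_compose2) (auto intro!: continuous_intros)
    then show "continuous_on {0..1} (\<lambda>t. ?w t \<bullet> x)" by (intro continuous_intros)
    fix t :: real
    have "norm (?w t) = norm (u (t *\<^sub>R x))"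
      unfolding norm_eq_sqrt_inner inner_plane by (simp add: add.commute)
    then have "norm (?w t) = norm (f (t *\<^sub>R x))" unfolding norm_f .
    then have "norm (?w t) * norm x \<le> m * norm x" using assms by (simp add: mult_right_mono)
    then show "norm (?w t \<bullet> x) \<le> m * norm x" using Cauchy_Schwarz_ineq2[of "?w t" x] by simp
  qed simp
  then show ?thesis unfolding \<psi>_def by simp
qed

lemma bump2_curl: "Im (bump2 c 1 x) = Re (bump2 c 2 x)"
  unfolding bump2_def cpl_def by (simp add: axis_def)

definition Q :: "plane \<Rightarrow> complex" where "Q x = P (dbar f' x) - \<i> * (cnj (f x) * cnj (f x))"

lemma E_cont: "continuous_on UNIV (dbar f')" by (rule dbar_cont[OF f_C1])

lemma PE_cont: "continuous_on UNIV (\<lambda>x. \<mu> (norm (dbar f' x) / sqrt 2))"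
  by (rule continuous_on_compose2[OF mu_cont]) (auto intro!: continuous_intros E_cont)

text \<open>The weak formulation with the curl of a bump as test field.\<close>
lemma weak_bump: "Re (I (\<lambda>x. Q x * dbar (bump2 c) (x - z))) = 0"
proof -
  define \<phi> where "\<phi> = curl_bump c z"
  define b where "b j x = bump2 c j (x - z)" for j x
  define B where "B x = dbar (bump2 c) (x - z)" for x
  have jac: "jacobian \<phi> (at x) = jmat (b 1 x) (b 2 x)" for x
    unfolding \<phi>_def curl_bump_jacobian jmat_def b_def ..
  have bc: "Im (b 1 x) = Re (b 2 x)" for x unfolding b_def by (rule bump2_curl)
  have B: "b 1 x + \<i> * b 2 x = B x" for x unfolding b_def B_def dbar_def by simp
  have E: "f' 1 x + \<i> * f' 2 x = dbar f' x" for x unfolding dbar_def by simp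
  have cB: "continuous_on UNIV B" unfolding B_def[abs_def]
    by (rule continuous_on_compose2[OF dbar_cont[OF C2_bump[unfolded C2_def, THEN conjunct2]]]) (auto intro!: continuous_intros)
  have vB: "vanishes_outside_ball B"
  proof -
    have "vanishes_outside_ball (dbar (bump2 c))" unfolding dbar_def[abs_def] by (intro supp_add(1) supp_mult(2) bump_supp)
    then obtain r where r: "\<And>x. norm x > r \<Longrightarrow> dbar (bump2 c) x = 0" unfolding vanishes_outside_ball_def by blast
    have "B x = 0" if "norm x > r + norm z" for x
      unfolding B_def using that norm_triangle_ineq2[of x z] by (intro r) linarith
    then show ?thesis unfolding vanishes_outside_ball_def by blast
  qed
  have div: "divergence \<phi> x = 0" for x
    unfolding divergence_def jac trace_def sum_2 using bc[of x] by (simp add: jmat_def)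
  have st: "stress h (sym_grad u x) \<bullet> sym_grad \<phi> x = Re (P (dbar f' x) * B x) / 2" for x
  proof -
    have "sym_grad u x \<bullet> sym_grad \<phi> x = Re (cnj (dbar f' x) * B x) / 2"
      using sym_grad_inner[OF jacobian_u f_curl jac bc] unfolding E B .
    moreover have "norm (sym_grad u x) = norm (dbar f' x) / sqrt 2"
      using norm_sym_grad[OF jacobian_u f_curl] unfolding E .
    ultimately show ?thesis unfolding stress_def P_def inner_scaleR_left by (simp add: mult.assoc)
  qed
  have cv: "(\<Sum>i\<in>UNIV. \<Sum>k\<in>UNIV. u x $ k * u x $ i * jacobian \<phi> (at x) $ i $ k) = Re (\<i> * (cnj (f x) * cnj (f x)) * B x) / 2" for x
    unfolding jac sum_2 B[symmetric] using bc[of x] by (simp add: jmat_def f_def cx_def field_simps)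
  have cP: "continuous_on UNIV (\<lambda>x. P (dbar f' x))"
    unfolding P_def by (intro continuous_intros PE_cont E_cont)
  note cf = C1_cont[OF f_C1]
  have c1: "continuous_on UNIV (\<lambda>x. Re (P (dbar f' x) * B x) / 2)"
    and c2: "continuous_on UNIV (\<lambda>x. Re (\<i> * (cnj (f x) * cnj (f x)) * B x) / 2)"
    by (intro continuous_intros cP cB cf | simp)+
  have v1: "vanishes_outside_ball (\<lambda>x. g x * B x)" for g :: "plane \<Rightarrow> complex" by (rule supp_mult(2)[OF vB])
  have v2: "vanishes_outside_ball (\<lambda>x. Re (g x * B x) / 2)" for g :: "plane \<Rightarrow> complex"
    using supp_mult(1)[OF supp_map(2)[OF v1[of g]], of "\<lambda>_. 1/2"] by simp
  have "test_function \<phi>" unfolding \<phi>_def by (rule curl_bump_test)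
  then have "(LINT x|lebesgue. stress h (sym_grad u x) \<bullet> sym_grad \<phi> x)
        - (LINT x|lebesgue. (\<Sum>i\<in>UNIV. \<Sum>k\<in>UNIV. u x $ k * u x $ i * jacobian \<phi> (at x) $ i $ k)) = 0"
    using u_sol div unfolding entire_weak_solution_def by blast
  then have "I (\<lambda>x. Re (P (dbar f' x) * B x) / 2) - I (\<lambda>x. Re (\<i> * (cnj (f x) * cnj (f x)) * B x) / 2) = 0"
    unfolding st cv lebesgue_I[OF c1] lebesgue_I[OF c2] .
  then have "I (\<lambda>x. Re (P (dbar f' x) * B x) / 2 - Re (\<i> * (cnj (f x) * cnj (f x)) * B x) / 2) = 0"
    unfolding Bochner_Integration.integral_diff[OF integrable_cc[OF c1 v2] integrable_cc[OF c2 v2]] .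
  moreover have "Re (P (dbar f' x) * B x) / 2 - Re (\<i> * (cnj (f x) * cnj (f x)) * B x) / 2 = Re (Q x * B x) / 2" for x
    unfolding Q_def left_diff_distrib minus_complex.simps diff_divide_distrib ..
  ultimately have "I (\<lambda>x. Re (Q x * B x) / 2) = 0" by (simp only:)
  then have "I (\<lambda>x. Re (Q x * B x)) = 0" by simp
  moreover have "continuous_on UNIV (\<lambda>x. Q x * B x)" unfolding Q_def by (intro continuous_intros cP cB cf)
  ultimately show ?thesis using Re_I[OF _ v1] unfolding B_def by simp
qed

lemma u_const: "\<exists>c. \<forall>x. u x = c"
proof -
  obtain m where m: "\<And>x. norm (f x) \<le> m"
    using L_infinity_continuous_bounded[OF u_bounded C1_cont[OF u_C1']] unfolding norm_f by blast
  obtain C K where CK: "C \<ge> 0" "\<And>t. t \<ge> 0 \<Longrightarrow> \<mu> t \<le> C * (1 + t) ^ K" using mu_growth by blast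
  let ?E = "dbar f'" and ?M = "\<lambda>x. \<mu> (norm (dbar f' x) / sqrt 2)"
  have le: "norm z / sqrt 2 \<le> norm z" for z :: complex
    using mult_left_mono[of 1 "sqrt 2" "norm z"] by (simp add: divide_le_eq)
  interpret fl: flow_growth \<psi> f f' ?M m "\<mu> 0" C K
  proof
    show "C2 \<psi> f f'" by (rule psi_C2)
    show "Im (f' 1 x) = Re (f' 2 x)" for x by (rule f_curl)
    show "norm (f x) \<le> m" "\<bar>\<psi> x\<bar> \<le> m * norm x" for x by (rule m, rule psi_bound[OF m])
    show "continuous_on UNIV ?M" by (rule PE_cont)
    show "0 < \<mu> 0" "\<mu> 0 \<le> ?M x" for x by (rule mu_zero_pos, rule mu_pos, simp)
    show "Re (I (\<lambda>x. (complex_of_real (?M x) * cnj (?E x) - \<i> * (cnj (f x) * cnj (f x))) * dbar g' x)) = 0"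
      if F: "C2 F g g'" "vanishes_outside_ball F" for F g g'
    proof -
      have "continuous_on UNIV Q" unfolding Q_def[abs_def] P_def
        by (intro continuous_intros PE_cont E_cont C1_cont[OF f_C1])
      from mollify[OF this weak_bump F] show ?thesis unfolding Q_def P_def .
    qed
    show "(?M y + ?M x) / 2 * (norm (?E y - ?E x))\<^sup>2
       \<le> Re ((complex_of_real (?M y) * cnj (?E y) - complex_of_real (?M x) * cnj (?E x)) * (?E y - ?E x))" for x y
      using P_monotone[of "?E y" "?E x"] unfolding P_def .
    show "\<exists>K\<ge>0. \<forall>x y. norm x \<le> r \<longrightarrow> norm y \<le> r \<longrightarrow>
        norm (complex_of_real (?M y) * cnj (?E y) - complex_of_real (?M x) * cnj (?E x)) \<le> K * norm (?E y - ?E x)" for r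
    proof -
      have "compact (?E ` cball 0 r)" by (intro compact_continuous_image continuous_on_subset[OF E_cont]) auto
      from compact_imp_bounded[OF this] obtain R where "\<forall>x\<in>cball 0 r. norm (?E x) \<le> R"
        unfolding bounded_iff by auto
      then have R: "norm (?E x) \<le> R" if "norm x \<le> r" for x using that by simp
      obtain K where K: "K \<ge> 0" "\<And>A B. norm A \<le> R \<Longrightarrow> norm B \<le> R \<Longrightarrow> norm (P A - P B) \<le> K * norm (A - B)"
        using P_lipschitz by blast
      have "norm (P (?E y) - P (?E x)) \<le> K * norm (?E y - ?E x)" if "norm x \<le> r" "norm y \<le> r" for x y
        using that by (intro K(2) R)
      then show ?thesis using K(1) unfolding P_def by blast
    qed
    show "0 \<le> C" by (rule CK(1))
    show "?M x \<le> C * (1 + norm (?E x)) ^ K" for x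
    proof -
      have "?M x \<le> \<mu> (norm (?E x))" by (rule mu_mono) (auto intro: le)
      also have "\<dots> \<le> C * (1 + norm (?E x)) ^ K" by (rule CK(2)) simp
      finally show ?thesis .
    qed
  qed
  have "u x = u 0" for x
  proof -
    have "cx (u x) = cx (u 0)" using fl.f_const[of x 0] unfolding f_def .
    then show ?thesis unfolding cx_def by (simp add: vec_eq_iff forall_2)
  qed
  then show ?thesis by blast
qed

end

theorem theorem1:
  fixes h :: "real \<Rightarrow> real" and u :: "real^2 \<Rightarrow> real^2"
  assumes h_nonneg: "\<And>t. t \<ge> 0 \<Longrightarrow> h t \<ge> 0"
    and h_C2: "C2_half_line h"
    and h_A1: "A1 h"
    and h_A2: "A2 h"
    and h_A3: "A3 h"
    and u_C1: "Ck 1 u"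
    and u_bounded: "L_infinity u"
    and u_sol: "entire_weak_solution h u"
  shows "\<exists>c. \<forall>x. u x = c"
proof -
  interpret bounded_solution h u by unfold_locales (fact assms)+
  show ?thesis by (rule u_const)
qed

end
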